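(* Let $\lambda=(\lambda_1\ge\cdots\ge\lambda_s>0)$ be a partition with $s\le n$ parts (identified with a dominant integral weight of type $A_n$), and let $T\in\mathbf{B}(\lambda)$ be a semistandard tableau of shape $\lambda$ with entries in $\{1,\ldots,n+1\}$. Then the head $\mathrm{hd}\,\mathrm{Ind}\,\nabla_T$ of the induced module $\mathrm{Ind}\,\nabla_T$ is an irreducible graded module over the Khovanov-Lauda-Rouquier algebra of type $A_n$.
   Context: **KLR algebras.** Fix $n\ge1$, $I=\{1,\ldots,n\}$, and let $(a_{ij})_{i,j\in I}$ be the Cartan matrix of type $A_n$ ($a_{ii}=2$, $a_{ij}=-1$ if $|i-j|=1$, and $0$ otherwise), with simple roots $\alpha_i$ and $Q^+=\bigoplus_{i}\mathbb{Z}_{\ge0}\alpha_i$, $\mathrm{ht}(\sum k_i\alpha_i)=\sum k_i$. For $\alpha\in Q^+$ of height $d$ let $I^\alpha=\{\mathbf{i}=(i_1,\ldots,i_d)\in I^d : \alpha_{i_1}+\cdots+\alpha_{i_d}=\alpha\}$, on which the symmetric group acts by permuting places. $R(\alpha)$ is the associative graded $\mathbb{C}$-algebra (with unit $\sum_{\mathbf i}1_{\mathbf i}$) generated by $1_{\mathbf{i}}$ ($\mathbf{i}\in I^\alpha$), $x_k$ ($1\le k\le d$), $\tau_t$ ($1\le t\le d-1$) with relations: $1_{\mathbf{i}}1_{\mathbf{j}}=\delta_{\mathbf{i}\mathbf{j}}1_{\mathbf{i}}$, $x_k1_{\mathbf{i}}=1_{\mathbf{i}}x_k$, $\tau_t1_{\mathbf{i}}=1_{\tau_t(\mathbf{i})}\tau_t$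 (where $\tau_t(\cdot)$ is the transposition $(t\ t+1)$); $x_kx_l=x_lx_k$; $\tau_t\tau_s=\tau_s\tau_t$ if $|t-s|>1$; $\tau_t^21_{\mathbf{i}}=0$ if $i_t=i_{t+1}$, $=1_{\mathbf{i}}$ if $|i_t-i_{t+1}|>1$, $=(x_t+x_{t+1})1_{\mathbf{i}}$ if $|i_t-i_{t+1}|=1$; $(\tau_t\tau_{t+1}\tau_t-\tau_{t+1}\tau_t\tau_{t+1})1_{\mathbf{i}}=1_{\mathbf{i}}$ if $i_t=i_{t+2}$ and $|i_t-i_{t+1}|=1$, and $=0$ otherwise; $(\tau_tx_k-x_{\tau_t(k)}\tau_t)1_{\mathbf{i}}=1_{\mathbf{i}}$ if $k=t$, $i_t=i_{t+1}$, $=-1_{\mathbf{i}}$ if $k=t+1$, $i_t=i_{t+1}$, and $=0$ otherwise. The grading is $\deg 1_{\mathbf{i}}=0$, $\deg x_k1_{\mathbf{i}}=2$, $\deg\tau_t1_{\mathbf{i}}=-a_{i_t,i_{t+1}}$. $R(0)=\mathbb{C}$. **Induction.** For $\beta_1,\ldots,\beta_k\in Q^+$ with sum $\beta$ there is the natural embedding $R(\beta_1)\otimes\cdots\otimes R(\beta_k)\hookrightarrow R(\beta)$ (concatenation), and $\mathrm{Ind}=R(\beta)\otimes_{R(\beta_1)\otimes\cdots\otimes R(\beta_k)}-$. All modules are finite-dimensional graded; $\boxtimes$ is the outer tensor product; $\mathrm{hd}$ is the head (largest semisimple quotient). **Segment modules.** For $a,\ell\in\mathbb{Z}_{>0}$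 with $a+\ell-1\le n$ put $\alpha_{(a;\ell)}=\alpha_a+\cdots+\alpha_{a+\ell-1}$, $\mathbf{i}_{(a;\ell)}=(a,a+1,\ldots,a+\ell-1)$, and let $\nabla_{(a;\ell)}=\mathbb{C}v$ be the 1-dimensional $R(\alpha_{(a;\ell)})$-module with $x_iv=0$, $\tau_jv=0$, $1_{\mathbf{i}}v=v$ if $\mathbf{i}=\mathbf{i}_{(a;\ell)}$ and $0$ otherwise. $\nabla_{(a;0)}=\mathbb{C}$ over $R(0)$. For a Young diagram $\mu=(\mu_1\ge\cdots\ge\mu_r>0)$ and $k\in\mathbb{Z}_{>0}$ with $k+\mu_1-1\le n$, $\nabla_\mu[k]=\nabla_{(k;\mu_1)}\boxtimes\cdots\boxtimes\nabla_{(k;\mu_r)}$ (zero parts contribute trivial factors). **The module $\nabla_T$.** A semistandard tableau has rows weakly increasing left to right and columns strictly increasing top to bottom. For $T\in\mathbf{B}(\lambda)$ with entry $a^T_{ij}$ in the $j$th box of row $i$, let $\Psi_\lambda(T)=(\mu^{(1)},\ldots,\mu^{(s)})$, $\mu^{(k)}=(a^T_{k,\lambda_k}-k,\,a^T_{k,\lambda_k-1}-k,\ldots,a^T_{k,1}-k)$, a partition (possibly with zero parts, possibly empty). Define $\nabla_T=\nabla_{\mu^{(s)}}[s]\boxtimes\nabla_{\mu^{(s-1)}}[s-1]\boxtimes\cdots\boxtimes\nabla_{\mu^{(1)}}[1]$, and $\mathrm{Ind}\,\nabla_T$ is the induction of $\nabla_T$ to $R(\alpha)$, where $\alpha$ is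 the sum of all the $\alpha_{(k;\mu^{(k)}_j)}$. *)

theory Defs
  imports Complex_Main "HOL-Library.Multiset" "HOL-Library.Poly_Mapping"
    "HOL-Algebra.Module" "HOL-Algebra.QuotRing" "HOL-Algebra.Generated_Groups" "HOL-Algebra.Free_Abelian_Groups"
begin

section \<open>Monoid algebras over the complex numbers\<close>

text \<open>
  Finitely supported functions \<^typ>\<open>'a \<Rightarrow>\<^sub>0 complex\<close> are formal linear combinations;
  \<open>cmon c w\<close> is \<open>c\<close> times the basis vector \<open>w\<close>, and \<open>bilin f\<close> is the bilinear extension
  of an operation \<open>f\<close> on basis vectors.
\<close>

abbreviation cmon :: "complex \<Rightarrow> 'a \<Rightarrow> 'a \<Rightarrow>\<^sub>0 complex" where
  "cmon c w \<equiv> Poly_Mapping.single w c"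

definition bilin ::
  "('a \<Rightarrow> 'b \<Rightarrow> 'c) \<Rightarrow> ('a \<Rightarrow>\<^sub>0 complex) \<Rightarrow> ('b \<Rightarrow>\<^sub>0 complex) \<Rightarrow> ('c \<Rightarrow>\<^sub>0 complex)" where
  "bilin f p q = (\<Sum>u\<in>Poly_Mapping.keys p. \<Sum>v\<in>Poly_Mapping.keys q.
     cmon (Poly_Mapping.lookup p u * Poly_Mapping.lookup q v) (f u v))"

definition monoid_alg :: "('a, 'z) monoid_scheme \<Rightarrow> ('a \<Rightarrow>\<^sub>0 complex) ring" where
  "monoid_alg G = \<lparr>carrier = {p. Poly_Mapping.keys p \<subseteq> carrier G},
     monoid.mult = bilin (monoid.mult G), one = cmon 1 (one G), ring.zero = 0, ring.add = (+)\<rparr>"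

definition free_monoid :: "'a set \<Rightarrow> 'a list monoid" where
  "free_monoid A = \<lparr>carrier = lists A, monoid.mult = (@), one = []\<rparr>"


section \<open>Graded modules\<close>

text \<open>
  The module record of HOL-Algebra extends the ring record by a scalar multiplication.
  A graded \<open>\<complex>\<close>-algebra is represented by a record of type \<open>(complex, 'r) graded\<close>,
  a left module over it by one of type \<open>('r, 'm) graded\<close>; in the latter case the ring
  multiplication and unit of the record carry no information. (The module locale of HOL-Algebra
  is restricted to commutative rings and cannot be used here.)
\<close>

record ('a, 'b) graded = "('a, 'b) module" +
  grade :: "int \<Rightarrow> 'b set"

definition cscale :: "(complex, 'r) graded \<Rightarrow> ('r, 'm) graded \<Rightarrow> complex \<Rightarrow> 'm \<Rightarrow> 'm" where
  "cscale R M c v = (c \<odot>\<^bsub>R\<^esub> \<one>\<^bsub>R\<^esub>) \<odot>\<^bsub>M\<^esub> v"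

definition left_module :: "(complex, 'r) graded \<Rightarrow> ('r, 'm) graded \<Rightarrow> bool" where
  "left_module R M \<longleftrightarrow> ring R \<and> abelian_group M \<and>
     (\<forall>r\<in>carrier R. \<forall>v\<in>carrier M. r \<odot>\<^bsub>M\<^esub> v \<in> carrier M) \<and>
     (\<forall>r\<in>carrier R. \<forall>s\<in>carrier R. \<forall>v\<in>carrier M.
        (r \<oplus>\<^bsub>R\<^esub> s) \<odot>\<^bsub>M\<^esub> v = r \<odot>\<^bsub>M\<^esub> v \<oplus>\<^bsub>M\<^esub> s \<odot>\<^bsub>M\<^esub> v) \<and>
     (\<forall>r\<in>carrier R. \<forall>v\<in>carrier M. \<forall>w\<in>carrier M.
        r \<odot>\<^bsub>M\<^esub> (v \<oplus>\<^bsub>M\<^esub> w) = r \<odot>\<^bsub>M\<^esub> v \<oplus>\<^bsub>M\<^esub> r \<odot>\<^bsub>M\<^esub> w) \<and>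
     (\<forall>r\<in>carrier R. \<forall>s\<in>carrier R. \<forall>v\<in>carrier M.
        (r \<otimes>\<^bsub>R\<^esub> s) \<odot>\<^bsub>M\<^esub> v = r \<odot>\<^bsub>M\<^esub> (s \<odot>\<^bsub>M\<^esub> v)) \<and>
     (\<forall>v\<in>carrier M. \<one>\<^bsub>R\<^esub> \<odot>\<^bsub>M\<^esub> v = v)"

definition graded_module :: "(complex, 'r) graded \<Rightarrow> ('r, 'm) graded \<Rightarrow> bool" where
  "graded_module R M \<longleftrightarrow> left_module R M \<and>
     (\<forall>d. additive_subgroup (grade M d) M) \<and>
     (\<forall>x\<in>carrier M. \<exists>!f. (\<forall>d. f d \<in> grade M d) \<and> finite {d. f d \<noteq> \<zero>\<^bsub>M\<^esub>} \<and>
        x = (\<Oplus>\<^bsub>M\<^esub>d\<in>{d. f d \<noteq> \<zero>\<^bsub>M\<^esub>}. f d)) \<and>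
     (\<forall>i j. \<forall>r\<in>grade R i. \<forall>v\<in>grade M j. r \<odot>\<^bsub>M\<^esub> v \<in> grade M (i + j))"

definition fin_dim :: "(complex, 'r) graded \<Rightarrow> ('r, 'm) graded \<Rightarrow> bool" where
  "fin_dim R M \<longleftrightarrow> (\<exists>B. finite B \<and> B \<subseteq> carrier M \<and>
     (\<forall>x\<in>carrier M. \<exists>c. x = (\<Oplus>\<^bsub>M\<^esub>b\<in>B. cscale R M (c b) b)))"

definition graded_submodule ::
  "(complex, 'r) graded \<Rightarrow> ('r, 'm) graded \<Rightarrow> 'm set \<Rightarrow> bool" where
  "graded_submodule R M N \<longleftrightarrow> additive_subgroup N M \<and>
     (\<forall>r\<in>carrier R. \<forall>v\<in>N. r \<odot>\<^bsub>M\<^esub> v \<in> N) \<and>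
     (\<forall>x\<in>N. \<exists>D f. finite D \<and> (\<forall>d\<in>D. f d \<in> N \<inter> grade M d) \<and> x = (\<Oplus>\<^bsub>M\<^esub>d\<in>D. f d))"

definition sub_mod :: "('r, 'm) graded \<Rightarrow> 'm set \<Rightarrow> ('r, 'm) graded" where
  "sub_mod M N = M\<lparr>carrier := N, grade := \<lambda>d. grade M d \<inter> N\<rparr>"

definition quot_mod :: "('r, 'm) graded \<Rightarrow> 'm set \<Rightarrow> ('r, 'm set) graded" where
  "quot_mod M N = \<lparr>carrier = a_rcosets\<^bsub>M\<^esub> N, monoid.mult = undefined, one = undefined,
     ring.zero = N, ring.add = set_add M,
     smult = \<lambda>r A. \<Union>a\<in>A. N +>\<^bsub>M\<^esub> (r \<odot>\<^bsub>M\<^esub> a),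
     grade = \<lambda>d. (\<lambda>v. N +>\<^bsub>M\<^esub> v) ` grade M d\<rparr>"

text \<open>All modules are finite-dimensional and graded, and irreducibility, semisimplicity and heads
  are taken in that category.\<close>

definition irreducible_graded :: "(complex, 'r) graded \<Rightarrow> ('r, 'm) graded \<Rightarrow> bool" where
  "irreducible_graded R M \<longleftrightarrow> graded_module R M \<and> fin_dim R M \<and> carrier M \<noteq> {\<zero>\<^bsub>M\<^esub>} \<and>
     (\<forall>N. graded_submodule R M N \<longrightarrow> N = {\<zero>\<^bsub>M\<^esub>} \<or> N = carrier M)"

definition semisimple_graded :: "(complex, 'r) graded \<Rightarrow> ('r, 'm) graded \<Rightarrow> bool" where
  "semisimple_graded R M \<longleftrightarrow> graded_module R M \<and> fin_dim R M \<and>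
     (\<exists>(k::nat) S. (\<forall>i<k. graded_submodule R M (S i) \<and> irreducible_graded R (sub_mod M (S i))) \<and>
        (\<forall>x\<in>carrier M. \<exists>!f. f \<in> (\<Pi>\<^sub>E i\<in>{..<k}. S i) \<and> x = (\<Oplus>\<^bsub>M\<^esub>i\<in>{..<k}. f i)))"

text \<open>The largest semisimple quotient of \<open>M\<close> is the quotient by the smallest graded submodule
  with semisimple quotient; for finite-dimensional \<open>M\<close> the intersection below is that submodule.\<close>

definition radical :: "(complex, 'r) graded \<Rightarrow> ('r, 'm) graded \<Rightarrow> 'm set" where
  "radical R M = \<Inter>{N. graded_submodule R M N \<and> semisimple_graded R (quot_mod M N)}"

definition hd_mod :: "(complex, 'r) graded \<Rightarrow> ('r, 'm) graded \<Rightarrow> ('r, 'm set) graded" where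
  "hd_mod R M = quot_mod M (radical R M)"


section \<open>Tensor products over the complex numbers and induction\<close>

text \<open>
  The tensor product over \<open>\<complex>\<close> of a list of spaces is the space of formal linear combinations of
  lists of vectors modulo the multilinearity relations. In \<open>multilin_rels\<close> a space is given by
  its carrier, addition and scalar multiplication; the scalar \<open>a\<close> makes the set of relations closed
  under scaling, so that the additive subgroup generated by it is a subspace.
\<close>

definition tuples :: "'v set list \<Rightarrow> 'v list set" where
  "tuples Cs = {us. length us = length Cs \<and> (\<forall>j<length Cs. us ! j \<in> Cs ! j)}"

definition multilin_rels ::
  "('v set \<times> ('v \<Rightarrow> 'v \<Rightarrow> 'v) \<times> (complex \<Rightarrow> 'v \<Rightarrow> 'v)) list \<Rightarrow> ('v list \<Rightarrow>\<^sub>0 complex) set" where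
  "multilin_rels Vs =
     {cmon a (us[j := plus u v]) - cmon a (us[j := u]) - cmon a (us[j := v]) |
        a us j C plus scale u v.
        us \<in> tuples (map fst Vs) \<and> j < length Vs \<and> Vs ! j = (C, plus, scale) \<and> u \<in> C \<and> v \<in> C} \<union>
     {cmon a (us[j := scale c u]) - cmon (a * c) (us[j := u]) |
        a us j C plus scale c u.
        us \<in> tuples (map fst Vs) \<and> j < length Vs \<and> Vs ! j = (C, plus, scale) \<and> u \<in> C}"

definition prod_monoid :: "(complex, 'r) graded list \<Rightarrow> 'r list monoid" where
  "prod_monoid Rs = \<lparr>carrier = tuples (map carrier Rs),
     monoid.mult = \<lambda>us vs. map (\<lambda>j. us ! j \<otimes>\<^bsub>Rs ! j\<^esub> vs ! j) [0..<length Rs],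
     one = map (\<lambda>R. \<one>\<^bsub>R\<^esub>) Rs\<rparr>"

definition tensor_alg :: "(complex, 'r) graded list \<Rightarrow> ('r list \<Rightarrow>\<^sub>0 complex) set ring" where
  "tensor_alg Rs = monoid_alg (prod_monoid Rs) Quot
     (Idl\<^bsub>monoid_alg (prod_monoid Rs)\<^esub>
        multilin_rels (map (\<lambda>R. (carrier R, ring.add R, smult R)) Rs))"

definition free_space :: "'a set \<Rightarrow> ('a \<Rightarrow>\<^sub>0 complex) ring" where
  "free_space A = \<lparr>carrier = {p. Poly_Mapping.keys p \<subseteq> A},
     monoid.mult = undefined, one = undefined, ring.zero = 0, ring.add = (+)\<rparr>"

definition outer_tensor ::
  "(complex, 'r) graded list \<Rightarrow> ('r, 'm) graded list \<Rightarrow>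
   (('r list \<Rightarrow>\<^sub>0 complex) set, ('m list \<Rightarrow>\<^sub>0 complex) set) graded" where
  "outer_tensor Rs Ms =
     (let F = free_space (tuples (map carrier Ms));
          N = generate (add_monoid F)
                (multilin_rels (map (\<lambda>(R, M). (carrier M, ring.add M, cscale R M)) (zip Rs Ms)))
      in \<lparr>carrier = a_rcosets\<^bsub>F\<^esub> N, monoid.mult = undefined, one = undefined,
          ring.zero = N, ring.add = set_add F,
          smult = \<lambda>P A. \<Union>p\<in>P. \<Union>a\<in>A. N +>\<^bsub>F\<^esub>
            bilin (\<lambda>us vs. map (\<lambda>j. us ! j \<odot>\<^bsub>Ms ! j\<^esub> vs ! j) [0..<length Ms]) p a,
          grade = \<lambda>d. (\<lambda>p. N +>\<^bsub>F\<^esub> p) ` generate (add_monoid F)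
            {cmon c vs | c vs ds. length ds = length Ms \<and> sum_list ds = d \<and>
               vs \<in> tuples (map (\<lambda>j. grade (Ms ! j) (ds ! j)) [0..<length Ms])}\<rparr>)"

text \<open>
  \<open>induced R S \<phi> M\<close> is \<open>R \<otimes>\<^bsub>S\<^esub> M\<close>, where \<open>R\<close> is a right \<open>S\<close>-module through
  \<open>\<phi> : S \<rightarrow> R\<close>: the free abelian group on the pairs \<open>(r, v)\<close> modulo biadditivity and
  \<open>S\<close>-balancedness. \<open>\<phi>\<close> need not be unital; since \<open>\<one> \<odot> v = v\<close> in \<open>M\<close>, the balancing
  relation identifies \<open>r \<otimes> v\<close> with \<open>r \<phi>(\<one>) \<otimes> v\<close>.
\<close>

definition pair_mod ::
  "(complex, 'r) graded \<Rightarrow> ('s, 'm) graded \<Rightarrow> ('r, ('r \<times> 'm) \<Rightarrow>\<^sub>0 int) graded" where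
  "pair_mod R M =
     \<lparr>carrier = carrier (free_Abelian_group (carrier R \<times> carrier M)),
      monoid.mult = undefined, one = undefined, ring.zero = 0, ring.add = (+),
      smult = \<lambda>r. frag_extend (\<lambda>(r', v). frag_of (r \<otimes>\<^bsub>R\<^esub> r', v)),
      grade = \<lambda>d. generate (free_Abelian_group (carrier R \<times> carrier M))
        {frag_of (r, v) | r v i j. r \<in> grade R i \<and> v \<in> grade M j \<and> i + j = d}\<rparr>"

definition induced ::
  "(complex, 'r) graded \<Rightarrow> 's ring \<Rightarrow> ('s \<Rightarrow> 'r) \<Rightarrow> ('s, 'm) graded \<Rightarrow>
   ('r, (('r \<times> 'm) \<Rightarrow>\<^sub>0 int) set) graded" where
  "induced R S \<phi> M = quot_mod (pair_mod R M)
     (generate (free_Abelian_group (carrier R \<times> carrier M))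
       ({frag_of (r \<oplus>\<^bsub>R\<^esub> r', v) - frag_of (r, v) - frag_of (r', v) | r r' v.
           r \<in> carrier R \<and> r' \<in> carrier R \<and> v \<in> carrier M} \<union>
        {frag_of (r, v \<oplus>\<^bsub>M\<^esub> v') - frag_of (r, v) - frag_of (r, v') | r v v'.
           r \<in> carrier R \<and> v \<in> carrier M \<and> v' \<in> carrier M} \<union>
        {frag_of (r \<otimes>\<^bsub>R\<^esub> \<phi> s, v) - frag_of (r, s \<odot>\<^bsub>M\<^esub> v) | r s v.
           r \<in> carrier R \<and> s \<in> carrier S \<and> v \<in> carrier M}))"


section \<open>The Khovanov-Lauda-Rouquier algebra of type A\<close>

text \<open>
  An element \<open>\<alpha>\<close> of the positive root lattice is a multiset over \<open>{1..n}\<close>, with \<open>\<alpha>\<^sub>i = {#i#}\<close>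
  and height \<open>size \<alpha>\<close>; a sequence has weight \<open>\<alpha>\<close> iff its underlying multiset is \<open>\<alpha>\<close>.
  Strands are numbered from 1, so that the entry \<open>i\<^sub>t\<close> of a sequence is \<open>entry i t\<close>.
\<close>

definition cartan :: "nat \<Rightarrow> nat \<Rightarrow> int" where
  "cartan i j = (if i = j then 2 else if \<bar>int i - int j\<bar> = 1 then -1 else 0)"

definition seqs :: "nat \<Rightarrow> nat multiset \<Rightarrow> nat list set" where
  "seqs n \<alpha> = {is. set is \<subseteq> {1..n} \<and> mset is = \<alpha>}"

abbreviation entry :: "nat list \<Rightarrow> nat \<Rightarrow> nat" where
  "entry is t \<equiv> is ! (t - 1)"

definition swap_seq :: "nat \<Rightarrow> nat list \<Rightarrow> nat list" where
  "swap_seq t is = is[t - 1 := is ! t, t := is ! (t - 1)]"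

datatype klr_gen = Gidem "nat list" | Gx nat | Gtau nat

definition klr_gens :: "nat \<Rightarrow> nat multiset \<Rightarrow> klr_gen set" where
  "klr_gens n \<alpha> = Gidem ` seqs n \<alpha> \<union> Gx ` {1..size \<alpha>} \<union> Gtau ` {1..<size \<alpha>}"

definition klr_rels :: "nat \<Rightarrow> nat multiset \<Rightarrow> (klr_gen list \<Rightarrow>\<^sub>0 complex) set" where
  "klr_rels n \<alpha> =
    {(\<Sum>is\<in>seqs n \<alpha>. cmon 1 [Gidem is]) - cmon 1 []} \<union>
    {cmon 1 [Gidem is, Gidem js] - (if is = js then cmon 1 [Gidem is] else 0) | is js.
       is \<in> seqs n \<alpha> \<and> js \<in> seqs n \<alpha>} \<union>
    {cmon 1 [Gx k, Gidem is] - cmon 1 [Gidem is, Gx k] | k is.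
       k \<in> {1..size \<alpha>} \<and> is \<in> seqs n \<alpha>} \<union>
    {cmon 1 [Gtau t, Gidem is] - cmon 1 [Gidem (swap_seq t is), Gtau t] | t is.
       t \<in> {1..<size \<alpha>} \<and> is \<in> seqs n \<alpha>} \<union>
    {cmon 1 [Gx k, Gx l] - cmon 1 [Gx l, Gx k] | k l.
       k \<in> {1..size \<alpha>} \<and> l \<in> {1..size \<alpha>}} \<union>
    {cmon 1 [Gtau t, Gtau s] - cmon 1 [Gtau s, Gtau t] | t s.
       t \<in> {1..<size \<alpha>} \<and> s \<in> {1..<size \<alpha>} \<and> \<bar>int t - int s\<bar> > 1} \<union>
    {cmon 1 [Gtau t, Gtau t, Gidem is] -
       (if entry is t = entry is (t + 1) then 0
        else if \<bar>int (entry is t) - int (entry is (t + 1))\<bar> > 1 then cmon 1 [Gidem is]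
        else cmon 1 [Gx t, Gidem is] + cmon 1 [Gx (t + 1), Gidem is]) | t is.
       t \<in> {1..<size \<alpha>} \<and> is \<in> seqs n \<alpha>} \<union>
    {cmon 1 [Gtau t, Gtau (t + 1), Gtau t, Gidem is]
       - cmon 1 [Gtau (t + 1), Gtau t, Gtau (t + 1), Gidem is]
       - (if entry is t = entry is (t + 2) \<and> \<bar>int (entry is t) - int (entry is (t + 1))\<bar> = 1
          then cmon 1 [Gidem is] else 0) | t is.
       t \<in> {1..<size \<alpha>} \<and> t + 1 \<in> {1..<size \<alpha>} \<and> is \<in> seqs n \<alpha>} \<union>
    {cmon 1 [Gtau t, Gx k, Gidem is]
       - cmon 1 [Gx (if k = t then t + 1 else if k = t + 1 then t else k), Gtau t, Gidem is]
       - (if k = t \<and> entry is t = entry is (t + 1) then cmon 1 [Gidem is]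
          else if k = t + 1 \<and> entry is t = entry is (t + 1) then cmon (-1) [Gidem is]
          else 0) | t k is.
       t \<in> {1..<size \<alpha>} \<and> k \<in> {1..size \<alpha>} \<and> is \<in> seqs n \<alpha>}"

abbreviation klr_free :: "nat \<Rightarrow> nat multiset \<Rightarrow> (klr_gen list \<Rightarrow>\<^sub>0 complex) ring" where
  "klr_free n \<alpha> \<equiv> monoid_alg (free_monoid (klr_gens n \<alpha>))"

type_synonym klr_elt = "(klr_gen list \<Rightarrow>\<^sub>0 complex) set"

definition klr_ideal :: "nat \<Rightarrow> nat multiset \<Rightarrow> klr_elt" where
  "klr_ideal n \<alpha> = Idl\<^bsub>klr_free n \<alpha>\<^esub> klr_rels n \<alpha>"

definition klr_ring :: "nat \<Rightarrow> nat multiset \<Rightarrow> klr_elt ring" where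
  "klr_ring n \<alpha> = klr_free n \<alpha> Quot klr_ideal n \<alpha>"

definition klr_class :: "nat \<Rightarrow> nat multiset \<Rightarrow> (klr_gen list \<Rightarrow>\<^sub>0 complex) \<Rightarrow> klr_elt" where
  "klr_class n \<alpha> p = klr_ideal n \<alpha> +>\<^bsub>klr_free n \<alpha>\<^esub> p"

definition klr_scale :: "nat \<Rightarrow> nat multiset \<Rightarrow> complex \<Rightarrow> klr_elt \<Rightarrow> klr_elt" where
  "klr_scale n \<alpha> c P = klr_class n \<alpha> (cmon c []) \<otimes>\<^bsub>klr_ring n \<alpha>\<^esub> P"

text \<open>The grading is the smallest multiplicative family of subspaces in which the given homogeneous
  generators have the prescribed degrees.\<close>

inductive klr_homogeneous :: "nat \<Rightarrow> nat multiset \<Rightarrow> int \<Rightarrow> klr_elt \<Rightarrow> bool" for n \<alpha> where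
  idem: "is \<in> seqs n \<alpha> \<Longrightarrow> klr_homogeneous n \<alpha> 0 (klr_class n \<alpha> (cmon 1 [Gidem is]))"
| x: "k \<in> {1..size \<alpha>} \<Longrightarrow> is \<in> seqs n \<alpha> \<Longrightarrow>
    klr_homogeneous n \<alpha> 2 (klr_class n \<alpha> (cmon 1 [Gx k, Gidem is]))"
| tau: "t \<in> {1..<size \<alpha>} \<Longrightarrow> is \<in> seqs n \<alpha> \<Longrightarrow>
    klr_homogeneous n \<alpha> (- cartan (entry is t) (entry is (t + 1)))
      (klr_class n \<alpha> (cmon 1 [Gtau t, Gidem is]))"
| zero: "klr_homogeneous n \<alpha> d \<zero>\<^bsub>klr_ring n \<alpha>\<^esub>"
| add: "klr_homogeneous n \<alpha> d P \<Longrightarrow> klr_homogeneous n \<alpha> d P' \<Longrightarrow>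
    klr_homogeneous n \<alpha> d (P \<oplus>\<^bsub>klr_ring n \<alpha>\<^esub> P')"
| scale: "klr_homogeneous n \<alpha> d P \<Longrightarrow> klr_homogeneous n \<alpha> d (klr_scale n \<alpha> c P)"
| times: "klr_homogeneous n \<alpha> d P \<Longrightarrow> klr_homogeneous n \<alpha> d' P' \<Longrightarrow>
    klr_homogeneous n \<alpha> (d + d') (P \<otimes>\<^bsub>klr_ring n \<alpha>\<^esub> P')"

definition klr :: "nat \<Rightarrow> nat multiset \<Rightarrow> (complex, klr_elt) graded" where
  "klr n \<alpha> = ring.extend (klr_ring n \<alpha>)
     \<lparr>smult = klr_scale n \<alpha>, grade = \<lambda>d. {P. klr_homogeneous n \<alpha> d P}\<rparr>"


section \<open>The concatenation embedding\<close>

text \<open>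
  A generator of the \<open>j\<close>th tensor factor is sent to the same generator on the \<open>j\<close>th group of
  strands times the sum of all \<open>1\<^bsub>i\<^esub>\<close> with \<open>i\<close> a concatenation of sequences of weights
  \<open>\<beta>s ! 0, \<beta>s ! 1, \<dots>\<close> (with prescribed \<open>j\<close>th block in the case of an idempotent generator).
  That sum, \<open>concat_idem\<close>, is the image of the unit.
\<close>

definition blocks :: "nat \<Rightarrow> nat multiset list \<Rightarrow> nat list list set" where
  "blocks n \<beta>s = tuples (map (seqs n) \<beta>s)"

definition offset :: "nat multiset list \<Rightarrow> nat \<Rightarrow> nat" where
  "offset \<beta>s j = (\<Sum>l<j. size (\<beta>s ! l))"

definition concat_idem :: "nat \<Rightarrow> nat multiset list \<Rightarrow> klr_elt" where
  "concat_idem n \<beta>s = klr_class n (sum_list \<beta>s) (\<Sum>b\<in>blocks n \<beta>s. cmon 1 [Gidem (concat b)])"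

fun embed_gen :: "nat \<Rightarrow> nat multiset list \<Rightarrow> nat \<Rightarrow> klr_gen \<Rightarrow> klr_elt" where
  "embed_gen n \<beta>s j (Gidem is) = klr_class n (sum_list \<beta>s)
     (\<Sum>b\<in>{b \<in> blocks n \<beta>s. b ! j = is}. cmon 1 [Gidem (concat b)])"
| "embed_gen n \<beta>s j (Gx k) = klr_class n (sum_list \<beta>s)
     (\<Sum>b\<in>blocks n \<beta>s. cmon 1 [Gx (offset \<beta>s j + k), Gidem (concat b)])"
| "embed_gen n \<beta>s j (Gtau t) = klr_class n (sum_list \<beta>s)
     (\<Sum>b\<in>blocks n \<beta>s. cmon 1 [Gtau (offset \<beta>s j + t), Gidem (concat b)])"

definition embed_prod :: "nat \<Rightarrow> nat multiset list \<Rightarrow> klr_elt list \<Rightarrow> klr_elt" where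
  "embed_prod n \<beta>s Ps = foldr (monoid.mult (klr n (sum_list \<beta>s))) Ps (concat_idem n \<beta>s)"

definition embed_factor :: "nat \<Rightarrow> nat multiset list \<Rightarrow> nat \<Rightarrow> klr_elt \<Rightarrow> klr_elt" where
  "embed_factor n \<beta>s j P = (let R = klr n (sum_list \<beta>s) in
     the_elem ((\<lambda>p. \<Oplus>\<^bsub>R\<^esub>w\<in>Poly_Mapping.keys p.
       Poly_Mapping.lookup p w \<odot>\<^bsub>R\<^esub> embed_prod n \<beta>s (map (embed_gen n \<beta>s j) w)) ` P))"

definition concat_embed ::
  "nat \<Rightarrow> nat multiset list \<Rightarrow> (klr_elt list \<Rightarrow>\<^sub>0 complex) set \<Rightarrow> klr_elt" where
  "concat_embed n \<beta>s Q = (let R = klr n (sum_list \<beta>s) in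
     the_elem ((\<lambda>q. \<Oplus>\<^bsub>R\<^esub>Ps\<in>Poly_Mapping.keys q. Poly_Mapping.lookup q Ps \<odot>\<^bsub>R\<^esub>
       embed_prod n \<beta>s (map (\<lambda>j. embed_factor n \<beta>s j (Ps ! j)) [0..<length \<beta>s])) ` Q))"

definition Ind ::
  "nat \<Rightarrow> nat multiset list \<Rightarrow> ((klr_elt list \<Rightarrow>\<^sub>0 complex) set, 'm) graded \<Rightarrow>
   (klr_elt, ((klr_elt \<times> 'm) \<Rightarrow>\<^sub>0 int) set) graded" where
  "Ind n \<beta>s M = induced (klr n (sum_list \<beta>s)) (tensor_alg (map (klr n) \<beta>s)) (concat_embed n \<beta>s) M"


section \<open>Segment modules and tableaux\<close>

text \<open>A segment \<open>(a; l)\<close> is the pair \<open>(a, l)\<close>. The one-dimensional segment module lives in degree 0;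
  an element of the KLR algebra acts through the character \<open>seg_char\<close> of the free algebra.\<close>

definition seg_weight :: "nat \<times> nat \<Rightarrow> nat multiset" where
  "seg_weight = (\<lambda>(a, l). mset [a..<a + l])"

fun seg_gen :: "nat \<times> nat \<Rightarrow> klr_gen \<Rightarrow> complex" where
  "seg_gen (a, l) (Gidem is) = (if is = [a..<a + l] then 1 else 0)"
| "seg_gen (a, l) (Gx k) = 0"
| "seg_gen (a, l) (Gtau t) = 0"

definition seg_char :: "nat \<times> nat \<Rightarrow> (klr_gen list \<Rightarrow>\<^sub>0 complex) \<Rightarrow> complex" where
  "seg_char sg p =
     (\<Sum>w\<in>Poly_Mapping.keys p. Poly_Mapping.lookup p w * prod_list (map (seg_gen sg) w))"

definition seg_module :: "nat \<times> nat \<Rightarrow> (klr_elt, complex) graded" where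
  "seg_module sg = \<lparr>carrier = UNIV, monoid.mult = undefined, one = undefined, ring.zero = 0,
     ring.add = (+),
     smult = \<lambda>P z. the_elem (seg_char sg ` P) * z,
     grade = \<lambda>d. if d = 0 then UNIV else {0}\<rparr>"

definition is_partition :: "nat list \<Rightarrow> bool" where
  "is_partition lam \<longleftrightarrow> sorted_wrt (\<ge>) lam \<and> 0 \<notin> set lam"

text \<open>A tableau is the list of its rows, so that \<open>T ! i ! j\<close> is the entry in the
  \<open>j+1\<close>st box of row \<open>i+1\<close>.\<close>

definition semistandard :: "nat \<Rightarrow> nat list \<Rightarrow> nat list list \<Rightarrow> bool" where
  "semistandard n lam T \<longleftrightarrow> map length T = lam \<and>
     (\<forall>row\<in>set T. set row \<subseteq> {1..n + 1} \<and> sorted row) \<and>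
     (\<forall>i j. i + 1 < length T \<and> j < length (T ! (i + 1)) \<longrightarrow> T ! i ! j < T ! (i + 1) ! j)"

text \<open>\<open>Psi T ! (k - 1)\<close> is the partition \<open>\<mu>\<^sup>(\<^sup>k\<^sup>)\<close>. The entries of row \<open>k\<close> are
  at least \<open>k\<close> because columns are strictly increasing, so the subtraction does not truncate.\<close>

definition Psi :: "nat list list \<Rightarrow> nat list list" where
  "Psi T = map (\<lambda>k. map (\<lambda>a. a - k) (rev (T ! (k - 1)))) [1..<length T + 1]"

text \<open>The segments of \<open>\<nabla>\<^sub>T\<close> in the order of its outer tensor factors: those starting at the
  last row number first.\<close>

definition tableau_segs :: "nat list list \<Rightarrow> (nat \<times> nat) list" where
  "tableau_segs T =
     concat (map (\<lambda>k. map (\<lambda>l. (k, l)) (Psi T ! (k - 1))) (rev [1..<length T + 1]))"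

definition tableau_weights :: "nat list list \<Rightarrow> nat multiset list" where
  "tableau_weights T = map seg_weight (tableau_segs T)"

definition nabla ::
  "nat \<Rightarrow> nat list list \<Rightarrow> ((klr_elt list \<Rightarrow>\<^sub>0 complex) set, (complex list \<Rightarrow>\<^sub>0 complex) set) graded"
  where
  "nabla n T = outer_tensor (map (klr n) (tableau_weights T)) (map seg_module (tableau_segs T))"

end

theory Submission
  imports Defs
begin

text \<open>
  The module \<open>Ind \<nabla>\<^sub>T\<close> is \<open>R/L\<close>, where the left ideal \<open>L\<close> is generated by the relations of the cyclic
  vector \<open>v\<close>: \<open>1\<^bsub>i\<^esub> v = v\<close> for the concatenation \<open>i\<close> of the segments, \<open>x\<^sub>k v = 0\<close>, and \<open>\<tau>\<^sub>t v = 0\<close> for \<open>t\<close>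
  inside a segment. It is spanned by the vectors \<open>\<tau>\<^sub>w v\<close> with \<open>w\<close> a shuffle of the segments. The starting
  points of the segments decrease, and among segments with the same starting point the lengths decrease.
  Therefore each shuffle whose word is again \<open>i\<close> has degree at most 0, with equality only for the trivial
  one, because to move a segment past an equal one costs degree. So the degree 0 part of the weight
  space of \<open>i\<close> is spanned by \<open>v\<close>.

  That \<open>v \<noteq> 0\<close> is seen on a generic module, where the \<open>x\<^sub>k\<close> act by pairwise distinct scalars: on a suitable
  vector the elements of \<open>L\<close> act like elements of smaller degree, whereas \<open>R\<close> is bounded below.

  A graded submodule is proper iff it does not contain \<open>v\<close>, that is, iff it does not meet the degree 0 part
  of the weight space of \<open>i\<close>. Hence there is a largest proper graded submodule, and the head is the
  irreducible quotient by it.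
\<close>

section \<open>The free algebra and the ideal of KLR relations\<close>

text \<open>Two obstacles shape the proof. The grading of the algebra is merely generated by the
  degrees of the generators, so a priori nothing separates different degrees. The torus action
  \<open>phi\<close> at the parameter 2 does: a homogeneous element of degree d is an eigenvector
  for the eigenvalue 2^d. Secondly, rewriting of words yields only the spanning half of a PBW
  theorem. One spanning result, \<open>klr_span\<close>, serves twice: with pairwise different
  labels it bounds the degrees of the algebra from below, with labels constant on each segment it
  describes \<open>R/L\<close>. The missing independence comes from the generic module. Since the
  quadratic relation contains x_t + x_{t+1}, a crossing inside a segment kills the test vector if
  consecutive letters carry opposite parameters; hence the alternating signs in
  \<open>\<zeta>\<close>. The records of the statement are quotients of quotients. Each is
  identified with a quotient of the free algebra, where modules become left ideals and equations
  become congruences. For the induced module the identification rests on two left ideals, its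
  annihilator \<open>Kr\<close> and \<open>lideal\<close>, each being the smallest one that contains
  the same relations.\<close>

instantiation list :: (type) monoid_add
begin
definition zero_list :: "'a list" where "zero_list = []"
definition plus_list :: "'a list \<Rightarrow> 'a list \<Rightarrow> 'a list" where "plus_list = (@)"
instance by standard (simp_all add: zero_list_def plus_list_def)
end

text \<open>With concatenation as the addition of lists, the convolution product of finitely
  supported functions is the product of the free algebra, and its ring laws come from the type
  class.\<close>

lemma cmon_mult [simp]: "cmon a u * cmon b v = cmon (a * b) (u @ v)"
  for u v :: "'a list"
  by (simp add: mult_single plus_list_def)

lemma cmon_one: "cmon 1 [] = (1 :: 'a list \<Rightarrow>\<^sub>0 complex)"
  by (metis single_one zero_list_def)

lemma poly_mapping_sum_singles: "p = (\<Sum>u\<in>Poly_Mapping.keys p. Poly_Mapping.single u (Poly_Mapping.lookup p u))"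
  by (rule poly_mapping_eqI)
    (auto simp: lookup_sum lookup_single when_def in_keys_iff sum.delta)

lemma poly_mapping_linear_induct [case_names single add]:
  fixes p :: "'a \<Rightarrow>\<^sub>0 'b::comm_monoid_add"
  assumes s: "\<And>u a. P (Poly_Mapping.single u a)" and a: "\<And>p q. P p \<Longrightarrow> P q \<Longrightarrow> P (p + q)"
  shows "P p"
proof -
  have "finite A \<Longrightarrow> P (\<Sum>u\<in>A. Poly_Mapping.single u (Poly_Mapping.lookup p u))" for A
  proof (induction A rule: finite_induct)
    case empty
    show ?case using s[of undefined 0] by simp
  qed (simp add: s a)
  then show ?thesis using poly_mapping_sum_singles[of p] by (metis finite_keys)
qed

text \<open>The scaling is a parameter because the extension is needed with several targets: the
  free algebra (\<open>cs\<close>), the complex numbers, and formal combinations over an arbitrary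
  basis (\<open>psc\<close>).\<close>

definition linext :: "(complex \<Rightarrow> 'b \<Rightarrow> 'b) \<Rightarrow> ('a \<Rightarrow> 'b) \<Rightarrow> ('a \<Rightarrow>\<^sub>0 complex) \<Rightarrow> 'b::comm_monoid_add" where
  "linext sc f p = (\<Sum>u\<in>Poly_Mapping.keys p. sc (Poly_Mapping.lookup p u) (f u))"

locale scaling =
  fixes sc :: "complex \<Rightarrow> 'b \<Rightarrow> 'b::ab_group_add"
  assumes sc_add: "sc (a + b) x = sc a x + sc b x"
    and sc_add2: "sc a (x + y) = sc a x + sc a y"
    and sc_mult: "sc a (sc b x) = sc (a * b) x"
    and sc_one: "sc 1 x = x"
begin

lemma sc_zero: "sc 0 x = 0" using sc_add[of 0 0 x] by simp
lemma sc_zero2: "sc a 0 = 0" using sc_add2[of a 0 0] by simp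

lemma linext_superset:
  "finite A \<Longrightarrow> Poly_Mapping.keys p \<subseteq> A \<Longrightarrow> linext sc f p = (\<Sum>u\<in>A. sc (Poly_Mapping.lookup p u) (f u))"
  unfolding linext_def by (rule sum.mono_neutral_left) (auto simp: in_keys_iff sc_zero)

lemma linext_add: "linext sc f (p + q) = linext sc f p + linext sc f q"
proof -
  let ?A = "Poly_Mapping.keys p \<union> Poly_Mapping.keys q"
  have "Poly_Mapping.keys (p + q) \<subseteq> ?A" by (rule Poly_Mapping.keys_add)
  then show ?thesis
    by (simp add: linext_superset[of ?A] lookup_add sc_add sum.distrib)
qed

lemma linext_single [simp]: "linext sc f (Poly_Mapping.single u a) = sc a (f u)"
  by (simp add: linext_def sc_zero)

lemma linext_zero [simp]: "linext sc f 0 = 0"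
  by (simp add: linext_def)

lemma linext_minus: "linext sc f (p - q) = linext sc f p - linext sc f q"
  by (metis add_diff_cancel_right' diff_add_cancel linext_add)

lemma linext_sum: "linext sc f (sum p A) = (\<Sum>i\<in>A. linext sc f (p i))"
  by (induction A rule: infinite_finite_induct) (simp_all add: linext_add)

end

text \<open>Scaling is multiplication by a constant, so that left ideals are closed under it without
  a separate axiom.\<close>

definition cs :: "complex \<Rightarrow> ('a list \<Rightarrow>\<^sub>0 complex) \<Rightarrow> ('a list \<Rightarrow>\<^sub>0 complex)" where
  "cs c p = cmon c [] * p"

lemma cs_cmon [simp]: "cs c (cmon a u) = cmon (c * a) u"
  by (simp add: cs_def)

interpretation cs: scaling cs
  by standard (simp_all add: cs_def algebra_simps single_add flip: mult.assoc, simp add: cmon_one)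

interpretation cm: scaling "(*) :: complex \<Rightarrow> complex \<Rightarrow> complex"
  by standard (simp_all add: algebra_simps)

lemma cs_mult_left: "cs c p * q = cs c (p * q)"
  by (simp add: cs_def mult.assoc)

lemma cs_mult_right: "p * cs c q = cs c (p * q)"
proof -
  have "p * cmon c [] = cmon c [] * p"
    by (induction p rule: poly_mapping_linear_induct) (simp_all add: algebra_simps)
  then show ?thesis by (simp add: cs_def flip: mult.assoc)
qed

lemma cs_diff: "cs c (p - q) = cs c p - cs c q"
  by (simp add: cs_def algebra_simps)

lemma cs_uminus: "cs c (- p) = - cs c p"
  by (simp add: cs_def)

lemma linext_cs_cmon: "linext cs (cmon 1) p = p"
  by (simp add: linext_def flip: poly_mapping_sum_singles)

lemma linext_cs_mult:
  assumes "\<And>u v. f (u @ v) = f u * f v"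
  shows "linext cs f (p * q) = linext cs f p * linext cs f q"
proof (induction p rule: poly_mapping_linear_induct)
  case (single u a)
  show ?case
    by (induction q rule: poly_mapping_linear_induct)
      (simp_all add: assms cs_mult_left cs_mult_right cs.sc_mult algebra_simps cs.linext_add)
qed (simp add: algebra_simps cs.linext_add)

lemma linext_cm_mult:
  assumes "\<And>u v. f (u @ v) = f u * f v"
  shows "linext (*) f (p * q) = linext (*) f p * linext (*) f q"
proof (induction p rule: poly_mapping_linear_induct)
  case (single u a)
  show ?case
    by (induction q rule: poly_mapping_linear_induct)
      (simp_all add: assms algebra_simps cm.linext_add)
qed (simp add: algebra_simps cm.linext_add)

lemma bilin_append: "bilin (@) p q = p * q" for p :: "'a list \<Rightarrow>\<^sub>0 complex"
proof -
  have "p * q = (\<Sum>u\<in>Poly_Mapping.keys p. \<Sum>v\<in>Poly_Mapping.keys q.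
     cmon (Poly_Mapping.lookup p u) u * cmon (Poly_Mapping.lookup q v) v)"
    by (subst poly_mapping_sum_singles[of p], subst poly_mapping_sum_singles[of q], subst sum_product, rule refl)
  then show ?thesis by (simp add: bilin_def)
qed

subsection \<open>Additive cosets in types\<close>

definition add_sg :: "'a::ab_group_add set \<Rightarrow> bool" where
  "add_sg N \<longleftrightarrow> 0 \<in> N \<and> (\<forall>x\<in>N. \<forall>y\<in>N. x - y \<in> N)"

lemma add_sg_0: "add_sg N \<Longrightarrow> 0 \<in> N"
  by (simp add: add_sg_def)

lemma add_sg_diff: "add_sg N \<Longrightarrow> x \<in> N \<Longrightarrow> y \<in> N \<Longrightarrow> x - y \<in> N"
  by (simp add: add_sg_def)

lemma add_sg_uminus: "add_sg N \<Longrightarrow> x \<in> N \<Longrightarrow> - x \<in> N"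
  by (metis add_sg_def diff_0)

lemma add_sg_add: "add_sg N \<Longrightarrow> x \<in> N \<Longrightarrow> y \<in> N \<Longrightarrow> x + y \<in> N"
  by (metis add_sg_uminus add_sg_diff diff_minus_eq_add)

lemma add_sg_sum: "add_sg N \<Longrightarrow> (\<And>i. i \<in> A \<Longrightarrow> f i \<in> N) \<Longrightarrow> sum f A \<in> N"
  by (induction A rule: infinite_finite_induct) (auto intro: add_sg_add add_sg_0)

text \<open>Cosets are given by differences in the type, without reference to a carrier. Additive
  cosets of the records take this form as soon as the addition of the record is that of the
  type.\<close>

definition cst :: "'a::ab_group_add set \<Rightarrow> 'a \<Rightarrow> 'a set" where
  "cst N a = {x. x - a \<in> N}"

lemma a_r_coset_eq_cst: "ring.add G = (+) \<Longrightarrow> N +>\<^bsub>G\<^esub> a = cst N a"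
  for N :: "'a::ab_group_add set"
  by (force simp: a_r_coset_def r_coset_def cst_def)

lemma a_rcosets_eq_cst: "ring.add G = (+) \<Longrightarrow> a_rcosets\<^bsub>G\<^esub> N = cst N ` carrier G"
  for N :: "'a::ab_group_add set"
  by (auto simp: A_RCOSETS_def' a_r_coset_eq_cst)

lemma cst_self: "add_sg N \<Longrightarrow> a \<in> cst N a"
  by (simp add: cst_def add_sg_0)

lemma cst_eq_iff:
  assumes N: "add_sg N"
  shows "cst N a = cst N b \<longleftrightarrow> a - b \<in> N"
proof
  assume "cst N a = cst N b"
  then have "a \<in> cst N b" using cst_self[OF N, of a] by simp
  then show "a - b \<in> N" by (simp add: cst_def)
next
  assume h: "a - b \<in> N"
  have "x - a \<in> N \<longleftrightarrow> x - b \<in> N" for x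
  proof
    assume "x - a \<in> N"
    from add_sg_add[OF N this h] show "x - b \<in> N" by simp
  next
    assume "x - b \<in> N"
    from add_sg_diff[OF N this h] show "x - a \<in> N" by simp
  qed
  then show "cst N a = cst N b" by (simp add: cst_def)
qed

lemma set_add_cst:
  assumes "ring.add G = (+)" "add_sg N"
  shows "set_add G (cst N a) (cst N b) = cst N (a + b)" 
proof -
  have "\<exists>y. y - a \<in> N \<and> (\<exists>z. z - b \<in> N \<and> x = y + z)" if "x - (a + b) \<in> N" for x
    using that add_sg_0[OF assms(2)]
    by (intro exI[of _ "x - b"]) (auto simp: algebra_simps intro!: exI[of _ b])
  moreover have "y + z - (a + b) \<in> N" if "y - a \<in> N" "z - b \<in> N" for y z
    using add_sg_add[OF assms(2) that] by (simp add: algebra_simps)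
  ultimately show ?thesis
    by (auto simp: set_add_def set_mult_def assms(1) cst_def)
qed

lemma cst_zero: "cst N 0 = N"
  by (simp add: cst_def)

subsection \<open>The ideal of relations\<close>

type_synonym falg = "klr_gen list \<Rightarrow>\<^sub>0 complex"

abbreviation gg :: "klr_gen \<Rightarrow> falg" where "gg g \<equiv> cmon 1 [g]"

definition legal :: "nat \<Rightarrow> nat multiset \<Rightarrow> falg set" where
  "legal n \<alpha> = {p. Poly_Mapping.keys p \<subseteq> lists (klr_gens n \<alpha>)}"

lemma klr_free_eq: "klr_free n \<alpha> = \<lparr>carrier = legal n \<alpha>, monoid.mult = (*), one = 1, ring.zero = 0, ring.add = (+)\<rparr>"
  by (auto simp: monoid_alg_def free_monoid_def cmon_one bilin_append legal_def fun_eq_iff)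

lemma legal_mult: "p \<in> legal n \<alpha> \<Longrightarrow> q \<in> legal n \<alpha> \<Longrightarrow> p * q \<in> legal n \<alpha>"
  using keys_mult[of p q] by (fastforce simp: legal_def plus_list_def)

lemma legal_add: "p \<in> legal n \<alpha> \<Longrightarrow> q \<in> legal n \<alpha> \<Longrightarrow> p + q \<in> legal n \<alpha>"
  using Poly_Mapping.keys_add[of p q] by (fastforce simp: legal_def)

lemma legal_uminus: "p \<in> legal n \<alpha> \<Longrightarrow> - p \<in> legal n \<alpha>"
  by (simp add: legal_def)

lemma legal_diff: "p \<in> legal n \<alpha> \<Longrightarrow> q \<in> legal n \<alpha> \<Longrightarrow> p - q \<in> legal n \<alpha>"
  using legal_add[OF _ legal_uminus, of p n \<alpha> q] by simp

lemma legal_zero: "0 \<in> legal n \<alpha>"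
  by (simp add: legal_def)

lemma legal_cmon: "set w \<subseteq> klr_gens n \<alpha> \<Longrightarrow> cmon c w \<in> legal n \<alpha>"
  by (auto simp: legal_def)

lemma legal_one: "1 \<in> legal n \<alpha>"
  by (simp add: legal_cmon flip: cmon_one)

lemma legal_sum: "(\<And>i. i \<in> A \<Longrightarrow> f i \<in> legal n \<alpha>) \<Longrightarrow> sum f A \<in> legal n \<alpha>"
  by (induction A rule: infinite_finite_induct) (auto simp: legal_add legal_zero)

lemma ring_klr_free: "ring (klr_free n \<alpha>)"
proof (rule ringI)
  show "abelian_group (klr_free n \<alpha>)"
  proof (rule abelian_groupI)
    fix x assume "x \<in> carrier (klr_free n \<alpha>)"
    then show "\<exists>y\<in>carrier (klr_free n \<alpha>). y \<oplus>\<^bsub>klr_free n \<alpha>\<^esub> x = \<zero>\<^bsub>klr_free n \<alpha>\<^esub>"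
      by (intro bexI[of _ "- x"]) (auto simp: klr_free_eq legal_uminus)
  qed (auto simp: klr_free_eq legal_add legal_zero algebra_simps)
  show "Group.monoid (klr_free n \<alpha>)"
    by (rule monoidI) (auto simp: klr_free_eq legal_mult legal_one algebra_simps)
qed (auto simp: klr_free_eq algebra_simps)

lemma swap_seq_in_seqs: "t < length is \<Longrightarrow> is \<in> seqs n \<alpha> \<Longrightarrow> swap_seq t is \<in> seqs n \<alpha>"
proof -
  assume "t < length is" "is \<in> seqs n \<alpha>"
  then have "mset (swap_seq t is) = mset is"
    by (auto simp: swap_seq_def mset_swap)
  with \<open>is \<in> seqs n \<alpha>\<close> show ?thesis
    by (auto simp: seqs_def dest: mset_eq_setD)
qed

lemma seqs_length: "is \<in> seqs n \<alpha> \<Longrightarrow> length is = size \<alpha>"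
  by (auto simp: seqs_def simp flip: size_mset)

lemma finite_seqs [simp]: "finite (seqs n \<alpha>)"
  by (rule finite_subset[OF _ finite_lists_length_eq[of "{1..n}" "size \<alpha>"]])
    (use seqs_length in \<open>auto simp: seqs_def\<close>)

lemma gens_memb:
  "Gx k \<in> klr_gens n \<alpha> \<longleftrightarrow> k \<in> {1..size \<alpha>}"
  "Gtau t \<in> klr_gens n \<alpha> \<longleftrightarrow> t \<in> {1..<size \<alpha>}"
  "Gidem i \<in> klr_gens n \<alpha> \<longleftrightarrow> i \<in> seqs n \<alpha>"
  by (auto simp: klr_gens_def)

abbreviation X :: "nat \<Rightarrow> falg" where "X k \<equiv> gg (Gx k)"
abbreviation T :: "nat \<Rightarrow> falg" where "T t \<equiv> gg (Gtau t)"
abbreviation E :: "nat list \<Rightarrow> falg" where "E i \<equiv> gg (Gidem i)"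

definition adj :: "nat \<Rightarrow> nat \<Rightarrow> bool" where "adj i j \<longleftrightarrow> \<bar>int i - int j\<bar> = 1"

text \<open>The relations in product form. The torus action, the generic module, the concatenation
  embedding and the segment characters are all checked on the relations through this rule.\<close>

lemma klr_rels_cases [consumes 1, case_names unit idem xidem tauidem xx tautau quad braid taux]:
  assumes "p \<in> klr_rels n \<alpha>"
    and "Q ((\<Sum>i\<in>seqs n \<alpha>. E i) - 1)"
    and "\<And>i j. i \<in> seqs n \<alpha> \<Longrightarrow> j \<in> seqs n \<alpha> \<Longrightarrow> Q (E i * E j - (if i = j then E i else 0))"
    and "\<And>k i. k \<in> {1..size \<alpha>} \<Longrightarrow> i \<in> seqs n \<alpha> \<Longrightarrow> Q (X k * E i - E i * X k)"
    and "\<And>t i. t \<in> {1..<size \<alpha>} \<Longrightarrow> i \<in> seqs n \<alpha> \<Longrightarrow> Q (T t * E i - E (swap_seq t i) * T t)"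
    and "\<And>k l. k \<in> {1..size \<alpha>} \<Longrightarrow> l \<in> {1..size \<alpha>} \<Longrightarrow> Q (X k * X l - X l * X k)"
    and "\<And>t s. t \<in> {1..<size \<alpha>} \<Longrightarrow> s \<in> {1..<size \<alpha>} \<Longrightarrow> \<bar>int t - int s\<bar> > 1 \<Longrightarrow> Q (T t * T s - T s * T t)"
    and "\<And>t i. t \<in> {1..<size \<alpha>} \<Longrightarrow> i \<in> seqs n \<alpha> \<Longrightarrow> Q (T t * T t * E i -
       (if entry i t = entry i (t + 1) then 0
        else if \<not> adj (entry i t) (entry i (t + 1)) then E i
        else (X t + X (t + 1)) * E i))"
    and "\<And>t i. t \<in> {1..<size \<alpha>} \<Longrightarrow> t + 1 \<in> {1..<size \<alpha>} \<Longrightarrow> i \<in> seqs n \<alpha> \<Longrightarrow>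
       Q (T t * T (t + 1) * T t * E i - T (t + 1) * T t * T (t + 1) * E i
       - (if entry i t = entry i (t + 2) \<and> adj (entry i t) (entry i (t + 1)) then E i else 0))"
    and "\<And>t k i. t \<in> {1..<size \<alpha>} \<Longrightarrow> k \<in> {1..size \<alpha>} \<Longrightarrow> i \<in> seqs n \<alpha> \<Longrightarrow>
       Q (T t * X k * E i - X (if k = t then t + 1 else if k = t + 1 then t else k) * T t * E i
       - (if k = t \<and> entry i t = entry i (t + 1) then E i
          else if k = t + 1 \<and> entry i t = entry i (t + 1) then - E i else 0))"
  shows "Q p"
proof -
  have a: "(if entry i t = entry i (t + 1) then 0
        else if \<not> adj (entry i t) (entry i (t + 1)) then E i
        else (X t + X (t + 1)) * E i) = (if entry i t = entry i (t + 1) then 0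
        else if \<bar>int (entry i t) - int (entry i (t + 1))\<bar> > 1 then cmon 1 [Gidem i]
        else cmon 1 [Gx t, Gidem i] + cmon 1 [Gx (t + 1), Gidem i])" for i t
    by (auto simp: adj_def algebra_simps)
  have b: "cmon (-1) [Gidem i] = - E i" for i
    by (simp add: single_uminus)
  note asm = assms(2-)[unfolded a] 
  show ?thesis
    using assms(1) unfolding klr_rels_def b
    apply (elim UnE CollectE exE conjE singletonE)
            apply (simp_all only:)
    subgoal using asm(1) by (simp add: cmon_one)
    subgoal for i j using asm(2)[of i j] by simp
    subgoal for k i using asm(3)[of k i] by simp
    subgoal for t i using asm(4)[of t i] by simp
    subgoal for k l using asm(5)[of k l] by simp
    subgoal for t s using asm(6)[of t s] by simp
    subgoal for t i using asm(7)[of t i] by simp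
    subgoal for t i using asm(8)[of t i] by (simp add: adj_def)
    subgoal for t k i using asm(9)[of t k i] by simp
    done
qed

lemma klr_rels_legal: "klr_rels n \<alpha> \<subseteq> legal n \<alpha>"
proof
  fix p assume "p \<in> klr_rels n \<alpha>"
  then show "p \<in> legal n \<alpha>"
    by (cases rule: klr_rels_cases[of p n \<alpha> "\<lambda>p. p \<in> legal n \<alpha>"])
      (auto simp: seqs_length gens_memb swap_seq_in_seqs
        intro!: legal_diff legal_add legal_sum legal_one legal_uminus legal_zero legal_mult legal_cmon)
qed

lemma ideal_klr_ideal: "ideal (klr_ideal n \<alpha>) (klr_free n \<alpha>)"
  unfolding klr_ideal_def
  by (rule ring.genideal_ideal[OF ring_klr_free]) (simp add: klr_free_eq klr_rels_legal)

text \<open>Intersecting \<open>H\<close> with the carrier gives an ideal of the record. Absorption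
  is asked for legal factors only, since \<open>klr_ideal_act\<close> can offer no more on the
  right.\<close>

lemma klr_ideal_minimal:
  assumes "add_sg H" "\<And>p q. p \<in> H \<Longrightarrow> q \<in> legal n \<alpha> \<Longrightarrow> q * p \<in> H"
    "\<And>p q. p \<in> H \<Longrightarrow> q \<in> legal n \<alpha> \<Longrightarrow> p * q \<in> H" "klr_rels n \<alpha> \<subseteq> H"
  shows "klr_ideal n \<alpha> \<subseteq> H"
proof -
  have "ideal (H \<inter> legal n \<alpha>) (klr_free n \<alpha>)"
  proof (rule idealI[OF ring_klr_free])
    show "subgroup (H \<inter> legal n \<alpha>) (add_monoid (klr_free n \<alpha>))"
    proof (rule group.subgroupI)
      show "group (add_monoid (klr_free n \<alpha>))"
        using ring_klr_free[of n \<alpha>] by (rule abelian_group.a_group[OF ring.is_abelian_group])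
      show "H \<inter> legal n \<alpha> \<noteq> {}"
        using add_sg_0[OF assms(1)] legal_zero by blast
      fix a assume a: "a \<in> H \<inter> legal n \<alpha>"
      have "inv\<^bsub>add_monoid (klr_free n \<alpha>)\<^esub> a = - a"
        by (rule group.inv_equality[OF \<open>group _\<close>])
          (use a in \<open>auto simp: klr_free_eq legal_uminus\<close>)
      then show "inv\<^bsub>add_monoid (klr_free n \<alpha>)\<^esub> a \<in> H \<inter> legal n \<alpha>"
        using a by (auto simp: legal_uminus add_sg_uminus[OF assms(1)])
    qed (auto simp: klr_free_eq legal_add add_sg_add[OF assms(1)])
  qed (use assms in \<open>auto simp: klr_free_eq legal_mult\<close>)
  moreover have "klr_rels n \<alpha> \<subseteq> H \<inter> legal n \<alpha>"
    using assms(4) klr_rels_legal by auto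
  ultimately show ?thesis
    unfolding klr_ideal_def by (metis ring.genideal_minimal[OF ring_klr_free] le_inf_iff)
qed

section \<open>Extension of the relation ideal to words with arbitrary letters\<close>

definition proj :: "nat \<Rightarrow> nat multiset \<Rightarrow> falg \<Rightarrow> falg" where
  "proj n \<alpha> = linext cs (\<lambda>u. if set u \<subseteq> klr_gens n \<alpha> then cmon 1 u else 0)"

lemma proj_add: "proj n \<alpha> (p + q) = proj n \<alpha> p + proj n \<alpha> q"
  by (simp add: proj_def cs.linext_add)

lemma proj_diff: "proj n \<alpha> (p - q) = proj n \<alpha> p - proj n \<alpha> q"
  by (simp add: proj_def cs.linext_minus)

lemma proj_mult: "proj n \<alpha> (p * q) = proj n \<alpha> p * proj n \<alpha> q"
  unfolding proj_def by (rule linext_cs_mult) auto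

lemma proj_legal: "p \<in> legal n \<alpha> \<Longrightarrow> proj n \<alpha> p = p"
proof -
  assume "p \<in> legal n \<alpha>"
  then have "proj n \<alpha> p = linext cs (cmon 1) p"
    unfolding proj_def linext_def legal_def by (intro sum.cong) (auto simp: in_lists_conv_set)
  then show ?thesis by (simp add: linext_cs_cmon)
qed

lemma proj_in_legal: "proj n \<alpha> p \<in> legal n \<alpha>"
  unfolding proj_def linext_def by (intro legal_sum) (auto simp: legal_zero legal_cmon cs.sc_zero2)

text \<open>Killing the words with letters outside \<open>klr_gens\<close> makes the ideal a two-sided
  ideal of the whole free algebra, so that computations need no carrier conditions.\<close>

definition J :: "nat \<Rightarrow> nat multiset \<Rightarrow> falg set" where
  "J n \<alpha> = {p. proj n \<alpha> p \<in> klr_ideal n \<alpha>}"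

lemma klr_ideal_sub_legal: "klr_ideal n \<alpha> \<subseteq> legal n \<alpha>"
  using ideal.Icarr[OF ideal_klr_ideal] by (auto simp: klr_free_eq)

lemma klr_ideal_sub_J: "klr_ideal n \<alpha> \<subseteq> J n \<alpha>"
  using klr_ideal_sub_legal[of n \<alpha>] by (auto simp: J_def proj_legal subset_iff)

lemma J_legal: "p \<in> J n \<alpha> \<Longrightarrow> p \<in> legal n \<alpha> \<Longrightarrow> p \<in> klr_ideal n \<alpha>"
  by (simp add: J_def proj_legal)

lemma add_sg_klr_ideal: "add_sg (klr_ideal n \<alpha>)"
proof -
  interpret ideal "klr_ideal n \<alpha>" "klr_free n \<alpha>" by (rule ideal_klr_ideal)
  have "x - y \<in> klr_ideal n \<alpha>" if "x \<in> klr_ideal n \<alpha>" "y \<in> klr_ideal n \<alpha>" for x y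
  proof -
    have "(- 1) * y \<in> klr_ideal n \<alpha>"
      using I_l_closed[OF that(2), of "-1"] by (simp add: klr_free_eq legal_uminus legal_one)
    then have "x \<oplus>\<^bsub>klr_free n \<alpha>\<^esub> (- y) \<in> klr_ideal n \<alpha>"
      using additive_subgroup.a_closed[OF additive_subgroup_axioms that(1), of "- y"] by simp
    then show ?thesis by (simp add: klr_free_eq)
  qed
  then show ?thesis using additive_subgroup.zero_closed[OF additive_subgroup_axioms]
    by (simp add: add_sg_def klr_free_eq)
qed

lemma add_sg_J: "add_sg (J n \<alpha>)"
  using add_sg_klr_ideal[of n \<alpha>] by (auto simp: add_sg_def J_def proj_diff) (simp add: proj_def)

lemma J_mult_left: "p \<in> J n \<alpha> \<Longrightarrow> q * p \<in> J n \<alpha>"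
  using ideal.I_l_closed[OF ideal_klr_ideal, of "proj n \<alpha> p" n \<alpha> "proj n \<alpha> q"]
  by (simp add: J_def proj_mult klr_free_eq proj_in_legal)

lemma J_mult_right: "p \<in> J n \<alpha> \<Longrightarrow> p * q \<in> J n \<alpha>"
  using ideal.I_r_closed[OF ideal_klr_ideal, of "proj n \<alpha> p" n \<alpha> "proj n \<alpha> q"]
  by (simp add: J_def proj_mult klr_free_eq proj_in_legal)

lemma J_rels: "p \<in> klr_rels n \<alpha> \<Longrightarrow> p \<in> J n \<alpha>"
  using ring.genideal_self[OF ring_klr_free, of "klr_rels n \<alpha>" n \<alpha>] klr_ideal_sub_J klr_rels_legal
  by (fastforce simp: klr_ideal_def klr_free_eq)

lemma J_illegal: "g \<notin> klr_gens n \<alpha> \<Longrightarrow> gg g \<in> J n \<alpha>"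
  by (simp add: J_def proj_def cs.sc_zero2 add_sg_0[OF add_sg_klr_ideal])

text \<open>Modulo \<open>H\<close> every element equals its legal part, because a word with an
  illegal letter is a multiple of that letter. The legal part is covered by
  \<open>klr_ideal_minimal\<close>.\<close>

lemma J_minimal:
  assumes "add_sg H" "\<And>p q. p \<in> H \<Longrightarrow> q * p \<in> H" "\<And>p q. p \<in> H \<Longrightarrow> p * q \<in> H"
    "klr_rels n \<alpha> \<subseteq> H" "\<And>g. g \<notin> klr_gens n \<alpha> \<Longrightarrow> gg g \<in> H"
  shows "J n \<alpha> \<subseteq> H"
proof
  fix p assume p: "p \<in> J n \<alpha>"
  have w: "cmon 1 u \<in> H" if "\<not> set u \<subseteq> klr_gens n \<alpha>" for u
  proof -
    obtain g where "g \<in> set u" "g \<notin> klr_gens n \<alpha>" using \<open>\<not> _\<close> by auto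
    then obtain a b where "u = a @ g # b" by (meson split_list)
    then have "cmon 1 u = cmon 1 a * gg g * cmon 1 b" by simp
    then show ?thesis using assms(2,3,5) \<open>g \<notin> _\<close> by metis
  qed
  have "q - proj n \<alpha> q \<in> H" for q
  proof (induction q rule: poly_mapping_linear_induct)
    case (single u a)
    have "cmon a u = cmon a [] * cmon 1 u" by simp
    then show ?case using w[of u] assms(2)[of "cmon 1 u" "cmon a []"] add_sg_0[OF assms(1)]
      by (simp add: proj_def cs.sc_zero2)
  next
    case (add p q)
    then show ?case using add_sg_add[OF assms(1), of "p - proj n \<alpha> p" "q - proj n \<alpha> q"]
      by (simp add: proj_add algebra_simps)
  qed
  moreover have "proj n \<alpha> p \<in> H"
    using klr_ideal_minimal[of H n \<alpha>] assms p by (auto simp: J_def)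
  ultimately show "p \<in> H" using add_sg_add[OF assms(1), of "p - proj n \<alpha> p" "proj n \<alpha> p"] by simp
qed

lemma rels_memb:
  "(\<Sum>i\<in>seqs n \<alpha>. E i) - 1 \<in> klr_rels n \<alpha>"
  "i \<in> seqs n \<alpha> \<Longrightarrow> j \<in> seqs n \<alpha> \<Longrightarrow> E i * E j - (if i = j then E i else 0) \<in> klr_rels n \<alpha>"
  "k \<in> {1..size \<alpha>} \<Longrightarrow> i \<in> seqs n \<alpha> \<Longrightarrow> X k * E i - E i * X k \<in> klr_rels n \<alpha>"
  "t \<in> {1..<size \<alpha>} \<Longrightarrow> i \<in> seqs n \<alpha> \<Longrightarrow> T t * E i - E (swap_seq t i) * T t \<in> klr_rels n \<alpha>"
  "k \<in> {1..size \<alpha>} \<Longrightarrow> l \<in> {1..size \<alpha>} \<Longrightarrow> X k * X l - X l * X k \<in> klr_rels n \<alpha>"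
  "t \<in> {1..<size \<alpha>} \<Longrightarrow> s \<in> {1..<size \<alpha>} \<Longrightarrow> \<bar>int t - int s\<bar> > 1 \<Longrightarrow> T t * T s - T s * T t \<in> klr_rels n \<alpha>"
  "t \<in> {1..<size \<alpha>} \<Longrightarrow> i \<in> seqs n \<alpha> \<Longrightarrow> T t * T t * E i -
       (if entry i t = entry i (t + 1) then 0
        else if \<not> adj (entry i t) (entry i (t + 1)) then E i
        else (X t + X (t + 1)) * E i) \<in> klr_rels n \<alpha>"
  "t \<in> {1..<size \<alpha>} \<Longrightarrow> t + 1 \<in> {1..<size \<alpha>} \<Longrightarrow> i \<in> seqs n \<alpha> \<Longrightarrow>
       T t * T (t + 1) * T t * E i - T (t + 1) * T t * T (t + 1) * E i
       - (if entry i t = entry i (t + 2) \<and> adj (entry i t) (entry i (t + 1)) then E i else 0) \<in> klr_rels n \<alpha>"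
  "t \<in> {1..<size \<alpha>} \<Longrightarrow> k \<in> {1..size \<alpha>} \<Longrightarrow> i \<in> seqs n \<alpha> \<Longrightarrow>
       T t * X k * E i - X (if k = t then t + 1 else if k = t + 1 then t else k) * T t * E i
       - (if k = t \<and> entry i t = entry i (t + 1) then E i
          else if k = t + 1 \<and> entry i t = entry i (t + 1) then - E i else 0) \<in> klr_rels n \<alpha>"
proof -
  have b: "- E i = cmon (-1) [Gidem i]" for i
    by (simp add: single_uminus)
  have a: "(if entry i t = entry i (t + 1) then 0
        else if \<not> adj (entry i t) (entry i (t + 1)) then E i
        else (X t + X (t + 1)) * E i) = (if entry i t = entry i (t + 1) then 0
        else if \<bar>int (entry i t) - int (entry i (t + 1))\<bar> > 1 then cmon 1 [Gidem i]
        else cmon 1 [Gx t, Gidem i] + cmon 1 [Gx (t + 1), Gidem i])" for i t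
    by (auto simp: adj_def algebra_simps)
  show "(\<Sum>i\<in>seqs n \<alpha>. E i) - 1 \<in> klr_rels n \<alpha>" by (simp add: klr_rels_def cmon_one)
  show "i \<in> seqs n \<alpha> \<Longrightarrow> j \<in> seqs n \<alpha> \<Longrightarrow> E i * E j - (if i = j then E i else 0) \<in> klr_rels n \<alpha>"
    by (unfold klr_rels_def, rule UnI1, rule UnI1, rule UnI1, rule UnI1, rule UnI1, rule UnI1, rule UnI1, rule UnI2, rule CollectI, rule exI[of _ i], rule exI[of _ j], simp)
  show "k \<in> {1..size \<alpha>} \<Longrightarrow> i \<in> seqs n \<alpha> \<Longrightarrow> X k * E i - E i * X k \<in> klr_rels n \<alpha>"
    by (unfold klr_rels_def, rule UnI1, rule UnI1, rule UnI1, rule UnI1, rule UnI1, rule UnI1, rule UnI2, rule CollectI, rule exI[of _ k], rule exI[of _ i], simp)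
  show "t \<in> {1..<size \<alpha>} \<Longrightarrow> i \<in> seqs n \<alpha> \<Longrightarrow> T t * E i - E (swap_seq t i) * T t \<in> klr_rels n \<alpha>"
    by (unfold klr_rels_def, rule UnI1, rule UnI1, rule UnI1, rule UnI1, rule UnI1, rule UnI2, rule CollectI, rule exI[of _ t], rule exI[of _ i], simp)
  show "k \<in> {1..size \<alpha>} \<Longrightarrow> l \<in> {1..size \<alpha>} \<Longrightarrow> X k * X l - X l * X k \<in> klr_rels n \<alpha>"
    by (unfold klr_rels_def, rule UnI1, rule UnI1, rule UnI1, rule UnI1, rule UnI2, rule CollectI, rule exI[of _ k], rule exI[of _ l], simp)
  show "t \<in> {1..<size \<alpha>} \<Longrightarrow> s \<in> {1..<size \<alpha>} \<Longrightarrow> \<bar>int t - int s\<bar> > 1 \<Longrightarrow> T t * T s - T s * T t \<in> klr_rels n \<alpha>"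
    by (unfold klr_rels_def, rule UnI1, rule UnI1, rule UnI1, rule UnI2, rule CollectI, rule exI[of _ t], rule exI[of _ s], simp)
  show "t \<in> {1..<size \<alpha>} \<Longrightarrow> i \<in> seqs n \<alpha> \<Longrightarrow> T t * T t * E i -
       (if entry i t = entry i (t + 1) then 0
        else if \<not> adj (entry i t) (entry i (t + 1)) then E i
        else (X t + X (t + 1)) * E i) \<in> klr_rels n \<alpha>"
    by (unfold klr_rels_def, rule UnI1, rule UnI1, rule UnI2, rule CollectI, rule exI[of _ t], rule exI[of _ i], simp only: a, simp)
  show "t \<in> {1..<size \<alpha>} \<Longrightarrow> t + 1 \<in> {1..<size \<alpha>} \<Longrightarrow> i \<in> seqs n \<alpha> \<Longrightarrow>
       T t * T (t + 1) * T t * E i - T (t + 1) * T t * T (t + 1) * E i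
       - (if entry i t = entry i (t + 2) \<and> adj (entry i t) (entry i (t + 1)) then E i else 0) \<in> klr_rels n \<alpha>"
    by (unfold klr_rels_def, rule UnI1, rule UnI2, rule CollectI, rule exI[of _ t], rule exI[of _ i], simp add: adj_def)
  show "t \<in> {1..<size \<alpha>} \<Longrightarrow> k \<in> {1..size \<alpha>} \<Longrightarrow> i \<in> seqs n \<alpha> \<Longrightarrow>
       T t * X k * E i - X (if k = t then t + 1 else if k = t + 1 then t else k) * T t * E i
       - (if k = t \<and> entry i t = entry i (t + 1) then E i
          else if k = t + 1 \<and> entry i t = entry i (t + 1) then - E i else 0) \<in> klr_rels n \<alpha>"
    by (unfold klr_rels_def, rule UnI2, rule CollectI, rule exI[of _ t], rule exI[of _ k], rule exI[of _ i], simp add: single_uminus)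
qed

lemmas J_rel = rels_memb[THEN J_rels]

declare cmon_mult [simp del] cs_cmon [simp del]

section \<open>The KLR algebra as a quotient of the free algebra\<close>

text \<open>Composing with \<open>proj\<close> makes the class map total on the free algebra, so
  that \<open>klr_simps\<close> holds without membership conditions.\<close>

definition cls :: "nat \<Rightarrow> nat multiset \<Rightarrow> falg \<Rightarrow> klr_elt" where
  "cls n \<alpha> p = cst (klr_ideal n \<alpha>) (proj n \<alpha> p)"

lemma klr_class_eq: "p \<in> legal n \<alpha> \<Longrightarrow> klr_class n \<alpha> p = cls n \<alpha> p"
  by (simp add: klr_class_def cls_def proj_legal a_r_coset_eq_cst klr_free_eq)

lemma cls_eq_iff: "cls n \<alpha> p = cls n \<alpha> q \<longleftrightarrow> p - q \<in> J n \<alpha>"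
  by (simp add: cls_def cst_eq_iff[OF add_sg_klr_ideal] J_def proj_diff)

lemma carrier_klr: "carrier (klr n \<alpha>) = range (cls n \<alpha>)"
proof -
  have "carrier (klr n \<alpha>) = cst (klr_ideal n \<alpha>) ` legal n \<alpha>"
    by (simp add: klr_def klr_ring_def ring.defs FactRing_def a_rcosets_eq_cst klr_free_eq)
  also have "\<dots> = range (cls n \<alpha>)"
  proof
    show "cst (klr_ideal n \<alpha>) ` legal n \<alpha> \<subseteq> range (cls n \<alpha>)"
      by (metis cls_def image_subsetI proj_legal rangeI)
    show "range (cls n \<alpha>) \<subseteq> cst (klr_ideal n \<alpha>) ` legal n \<alpha>"
      by (auto simp: cls_def proj_in_legal)
  qed
  finally show ?thesis .
qed

lemma klr_ring_mult: "cls n \<alpha> p \<otimes>\<^bsub>klr_ring n \<alpha>\<^esub> cls n \<alpha> q = cls n \<alpha> (p * q)"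
  using ideal.rcoset_mult_add[OF ideal_klr_ideal, of "proj n \<alpha> p" n \<alpha> "proj n \<alpha> q"]
  by (simp add: klr_ring_def FactRing_def cls_def a_r_coset_eq_cst klr_free_eq proj_in_legal proj_mult)

lemma klr_ring_add: "cls n \<alpha> p \<oplus>\<^bsub>klr_ring n \<alpha>\<^esub> cls n \<alpha> q = cls n \<alpha> (p + q)"
  by (simp add: klr_ring_def FactRing_def cls_def klr_free_eq set_add_cst add_sg_klr_ideal proj_add)

lemma klr_ring_zero: "\<zero>\<^bsub>klr_ring n \<alpha>\<^esub> = cls n \<alpha> 0"
  by (simp add: klr_ring_def FactRing_def cls_def cst_zero proj_legal legal_zero)

lemma klr_scale_cls: "klr_scale n \<alpha> c (cls n \<alpha> p) = cls n \<alpha> (cs c p)"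
  by (simp add: klr_scale_def klr_class_eq legal_cmon klr_ring_mult cs_def)

lemma klr_simps:
  "cls n \<alpha> p \<otimes>\<^bsub>klr n \<alpha>\<^esub> cls n \<alpha> q = cls n \<alpha> (p * q)"
  "cls n \<alpha> p \<oplus>\<^bsub>klr n \<alpha>\<^esub> cls n \<alpha> q = cls n \<alpha> (p + q)"
  "\<zero>\<^bsub>klr n \<alpha>\<^esub> = cls n \<alpha> 0"
  "c \<odot>\<^bsub>klr n \<alpha>\<^esub> cls n \<alpha> p = cls n \<alpha> (cs c p)"
  using klr_ring_mult klr_ring_add klr_ring_zero klr_scale_cls
  by (simp_all add: klr_def ring.defs)

lemma klr_one: "\<one>\<^bsub>klr n \<alpha>\<^esub> = cls n \<alpha> 1"
  by (simp add: klr_def ring.defs klr_ring_def FactRing_def cls_def a_r_coset_eq_cst klr_free_eq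
      proj_legal legal_one)

lemma ring_klr: "ring (klr n \<alpha>)"
proof (rule ringI)
  show "abelian_group (klr n \<alpha>)"
  proof (rule abelian_groupI)
    fix x assume "x \<in> carrier (klr n \<alpha>)"
    then obtain p where "x = cls n \<alpha> p" by (auto simp: carrier_klr)
    then show "\<exists>y\<in>carrier (klr n \<alpha>). y \<oplus>\<^bsub>klr n \<alpha>\<^esub> x = \<zero>\<^bsub>klr n \<alpha>\<^esub>"
      by (intro bexI[of _ "cls n \<alpha> (- p)"]) (auto simp: klr_simps carrier_klr)
  qed (auto simp: carrier_klr klr_simps algebra_simps)
  show "Group.monoid (klr n \<alpha>)"
    by (rule monoidI) (auto simp: carrier_klr klr_simps klr_one algebra_simps)
qed (auto simp: carrier_klr klr_simps algebra_simps)

lemma mem_cls: "p \<in> cls n \<alpha> q \<Longrightarrow> p - q \<in> J n \<alpha> \<and> p \<in> legal n \<alpha>"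
proof -
  assume "p \<in> cls n \<alpha> q"
  then have h: "p - proj n \<alpha> q \<in> klr_ideal n \<alpha>" by (simp add: cls_def cst_def)
  have "p - proj n \<alpha> q + proj n \<alpha> q \<in> legal n \<alpha>"
    using h klr_ideal_sub_legal proj_in_legal by (intro legal_add) auto
  then have "p \<in> legal n \<alpha>" by simp
  then show ?thesis using h by (simp add: J_def proj_diff proj_legal)
qed

lemma cls_nonempty: "proj n \<alpha> q \<in> cls n \<alpha> q"
  by (simp add: cls_def cst_self add_sg_klr_ideal)

lemma klr_sum: "finite A \<Longrightarrow> finsum (klr n \<alpha>) (\<lambda>i. cls n \<alpha> (f i)) A = cls n \<alpha> (sum f A)"
proof (induction A rule: finite_induct)
  case empty
  interpret ring "klr n \<alpha>" by (rule ring_klr)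
  show ?case by (simp add: klr_simps)
next
  case (insert x F)
  interpret ring "klr n \<alpha>" by (rule ring_klr)
  show ?case
    using insert by (subst finsum_insert) (auto simp: carrier_klr klr_simps)
qed

subsection \<open>Homogeneous elements\<close>

definition homog :: "nat \<Rightarrow> nat multiset \<Rightarrow> int \<Rightarrow> falg \<Rightarrow> bool" where
  "homog n \<alpha> d p \<longleftrightarrow> klr_homogeneous n \<alpha> d (cls n \<alpha> p)"

lemma klr_homogeneous_cls: "klr_homogeneous n \<alpha> d P \<Longrightarrow> \<exists>p. P = cls n \<alpha> p"
proof (induction rule: klr_homogeneous.induct)
  case (scale d P c) then show ?case using klr_scale_cls by blast
next
  case (add d P P') then show ?case using klr_ring_add by blast
next
  case (times d P d' P') then show ?case using klr_ring_mult by blast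
next
  case (zero d) then show ?case using klr_ring_zero by blast
qed (metis klr_class_eq legal_cmon bot.extremum empty_set list.simps(15) gens_memb insert_subset)+

lemma grade_klr: "grade (klr n \<alpha>) d = cls n \<alpha> ` {p. homog n \<alpha> d p}"
  by (auto simp: klr_def ring.defs homog_def dest: klr_homogeneous_cls)

lemma homog_cong: "p - q \<in> J n \<alpha> \<Longrightarrow> homog n \<alpha> d p \<longleftrightarrow> homog n \<alpha> d q"
  by (metis homog_def cls_eq_iff)

lemma homog_gens:
  "i \<in> seqs n \<alpha> \<Longrightarrow> homog n \<alpha> 0 (E i)"
  "k \<in> {1..size \<alpha>} \<Longrightarrow> i \<in> seqs n \<alpha> \<Longrightarrow> homog n \<alpha> 2 (X k * E i)"
  "t \<in> {1..<size \<alpha>} \<Longrightarrow> i \<in> seqs n \<alpha> \<Longrightarrow> homog n \<alpha> (- cartan (entry i t) (entry i (t + 1))) (T t * E i)"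
  unfolding homog_def
  subgoal using klr_homogeneous.idem[of i n \<alpha>] by (simp add: klr_class_eq legal_cmon gens_memb)
  subgoal using klr_homogeneous.x[of k \<alpha> i n] by (simp add: klr_class_eq legal_cmon gens_memb cmon_mult)
  subgoal using klr_homogeneous.tau[of t \<alpha> i n] by (simp add: klr_class_eq legal_cmon gens_memb cmon_mult)
  done

lemma homog_zero: "homog n \<alpha> d 0"
  using klr_homogeneous.zero by (simp add: homog_def klr_ring_zero)

lemma homog_add: "homog n \<alpha> d p \<Longrightarrow> homog n \<alpha> d q \<Longrightarrow> homog n \<alpha> d (p + q)"
  using klr_homogeneous.add by (fastforce simp: homog_def klr_ring_add)

lemma homog_cs: "homog n \<alpha> d p \<Longrightarrow> homog n \<alpha> d (cs c p)"
  using klr_homogeneous.scale by (fastforce simp: homog_def klr_scale_cls)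

lemma homog_mult: "homog n \<alpha> d p \<Longrightarrow> homog n \<alpha> e q \<Longrightarrow> homog n \<alpha> (d + e) (p * q)"
  using klr_homogeneous.times by (fastforce simp: homog_def klr_ring_mult)

lemma homog_uminus: "homog n \<alpha> d p \<Longrightarrow> homog n \<alpha> d (- p)"
  using homog_cs[of n \<alpha> d p "-1"] by (simp add: cs_def single_uminus cmon_one)

lemma homog_diff: "homog n \<alpha> d p \<Longrightarrow> homog n \<alpha> d q \<Longrightarrow> homog n \<alpha> d (p - q)"
  using homog_add[OF _ homog_uminus, of n \<alpha> d p q] by simp

lemma homog_sum: "(\<And>i. i \<in> A \<Longrightarrow> homog n \<alpha> d (f i)) \<Longrightarrow> homog n \<alpha> d (sum f A)"
  by (induction A rule: infinite_finite_induct) (auto simp: homog_zero homog_add)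

lemma if_mult_zero: "(if P then a else 0) * u = (if P then a * u else (0 :: 'a :: semiring_0))"
  by simp

subsection \<open>Left ideals containing the relations\<close>

definition eqv :: "falg \<Rightarrow> falg set \<Rightarrow> falg \<Rightarrow> bool" ("(_ \<bumpeq>\<^bsub>_\<^esub> _)" [51, 0, 51] 50) where
  "p \<bumpeq>\<^bsub>L\<^esub> q \<longleftrightarrow> p - q \<in> L"

text \<open>Such an \<open>L\<close> stands for the cyclic module \<open>R/L\<close>, and an element
  of the free algebra for the vector it produces from the generator. With
  \<open>L = J n \<alpha>\<close> the same lemmas compute in the algebra itself; other instances are
  \<open>lideal\<close>, \<open>Kr\<close> and \<open>Lmax\<close>.\<close>

locale klr_left =
  fixes n :: nat and \<alpha> :: "nat multiset" and L :: "falg set"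
  assumes sgL: "add_sg L" and L_mult: "\<And>p q. p \<in> L \<Longrightarrow> q * p \<in> L" and J_sub_L: "J n \<alpha> \<subseteq> L"
begin

lemma zero_L [simp]: "0 \<in> L" by (rule add_sg_0[OF sgL])
lemma eqv_refl [simp]: "p \<bumpeq>\<^bsub>L\<^esub> p" by (simp add: eqv_def)
lemma eqv_zero [simp]: "p \<bumpeq>\<^bsub>L\<^esub> 0 \<longleftrightarrow> p \<in> L" by (simp add: eqv_def)
lemma eqv_sym: "p \<bumpeq>\<^bsub>L\<^esub> q \<Longrightarrow> q \<bumpeq>\<^bsub>L\<^esub> p"
  using add_sg_uminus[OF sgL, of "p - q"] by (simp add: eqv_def)
lemma eqv_trans [trans]: "p \<bumpeq>\<^bsub>L\<^esub> q \<Longrightarrow> q \<bumpeq>\<^bsub>L\<^esub> r \<Longrightarrow> p \<bumpeq>\<^bsub>L\<^esub> r"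
  using add_sg_add[OF sgL, of "p - q" "q - r"] by (simp add: eqv_def)
lemma eqv_mult: "p \<bumpeq>\<^bsub>L\<^esub> q \<Longrightarrow> r * p \<bumpeq>\<^bsub>L\<^esub> r * q"
  using L_mult[of "p - q" r] by (simp add: algebra_simps eqv_def)
lemma eqv_cs: "p \<bumpeq>\<^bsub>L\<^esub> q \<Longrightarrow> cs c p \<bumpeq>\<^bsub>L\<^esub> cs c q" unfolding cs_def by (rule eqv_mult)
lemma eqv_add: "p \<bumpeq>\<^bsub>L\<^esub> q \<Longrightarrow> p' \<bumpeq>\<^bsub>L\<^esub> q' \<Longrightarrow> p + p' \<bumpeq>\<^bsub>L\<^esub> q + q'"
  using add_sg_add[OF sgL, of "p - q" "p' - q'"] by (simp add: algebra_simps eqv_def)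
lemma eqv_diff: "p \<bumpeq>\<^bsub>L\<^esub> q \<Longrightarrow> p' \<bumpeq>\<^bsub>L\<^esub> q' \<Longrightarrow> p - p' \<bumpeq>\<^bsub>L\<^esub> q - q'"
  using add_sg_diff[OF sgL, of "p - q" "p' - q'"] by (simp add: algebra_simps eqv_def)
lemma eqv_uminus: "p \<bumpeq>\<^bsub>L\<^esub> q \<Longrightarrow> - p \<bumpeq>\<^bsub>L\<^esub> - q"
  using eqv_diff[of 0 0 p q] by simp
lemma eqv_sum: "(\<And>i. i \<in> A \<Longrightarrow> f i \<bumpeq>\<^bsub>L\<^esub> g i) \<Longrightarrow> sum f A \<bumpeq>\<^bsub>L\<^esub> sum g A"
  using add_sg_sum[OF sgL, of A "\<lambda>i. f i - g i"] by (simp add: sum_subtractf eqv_def)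
lemma L_cong: "p \<bumpeq>\<^bsub>L\<^esub> q \<Longrightarrow> p \<in> L \<longleftrightarrow> q \<in> L"
  using eqv_sym eqv_trans eqv_zero by metis
lemma L_add: "p \<in> L \<Longrightarrow> q \<in> L \<Longrightarrow> p + q \<in> L" by (rule add_sg_add[OF sgL])
lemma L_diff: "p \<in> L \<Longrightarrow> q \<in> L \<Longrightarrow> p - q \<in> L" by (rule add_sg_diff[OF sgL])
lemma eqv_both: "p \<in> L \<Longrightarrow> q \<in> L \<Longrightarrow> p \<bumpeq>\<^bsub>L\<^esub> q" by (simp add: eqv_def L_diff)
lemma L_cs: "p \<in> L \<Longrightarrow> cs c p \<in> L" unfolding cs_def by (rule L_mult)
lemma J_act: "p \<in> J n \<alpha> \<Longrightarrow> p * q \<in> L" using J_mult_right J_sub_L by blast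

text \<open>Weight vectors modulo \<open>L\<close>. Most relations are stated at an idempotent, so
  they become rules for the action on such vectors.\<close>

definition wt :: "nat list \<Rightarrow> falg \<Rightarrow> bool" where
  "wt i u \<longleftrightarrow> i \<in> seqs n \<alpha> \<and> E i * u \<bumpeq>\<^bsub>L\<^esub> u"

lemma J_eqv: "p - q \<in> J n \<alpha> \<Longrightarrow> p \<bumpeq>\<^bsub>L\<^esub> q" using J_sub_L by (auto simp: eqv_def)

lemma wt_E: "i \<in> seqs n \<alpha> \<Longrightarrow> wt i (E i * u)"
  using J_act[OF J_rel(2), of i i u] unfolding wt_def by (simp add: eqv_def algebra_simps)

lemma wt_orth: "wt i u \<Longrightarrow> j \<in> seqs n \<alpha> \<Longrightarrow> i \<noteq> j \<Longrightarrow> E j * u \<in> L"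
proof -
  assume a: "wt i u" "j \<in> seqs n \<alpha>" "i \<noteq> j"
  then have "E j * (E i * u) \<in> L" using J_act[OF J_rel(2), of j i u]
    unfolding wt_def by (simp only: mult.assoc if_not_P) (simp flip: mult.assoc)
  moreover have "E j * (E i * u) \<bumpeq>\<^bsub>L\<^esub> E j * u" using a by (auto simp: wt_def intro: eqv_mult)
  ultimately show ?thesis using L_cong by blast
qed

lemma wt_cong: "p \<bumpeq>\<^bsub>L\<^esub> q \<Longrightarrow> wt i p \<longleftrightarrow> wt i q"
proof -
  assume h: "p \<bumpeq>\<^bsub>L\<^esub> q"
  have "E i * p \<bumpeq>\<^bsub>L\<^esub> E i * q" by (rule eqv_mult[OF h])
  then have "E i * p \<bumpeq>\<^bsub>L\<^esub> p \<longleftrightarrow> E i * q \<bumpeq>\<^bsub>L\<^esub> q" using h by (meson eqv_sym eqv_trans)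
  then show ?thesis by (simp add: wt_def)
qed

lemma wt_add: "wt i p \<Longrightarrow> wt i q \<Longrightarrow> wt i (p + q)"
  using eqv_add[of "E i * p" p "E i * q" q] by (simp add: wt_def algebra_simps)
lemma wt_cs: "wt i p \<Longrightarrow> wt i (cs c p)"
  using eqv_cs[of "E i * p" p c] by (simp add: wt_def cs_mult_right)
lemma wt_zero: "i \<in> seqs n \<alpha> \<Longrightarrow> wt i 0"
  by (simp add: wt_def)
lemma wt_L: "p \<in> L \<Longrightarrow> i \<in> seqs n \<alpha> \<Longrightarrow> wt i p"
  using L_mult[of p "E i"] by (auto simp: wt_def intro: eqv_both)

lemma X_illegal: "k \<notin> {1..size \<alpha>} \<Longrightarrow> X k * u \<in> L"
  by (rule J_act, rule J_illegal) (simp add: gens_memb)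
lemma T_illegal: "t \<notin> {1..<size \<alpha>} \<Longrightarrow> T t * u \<in> L"
  by (rule J_act, rule J_illegal) (simp add: gens_memb)
lemma E_illegal: "i \<notin> seqs n \<alpha> \<Longrightarrow> E i * u \<in> L"
  by (rule J_act, rule J_illegal) (simp add: gens_memb)

lemma wt_X: "wt i u \<Longrightarrow> wt i (X k * u)"
proof (cases "k \<in> {1..size \<alpha>}")
  case True
  assume a: "wt i u"
  then have "X k * (E i * u) \<bumpeq>\<^bsub>L\<^esub> E i * (X k * u)"
    using J_act[OF J_rel(3)[OF True], of i u] by (simp only: wt_def eqv_def left_diff_distrib mult.assoc)
  moreover have "X k * (E i * u) \<bumpeq>\<^bsub>L\<^esub> X k * u" using a by (auto simp: wt_def intro: eqv_mult)
  ultimately show ?thesis using a unfolding wt_def by (meson eqv_sym eqv_trans)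
qed (use wt_L X_illegal in \<open>auto simp: wt_def\<close>)

lemma wt_T: "wt i u \<Longrightarrow> t \<in> {1..<size \<alpha>} \<Longrightarrow> wt (swap_seq t i) (T t * u)"
proof -
  assume a: "wt i u" "t \<in> {1..<size \<alpha>}"
  then have "T t * (E i * u) \<bumpeq>\<^bsub>L\<^esub> E (swap_seq t i) * (T t * u)"
    using J_act[OF J_rel(4)[OF a(2)], of i u] by (simp only: wt_def eqv_def left_diff_distrib mult.assoc)
  moreover have "T t * (E i * u) \<bumpeq>\<^bsub>L\<^esub> T t * u" using a by (auto simp: wt_def intro: eqv_mult)
  ultimately show ?thesis using a swap_seq_in_seqs[of t i n \<alpha>] seqs_length[of i n \<alpha>] unfolding wt_def
    by (auto intro: eqv_trans eqv_sym)
qed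

lemma XX_act: "X k * (X l * u) \<bumpeq>\<^bsub>L\<^esub> X l * (X k * u)"
proof (cases "k \<in> {1..size \<alpha>} \<and> l \<in> {1..size \<alpha>}")
  case True
  then show ?thesis using J_act[OF J_rel(5), of k l u] by (simp only: eqv_def left_diff_distrib mult.assoc)
next
  case False
  then have "X k * (X l * u) \<in> L \<and> X l * (X k * u) \<in> L"
    by (metis X_illegal L_mult)
  then show ?thesis using eqv_both by blast
qed

lemma TT_far: "\<bar>int t - int s\<bar> > 1 \<Longrightarrow> T t * (T s * u) \<bumpeq>\<^bsub>L\<^esub> T s * (T t * u)"
proof (cases "t \<in> {1..<size \<alpha>} \<and> s \<in> {1..<size \<alpha>}")
  case True
  assume "\<bar>int t - int s\<bar> > 1"
  then show ?thesis using True J_act[OF J_rel(6), of t s u] by (simp only: eqv_def left_diff_distrib mult.assoc)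
next
  case False
  then have "T t * (T s * u) \<in> L \<and> T s * (T t * u) \<in> L"
    by (metis T_illegal L_mult)
  then show ?thesis using eqv_both by blast
qed

text \<open>The weight of \<open>u\<close> allows the idempotent of the relation to be inserted in
  front of \<open>u\<close> and removed afterwards. The next two lemmas work in the same
  way.\<close>

lemma TT_act:
  assumes "wt i u" "t \<in> {1..<size \<alpha>}"
  shows "T t * (T t * u) \<bumpeq>\<^bsub>L\<^esub> (if entry i t = entry i (t + 1) then 0
        else if \<not> adj (entry i t) (entry i (t + 1)) then u
        else X t * u + X (t + 1) * u)"
proof -
  have i: "i \<in> seqs n \<alpha>" and u: "E i * u \<bumpeq>\<^bsub>L\<^esub> u" using assms by (auto simp: wt_def)
  have r: "T t * (T t * (E i * u)) \<bumpeq>\<^bsub>L\<^esub> (if entry i t = entry i (t + 1) then 0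
        else if \<not> adj (entry i t) (entry i (t + 1)) then E i * u
        else X t * (E i * u) + X (t + 1) * (E i * u))"
    (is "_ \<bumpeq>\<^bsub>L\<^esub> ?r")
  proof -
    have "(T t * T t * E i - (if entry i t = entry i (t + 1) then 0
        else if \<not> adj (entry i t) (entry i (t + 1)) then E i
        else (X t + X (t + 1)) * E i)) * u = T t * (T t * (E i * u)) - ?r"
      by (simp add: algebra_simps)
    then show ?thesis using J_act[OF J_rel(7)[OF assms(2) i], of u] by (simp only: eqv_def)
  qed
  have "T t * (T t * u) \<bumpeq>\<^bsub>L\<^esub> T t * (T t * (E i * u))"
    by (intro eqv_mult eqv_sym[OF u])
  note eqv_trans[OF this r]
  also have "(if entry i t = entry i (t + 1) then 0
        else if \<not> adj (entry i t) (entry i (t + 1)) then E i * u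
        else X t * (E i * u) + X (t + 1) * (E i * u)) \<bumpeq>\<^bsub>L\<^esub> (if entry i t = entry i (t + 1) then 0
        else if \<not> adj (entry i t) (entry i (t + 1)) then u
        else X t * u + X (t + 1) * u)"
    using eqv_add[OF eqv_mult[OF u, of "X t"] eqv_mult[OF u, of "X (t+1)"]] u by simp
  finally show ?thesis .
qed

lemma TTT_act:
  assumes "wt i u" "t \<in> {1..<size \<alpha>}" "t + 1 \<in> {1..<size \<alpha>}"
  shows "T t * (T (t + 1) * (T t * u)) \<bumpeq>\<^bsub>L\<^esub> T (t + 1) * (T t * (T (t + 1) * u)) +
     (if entry i t = entry i (t + 2) \<and> adj (entry i t) (entry i (t + 1)) then u else 0)"
proof -
  have i: "i \<in> seqs n \<alpha>" and u: "E i * u \<bumpeq>\<^bsub>L\<^esub> u" using assms by (auto simp: wt_def)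
  let ?c = "entry i t = entry i (t + 2) \<and> adj (entry i t) (entry i (t + 1))"
  have r: "T t * (T (t + 1) * (T t * (E i * u))) \<bumpeq>\<^bsub>L\<^esub> T (t + 1) * (T t * (T (t + 1) * (E i * u))) +
     (if ?c then E i * u else 0)"
    (is "_ \<bumpeq>\<^bsub>L\<^esub> ?r")
  proof -
    have "(T t * T (t + 1) * T t * E i - T (t + 1) * T t * T (t + 1) * E i
       - (if ?c then E i else 0)) * u = T t * (T (t + 1) * (T t * (E i * u))) - ?r"
      by (simp only: left_diff_distrib distrib_right mult.assoc diff_diff_eq if_mult_zero)
    then show ?thesis using J_act[OF J_rel(8)[OF assms(2,3) i], of u] by (simp only: eqv_def)
  qed
  have "T t * (T (t + 1) * (T t * u)) \<bumpeq>\<^bsub>L\<^esub> T t * (T (t + 1) * (T t * (E i * u)))"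
    by (intro eqv_mult eqv_sym[OF u])
  note eqv_trans[OF this r]
  also have "T (t + 1) * (T t * (T (t + 1) * (E i * u))) + (if ?c then E i * u else 0)
    \<bumpeq>\<^bsub>L\<^esub> T (t + 1) * (T t * (T (t + 1) * u)) + (if ?c then u else 0)"
    by (rule eqv_add) (use u in \<open>auto intro!: eqv_mult\<close>)
  finally show ?thesis .
qed

lemma TX_act:
  assumes "wt i u" "t \<in> {1..<size \<alpha>}" "k \<in> {1..size \<alpha>}"
  shows "T t * (X k * u) \<bumpeq>\<^bsub>L\<^esub> X (if k = t then t + 1 else if k = t + 1 then t else k) * (T t * u)
    + (if k = t \<and> entry i t = entry i (t + 1) then u
          else if k = t + 1 \<and> entry i t = entry i (t + 1) then - u else 0)"
proof -
  have i: "i \<in> seqs n \<alpha>" and u: "E i * u \<bumpeq>\<^bsub>L\<^esub> u" using assms by (auto simp: wt_def)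
  have u': "- (E i * u) \<bumpeq>\<^bsub>L\<^esub> - u" by (rule eqv_uminus[OF u])
  let ?k = "if k = t then t + 1 else if k = t + 1 then t else k"
  let ?f = "\<lambda>x. if k = t \<and> entry i t = entry i (t + 1) then x
          else if k = t + 1 \<and> entry i t = entry i (t + 1) then - x else (0::falg)"
  have r: "T t * (X k * (E i * u)) \<bumpeq>\<^bsub>L\<^esub> X ?k * (T t * (E i * u)) + ?f (E i * u)"
    (is "_ \<bumpeq>\<^bsub>L\<^esub> ?r")
  proof -
    have "(T t * X k * E i - X ?k * T t * E i - ?f (E i)) * u = T t * (X k * (E i * u)) - ?r"
      by (simp add: algebra_simps)
    then show ?thesis using J_act[OF J_rel(9)[OF assms(2,3) i], of u] by (simp only: eqv_def)
  qed
  have "T t * (X k * u) \<bumpeq>\<^bsub>L\<^esub> T t * (X k * (E i * u))"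
    by (intro eqv_mult eqv_sym[OF u])
  note eqv_trans[OF this r]
  also have "X ?k * (T t * (E i * u)) + ?f (E i * u) \<bumpeq>\<^bsub>L\<^esub> X ?k * (T t * u) + ?f u"
    by (rule eqv_add) (use u u' in \<open>auto intro!: eqv_mult\<close>)
  finally show ?thesis .
qed

end

lemma klr_left_J: "klr_left n \<alpha> (J n \<alpha>)"
  by standard (auto intro: add_sg_J J_mult_left)

section \<open>The grading\<close>

definition wprod :: "(klr_gen \<Rightarrow> falg) \<Rightarrow> klr_gen list \<Rightarrow> falg" where
  "wprod f w = foldr (\<lambda>g q. f g * q) w 1"

lemma wprod_append: "wprod f (u @ v) = wprod f u * wprod f v"
  by (induction u) (simp_all add: wprod_def mult.assoc)

text \<open>The universal property of the free algebra. It is applied to the torus action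
  \<open>phig\<close> and to the concatenation embedding \<open>eg\<close>.\<close>

definition ext :: "(klr_gen \<Rightarrow> falg) \<Rightarrow> falg \<Rightarrow> falg" where
  "ext f = linext cs (wprod f)"

lemma ext_mult: "ext f (p * q) = ext f p * ext f q"
  unfolding ext_def by (rule linext_cs_mult) (rule wprod_append)

lemma ext_simps [simp]:
  "ext f (p + q) = ext f p + ext f q" "ext f (p - q) = ext f p - ext f q" "ext f 0 = 0"
  "ext f (sum h A) = (\<Sum>i\<in>A. ext f (h i))" "ext f 1 = 1"
  "ext f (gg g) = f g" "ext f (cs c p) = cs c (ext f p)"
proof -
  show "ext f (gg g) = f g" by (simp add: ext_def wprod_def cs.sc_one)
  have "ext f (cmon 1 []) = 1" by (simp add: ext_def wprod_def cs.sc_one)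
  then show "ext f 1 = 1" by (simp add: cmon_one)
  have "ext f (cmon c []) = cmon c []"
    by (simp add: ext_def wprod_def) (simp add: cs_def)
  then show "ext f (cs c p) = cs c (ext f p)"
    by (simp add: cs_def ext_mult)
qed (simp_all add: ext_def cs.linext_add cs.linext_minus cs.linext_sum)

lemma ext_uminus [simp]: "ext f (- p) = - ext f p"
  using ext_simps(2)[of f 0 p] by simp

section \<open>Letters under transpositions, and the torus action\<close>

lemma entry_swap:
  assumes "1 \<le> t" "t < length i" "1 \<le> s" "s \<le> length i"
  shows "entry (swap_seq t i) s = (if s = t then entry i (t + 1) else if s = t + 1 then entry i t else entry i s)"
  using assms by (auto simp: swap_seq_def nth_list_update)

lemma length_swap [simp]: "length (swap_seq t i) = length i"
  by (simp add: swap_seq_def)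

lemma swap_swap: "1 \<le> t \<Longrightarrow> t < length i \<Longrightarrow> swap_seq t (swap_seq t i) = i"
  by (rule nth_equalityI) (auto simp: swap_seq_def nth_list_update)

text \<open>The power of 2 whose exponent is the degree of a crossing of the letters
  \<open>a\<close> and \<open>b\<close>.\<close>

definition zf :: "nat \<Rightarrow> nat \<Rightarrow> complex" where "zf a b = 2 powi (- cartan a b)"

lemma zf_simps: "zf a a = 1 / 4" "a \<noteq> b \<Longrightarrow> \<not> adj a b \<Longrightarrow> zf a b = 1" "adj a b \<Longrightarrow> zf a b = 2"
  by (auto simp: zf_def cartan_def adj_def power_int_minus)

lemma zf_sym: "zf a b = zf b a"
  by (auto simp: zf_def cartan_def)

text \<open>A crossing has a degree only after multiplication by an idempotent, hence the sum over
  all weights. The factor 4 is the second power of 2, since dots have degree 2.\<close>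

definition phig :: "nat \<Rightarrow> nat multiset \<Rightarrow> klr_gen \<Rightarrow> falg" where
  "phig n \<alpha> g = (case g of Gidem i \<Rightarrow> E i | Gx k \<Rightarrow> cs 4 (X k)
     | Gtau t \<Rightarrow> (\<Sum>i\<in>seqs n \<alpha>. cs (zf (entry i t) (entry i (t + 1))) (T t * E i)))"

text \<open>The torus action at the parameter 2: it multiplies elements of degree d by the d-th power of 2.\<close>

definition phi :: "nat \<Rightarrow> nat multiset \<Rightarrow> falg \<Rightarrow> falg" where
  "phi n \<alpha> = ext (phig n \<alpha>)"

lemma phi_gens [simp]:
  "phi n \<alpha> (E i) = E i" "phi n \<alpha> (X k) = cs 4 (X k)"
  by (simp_all add: phi_def phig_def)

lemma phi_simps [simp]:
  "phi n \<alpha> (p * q) = phi n \<alpha> p * phi n \<alpha> q"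
  "phi n \<alpha> (p + q) = phi n \<alpha> p + phi n \<alpha> q" "phi n \<alpha> (p - q) = phi n \<alpha> p - phi n \<alpha> q" "phi n \<alpha> 0 = 0"
  "phi n \<alpha> (sum h A) = (\<Sum>i\<in>A. phi n \<alpha> (h i))" "phi n \<alpha> 1 = 1"
  "phi n \<alpha> (cs c p) = cs c (phi n \<alpha> p)" "phi n \<alpha> (- p) = - phi n \<alpha> p"
  by (simp_all add: phi_def ext_mult)

lemma (in klr_left) phi_T:
  assumes "wt i u"
  shows "phi n \<alpha> (T t) * u \<bumpeq>\<^bsub>L\<^esub> cs (zf (entry i t) (entry i (t + 1))) (T t * u)"
proof -
  let ?c = "\<lambda>j. zf (entry j t) (entry j (t + 1))"
  have i: "i \<in> seqs n \<alpha>" using assms by (simp add: wt_def)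
  have "phi n \<alpha> (T t) * u = (\<Sum>j\<in>seqs n \<alpha>. cs (?c j) (T t * (E j * u)))"
    by (simp add: phi_def phig_def sum_distrib_right cs_mult_left mult.assoc)
  also have "\<dots> \<bumpeq>\<^bsub>L\<^esub> (\<Sum>j\<in>seqs n \<alpha>. if j = i then cs (?c i) (T t * u) else 0)"
  proof (rule eqv_sum)
    fix j assume j: "j \<in> seqs n \<alpha>"
    show "cs (?c j) (T t * (E j * u)) \<bumpeq>\<^bsub>L\<^esub> (if j = i then cs (?c i) (T t * u) else 0)"
    proof (cases "j = i")
      case True
      then show ?thesis using assms by (auto simp: wt_def intro!: eqv_cs eqv_mult)
    next
      case False
      then show ?thesis using wt_orth[OF assms j] by (auto intro!: L_cs L_mult)
    qed
  qed
  finally show ?thesis using i by simp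
qed

lemma (in klr_left) phi_TT:
  assumes "wt i u" "s \<in> {1..<size \<alpha>}"
  shows "phi n \<alpha> (T t) * (phi n \<alpha> (T s) * u) \<bumpeq>\<^bsub>L\<^esub>
    cs (zf (entry (swap_seq s i) t) (entry (swap_seq s i) (t + 1)) * zf (entry i s) (entry i (s + 1))) (T t * (T s * u))"
proof -
  have "phi n \<alpha> (T t) * (phi n \<alpha> (T s) * u) \<bumpeq>\<^bsub>L\<^esub> phi n \<alpha> (T t) * cs (zf (entry i s) (entry i (s + 1))) (T s * u)"
    by (rule eqv_mult[OF phi_T[OF assms(1)]])
  also have "\<dots> = cs (zf (entry i s) (entry i (s + 1))) (phi n \<alpha> (T t) * (T s * u))"
    by (simp add: cs_mult_right)
  also have "\<dots> \<bumpeq>\<^bsub>L\<^esub> cs (zf (entry i s) (entry i (s + 1)))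
      (cs (zf (entry (swap_seq s i) t) (entry (swap_seq s i) (t + 1))) (T t * (T s * u)))"
    by (rule eqv_cs[OF phi_T[OF wt_T[OF assms]]])
  finally show ?thesis by (simp add: cs.sc_mult mult.commute)
qed

lemma (in klr_left) phi_TTT:
  assumes "wt i u" "s \<in> {1..<size \<alpha>}" "t \<in> {1..<size \<alpha>}"
  shows "phi n \<alpha> (T r) * (phi n \<alpha> (T t) * (phi n \<alpha> (T s) * u)) \<bumpeq>\<^bsub>L\<^esub>
    cs (zf (entry (swap_seq t (swap_seq s i)) r) (entry (swap_seq t (swap_seq s i)) (r + 1)) *
      zf (entry (swap_seq s i) t) (entry (swap_seq s i) (t + 1)) * zf (entry i s) (entry i (s + 1)))
     (T r * (T t * (T s * u)))"
proof -
  have "phi n \<alpha> (T r) * (phi n \<alpha> (T t) * (phi n \<alpha> (T s) * u)) \<bumpeq>\<^bsub>L\<^esub>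
    phi n \<alpha> (T r) * (phi n \<alpha> (T t) * cs (zf (entry i s) (entry i (s + 1))) (T s * u))"
    by (rule eqv_mult[OF eqv_mult[OF phi_T[OF assms(1)]]])
  also have "\<dots> = cs (zf (entry i s) (entry i (s + 1))) (phi n \<alpha> (T r) * (phi n \<alpha> (T t) * (T s * u)))"
    by (simp add: cs_mult_right)
  also note eqv_cs[OF phi_TT[OF wt_T[OF assms(1,2)] assms(3)]]
  finally show ?thesis by (simp add: cs.sc_mult mult_ac)
qed

text \<open>The idempotents add up to 1. This supplies weights for a relation that is stated without
  an idempotent, the commutation of distant crossings.\<close>

lemma (in klr_left) test_right:
  assumes "\<And>i. i \<in> seqs n \<alpha> \<Longrightarrow> q * E i \<in> J n \<alpha>"
  shows "q \<in> J n \<alpha>"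
proof -
  have "q * ((\<Sum>i\<in>seqs n \<alpha>. E i) - 1) \<in> J n \<alpha>" by (rule J_mult_left[OF J_rel(1)])
  moreover have "(\<Sum>i\<in>seqs n \<alpha>. q * E i) \<in> J n \<alpha>" by (rule add_sg_sum[OF add_sg_J assms])
  ultimately have "(\<Sum>i\<in>seqs n \<alpha>. q * E i) - q * ((\<Sum>i\<in>seqs n \<alpha>. E i) - 1) \<in> J n \<alpha>"
    by (rule add_sg_diff[OF add_sg_J, rotated])
  then show ?thesis by (simp add: algebra_simps sum_distrib_left)
qed

text \<open>The terms of each relation have equal degrees, so \<open>phi\<close> multiplies all of
  them by the same power of 2. The degree of a product of crossings depends on the permuted weights,
  hence the computations of letters of swapped sequences.\<close>

lemma phi_J: "p \<in> J n \<alpha> \<Longrightarrow> phi n \<alpha> p \<in> J n \<alpha>"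
proof -
  interpret klr_left n \<alpha> "J n \<alpha>" by (rule klr_left_J)
  have wtE: "wt i (E i)" if "i \<in> seqs n \<alpha>" for i using wt_E[OF that, of 1] by simp
  have "J n \<alpha> \<subseteq> {p. phi n \<alpha> p \<in> J n \<alpha>}"
  proof (rule J_minimal)
    show "add_sg {p. phi n \<alpha> p \<in> J n \<alpha>}"
      using sgL by (auto simp: add_sg_def)
  next
    fix g assume g: "g \<notin> klr_gens n \<alpha>"
    then have j: "gg g \<in> J n \<alpha>" by (rule J_illegal)
    have "phi n \<alpha> (gg g) \<in> J n \<alpha>"
    proof (cases g)
      case (Gidem i) then show ?thesis using j by simp
    next
      case (Gx k) then show ?thesis using L_cs[OF j, of 4] by (simp del: cs_cmon)
    next
      case (Gtau t)
      then show ?thesis using J_mult_right j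
        by (auto simp: phi_def phig_def intro!: add_sg_sum[OF sgL] L_cs)
    qed
    then show "gg g \<in> {p. phi n \<alpha> p \<in> J n \<alpha>}" by simp
  next
    show "klr_rels n \<alpha> \<subseteq> {p. phi n \<alpha> p \<in> J n \<alpha>}"
    proof
      fix p assume "p \<in> klr_rels n \<alpha>"
      then have "phi n \<alpha> p \<in> J n \<alpha>"
      proof (induct rule: klr_rels_cases)
        case unit
        then show ?case using J_rel(1) by simp
      next
        case (idem i j)
        then show ?case using J_rel(2)[OF idem] by (cases "i = j") simp_all
      next
        case (xidem k i)
        have "cs 4 (X k * E i - E i * X k) \<in> J n \<alpha>" by (intro L_cs J_rel xidem)
        then show ?case by (simp add: cs_mult_left cs_mult_right cs_diff)
      next
        case (tauidem t i)
        note l = seqs_length[OF tauidem(2)]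
        have si: "swap_seq t i \<in> seqs n \<alpha>" using tauidem l by (auto intro!: swap_seq_in_seqs)
        let ?c = "\<lambda>j. zf (entry j t) (entry j (t + 1))"
        have "E (swap_seq t i) * phi n \<alpha> (T t) = (\<Sum>j\<in>seqs n \<alpha>. cs (?c j) (E (swap_seq t i) * (T t * E j)))"
          by (simp add: phi_def phig_def sum_distrib_left cs_mult_right)
        also have "\<dots> \<bumpeq>\<^bsub>J n \<alpha>\<^esub> (\<Sum>j\<in>seqs n \<alpha>. if j = i then cs (?c i) (T t * E i) else 0)"
        proof (rule eqv_sum)
          fix j assume j: "j \<in> seqs n \<alpha>"
          have w: "wt (swap_seq t j) (T t * E j)" by (rule wt_T[OF wtE[OF j] tauidem(1)])
          show "cs (?c j) (E (swap_seq t i) * (T t * E j)) \<bumpeq>\<^bsub>J n \<alpha>\<^esub> (if j = i then cs (?c i) (T t * E i) else 0)"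
          proof (cases "j = i")
            case True
            then show ?thesis using w by (auto simp: wt_def intro!: eqv_cs)
          next
            case False
            then have "swap_seq t j \<noteq> swap_seq t i"
              using swap_swap[of t i] swap_swap[of t j] tauidem l seqs_length[OF j] by auto
            from wt_orth[OF w si this] False show ?thesis by (auto intro!: L_cs)
          qed
        qed
        finally have "E (swap_seq t i) * phi n \<alpha> (T t) \<bumpeq>\<^bsub>J n \<alpha>\<^esub> cs (?c i) (T t * E i)"
          using tauidem by simp
        from eqv_trans[OF phi_T[OF wtE] eqv_sym[OF this]] tauidem show ?case by (simp add: eqv_def)
      next
        case (xx k l)
        have "cs 16 (X k * X l - X l * X k) \<in> J n \<alpha>" by (intro L_cs J_rel xx)
        then show ?case by (simp add: cs_mult_left cs_mult_right cs_diff cs.sc_mult)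
      next
        case (tautau t s)
        have "phi n \<alpha> (T t * T s - T s * T t) * E i \<in> J n \<alpha>" if i: "i \<in> seqs n \<alpha>" for i
        proof -
          note l = seqs_length[OF i]
          have sw: "entry (swap_seq s i) t = entry i t" "entry (swap_seq s i) (t + 1) = entry i (t + 1)"
            "entry (swap_seq t i) s = entry i s" "entry (swap_seq t i) (s + 1) = entry i (s + 1)"
            using tautau l by (subst entry_swap; auto)+
          have a: "phi n \<alpha> (T t) * (phi n \<alpha> (T s) * E i) \<bumpeq>\<^bsub>J n \<alpha>\<^esub>
            cs (zf (entry i t) (entry i (t + 1)) * zf (entry i s) (entry i (s + 1))) (T t * (T s * E i))"
            using phi_TT[OF wtE[OF i] tautau(2), of t] by (simp only: sw)
          have b: "phi n \<alpha> (T s) * (phi n \<alpha> (T t) * E i) \<bumpeq>\<^bsub>J n \<alpha>\<^esub>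
            cs (zf (entry i t) (entry i (t + 1)) * zf (entry i s) (entry i (s + 1))) (T s * (T t * E i))"
            using phi_TT[OF wtE[OF i] tautau(1), of s] by (simp only: sw mult.commute)
          have "phi n \<alpha> (T t) * (phi n \<alpha> (T s) * E i) \<bumpeq>\<^bsub>J n \<alpha>\<^esub> phi n \<alpha> (T s) * (phi n \<alpha> (T t) * E i)"
            by (rule eqv_trans[OF a eqv_trans[OF eqv_cs[OF TT_far] eqv_sym[OF b]]]) (use tautau in auto)
          then show ?thesis by (simp add: algebra_simps eqv_def)
        qed
        then show ?case by (rule test_right)
      next
        case (quad t i)
        note l = seqs_length[OF quad(2)]
        let ?z = "zf (entry i t) (entry i (t + 1))"
        let ?r = "if entry i t = entry i (t + 1) then 0
          else if \<not> adj (entry i t) (entry i (t + 1)) then E i else X t * E i + X (t + 1) * E i"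
        have "phi n \<alpha> (T t) * (phi n \<alpha> (T t) * E i) \<bumpeq>\<^bsub>J n \<alpha>\<^esub> cs (?z * ?z) (T t * (T t * E i))"
        proof -
          have sw: "entry (swap_seq t i) t = entry i (t + 1)" "entry (swap_seq t i) (t + 1) = entry i t"
            using quad l by (subst entry_swap; auto)+
          show ?thesis using phi_TT[OF wtE[OF quad(2)] quad(1), of t]
            by (simp only: sw zf_sym[of "entry i (t+1)"])
        qed
        also note eqv_cs[OF TT_act[OF wtE[OF quad(2)] quad(1)]]
        \<comment> \<open>The square of the crossing has the factor 1 for distant letters and 4 for
          neighbouring ones, in accordance with the degrees 0 and 2 of the right side; for equal
          letters the right side is 0.\<close>
        also have "cs (?z * ?z) ?r = phi n \<alpha> ?r"
          by (auto simp: zf_simps cs.sc_one cs.sc_zero2 cs.sc_add2 cs_mult_left)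
        finally show ?case
          by (simp add: eqv_def algebra_simps if_distrib[of "phi n \<alpha>"] del: One_nat_def cong: if_cong)
      next
        case (braid t i)
        note l = seqs_length[OF braid(3)]
        let ?z = "zf (entry i t) (entry i (t + 1)) * zf (entry i t) (entry i (t + 2)) * zf (entry i (t + 1)) (entry i (t + 2))"
        let ?c = "entry i t = entry i (t + 2) \<and> adj (entry i t) (entry i (t + 1))"
        have e: "t + 1 + 1 = t + 2" by auto
        have sw: "entry (swap_seq t i) (t + 1) = entry i t" "entry (swap_seq t i) (t + 2) = entry i (t + 2)"
          "entry (swap_seq t i) t = entry i (t + 1)"
          "entry (swap_seq (t + 1) i) (t + 1) = entry i (t + 2)" "entry (swap_seq (t + 1) i) t = entry i t"
          "entry (swap_seq (t + 1) i) (t + 2) = entry i (t + 1)"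
          using braid l by (subst entry_swap; auto)+
        have sw2a: "entry (swap_seq (t + 1) (swap_seq t i)) t = entry (swap_seq t i) t"
          "entry (swap_seq (t + 1) (swap_seq t i)) (t + 1) = entry (swap_seq t i) (t + 2)"
          "entry (swap_seq t (swap_seq (t + 1) i)) (t + 1) = entry (swap_seq (t + 1) i) t"
          "entry (swap_seq t (swap_seq (t + 1) i)) (t + 2) = entry (swap_seq (t + 1) i) (t + 2)"
          using braid l by (subst entry_swap; auto)+
        note sw2 = sw2a[unfolded sw]
        have a: "phi n \<alpha> (T t) * (phi n \<alpha> (T (t + 1)) * (phi n \<alpha> (T t) * E i)) \<bumpeq>\<^bsub>J n \<alpha>\<^esub>
          cs ?z (T t * (T (t + 1) * (T t * E i)))"
          using phi_TTT[OF wtE[OF braid(3)] braid(1,2), of t] by (simp only: sw sw2 e mult_ac)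
        have b: "phi n \<alpha> (T (t + 1)) * (phi n \<alpha> (T t) * (phi n \<alpha> (T (t + 1)) * E i)) \<bumpeq>\<^bsub>J n \<alpha>\<^esub>
          cs ?z (T (t + 1) * (T t * (T (t + 1) * E i)))"
          using phi_TTT[OF wtE[OF braid(3)] braid(2,1), of "t + 1"] by (simp only: sw sw2 e mult_ac)
        \<comment> \<open>The error term has degree 0: two pairs of neighbouring letters contribute
          2 each, the pair of equal letters contributes 1/4.\<close>
        have z1: "?c \<Longrightarrow> ?z = 1"
          using zf_sym[of "entry i t" "entry i (t+1)"] by (auto simp: zf_simps)
        note a
        also note eqv_cs[OF TTT_act[OF wtE[OF braid(3)] braid(1,2)]]
        also have "cs ?z (T (t + 1) * (T t * (T (t + 1) * E i)) + (if ?c then E i else 0)) =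
          cs ?z (T (t + 1) * (T t * (T (t + 1) * E i))) + (if ?c then E i else 0)"
          using z1 by (auto simp: cs.sc_add2 cs.sc_zero2 cs.sc_one)
        also have "\<dots> \<bumpeq>\<^bsub>J n \<alpha>\<^esub> phi n \<alpha> (T (t + 1)) * (phi n \<alpha> (T t) * (phi n \<alpha> (T (t + 1)) * E i)) + (if ?c then E i else 0)"
          by (rule eqv_add[OF eqv_sym[OF b]]) simp
        finally show ?case
          by (simp only: phi_simps mult.assoc if_distrib[of "phi n \<alpha>"] phi_gens diff_diff_eq eqv_def cong: if_cong)
      next
        case (taux t k i)
        note l = seqs_length[OF taux(3)]
        let ?z = "zf (entry i t) (entry i (t + 1))"
        let ?k = "if k = t then t + 1 else if k = t + 1 then t else k"
        let ?f = "if k = t \<and> entry i t = entry i (t + 1) then E i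
          else if k = t + 1 \<and> entry i t = entry i (t + 1) then - E i else 0"
        have wX: "wt i (X k * E i)" by (rule wt_X[OF wtE[OF taux(3)]])
        have "phi n \<alpha> (T t) * cs 4 (X k * E i) = cs 4 (phi n \<alpha> (T t) * (X k * E i))"
          by (rule cs_mult_right)
        also note eqv_cs[OF phi_T[OF wX]]
        also note eqv_cs[OF eqv_cs[OF TX_act[OF wtE[OF taux(3)] taux(1,2)]]]
        \<comment> \<open>The correction occurs for equal letters only, where the factor 4 of the
          dot cancels the factor 1/4 of the crossing.\<close>
        also have "cs 4 (cs ?z (X ?k * (T t * E i) + ?f)) = cs 4 (X ?k) * cs ?z (T t * E i) + ?f"
          by (auto simp: cs.sc_add2 cs_mult_left cs_mult_right cs.sc_mult cs.sc_zero2 cs_uminus cs.sc_one zf_simps mult.commute[of "4::complex"])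
        also have "\<dots> \<bumpeq>\<^bsub>J n \<alpha>\<^esub> cs 4 (X ?k) * (phi n \<alpha> (T t) * E i) + ?f"
          by (rule eqv_add[OF eqv_mult[OF eqv_sym[OF phi_T]]]) (use wtE taux in auto)
        finally show ?case
          by (simp only: phi_simps mult.assoc if_distrib[of "phi n \<alpha>"] phi_gens diff_diff_eq eqv_def cs_mult_left cong: if_cong)
      qed
      then show "p \<in> {p. phi n \<alpha> p \<in> J n \<alpha>}" by simp
    qed
  qed (simp_all add: J_mult_left J_mult_right)
  then show "p \<in> J n \<alpha> \<Longrightarrow> phi n \<alpha> p \<in> J n \<alpha>" by blast
qed

text \<open>The generating homogeneous elements are eigenvectors, and eigenvectors for a given
  exponent are closed under the rules that generate the grading. So an inductive definition, which
  says nothing about overlaps of degrees, is converted into an equation.\<close>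

lemma homog_phi: "homog n \<alpha> d p \<Longrightarrow> phi n \<alpha> p - cs (2 powi d) p \<in> J n \<alpha>"
proof -
  interpret klr_left n \<alpha> "J n \<alpha>" by (rule klr_left_J)
  \<comment> \<open>Homogeneity is a property of classes; this transports the eigenvalue equation to
    any other representative.\<close>
  have cong: "phi n \<alpha> p \<bumpeq>\<^bsub>J n \<alpha>\<^esub> cs c p" if "p \<bumpeq>\<^bsub>J n \<alpha>\<^esub> q" "phi n \<alpha> q \<bumpeq>\<^bsub>J n \<alpha>\<^esub> cs c q" for p q c
  proof -
    have "phi n \<alpha> p \<bumpeq>\<^bsub>J n \<alpha>\<^esub> phi n \<alpha> q" using phi_J[of "p - q" n \<alpha>] that(1) by (simp add: eqv_def)
    also note that(2)
    also have "cs c q \<bumpeq>\<^bsub>J n \<alpha>\<^esub> cs c p" by (rule eqv_cs[OF eqv_sym[OF that(1)]])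
    finally show ?thesis .
  qed
  have wtE: "wt i (E i)" if "i \<in> seqs n \<alpha>" for i using wt_E[OF that, of 1] by simp
  have "klr_homogeneous n \<alpha> d P \<Longrightarrow> P = cls n \<alpha> p \<Longrightarrow> phi n \<alpha> p \<bumpeq>\<^bsub>J n \<alpha>\<^esub> cs (2 powi d) p" for P
  proof (induction arbitrary: p rule: klr_homogeneous.induct)
    case (idem i)
    then have "p \<bumpeq>\<^bsub>J n \<alpha>\<^esub> E i" by (simp add: eqv_def klr_class_eq legal_cmon gens_memb flip: cls_eq_iff)
    from cong[OF this, of 1] show ?case by (simp add: cs.sc_one)
  next
    case (x k i)
    then have "p \<bumpeq>\<^bsub>J n \<alpha>\<^esub> X k * E i" by (simp add: eqv_def klr_class_eq legal_cmon gens_memb cmon_mult flip: cls_eq_iff)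
    from cong[OF this] show ?case by (simp add: cs_mult_left)
  next
    case (tau t i)
    then have "p \<bumpeq>\<^bsub>J n \<alpha>\<^esub> T t * E i" by (simp add: eqv_def klr_class_eq legal_cmon gens_memb cmon_mult flip: cls_eq_iff)
    from cong[OF this] show ?case using phi_T[OF wtE[OF tau(2)], of t] by (simp add: zf_def)
  next
    case (zero d)
    then have "cls n \<alpha> p = cls n \<alpha> 0" by (simp only: klr_ring_zero)
    then have "p - 0 \<in> J n \<alpha>" by (simp only: cls_eq_iff)
    then have pz: "p \<bumpeq>\<^bsub>J n \<alpha>\<^esub> 0" by (simp only: eqv_def)
    show ?case by (rule cong[OF pz]) (simp add: cs.sc_zero2)
  next
    case (add d P P')
    obtain q where q1: "P = cls n \<alpha> q" using klr_homogeneous_cls[OF add.hyps(1)] by blast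
    obtain r where r1: "P' = cls n \<alpha> r" using klr_homogeneous_cls[OF add.hyps(2)] by blast
    note q = q1 r1
    have "cls n \<alpha> p = cls n \<alpha> (q + r)" using add.prems by (simp only: q klr_ring_add)
    then have "p \<bumpeq>\<^bsub>J n \<alpha>\<^esub> q + r" by (simp only: eqv_def cls_eq_iff)
    then show ?case by (rule cong) (use eqv_add[OF add.IH(1)[OF q(1)] add.IH(2)[OF q(2)]] in \<open>simp add: cs.sc_add2\<close>)
  next
    case (scale d P c)
    obtain q where q: "P = cls n \<alpha> q" using klr_homogeneous_cls[OF scale.hyps] by blast
    have "cls n \<alpha> p = cls n \<alpha> (cs c q)" using scale.prems by (simp only: q klr_scale_cls)
    then have "p \<bumpeq>\<^bsub>J n \<alpha>\<^esub> cs c q" by (simp only: eqv_def cls_eq_iff)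
    then show ?case by (rule cong) (use eqv_cs[OF scale.IH[OF q], of c] in \<open>simp add: cs.sc_mult mult.commute\<close>)
  next
    case (times d P d' P')
    obtain q where q1: "P = cls n \<alpha> q" using klr_homogeneous_cls[OF times.hyps(1)] by blast
    obtain r where r1: "P' = cls n \<alpha> r" using klr_homogeneous_cls[OF times.hyps(2)] by blast
    note q = q1 r1
    have "cls n \<alpha> p = cls n \<alpha> (q * r)" using times.prems by (simp only: q klr_ring_mult)
    then have pq: "p \<bumpeq>\<^bsub>J n \<alpha>\<^esub> q * r" by (simp only: eqv_def cls_eq_iff)
    have "phi n \<alpha> q * phi n \<alpha> r \<bumpeq>\<^bsub>J n \<alpha>\<^esub> phi n \<alpha> q * cs (2 powi d') r"
      by (rule eqv_mult[OF times.IH(2)[OF q(2)]])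
    also have "\<dots> \<bumpeq>\<^bsub>J n \<alpha>\<^esub> cs (2 powi d) q * cs (2 powi d') r"
      using J_mult_right[OF times.IH(1)[OF q(1), unfolded eqv_def], of "cs (2 powi d') r"] by (simp add: algebra_simps eqv_def)
    finally show ?case using cong[OF pq, of "2 powi (d + d')"]
      by (simp add: cs_mult_left cs_mult_right cs.sc_mult power_int_add mult.commute[of "2 powi d :: complex"])
  qed
  then show "homog n \<alpha> d p \<Longrightarrow> ?thesis" by (simp add: homog_def eqv_def)
qed

section \<open>Graded left ideals and independence of degrees\<close>

lemma two_powi_inj: "(2 :: complex) powi d = 2 powi e \<Longrightarrow> d = e"
proof -
  assume "(2 :: complex) powi d = 2 powi e"
  then have "complex_of_real (2 powi d) = complex_of_real (2 powi e)"
    by (simp add: of_real_power_int)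
  then have "(2 :: real) powi d = 2 powi e" by (simp only: of_real_eq_iff)
  then show ?thesis
    using power_int_strict_increasing[of d e "2 :: real"] power_int_strict_increasing[of e d "2 :: real"]
    by (metis less_irrefl linorder_neqE one_less_numeral_iff semiring_norm(76))
qed

text \<open>Stability under the torus action serves as the definition of a graded left ideal. That
  it agrees with containing all homogeneous components is shown by \<open>homog_parts\<close> and
  \<open>klr_graded_leftI\<close>.\<close>

locale klr_graded_left = klr_left +
  assumes phi_L: "p \<in> L \<Longrightarrow> phi n \<alpha> p \<in> L"
begin

lemma homog_eig: "homog n \<alpha> d p \<Longrightarrow> phi n \<alpha> p \<bumpeq>\<^bsub>L\<^esub> cs (2 powi d) p"
  by (rule J_eqv[OF homog_phi])

text \<open>The argument of a Vandermonde determinant: \<open>phi\<close> of the sum minus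
  \<open>2 powi e\<close> times the sum has lost the component of degree \<open>e\<close>, while
  every other component is rescaled by a non-zero number, the integer powers of 2 being
  distinct.\<close>

lemma homog_direct:
  assumes "finite D" "\<And>d. d \<in> D \<Longrightarrow> homog n \<alpha> d (f d)" "(\<Sum>d\<in>D. f d) \<in> L" "d \<in> D"
  shows "f d \<in> L"
  using assms
proof (induction D arbitrary: f d rule: finite_induct)
  case (insert e D)
  let ?S = "f e + (\<Sum>d\<in>D. f d)"
  have S: "?S \<in> L" using insert by simp
  have "phi n \<alpha> ?S \<bumpeq>\<^bsub>L\<^esub> cs (2 powi e) (f e) + (\<Sum>d\<in>D. cs (2 powi d) (f d))"
    using insert.prems by (auto intro!: eqv_add eqv_sum homog_eig simp del: add_diff_cancel_left)
  moreover have "cs (2 powi e) ?S \<in> L" "phi n \<alpha> ?S \<in> L" using L_cs[OF S] phi_L[OF S] by blast+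
  ultimately have "cs (2 powi e) (f e) + (\<Sum>d\<in>D. cs (2 powi d) (f d)) \<in> L"
    using L_cong by blast
  from add_sg_diff[OF sgL this \<open>cs (2 powi e) ?S \<in> L\<close>]
  have "(\<Sum>d\<in>D. cs (2 powi d - 2 powi e) (f d)) \<in> L"
    by (simp add: cs_def algebra_simps sum_distrib_left sum_subtractf single_diff)
  then have h: "cs (2 powi d - 2 powi e) (f d) \<in> L" if "d \<in> D" for d
    by (rule insert.IH[rotated]) (use insert.prems that in \<open>auto intro: homog_cs\<close>)
  have *: "f d \<in> L" if "d \<in> D" for d
  proof -
    have "(2 :: complex) powi d - 2 powi e \<noteq> 0"
      using that insert.hyps(2) two_powi_inj[of d e] by (metis eq_iff_diff_eq_0)
    then have "inverse (2 powi d - 2 powi e) * (2 powi d - 2 powi e) = (1 :: complex)" by (rule Fields.left_inverse)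
    then show ?thesis using L_cs[OF h[OF that], of "inverse (2 powi d - 2 powi e)"]
      by (simp only: cs.sc_mult cs.sc_one)
  qed
  have "(\<Sum>d\<in>D. f d) \<in> L" by (intro add_sg_sum[OF sgL] *)
  from add_sg_diff[OF sgL S this] have "f e \<in> L" by simp
  then show ?case using * insert.prems(3) by blast
qed simp

end

text \<open>Letter by letter from the right: each letter either shifts degree and weight or
  annihilates, and the zero class is homogeneous of every degree.\<close>

lemma word_homog:
  assumes "i \<in> seqs n \<alpha>"
  shows "\<exists>d j. homog n \<alpha> d (cmon 1 w * E i) \<and> klr_left.wt n \<alpha> (J n \<alpha>) j (cmon 1 w * E i)"
proof (induction w)
  interpret klr_left n \<alpha> "J n \<alpha>" by (rule klr_left_J)
  case Nil
  then show ?case using homog_gens(1)[OF assms] wt_E[OF assms, of 1] by (auto simp: cmon_one)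
next
  interpret klr_left n \<alpha> "J n \<alpha>" by (rule klr_left_J)
  case (Cons g w)
  then obtain d j where u: "homog n \<alpha> d (cmon 1 w * E i)" "wt j (cmon 1 w * E i)" by auto
  let ?u = "cmon 1 w * E i"
  have e: "cmon 1 (g # w) * E i = gg g * ?u" by (simp add: cmon_mult flip: mult.assoc)
  have j: "j \<in> seqs n \<alpha>" "E j * ?u \<bumpeq>\<^bsub>J n \<alpha>\<^esub> ?u" using u(2) by (auto simp: wt_def)
  have m: "homog n \<alpha> (c + d) (q * ?u)" if "homog n \<alpha> c (q * E j)" for c q
  proof -
    have "q * (E j * ?u) \<bumpeq>\<^bsub>J n \<alpha>\<^esub> q * ?u" by (rule eqv_mult[OF j(2)])
    then show ?thesis using homog_mult[OF that u(1)] homog_cong by (simp add: mult.assoc eqv_def)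
  qed
  have z: "homog n \<alpha> d q" "wt i q" if "q \<in> J n \<alpha>" for q
    using homog_cong[of q 0] homog_zero that wt_L[OF that assms] by auto
  have "\<exists>d j. homog n \<alpha> d (gg g * ?u) \<and> wt j (gg g * ?u)"
  proof (cases "g \<in> klr_gens n \<alpha>")
    case False
    then have "gg g * ?u \<in> J n \<alpha>" by (intro J_act J_illegal)
    then show ?thesis using z by blast
  next
    case True
    show ?thesis
    proof (cases g)
      case (Gidem k)
      show ?thesis
      proof (cases "k = j")
        case True
        then show ?thesis using u j homog_cong[OF j(2)[unfolded eqv_def]] wt_cong[OF j(2)] Gidem by auto
      next
        case False
        then have "E k * ?u \<in> J n \<alpha>" using wt_orth[OF u(2), of k] \<open>g \<in> _\<close> Gidem by (auto simp: gens_memb)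
        then show ?thesis using z Gidem by blast
      qed
    next
      case (Gx k)
      then show ?thesis using True m[OF homog_gens(2)] wt_X[OF u(2)] j by (auto simp: gens_memb)
    next
      case (Gtau t)
      then show ?thesis using True m[OF homog_gens(3)] wt_T[OF u(2)] j by (fastforce simp: gens_memb)
    qed
  qed
  then show ?case by (simp only: e)
qed

text \<open>An element is the sum of its words multiplied by the idempotents on the right. The terms
  are collected by a degree chosen for each of them, as a term that vanishes in the algebra has
  many.\<close>

lemma homog_decomp:
  "\<exists>D f. finite D \<and> (\<forall>d\<in>D. homog n \<alpha> d (f d)) \<and> p - (\<Sum>d\<in>D. f d) \<in> J n \<alpha>"
proof -
  interpret klr_left n \<alpha> "J n \<alpha>" by (rule klr_left_J)
  let ?S = "Poly_Mapping.keys p \<times> seqs n \<alpha>"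
  let ?g = "\<lambda>(w, i). cs (Poly_Mapping.lookup p w) (cmon 1 w * E i)"
  obtain dg where dg: "\<And>x. x \<in> ?S \<Longrightarrow> homog n \<alpha> (dg x) (cmon 1 (fst x) * E (snd x))"
  proof -
    have "\<forall>x\<in>?S. \<exists>d. homog n \<alpha> d (cmon 1 (fst x) * E (snd x))" using word_homog by fastforce
    then show ?thesis using that by metis
  qed
  let ?f = "\<lambda>d. \<Sum>x\<in>{x \<in> ?S. dg x = d}. ?g x"
  have "p * (\<Sum>i\<in>seqs n \<alpha>. E i) = (\<Sum>w\<in>Poly_Mapping.keys p. \<Sum>i\<in>seqs n \<alpha>. ?g (w, i))"
    by (subst poly_mapping_sum_singles[of p], subst sum_product) (simp add: cs_def cmon_mult flip: mult.assoc)
  also have "\<dots> = sum ?g ?S" by (simp add: sum.cartesian_product)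
  also have "\<dots> = (\<Sum>d\<in>dg ` ?S. ?f d)" by (rule sum.image_gen) simp
  finally have "p * (\<Sum>i\<in>seqs n \<alpha>. E i) = (\<Sum>d\<in>dg ` ?S. ?f d)" .
  moreover have "p * (\<Sum>i\<in>seqs n \<alpha>. E i) \<bumpeq>\<^bsub>J n \<alpha>\<^esub> p"
    using J_mult_left[OF J_rel(1), of p n \<alpha>] by (simp add: algebra_simps eqv_def)
  ultimately have "p \<bumpeq>\<^bsub>J n \<alpha>\<^esub> (\<Sum>d\<in>dg ` ?S. ?f d)" using eqv_sym by simp
  moreover have "homog n \<alpha> d (?f d)" for d
    by (rule homog_sum) (use dg in \<open>auto intro!: homog_cs\<close>)
  ultimately show ?thesis by (intro exI[of _ "dg ` ?S"] exI[of _ ?f]) (auto simp: eqv_def)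
qed

section \<open>Spanning sets indexed by shuffles\<close>

definition sw :: "nat \<Rightarrow> nat list \<Rightarrow> nat list" where
  "sw j \<sigma> = swap_seq (Suc j) \<sigma>"

lemma length_sw [simp]: "length (sw j \<sigma>) = length \<sigma>"
  by (simp add: sw_def)

lemma sw_nth: "Suc j < length \<sigma> \<Longrightarrow> k < length \<sigma> \<Longrightarrow>
    sw j \<sigma> ! k = (if k = j then \<sigma> ! Suc j else if k = Suc j then \<sigma> ! j else \<sigma> ! k)"
  by (auto simp: sw_def swap_seq_def nth_list_update)

lemma sw_sw [simp]: "Suc j < length \<sigma> \<Longrightarrow> sw j (sw j \<sigma>) = \<sigma>"
  by (rule nth_equalityI) (auto simp: sw_nth)

lemma sw_far: "Suc j < length \<sigma> \<Longrightarrow> Suc k < length \<sigma> \<Longrightarrow> j \<noteq> k \<Longrightarrow> j \<noteq> Suc k \<Longrightarrow> k \<noteq> Suc j \<Longrightarrow>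
    sw j (sw k \<sigma>) = sw k (sw j \<sigma>)"
  by (rule nth_equalityI) (auto simp: sw_nth)

lemma sw_braid: "Suc (Suc j) < length \<sigma> \<Longrightarrow>
    sw j (sw (Suc j) (sw j \<sigma>)) = sw (Suc j) (sw j (sw (Suc j) \<sigma>))"
  by (rule nth_equalityI) (auto simp: sw_nth)

lemma mset_sw: "Suc j < length \<sigma> \<Longrightarrow> mset (sw j \<sigma>) = mset \<sigma>"
  by (auto simp: sw_def swap_seq_def mset_swap)

lemma sw_split: "Suc j < length \<sigma> \<Longrightarrow> \<exists>xs ys. length xs = j \<and> \<sigma> = xs @ \<sigma> ! j # \<sigma> ! Suc j # ys \<and>
    sw j \<sigma> = xs @ \<sigma> ! Suc j # \<sigma> ! j # ys"
proof -
  assume h: "Suc j < length \<sigma>"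
  have s: "\<sigma> = take j \<sigma> @ \<sigma> ! j # \<sigma> ! Suc j # drop (Suc (Suc j)) \<sigma>"
    using h by (metis Cons_nth_drop_Suc Suc_lessD append_take_drop_id)
  have "sw j \<sigma> = take j \<sigma> @ \<sigma> ! Suc j # \<sigma> ! j # drop (Suc (Suc j)) \<sigma>"
    using h by (intro nth_equalityI) (auto simp: sw_nth nth_append nth_Cons' Suc_diff_Suc numeral_2_eq_2)
  with s h show ?thesis by (intro exI[of _ "take j \<sigma>"] exI[of _ "drop (Suc (Suc j)) \<sigma>"]) auto
qed

section \<open>Inversions and ascents of lists of labels\<close>

fun invs :: "nat list \<Rightarrow> nat" where
  "invs [] = 0"
| "invs (x # xs) = length (filter (\<lambda>y. y < x) xs) + invs xs"

lemma inv_append_swap: "a < b \<Longrightarrow> invs (xs @ b # a # ys) = Suc (invs (xs @ a # b # ys))"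
  by (induction xs) auto

definition asc :: "nat \<Rightarrow> nat list \<Rightarrow> bool" where
  "asc j \<sigma> \<longleftrightarrow> Suc j < length \<sigma> \<and> \<sigma> ! j < \<sigma> ! Suc j"

lemma inv_sw: "asc j \<sigma> \<Longrightarrow> invs (sw j \<sigma>) = Suc (invs \<sigma>)"
  by (metis asc_def inv_append_swap sw_split)

lemma sorted_inv: "sorted \<sigma> \<Longrightarrow> invs \<sigma> = 0"
  by (induction \<sigma>) (auto simp: filter_empty_conv)

lemma not_sorted_desc: "\<not> sorted \<sigma> \<Longrightarrow> \<exists>j. Suc j < length \<sigma> \<and> \<sigma> ! Suc j < \<sigma> ! j"
  by (metis linorder_not_le sorted_iff_nth_Suc)

text \<open>\<open>E0\<close> is a space of initial vectors, stable under dots, and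
  \<open>s0\<close> labels the strands at the bottom; crossings of neighbouring strands with equal
  labels kill \<open>E0\<close>. For the algebra the labels are pairwise different and
  \<open>E0\<close> consists of polynomials in the dots; for the product of segments a label is the
  number of a segment and \<open>E0\<close> is the line through the cyclic vector.\<close>

locale klr_span = klr_left +
  fixes s0 i0 :: "nat list" and E0 :: "falg set"
  assumes sorted_s0: "sorted s0" and length_s0: "length s0 = size \<alpha>"
    and E0_0: "0 \<in> E0" and E0_add: "e \<in> E0 \<Longrightarrow> e' \<in> E0 \<Longrightarrow> e + e' \<in> E0" and E0_cs: "e \<in> E0 \<Longrightarrow> cs c e \<in> E0"
    and E0_wt: "e \<in> E0 \<Longrightarrow> wt i0 e"
    and E0_X: "e \<in> E0 \<Longrightarrow> \<exists>e'\<in>E0. X k * e \<bumpeq>\<^bsub>L\<^esub> e'"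
    and E0_T: "e \<in> E0 \<Longrightarrow> Suc j < size \<alpha> \<Longrightarrow> s0 ! j = s0 ! Suc j \<Longrightarrow> T (Suc j) * e \<in> L"
begin

text \<open>Combinations of diagrams with fewer than \<open>m\<close> crossings, modulo
  \<open>L\<close>. The bound is strict so that stage 0 is \<open>L\<close> itself.\<close>

inductive filt :: "nat \<Rightarrow> falg \<Rightarrow> bool" where
  filt_L: "p \<in> L \<Longrightarrow> filt m p"
| filt_E0: "e \<in> E0 \<Longrightarrow> filt (Suc m) e"
| filt_add: "filt m p \<Longrightarrow> filt m q \<Longrightarrow> filt m (p + q)"
| filt_cs: "filt m p \<Longrightarrow> filt m (cs c p)"
| filt_X: "filt m p \<Longrightarrow> filt m (X k * p)"
| filt_E: "filt m p \<Longrightarrow> filt m (E i * p)"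
| filt_T: "filt m p \<Longrightarrow> filt (Suc m) (T t * p)"

lemma filt_Suc: "filt m p \<Longrightarrow> filt (Suc m) p"
  by (induction rule: filt.induct) (auto intro: filt.intros)

lemma filt_mono: "filt m p \<Longrightarrow> m \<le> m' \<Longrightarrow> filt m' p"
  by (induction m' arbitrary: rule: nat_induct) (auto simp: le_Suc_eq intro: filt_Suc)

lemma filt_0: "filt m p \<Longrightarrow> m = 0 \<Longrightarrow> p \<in> L"
  by (induction rule: filt.induct) (auto intro: L_add L_cs L_mult)

lemma filt_uminus: "filt m p \<Longrightarrow> filt m (- p)"
  using filt_cs[of m p "-1"] by (simp add: cs_def single_uminus cmon_one)

lemma filt_diff: "filt m p \<Longrightarrow> filt m q \<Longrightarrow> filt m (p - q)"
  using filt_add[OF _ filt_uminus, of m p q] by simp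

lemma filt_eqv: "p \<bumpeq>\<^bsub>L\<^esub> q \<Longrightarrow> filt m (p - q)"
  by (rule filt_L) (simp add: eqv_def)

lemma filt_trans: "filt m (p - q) \<Longrightarrow> filt m (q - r) \<Longrightarrow> filt m (p - r)"
  using filt_add[of m "p - q" "q - r"] by simp

lemma filt_sym: "filt m (p - q) \<Longrightarrow> filt m (q - p)"
  using filt_uminus[of m "p - q"] by simp

lemma filt_cong: "filt m (p - q) \<Longrightarrow> filt m q \<Longrightarrow> filt m p"
  using filt_add[of m "p - q" q] by simp

lemma filt_T_diff: "filt m (p - q) \<Longrightarrow> filt (Suc m) (T t * p - T t * q)"
  using filt_T[of m "p - q" t] by (simp add: algebra_simps)

text \<open>Hides the condition on letters in the braid relation: whether the error is
  \<open>u\<close> or 0, it has fewer crossings.\<close>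

lemma TTT_ex:
  assumes "wt i u" "Suc (Suc j) < size \<alpha>"
  shows "\<exists>y. (y = u \<or> y = 0) \<and> T (Suc j) * (T (Suc (Suc j)) * (T (Suc j) * u)) \<bumpeq>\<^bsub>L\<^esub>
    T (Suc (Suc j)) * (T (Suc j) * (T (Suc (Suc j)) * u)) + y"
proof -
  let ?y = "if entry i (Suc j) = entry i (Suc j + 2) \<and> adj (entry i (Suc j)) (entry i (Suc j + 1)) then u else 0"
  have "T (Suc j) * (T (Suc (Suc j)) * (T (Suc j) * u)) \<bumpeq>\<^bsub>L\<^esub>
    T (Suc (Suc j)) * (T (Suc j) * (T (Suc (Suc j)) * u)) + ?y"
    using TTT_act[OF assms(1), of "Suc j"] assms(2) by simp
  then show ?thesis by (intro exI[of _ ?y]) simp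
qed

text \<open>\<open>p\<close> is the product of crossings along a reduced expression that carries
  \<open>s0\<close> to \<open>\<sigma>\<close>. As each step creates an inversion of labels, strands
  with equal labels never cross: lists with repeated labels encode minimal coset
  representatives.\<close>

inductive red :: "nat \<Rightarrow> nat list \<Rightarrow> falg \<Rightarrow> bool" where
  red_0: "red 0 s0 1"
| red_Suc: "red m \<sigma> p \<Longrightarrow> asc j \<sigma> \<Longrightarrow> red (Suc m) (sw j \<sigma>) (T (Suc j) * p)"

lemma red_inv: "red m \<sigma> p \<Longrightarrow> m = invs \<sigma> \<and> mset \<sigma> = mset s0"
  by (induction rule: red.induct) (auto simp: sorted_inv sorted_s0 inv_sw mset_sw asc_def)

lemma red_length: "red m \<sigma> p \<Longrightarrow> length \<sigma> = size \<alpha>"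
  using red_inv length_s0 by (metis size_mset)

text \<open>Bubble sort: an unsorted list has a descent at neighbouring places, and swapping there
  removes exactly one inversion.\<close>

lemma red_ex: "mset \<sigma> = mset s0 \<Longrightarrow> \<exists>p. red (invs \<sigma>) \<sigma> p"
proof (induction "invs \<sigma>" arbitrary: \<sigma> rule: less_induct)
  case less
  show ?case
  proof (cases "sorted \<sigma>")
    case True
    then have "\<sigma> = s0" using less.prems sorted_s0 by (metis properties_for_sort)
    then show ?thesis using red_0 sorted_inv[OF sorted_s0] by metis
  next
    case False
    then obtain j where j: "Suc j < length \<sigma>" "\<sigma> ! Suc j < \<sigma> ! j" using not_sorted_desc by blast
    then have a: "asc j (sw j \<sigma>)" by (simp add: asc_def sw_nth)
    then have i: "invs \<sigma> = Suc (invs (sw j \<sigma>))" using inv_sw[OF a] j by simp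
    obtain p where "red (invs (sw j \<sigma>)) (sw j \<sigma>) p"
      using less.hyps[of "sw j \<sigma>"] i j less.prems by (auto simp: mset_sw)
    from red_Suc[OF this a] show ?thesis using i j by auto
  qed
qed

text \<open>A form of the exchange property: any descent of \<open>\<sigma>\<close> can be made the
  last crossing of a reduced expression.\<close>

lemma red_ex': "red m \<sigma> p \<Longrightarrow> Suc j < length \<sigma> \<Longrightarrow> \<sigma> ! Suc j < \<sigma> ! j \<Longrightarrow>
    \<exists>k r. m = Suc k \<and> red k (sw j \<sigma>) r \<and> asc j (sw j \<sigma>)"
proof -
  assume h: "red m \<sigma> p" "Suc j < length \<sigma>" "\<sigma> ! Suc j < \<sigma> ! j"
  then have a: "asc j (sw j \<sigma>)" by (simp add: asc_def sw_nth)
  have "m = Suc (invs (sw j \<sigma>))" using red_inv[OF h(1)] inv_sw[OF a] h by simp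
  moreover obtain r where "red (invs (sw j \<sigma>)) (sw j \<sigma>) r"
    using red_ex[of "sw j \<sigma>"] red_inv[OF h(1)] h by (auto simp: mset_sw)
  ultimately show ?thesis using a by blast
qed

lemma red_wt_ex: "red m \<sigma> p \<Longrightarrow> e \<in> E0 \<Longrightarrow> \<exists>i. wt i (p * e)"
proof (induction rule: red.induct)
  case red_0 then show ?case using E0_wt by auto
next
  case (red_Suc m \<sigma> p j)
  then obtain i where "wt i (p * e)" by blast
  then have "wt (swap_seq (Suc j) i) (T (Suc j) * (p * e))"
    using red_Suc red_length by (intro wt_T) (auto simp: asc_def)
  then show ?case by (auto simp: mult.assoc)
qed

lemma red_filt: "red m \<sigma> p \<Longrightarrow> e \<in> E0 \<Longrightarrow> filt (Suc m) (p * e)"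
  by (induction rule: red.induct) (auto simp: mult.assoc intro: filt.intros)

text \<open>Descents at \<open>j\<close> and \<open>Suc j\<close> mean that three consecutive labels
  are decreasing. Below their full reversal there is a common \<open>\<rho>\<close>; both words are
  compared with one through \<open>\<rho>\<close>, and the two are related by a braid move whose
  error has fewer crossings.\<close>

lemma red_diamond_adj:
  assumes IH: "\<And>m' \<sigma> p q. m' < m \<Longrightarrow> red m' \<sigma> p \<Longrightarrow> red m' \<sigma> q \<Longrightarrow> filt m' (p * e - q * e)"
    and e: "e \<in> E0" and m: "m = Suc k"
    and p: "red k (sw j \<sigma>) p" "asc j (sw j \<sigma>)" and q: "red k (sw (Suc j) \<sigma>) q" "asc (Suc j) (sw (Suc j) \<sigma>)"
  shows "filt m (T (Suc j) * p * e - T (Suc (Suc j)) * q * e)"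
proof -
  let ?\<rho> = "sw j (sw (Suc j) (sw j \<sigma>))"
  have l: "length \<sigma> = size \<alpha>" using red_length[OF p(1)] by simp
  have jl: "Suc (Suc j) < length \<sigma>" using q(2) by (simp add: asc_def)
  have d1: "\<sigma> ! Suc j < \<sigma> ! j" using p(2) jl by (auto simp: asc_def sw_nth)
  have d2: "\<sigma> ! Suc (Suc j) < \<sigma> ! Suc j" using q(2) jl by (auto simp: asc_def sw_nth)
  obtain k1 r1 where r1: "k = Suc k1" "red k1 (sw (Suc j) (sw j \<sigma>)) r1" "asc (Suc j) (sw (Suc j) (sw j \<sigma>))"
    using red_ex'[OF p(1), of "Suc j"] jl d1 d2 by (auto simp: sw_nth)
  obtain k2 r where r: "k1 = Suc k2" "red k2 ?\<rho> r" "asc j ?\<rho>"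
    using red_ex'[OF r1(2), of j] jl d1 d2 by (auto simp: sw_nth)
  have "red (Suc k2) (sw (Suc j) (sw j \<sigma>)) (T (Suc j) * r)"
    using red_Suc[OF r(2,3)] jl by simp
  from red_Suc[OF this r1(3)] have a: "red k (sw j \<sigma>) (T (Suc (Suc j)) * (T (Suc j) * r))"
    using jl r1 r by simp
  have b0: "?\<rho> = sw (Suc j) (sw j (sw (Suc j) \<sigma>))" using sw_braid jl by simp
  have "asc (Suc j) ?\<rho>" using jl d1 d2 by (auto simp: asc_def sw_nth)
  from red_Suc[OF r(2) this] have "red (Suc k2) (sw j (sw (Suc j) \<sigma>)) (T (Suc (Suc j)) * r)"
    using jl b0 by simp
  moreover have "asc j (sw j (sw (Suc j) \<sigma>))" using jl d1 d2 by (auto simp: asc_def sw_nth)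
  ultimately have b: "red k (sw (Suc j) \<sigma>) (T (Suc j) * (T (Suc (Suc j)) * r))"
    using red_Suc[of "Suc k2" "sw j (sw (Suc j) \<sigma>)" _ j] jl r1 r by simp
  let ?u = "r * e"
  obtain i where i: "wt i ?u" using red_wt_ex[OF r(2) e] by blast
  obtain y where y: "y = ?u \<or> y = 0" "T (Suc j) * (T (Suc (Suc j)) * (T (Suc j) * ?u)) \<bumpeq>\<^bsub>L\<^esub>
    T (Suc (Suc j)) * (T (Suc j) * (T (Suc (Suc j)) * ?u)) + y" using TTT_ex[OF i, of j] jl l by auto
  have fy: "filt m y"
    using y(1) filt_mono[OF red_filt[OF r(2) e], of m] r r1 m by (auto intro: filt_L)
  have 1: "filt m (T (Suc j) * p * e - T (Suc j) * (T (Suc (Suc j)) * (T (Suc j) * ?u)))"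
    using filt_T_diff[OF IH[OF _ p(1) a], of "Suc j"] m by (simp add: mult.assoc)
  have 2: "filt m (T (Suc (Suc j)) * q * e - T (Suc (Suc j)) * (T (Suc j) * (T (Suc (Suc j)) * ?u)))"
    using filt_T_diff[OF IH[OF _ q(1) b], of "Suc (Suc j)"] m by (simp add: mult.assoc)
  have 3: "filt m (T (Suc j) * (T (Suc (Suc j)) * (T (Suc j) * ?u)) -
      T (Suc (Suc j)) * (T (Suc j) * (T (Suc (Suc j)) * ?u)))"
    by (rule filt_trans[OF filt_eqv[OF y(2)]]) (simp add: fy)
  show ?thesis by (rule filt_trans[OF 1 filt_trans[OF 3 filt_sym[OF 2]]])
qed

text \<open>Matsumoto's theorem up to lower terms. The last crossings of the two words are equal,
  neighbouring or distant; in each case both words are linked by induction to words that differ by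
  at most one move.\<close>

lemma red_diamond:
  assumes e: "e \<in> E0"
  shows "red m \<sigma> p \<Longrightarrow> red m \<sigma> q \<Longrightarrow> filt m (p * e - q * e)"
proof (induction m arbitrary: \<sigma> p q rule: less_induct)
  case (less m)
  show ?case
  proof (cases m)
    case 0
    then have "p = 1" "q = 1" using less.prems by (auto elim: red.cases)
    then show ?thesis by (simp add: filt_L)
  next
    case (Suc k)
    from less.prems(1) Suc obtain \<sigma>1 j p1 where p1: "red k \<sigma>1 p1" "asc j \<sigma>1" "\<sigma> = sw j \<sigma>1" "p = T (Suc j) * p1"
      by (auto elim: red.cases)
    from less.prems(2) Suc obtain \<sigma>2 i q1 where q1: "red k \<sigma>2 q1" "asc i \<sigma>2" "\<sigma> = sw i \<sigma>2" "q = T (Suc i) * q1"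
      by (auto elim: red.cases)
    have l: "Suc j < length \<sigma>" using p1(2) by (simp add: asc_def p1(3))
    have l2: "Suc i < length \<sigma>" using q1(2) by (simp add: asc_def q1(3))
    note l = l l2
    have s: "\<sigma>1 = sw j \<sigma>" "\<sigma>2 = sw i \<sigma>"
      using p1(2) q1(2) sw_sw[of j \<sigma>1] sw_sw[of i \<sigma>2] by (simp_all add: asc_def p1(3)[symmetric] q1(3)[symmetric])
    note P = p1(1,2)[unfolded s] and Q = q1(1,2)[unfolded s]
    consider "i = j" | "i = Suc j" | "j = Suc i" | "i \<noteq> j" "i \<noteq> Suc j" "j \<noteq> Suc i" by blast
    then show ?thesis
    proof cases
      case 1
      have "filt k (p1 * e - q1 * e)" by (rule less.IH[OF _ P(1)]) (use Q Suc 1 in \<open>auto\<close>)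
      then show ?thesis using filt_T_diff[of k "p1 * e" "q1 * e" "Suc j"] Suc p1 q1 1
        by (simp add: mult.assoc)
    next
      case 2
      have "filt m (T (Suc j) * p1 * e - T (Suc (Suc j)) * q1 * e)"
        by (rule red_diamond_adj[OF less.IH e Suc P]) (use Q 2 in \<open>auto\<close>)
      then show ?thesis using p1 q1 2 by simp
    next
      case 3
      have "filt m (T (Suc i) * q1 * e - T (Suc (Suc i)) * p1 * e)"
        by (rule red_diamond_adj[OF less.IH e Suc Q]) (use P 3 in \<open>auto\<close>)
      then show ?thesis using p1 q1 3 filt_sym by simp
    next
      case 4
      have d1: "\<sigma> ! Suc j < \<sigma> ! j" "\<sigma> ! Suc i < \<sigma> ! i" using P(2) Q(2) l by (auto simp: asc_def sw_nth)
      obtain k1 r where r: "k = Suc k1" "red k1 (sw i (sw j \<sigma>)) r" "asc i (sw i (sw j \<sigma>))"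
        using red_ex'[OF P(1), of i] l d1 4 by (auto simp: sw_nth)
      have f: "sw i (sw j \<sigma>) = sw j (sw i \<sigma>)" using sw_far l 4 by simp
      have a: "red k (sw j \<sigma>) (T (Suc i) * r)" using red_Suc[OF r(2,3)] r(1) l by simp
      have "asc j (sw i (sw j \<sigma>))" using 4 l d1 by (auto simp: asc_def sw_nth)
      from red_Suc[OF r(2) this] have b: "red k (sw i \<sigma>) (T (Suc j) * r)" using r(1) l f by simp
      let ?u = "r * e"
      have 1: "filt m (T (Suc j) * p1 * e - T (Suc j) * (T (Suc i) * ?u))"
        using filt_T_diff[OF less.IH[OF _ P(1) a], of "Suc j"] Suc by (simp add: mult.assoc)
      have 2: "filt m (T (Suc i) * q1 * e - T (Suc i) * (T (Suc j) * ?u))"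
        using filt_T_diff[OF less.IH[OF _ Q(1) b], of "Suc i"] Suc by (simp add: mult.assoc)
      have 3: "filt m (T (Suc j) * (T (Suc i) * ?u) - T (Suc i) * (T (Suc j) * ?u))"
        by (rule filt_eqv[OF TT_far]) (use 4 in auto)
      show ?thesis unfolding p1(4) q1(4) by (rule filt_trans[OF 1 filt_trans[OF 3 filt_sym[OF 2]]])
    qed
  qed
qed

text \<open>The crossing of the equal strands is moved down through the reduced word until it
  reaches \<open>s0\<close>, where it kills \<open>E0\<close>. What remains has at most as many
  crossings as \<open>p\<close>, one fewer than the number of factors.\<close>

lemma red_same_label:
  assumes e: "e \<in> E0"
  shows "red m \<sigma> p \<Longrightarrow> Suc t < length \<sigma> \<Longrightarrow> \<sigma> ! t = \<sigma> ! Suc t \<Longrightarrow> filt (Suc m) (T (Suc t) * (p * e))"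
proof (induction m arbitrary: \<sigma> p t rule: less_induct)
  case (less m)
  show ?case
  proof (cases m)
    case 0
    then have "p = 1" "\<sigma> = s0" using less.prems by (auto elim: red.cases)
    then show ?thesis using E0_T[OF e, of t] less.prems length_s0 by (simp add: filt_L)
  next
    case (Suc k)
    from less.prems(1) Suc obtain \<sigma>1 j p1 where p1: "red k \<sigma>1 p1" "asc j \<sigma>1" "\<sigma> = sw j \<sigma>1" "p = T (Suc j) * p1"
      by (auto elim: red.cases)
    have s: "\<sigma>1 = sw j \<sigma>" using p1 by (auto simp: asc_def)
    have l: "Suc j < length \<sigma>" using p1 by (auto simp: asc_def)
    have lA: "length \<sigma> = size \<alpha>" using red_length[OF less.prems(1)] .
    note P = p1(1,2)[unfolded s]
    have d1: "\<sigma> ! Suc j < \<sigma> ! j" using P(2) l by (auto simp: asc_def sw_nth)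
    have "j \<noteq> t" using d1 less.prems by auto
    then consider "j = Suc t" | "t = Suc j" | "j \<noteq> t" "j \<noteq> Suc t" "t \<noteq> Suc j" by blast
    then show ?thesis
    proof cases
      case 3
      have "filt (Suc k) (T (Suc t) * (p1 * e))"
        using less.IH[OF _ P(1), of t] Suc less.prems l 3 by (auto simp: sw_nth)
      from filt_T[OF this, of "Suc j"] have "filt (Suc m) (T (Suc j) * (T (Suc t) * (p1 * e)))" using Suc by simp
      then show ?thesis
        using filt_cong[OF filt_eqv[OF TT_far[of "Suc t" "Suc j" "p1 * e"]]] 3 p1 by (simp add: mult.assoc)
    next
      \<comment> \<open>A strand with a smaller label has crossed both equal strands. The braid
        relation moves their crossing below it, where the induction hypothesis applies. The case of
        a larger label is the mirror image.\<close>
      case 1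
      obtain k1 r where r: "k = Suc k1" "red k1 (sw t (sw j \<sigma>)) r" "asc t (sw t (sw j \<sigma>))"
        using red_ex'[OF P(1), of t] l d1 less.prems 1 by (auto simp: sw_nth)
      have a: "red k (sw j \<sigma>) (T (Suc t) * r)" using red_Suc[OF r(2,3)] r(1) l less.prems by simp
      let ?u = "r * e"
      obtain i where i: "wt i ?u" using red_wt_ex[OF r(2) e] by blast
      obtain y where y: "y = ?u \<or> y = 0" "T (Suc t) * (T (Suc (Suc t)) * (T (Suc t) * ?u)) \<bumpeq>\<^bsub>L\<^esub>
        T (Suc (Suc t)) * (T (Suc t) * (T (Suc (Suc t)) * ?u)) + y" using TTT_ex[OF i, of t] l lA 1 by auto
      have fy: "filt (Suc m) y"
        using y(1) filt_mono[OF red_filt[OF r(2) e], of "Suc m"] r Suc by (auto intro: filt_L)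
      have "filt (Suc k1) (T (Suc (Suc t)) * ?u)"
        using less.IH[OF _ r(2), of "Suc t"] r Suc less.prems l 1 by (auto simp: sw_nth)
      from filt_T[OF filt_T[OF this, of "Suc t"], of "Suc (Suc t)"]
      have g: "filt (Suc m) (T (Suc (Suc t)) * (T (Suc t) * (T (Suc (Suc t)) * ?u)) + y)"
        using r Suc by (intro filt_add fy) simp
      have "filt k (p1 * e - T (Suc t) * r * e)" by (rule red_diamond[OF e P(1) a])
      from filt_T_diff[OF filt_T_diff[OF this, of "Suc j"], of "Suc t"]
      have "filt (Suc m) (T (Suc t) * (p * e) - T (Suc t) * (T (Suc (Suc t)) * (T (Suc t) * ?u)))"
        using Suc p1 1 by (simp add: mult.assoc)
      from filt_cong[OF this filt_cong[OF filt_eqv[OF y(2)] g]] show ?thesis .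
    next
      case 2
      obtain k1 r where r: "k = Suc k1" "red k1 (sw t (sw j \<sigma>)) r" "asc t (sw t (sw j \<sigma>))"
        using red_ex'[OF P(1), of t] l d1 less.prems 2 by (auto simp: sw_nth)
      have a: "red k (sw j \<sigma>) (T (Suc t) * r)" using red_Suc[OF r(2,3)] r(1) l less.prems by simp
      let ?u = "r * e"
      obtain i where i: "wt i ?u" using red_wt_ex[OF r(2) e] by blast
      obtain y where y: "y = ?u \<or> y = 0" "T (Suc j) * (T (Suc (Suc j)) * (T (Suc j) * ?u)) \<bumpeq>\<^bsub>L\<^esub>
        T (Suc (Suc j)) * (T (Suc j) * (T (Suc (Suc j)) * ?u)) + y" using TTT_ex[OF i, of j] less.prems lA 2 by auto
      have fy: "filt (Suc m) y"
        using y(1) filt_mono[OF red_filt[OF r(2) e], of "Suc m"] r Suc by (auto intro: filt_L)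
      have "filt (Suc k1) (T (Suc j) * ?u)"
        using less.IH[OF _ r(2), of j] r Suc less.prems l 2 by (auto simp: sw_nth)
      from filt_T[OF filt_T[OF this, of "Suc (Suc j)"], of "Suc j"]
      have g: "filt (Suc m) (T (Suc j) * (T (Suc (Suc j)) * (T (Suc j) * ?u)) - y)"
        using r Suc by (intro filt_diff fy) simp
      have h: "filt (Suc m) (T (Suc (Suc j)) * (T (Suc j) * (T (Suc (Suc j)) * ?u)) -
          (T (Suc j) * (T (Suc (Suc j)) * (T (Suc j) * ?u)) - y))"
        using filt_sym[OF filt_eqv[OF y(2)], of "Suc m"] by (simp add: algebra_simps)
      have "filt k (p1 * e - T (Suc t) * r * e)" by (rule red_diamond[OF e P(1) a])
      from filt_T_diff[OF filt_T_diff[OF this, of "Suc j"], of "Suc t"]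
      have "filt (Suc m) (T (Suc t) * (p * e) - T (Suc (Suc j)) * (T (Suc j) * (T (Suc (Suc j)) * ?u)))"
        using Suc p1 2 by (simp add: mult.assoc)
      from filt_cong[OF this filt_cong[OF h g]] show ?thesis .
    qed
  qed
qed

text \<open>A dot slides down through a crossing at the cost of a term with the crossing removed; at
  the bottom it is absorbed by \<open>E0\<close>.\<close>

lemma red_X: "red m \<sigma> p \<Longrightarrow> e \<in> E0 \<Longrightarrow> \<exists>e'\<in>E0. filt m (X k * (p * e) - p * e')"
proof (induction arbitrary: k rule: red.induct)
  case red_0
  then obtain e' where "e' \<in> E0" "X k * e \<bumpeq>\<^bsub>L\<^esub> e'" using E0_X by blast
  then show ?case by (intro bexI[of _ e']) (auto intro: filt_eqv)
next
  case (red_Suc m \<sigma> p j)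
  let ?u = "p * e" and ?t = "Suc j"
  have t: "?t \<in> {1..<size \<alpha>}" using red_Suc.hyps red_length by (auto simp: asc_def)
  obtain i where i: "wt i ?u" using red_wt_ex red_Suc by blast
  show ?case
  proof (cases "k \<in> {1..size \<alpha>}")
    case False
    then have "X k * (T ?t * p * e) - T ?t * p * 0 \<in> L" using X_illegal by simp
    then show ?thesis using E0_0 filt_L by blast
  next
    case True
    \<comment> \<open>\<open>TX_act\<close> is read from right to left: \<open>k'\<close> is the
      place that the transposition carries to \<open>k\<close>.\<close>
    define k' where "k' = (if k = ?t then ?t + 1 else if k = ?t + 1 then ?t else k)"
    have k': "k' \<in> {1..size \<alpha>}" "(if k' = ?t then ?t + 1 else if k' = ?t + 1 then ?t else k') = k"
      using True t by (auto simp: k'_def)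
    let ?y = "if k' = ?t \<and> entry i ?t = entry i (?t + 1) then ?u
          else if k' = ?t + 1 \<and> entry i ?t = entry i (?t + 1) then - ?u else 0"
    have a: "T ?t * (X k' * ?u) \<bumpeq>\<^bsub>L\<^esub> X k * (T ?t * ?u) + ?y"
      using TX_act[OF i t k'(1)] unfolding k'(2) .
    have fy: "filt (Suc m) ?y"
      using red_filt[OF red_Suc.hyps(1) red_Suc.prems] by (auto intro: filt_L filt_uminus)
    obtain e' where e': "e' \<in> E0" "filt m (X k' * ?u - p * e')" using red_Suc by blast
    have "filt (Suc m) (X k * (T ?t * ?u) - T ?t * (X k' * ?u))"
      using filt_add[OF filt_eqv[OF eqv_sym[OF a], of "Suc m"] filt_uminus[OF fy]] by (simp add: algebra_simps)
    from filt_trans[OF this filt_T_diff[OF e'(2)]] e'(1) show ?thesis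
      by (intro bexI[of _ e']) (simp_all add: mult.assoc)
  qed
qed

section \<open>Rewriting with one chosen reduced word per shuffle\<close>

definition Tw :: "nat list \<Rightarrow> falg" where "Tw \<sigma> = (SOME p. red (invs \<sigma>) \<sigma> p)"

lemma red_Tw: "mset \<sigma> = mset s0 \<Longrightarrow> red (invs \<sigma>) \<sigma> (Tw \<sigma>)"
  unfolding Tw_def by (rule someI_ex[OF red_ex])

text \<open>The counterpart of \<open>filt\<close> in which only chosen reduced words and initial
  vectors occur. The aim is \<open>filt_spn\<close>, that nothing is lost by this
  restriction.\<close>

inductive spn :: "nat \<Rightarrow> falg \<Rightarrow> bool" where
  spn_L: "p \<in> L \<Longrightarrow> spn m p"
| spn_Tw: "mset \<sigma> = mset s0 \<Longrightarrow> invs \<sigma> < m \<Longrightarrow> e \<in> E0 \<Longrightarrow> spn m (Tw \<sigma> * e)"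
| spn_add: "spn m p \<Longrightarrow> spn m q \<Longrightarrow> spn m (p + q)"

lemma spn_mono: "spn m p \<Longrightarrow> m \<le> m' \<Longrightarrow> spn m' p"
  by (induction rule: spn.induct) (auto intro: spn.intros)

lemma spn_cs: "spn m p \<Longrightarrow> spn m (cs c p)"
  by (induction rule: spn.induct)
    (auto simp: cs.sc_add2 intro: spn.intros L_cs E0_cs simp flip: cs_mult_right)

lemma spn_diff_cong: "spn m (p - q) \<Longrightarrow> spn m q \<Longrightarrow> spn m p"
  using spn_add[of m "p - q" q] by simp

lemma spn_X:
  assumes IH: "\<And>m' x. m' < m \<Longrightarrow> filt m' x \<Longrightarrow> spn m' x"
  shows "spn m' p \<Longrightarrow> m' = m \<Longrightarrow> spn m (X k * p)"
proof (induction rule: spn.induct)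
  case (spn_Tw \<sigma> m' e)
  obtain e' where e': "e' \<in> E0" "filt (invs \<sigma>) (X k * (Tw \<sigma> * e) - Tw \<sigma> * e')"
    using red_X[OF red_Tw] spn_Tw by blast
  show ?case
    by (rule spn_diff_cong[OF spn_mono[OF IH[OF _ e'(2)]]]) (use spn_Tw e' in \<open>auto intro: spn.intros\<close>)
qed (auto simp: distrib_left intro: spn.intros L_mult)

lemma spn_E: "spn m p \<Longrightarrow> spn m (E i * p)"
proof (induction rule: spn.induct)
  case (spn_Tw \<sigma> m e)
  obtain j where j: "wt j (Tw \<sigma> * e)" using red_wt_ex[OF red_Tw] spn_Tw by blast
  show ?case
  proof (cases "i = j")
    case True
    then have "E i * (Tw \<sigma> * e) - Tw \<sigma> * e \<in> L" using j by (simp add: wt_def eqv_def)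
    from spn_diff_cong[OF spn_L[OF this]] show ?thesis using spn_Tw by (auto intro: spn.intros)
  next
    case False
    then have "E i * (Tw \<sigma> * e) \<in> L" using wt_orth[OF j] E_illegal by blast
    then show ?thesis by (rule spn_L)
  qed
qed (auto simp: distrib_left intro: spn.intros L_mult)

text \<open>At an ascent the product is a reduced word of a longer shuffle, to be replaced by the
  chosen one. At equal labels \<open>red_same_label\<close> lowers the number of crossings. At a
  descent the word can be taken to end with the same crossing, and the quadratic relation removes
  both.\<close>

lemma spn_T:
  assumes IH: "\<And>m' x. m' < Suc m \<Longrightarrow> filt m' x \<Longrightarrow> spn m' x"
  shows "spn m' p \<Longrightarrow> m' = m \<Longrightarrow> spn (Suc m) (T t * p)"
proof (induction rule: spn.induct)
  case (spn_Tw \<sigma> m' e)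
  let ?k = "invs \<sigma>"
  have r: "red ?k \<sigma> (Tw \<sigma>)" using red_Tw spn_Tw by blast
  have l: "length \<sigma> = size \<alpha>" using red_length[OF r] .
  have *: "spn (Suc m) (T t * (Tw \<sigma> * e))" if "filt (Suc ?k) (T t * (Tw \<sigma> * e))"
    by (rule spn_mono[OF IH[OF _ that]]) (use spn_Tw in auto)
  show ?case
  proof (cases "t \<in> {1..<size \<alpha>}")
    case False
    then show ?thesis using T_illegal spn_L by blast
  next
    case True
    then obtain j where j: "t = Suc j" "Suc j < length \<sigma>" using l by (cases t) auto
    consider "\<sigma> ! j < \<sigma> ! Suc j" | "\<sigma> ! j = \<sigma> ! Suc j" | "\<sigma> ! Suc j < \<sigma> ! j" by linarith
    then show ?thesis
    proof cases
      case 1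
      then have a: "asc j \<sigma>" using j by (simp add: asc_def)
      have ms: "mset (sw j \<sigma>) = mset s0" using spn_Tw j by (simp add: mset_sw)
      have "filt (Suc ?k) (T (Suc j) * Tw \<sigma> * e - Tw (sw j \<sigma>) * e)"
        by (rule red_diamond[OF _ red_Suc[OF r a]]) (use red_Tw[OF ms] inv_sw[OF a] spn_Tw in auto)
      then have "spn (Suc m) (T t * (Tw \<sigma> * e) - Tw (sw j \<sigma>) * e)"
        using spn_Tw j by (intro spn_mono[OF IH]) (auto simp: mult.assoc)
      then show ?thesis
        by (rule spn_diff_cong) (use spn_Tw ms inv_sw[OF a] in \<open>auto intro: spn.intros\<close>)
    next
      case 2
      then show ?thesis using red_same_label[OF spn_Tw(3) r] j by (intro *) auto
    next
      case 3
      obtain k1 q where q: "?k = Suc k1" "red k1 (sw j \<sigma>) q" "asc j (sw j \<sigma>)"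
        using red_ex'[OF r, of j] 3 j by auto
      have a: "red ?k \<sigma> (T (Suc j) * q)" using red_Suc[OF q(2,3)] q(1) j by simp
      let ?u = "q * e"
      obtain i where i: "wt i ?u" using red_wt_ex[OF q(2)] spn_Tw by blast
      have fu: "filt ?k ?u" using red_filt[OF q(2)] spn_Tw q by auto
      have "filt ?k (if entry i t = entry i (t + 1) then 0
        else if \<not> adj (entry i t) (entry i (t + 1)) then ?u
        else X t * ?u + X (t + 1) * ?u)"
        using fu by (auto intro: filt_L filt_add filt_X)
      from filt_cong[OF filt_eqv[OF TT_act[OF i True]] this] have "filt ?k (T t * (T t * ?u))" .
      then have b: "filt (Suc ?k) (T t * (T t * ?u))" by (rule filt_Suc)
      have "filt ?k (Tw \<sigma> * e - T (Suc j) * q * e)" using red_diamond[OF _ r a] spn_Tw by blast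
      from filt_cong[OF filt_T_diff[OF this, of t]] b j
      have "filt (Suc ?k) (T t * (Tw \<sigma> * e))" by (simp add: mult.assoc)
      then show ?thesis by (rule *)
    qed
  qed
qed (auto simp: distrib_left intro: spn.intros L_mult)

text \<open>The outer induction takes care of the error terms, all of which lie in a smaller stage
  of the filtration; the inner one follows the construction of \<open>x\<close>.\<close>

lemma filt_spn: "filt m x \<Longrightarrow> spn m x"
proof (induction m arbitrary: x rule: less_induct)
  case (less m)
  have IH: "\<And>m' x. m' < m \<Longrightarrow> filt m' x \<Longrightarrow> spn m' x" by (rule less.IH)
  have "filt m' x \<Longrightarrow> m' = m \<Longrightarrow> spn m x" for m' x
  proof (induction rule: filt.induct)
    case (filt_E0 e k)
    have "filt 0 (e - Tw s0 * e)"
      using red_diamond[OF filt_E0(1) red_0, of "Tw s0"] red_Tw[of s0] sorted_inv[OF sorted_s0] by simp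
    then have "e - Tw s0 * e \<in> L" using filt_0 by blast
    then show ?case
      by (rule spn_diff_cong[OF spn_L]) (use filt_E0 sorted_inv[OF sorted_s0] in \<open>auto intro: spn.intros\<close>)
  next
    case (filt_X k p q)
    then show ?case using spn_X[OF IH] by blast
  next
    case (filt_T k p t)
    then have "spn k p" using IH by blast
    then show ?case using spn_T[of k k p t] IH filt_T by blast
  qed (auto intro: spn_L spn_add spn_cs spn_E)
  then show ?case using less.prems by blast
qed

lemma filt_word: "e \<in> E0 \<Longrightarrow> \<exists>m. filt m (cmon 1 w * e)"
proof (induction w)
  case Nil
  then show ?case using filt_E0[of e 0] by (auto simp: cmon_one)
next
  case (Cons g w)
  then obtain m where m: "filt m (cmon 1 w * e)" by blast
  have "cmon 1 (g # w) * e = gg g * (cmon 1 w * e)" by (simp add: cmon_mult flip: mult.assoc)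
  then show ?case using filt_X[OF m] filt_E[OF m] filt_T[OF m] by (cases g) auto
qed

lemma spn_all: "e \<in> E0 \<Longrightarrow> \<exists>m. spn m (q * e)"
proof (induction q rule: poly_mapping_linear_induct)
  case (single u a)
  then obtain m where "filt m (cmon 1 u * e)" using filt_word by blast
  moreover have "cmon a u * e = cs a (cmon 1 u * e)" by (simp add: cs_def cmon_mult flip: mult.assoc)
  ultimately show ?case using filt_spn filt_cs by metis
next
  case (add p q)
  then obtain m m' where "spn m (p * e)" "spn m' (q * e)" by blast
  then have "spn (max m m') (p * e)" "spn (max m m') (q * e)" by (auto intro: spn_mono)
  from spn_add[OF this] show ?case by (auto simp: distrib_right)
qed

definition shufs :: "nat list set" where "shufs = {\<sigma>. mset \<sigma> = mset s0}"

lemma finite_shufs: "finite shufs"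
  by (rule finite_subset[OF _ finite_lists_length_eq[of "set s0" "length s0"]])
    (auto simp: shufs_def dest: mset_eq_length mset_eq_setD)

text \<open>The spanning half of a PBW theorem: one reduced word per shuffle, with coefficients from
  \<open>E0\<close> on the right.\<close>

theorem spanning:
  assumes "e \<in> E0"
  shows "\<exists>\<epsilon>. (\<forall>\<sigma>. \<epsilon> \<sigma> \<in> E0) \<and> q * e \<bumpeq>\<^bsub>L\<^esub> (\<Sum>\<sigma>\<in>shufs. Tw \<sigma> * \<epsilon> \<sigma>)"
proof -
  have "spn m p \<Longrightarrow> \<exists>\<epsilon>. (\<forall>\<sigma>. \<epsilon> \<sigma> \<in> E0) \<and> p \<bumpeq>\<^bsub>L\<^esub> (\<Sum>\<sigma>\<in>shufs. Tw \<sigma> * \<epsilon> \<sigma>)" for m p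
  proof (induction rule: spn.induct)
    case (spn_L p m)
    then show ?case using E0_0 by (intro exI[of _ "\<lambda>_. 0"]) auto
  next
    case (spn_Tw \<sigma> m e)
    have "(\<Sum>\<rho>\<in>shufs. Tw \<rho> * (if \<rho> = \<sigma> then e else 0)) = (\<Sum>\<rho>\<in>shufs. if \<rho> = \<sigma> then Tw \<sigma> * e else 0)"
      by (rule sum.cong) auto
    also have "\<dots> = Tw \<sigma> * e" using spn_Tw finite_shufs by (simp add: shufs_def)
    finally show ?case using E0_0 spn_Tw by (intro exI[of _ "\<lambda>\<rho>. if \<rho> = \<sigma> then e else 0"]) auto
  next
    case (spn_add m p q)
    then obtain f g where f: "\<forall>\<sigma>. f \<sigma> \<in> E0" "p \<bumpeq>\<^bsub>L\<^esub> (\<Sum>\<sigma>\<in>shufs. Tw \<sigma> * f \<sigma>)"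
      and g: "\<forall>\<sigma>. g \<sigma> \<in> E0" "q \<bumpeq>\<^bsub>L\<^esub> (\<Sum>\<sigma>\<in>shufs. Tw \<sigma> * g \<sigma>)" by blast
    show ?case
      using E0_add f(1) g(1) eqv_add[OF f(2) g(2)]
      by (intro exI[of _ "\<lambda>\<sigma>. f \<sigma> + g \<sigma>"]) (simp add: distrib_left sum.distrib)
  qed
  then show ?thesis using spn_all[OF assms] by blast
qed

end

section \<open>Letters and degrees of shuffles\<close>

text \<open>A shuffle is a list of labels; \<open>lf p c\<close> is the letter of the (c+1)st strand with label \<open>p\<close>,
  and \<open>f\<close> counts the strands of each label seen so far.\<close>

fun pr :: "(nat \<Rightarrow> nat \<Rightarrow> nat) \<Rightarrow> (nat \<Rightarrow> nat) \<Rightarrow> nat list \<Rightarrow> (nat \<times> nat) list" where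
  "pr lf f [] = []"
| "pr lf f (p # \<sigma>) = (p, lf p (f p)) # pr lf (f(p := Suc (f p))) \<sigma>"

text \<open>Two strands have crossed iff their labels are in the wrong order, and each crossing
  contributes the degree determined by its two letters.\<close>

fun dgl :: "(nat \<times> nat) list \<Rightarrow> int" where
  "dgl [] = 0"
| "dgl (x # xs) = (\<Sum>y\<leftarrow>xs. if fst y < fst x then - cartan (snd x) (snd y) else 0) + dgl xs"

lemma length_pr [simp]: "length (pr lf f \<sigma>) = length \<sigma>"
  by (induction \<sigma> arbitrary: f) auto

lemma map_fst_pr [simp]: "map fst (pr lf f \<sigma>) = \<sigma>"
  by (induction \<sigma> arbitrary: f) auto

definition wd :: "(nat \<Rightarrow> nat \<Rightarrow> nat) \<Rightarrow> nat list \<Rightarrow> nat list" where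
  "wd lf \<sigma> = map snd (pr lf (\<lambda>_. 0) \<sigma>)"

definition dg :: "(nat \<Rightarrow> nat \<Rightarrow> nat) \<Rightarrow> nat list \<Rightarrow> int" where
  "dg lf \<sigma> = dgl (pr lf (\<lambda>_. 0) \<sigma>)"

lemma length_wd [simp]: "length (wd lf \<sigma>) = length \<sigma>"
  by (simp add: wd_def)

text \<open>The letter of a strand depends only on the earlier strands with its own label, so
  swapping different labels carries the letters along.\<close>

lemma pr_swap: "a \<noteq> b \<Longrightarrow> \<exists>XS A B YS. pr lf f (xs @ a # b # ys) = XS @ (a, A) # (b, B) # YS \<and>
    pr lf f (xs @ b # a # ys) = XS @ (b, B) # (a, A) # YS \<and> length XS = length xs"
proof (induction xs arbitrary: f)
  case Nil
  then show ?case by (intro exI[of _ "[]"]) (auto simp: fun_upd_twist)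
next
  case (Cons x xs)
  from Cons.IH[OF Cons.prems, of "f(x := Suc (f x))"] obtain XS A B YS where
    "pr lf (f(x := Suc (f x))) (xs @ a # b # ys) = XS @ (a, A) # (b, B) # YS"
    "pr lf (f(x := Suc (f x))) (xs @ b # a # ys) = XS @ (b, B) # (a, A) # YS" "length XS = length xs" by blast
  then show ?case by (intro exI[of _ "(x, lf x (f x)) # XS"]) auto
qed

lemma dgl_swap: "a < b \<Longrightarrow> dgl (XS @ (b, B) # (a, A) # YS) = dgl (XS @ (a, A) # (b, B) # YS) - cartan B A"
  by (induction XS) auto

lemma cartan_sym: "cartan a b = cartan b a"
  by (auto simp: cartan_def)

lemma swap_seq_append: "length xs = j \<Longrightarrow> swap_seq (Suc j) (xs @ a # b # ys) = xs @ b # a # ys"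
  by (auto simp: swap_seq_def nth_append list_update_append)

text \<open>Links combinatorics and algebra: one step of a reduced word changes word and degree of a
  shuffle as the crossing changes weight and degree of a vector.\<close>

lemma asc_letters:
  assumes "asc j \<sigma>"
  shows "wd lf (sw j \<sigma>) = swap_seq (Suc j) (wd lf \<sigma>)"
    and "dg lf (sw j \<sigma>) = dg lf \<sigma> - cartan (entry (wd lf \<sigma>) (Suc j)) (entry (wd lf \<sigma>) (Suc j + 1))"
proof -
  obtain xs ys where s: "length xs = j" "\<sigma> = xs @ \<sigma> ! j # \<sigma> ! Suc j # ys" "sw j \<sigma> = xs @ \<sigma> ! Suc j # \<sigma> ! j # ys"
    using sw_split assms unfolding asc_def by blast
  have "\<sigma> ! j \<noteq> \<sigma> ! Suc j" using assms by (simp add: asc_def)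
  from pr_swap[OF this, of lf "\<lambda>_. 0" xs ys] obtain XS A B YS where
    p: "pr lf (\<lambda>_. 0) \<sigma> = XS @ (\<sigma> ! j, A) # (\<sigma> ! Suc j, B) # YS"
       "pr lf (\<lambda>_. 0) (sw j \<sigma>) = XS @ (\<sigma> ! Suc j, B) # (\<sigma> ! j, A) # YS" "length XS = j"
    using s by metis
  show "wd lf (sw j \<sigma>) = swap_seq (Suc j) (wd lf \<sigma>)"
    unfolding wd_def p by (simp add: swap_seq_append p(3))
  show "dg lf (sw j \<sigma>) = dg lf \<sigma> - cartan (entry (wd lf \<sigma>) (Suc j)) (entry (wd lf \<sigma>) (Suc j + 1))"
    unfolding wd_def dg_def p using assms p(3)
    by (simp add: asc_def dgl_swap nth_append cartan_sym)
qed

lemma dg_sorted: "sorted \<sigma> \<Longrightarrow> dg lf \<sigma> = 0"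
proof -
  have "sorted \<sigma> \<Longrightarrow> dgl (pr lf f \<sigma>) = 0" for f
  proof (induction \<sigma> arbitrary: f)
    case (Cons p \<sigma>)
    have "(\<Sum>y\<leftarrow>pr lf (f(p := Suc (f p))) \<sigma>. if fst y < p then - cartan (snd (p, lf p (f p))) (snd y) else 0)
      = (\<Sum>y\<leftarrow>pr lf (f(p := Suc (f p))) \<sigma>. 0)"
    proof (rule arg_cong[of _ _ sum_list], rule map_cong[OF refl])
      fix y assume "y \<in> set (pr lf (f(p := Suc (f p))) \<sigma>)"
      then have "fst y \<in> set (map fst (pr lf (f(p := Suc (f p))) \<sigma>))" by (simp only: set_map image_eqI)
      then have "fst y \<in> set \<sigma>" by (simp only: map_fst_pr)
      then show "(if fst y < p then - cartan (snd (p, lf p (f p))) (snd y) else 0) = 0" using Cons.prems by auto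
    qed
    then show ?case using Cons by simp
  qed simp
  then show "sorted \<sigma> \<Longrightarrow> dg lf \<sigma> = 0" by (simp add: dg_def)
qed

locale klr_span_letters = klr_span +
  fixes lf :: "nat \<Rightarrow> nat \<Rightarrow> nat"
  assumes wd_s0: "wd lf s0 = i0" and i0_seqs: "i0 \<in> seqs n \<alpha>"
begin

lemma red_wt: "red m \<sigma> p \<Longrightarrow> e \<in> E0 \<Longrightarrow> wt (wd lf \<sigma>) (p * e)"
proof (induction rule: red.induct)
  case red_0 then show ?case using E0_wt wd_s0 by simp
next
  case (red_Suc m \<sigma> p j)
  then have "wt (swap_seq (Suc j) (wd lf \<sigma>)) (T (Suc j) * (p * e))"
    using red_Suc red_length by (intro wt_T) (auto simp: asc_def)
  then show ?case using asc_letters(1)[OF red_Suc.hyps(2)] by (simp add: mult.assoc)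
qed

lemma red_homog: "red m \<sigma> p \<Longrightarrow> homog n \<alpha> (dg lf \<sigma>) (p * E i0) \<and> klr_left.wt n \<alpha> (J n \<alpha>) (wd lf \<sigma>) (p * E i0)"
proof (induction rule: red.induct)
  interpret Jm: klr_left n \<alpha> "J n \<alpha>" by (rule klr_left_J)
  case red_0
  then show ?case using homog_gens(1)[OF i0_seqs] Jm.wt_E[OF i0_seqs, of 1] wd_s0 dg_sorted[OF sorted_s0] by simp
next
  interpret Jm: klr_left n \<alpha> "J n \<alpha>" by (rule klr_left_J)
  case (red_Suc m \<sigma> p j)
  let ?u = "p * E i0" and ?i = "wd lf \<sigma>"
  have u: "homog n \<alpha> (dg lf \<sigma>) ?u" "Jm.wt ?i ?u" using red_Suc by auto
  have t: "Suc j \<in> {1..<size \<alpha>}" using red_Suc red_length by (auto simp: asc_def)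
  have i: "?i \<in> seqs n \<alpha>" "E ?i * ?u \<bumpeq>\<^bsub>J n \<alpha>\<^esub> ?u" using u(2) by (auto simp: Jm.wt_def)
  have "homog n \<alpha> (- cartan (entry ?i (Suc j)) (entry ?i (Suc j + 1)) + dg lf \<sigma>) (T (Suc j) * E ?i * ?u)"
    by (rule homog_mult[OF homog_gens(3)[OF t i(1)] u(1)])
  moreover have "T (Suc j) * E ?i * ?u - T (Suc j) * ?u \<in> J n \<alpha>"
    using Jm.eqv_mult[OF i(2), of "T (Suc j)"] by (simp add: eqv_def mult.assoc)
  ultimately have "homog n \<alpha> (dg lf (sw j \<sigma>)) (T (Suc j) * ?u)"
    using homog_cong asc_letters(2)[OF red_Suc.hyps(2), of lf] by simp
  then show ?case using Jm.wt_T[OF u(2) t] asc_letters(1)[OF red_Suc.hyps(2), of lf] by (simp add: mult.assoc)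
qed

lemma Tw_wt: "\<sigma> \<in> shufs \<Longrightarrow> e \<in> E0 \<Longrightarrow> wt (wd lf \<sigma>) (Tw \<sigma> * e)"
  using red_wt[OF red_Tw] by (simp add: shufs_def)

lemma Tw_homog: "\<sigma> \<in> shufs \<Longrightarrow> homog n \<alpha> (dg lf \<sigma>) (Tw \<sigma> * E i0)"
  using red_homog red_Tw by (auto simp: shufs_def)

end

section \<open>The KLR algebra is bounded below\<close>

text \<open>The polynomials in the dots, applied to an idempotent. All of them have degree at least
  0.\<close>

inductive_set XE :: "nat list \<Rightarrow> falg set" for i where
  XE_0: "0 \<in> XE i"
| XE_E: "E i \<in> XE i"
| XE_add: "p \<in> XE i \<Longrightarrow> q \<in> XE i \<Longrightarrow> p + q \<in> XE i"
| XE_cs: "p \<in> XE i \<Longrightarrow> cs c p \<in> XE i"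
| XE_X: "p \<in> XE i \<Longrightarrow> X k * p \<in> XE i"

inductive hge :: "nat \<Rightarrow> nat multiset \<Rightarrow> int \<Rightarrow> falg \<Rightarrow> bool" for n \<alpha> b where
  hge_homog: "homog n \<alpha> d p \<Longrightarrow> b \<le> d \<Longrightarrow> hge n \<alpha> b p"
| hge_add: "hge n \<alpha> b p \<Longrightarrow> hge n \<alpha> b q \<Longrightarrow> hge n \<alpha> b (p + q)"

lemma J_homog: "p \<in> J n \<alpha> \<Longrightarrow> homog n \<alpha> d p"
  using homog_cong[of p 0] homog_zero by auto

lemma hge_J: "p \<in> J n \<alpha> \<Longrightarrow> hge n \<alpha> b p"
  by (rule hge_homog[OF J_homog order_refl])

lemma hge_sum: "(\<And>i. i \<in> A \<Longrightarrow> hge n \<alpha> b (f i)) \<Longrightarrow> hge n \<alpha> b (sum f A)"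
  by (induction A rule: infinite_finite_induct) (auto intro: hge_add hge_homog[OF homog_zero order_refl])

lemma hge_mono: "hge n \<alpha> b p \<Longrightarrow> b' \<le> b \<Longrightarrow> hge n \<alpha> b' p"
  by (induction rule: hge.induct) (auto intro: hge.intros)

lemma hge_cs: "hge n \<alpha> b p \<Longrightarrow> hge n \<alpha> b (cs c p)"
  by (induction rule: hge.induct) (auto simp: cs.sc_add2 intro: hge.intros homog_cs)

lemma hge_mult: "homog n \<alpha> d q \<Longrightarrow> hge n \<alpha> b p \<Longrightarrow> hge n \<alpha> (d + b) (q * p)"
  by (rotate_tac, induction rule: hge.induct) (auto simp: distrib_left intro: hge.intros homog_mult)

lemma hge_cong: "p \<bumpeq>\<^bsub>J n \<alpha>\<^esub> q \<Longrightarrow> hge n \<alpha> b q \<Longrightarrow> hge n \<alpha> b p"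
  using hge_add[OF hge_J[of "p - q" n \<alpha>], of b q] by (simp add: eqv_def)

lemma hge_decomp: "hge n \<alpha> b p \<Longrightarrow>
  \<exists>D f. finite D \<and> (\<forall>d\<in>D. b \<le> d \<and> homog n \<alpha> d (f d)) \<and> p = (\<Sum>d\<in>D. f d)"
proof (induction rule: hge.induct)
  case (hge_homog d p)
  then show ?case by (intro exI[of _ "{d}"] exI[of _ "\<lambda>_. p"]) auto
next
  case (hge_add p q)
  then obtain D f D' f' where D: "finite D" "\<forall>d\<in>D. b \<le> d \<and> homog n \<alpha> d (f d)" "p = (\<Sum>d\<in>D. f d)"
    and D': "finite D'" "\<forall>d\<in>D'. b \<le> d \<and> homog n \<alpha> d (f' d)" "q = (\<Sum>d\<in>D'. f' d)" by blast
  let ?g = "\<lambda>d. (if d \<in> D then f d else 0) + (if d \<in> D' then f' d else 0)"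
  have "(\<Sum>d\<in>D \<union> D'. ?g d) = p + q"
    using D D' by (simp add: sum.distrib sum.If_cases Int_absorb1)
  then show ?case using D D' by (intro exI[of _ "D \<union> D'"] exI[of _ ?g]) (auto intro!: homog_add homog_zero)
qed

lemma klr_graded_J: "klr_graded_left n \<alpha> (J n \<alpha>)"
  by (intro klr_graded_left.intro klr_left_J klr_graded_left_axioms.intro phi_J)

text \<open>Brought to the other side, \<open>p\<close> becomes one more component, of a degree
  below all others, in a sum that is zero; components of a zero sum vanish.\<close>

lemma hge_low:
  assumes "hge n \<alpha> b p" "homog n \<alpha> d p" "d < b"
  shows "p \<in> J n \<alpha>"
proof -
  interpret klr_graded_left n \<alpha> "J n \<alpha>" by (rule klr_graded_J)
  obtain D f where D: "finite D" "\<forall>d\<in>D. b \<le> d \<and> homog n \<alpha> d (f d)" "p = (\<Sum>d\<in>D. f d)"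
    using hge_decomp[OF assms(1)] by blast
  have d: "d \<notin> D" using D(2) assms(3) by auto
  let ?g = "\<lambda>e. if e = d then - p else f e"
  have "(\<Sum>e\<in>D. ?g e) = (\<Sum>e\<in>D. f e)" by (rule sum.cong) (use d in auto)
  then have s: "(\<Sum>e\<in>insert d D. ?g e) \<in> J n \<alpha>" using d D by simp
  have "?g d \<in> J n \<alpha>"
    by (rule homog_direct[OF _ _ s]) (use D assms(2) in \<open>auto intro: homog_uminus\<close>)
  then show ?thesis using L_mult[of "- p" "-1"] by simp
qed

lemma wd_upt: "wd (\<lambda>p c. i ! p) [0..<length i] = i"
proof -
  have "map snd (pr (\<lambda>p c. i ! p) f \<sigma>) = map ((!) i) \<sigma>" for f \<sigma>
    by (induction \<sigma> arbitrary: f) auto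
  then show ?thesis by (simp add: wd_def map_nth)
qed

text \<open>For each weight the algebra is spanned by finitely many products of crossings times
  polynomials in the dots. Dots have positive degree, so the crossings give a lower bound.\<close>

theorem klr_bounded_below: "\<exists>b. \<forall>d p. homog n \<alpha> d p \<longrightarrow> d < b \<longrightarrow> p \<in> J n \<alpha>"
proof -
  interpret Jm: klr_left n \<alpha> "J n \<alpha>" by (rule klr_left_J)
  have "\<exists>b. \<forall>p. hge n \<alpha> b (p * E i)" if i: "i \<in> seqs n \<alpha>" for i
  proof -
    \<comment> \<open>Every strand has its own label, so the condition on equal labels is vacuous
      and the letter of a strand is read off from \<open>i\<close>.\<close>
    let ?s0 = "[0..<size \<alpha>]" and ?lf = "\<lambda>p c. i ! p"
    have XE: "hge n \<alpha> 0 e \<and> Jm.wt i e" if "e \<in> XE i" for e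
      using that
    proof induction
      case XE_0 then show ?case using i Jm.wt_zero hge_J Jm.zero_L by blast
    next
      case XE_E then show ?case using homog_gens(1)[OF i] Jm.wt_E[OF i, of 1] by (auto intro: hge_homog)
    next
      case (XE_X e k)
      then have e: "E i * e \<bumpeq>\<^bsub>J n \<alpha>\<^esub> e" by (auto simp: Jm.wt_def)
      have "hge n \<alpha> 0 (X k * e)"
      proof (cases "k \<in> {1..size \<alpha>}")
        case True
        have "hge n \<alpha> (2 + 0) (X k * E i * e)" by (rule hge_mult[OF homog_gens(2)[OF True i]]) (use XE_X in auto)
        then have "hge n \<alpha> 0 (X k * (E i * e))" by (auto intro: hge_mono simp: mult.assoc)
        then show ?thesis using hge_cong[OF Jm.eqv_mult[OF Jm.eqv_sym[OF e]]] by blast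
      next
        case False
        then show ?thesis by (intro hge_J Jm.X_illegal)
      qed
      then show ?case using XE_X Jm.wt_X by blast
    qed (auto intro: hge_add hge_cs Jm.wt_add Jm.wt_cs)
    interpret S: klr_span_letters n \<alpha> "J n \<alpha>" ?s0 i "XE i" ?lf
    proof
      show "wd ?lf ?s0 = i" using wd_upt[of i] seqs_length[OF i] by simp
      show "\<exists>e'\<in>XE i. X k * e \<bumpeq>\<^bsub>J n \<alpha>\<^esub> e'" if "e \<in> XE i" for e k
        using XE_X[OF that] by (intro bexI[of _ "X k * e"]) auto
    qed (use i XE in \<open>auto intro: XE.intros\<close>)
    have E: "hge n \<alpha> (dg ?lf \<sigma>) (S.Tw \<sigma> * e)" if "e \<in> XE i" "\<sigma> \<in> S.shufs" for e \<sigma>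
    proof -
      have e: "E i * e \<bumpeq>\<^bsub>J n \<alpha>\<^esub> e" using XE[OF that(1)] by (auto simp: Jm.wt_def)
      have "hge n \<alpha> (dg ?lf \<sigma> + 0) (S.Tw \<sigma> * E i * e)"
        by (rule hge_mult[OF S.Tw_homog[OF that(2)]]) (use XE[OF that(1)] in auto)
      then have "hge n \<alpha> (dg ?lf \<sigma>) (S.Tw \<sigma> * (E i * e))" by (simp add: mult.assoc)
      then show ?thesis using hge_cong[OF Jm.eqv_mult[OF Jm.eqv_sym[OF e]]] by blast
    qed
    obtain b where b: "\<And>\<sigma>. \<sigma> \<in> S.shufs \<Longrightarrow> b \<le> dg ?lf \<sigma>"
      using bdd_below_finite[OF finite_imageI[OF S.finite_shufs, of "dg ?lf"]] by (auto simp: bdd_below_def)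
    have "hge n \<alpha> b (p * E i)" for p
    proof -
      obtain \<epsilon> where \<epsilon>: "\<forall>\<sigma>. \<epsilon> \<sigma> \<in> XE i" "p * E i \<bumpeq>\<^bsub>J n \<alpha>\<^esub> (\<Sum>\<sigma>\<in>S.shufs. S.Tw \<sigma> * \<epsilon> \<sigma>)"
        using S.spanning[OF XE_E] by blast
      have "hge n \<alpha> b (\<Sum>\<sigma>\<in>S.shufs. S.Tw \<sigma> * \<epsilon> \<sigma>)"
        by (rule hge_sum) (use E \<epsilon> b in \<open>blast intro: hge_mono\<close>)
      then show ?thesis using hge_cong[OF \<epsilon>(2)] by blast
    qed
    then show ?thesis by blast
  qed
  then obtain b where b: "\<And>i p. i \<in> seqs n \<alpha> \<Longrightarrow> hge n \<alpha> (b i) (p * E i)" by metis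
  obtain c where c: "\<And>i. i \<in> seqs n \<alpha> \<Longrightarrow> c \<le> b i"
    using bdd_below_finite[OF finite_imageI[OF finite_seqs, of b n \<alpha>]] by (auto simp: bdd_below_def)
  have "hge n \<alpha> c p" for p
  proof -
    have "p \<bumpeq>\<^bsub>J n \<alpha>\<^esub> (\<Sum>i\<in>seqs n \<alpha>. p * E i)"
      using J_mult_left[OF J_rel(1), of "- p" n \<alpha>] by (simp add: algebra_simps sum_distrib_left sum_negf eqv_def)
    moreover have "hge n \<alpha> c (\<Sum>i\<in>seqs n \<alpha>. p * E i)"
      by (rule hge_sum) (use b c in \<open>blast intro: hge_mono\<close>)
    ultimately show ?thesis by (rule hge_cong)
  qed
  then show ?thesis using hge_low by blast
qed

section \<open>Generic modules\<close>

text \<open>For a list of strands with generic parameters \<open>\<zeta>\<close>, the algebra acts on the functions on the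
  orderings of the strands: \<open>x\<^sub>k\<close> is multiplication by the parameter at position \<open>k\<close>, and \<open>\<tau>\<^sub>t\<close>
  is a Demazure operator or a multiple of a transposition.\<close>

definition swl :: "nat \<Rightarrow> 'a list \<Rightarrow> 'a list" where
  "swl j xs = xs[j := xs ! Suc j, Suc j := xs ! j]"

lemma length_swl [simp]: "length (swl j xs) = length xs"
  by (simp add: swl_def)

lemma swl_nth: "Suc j < length \<sigma> \<Longrightarrow> k < length \<sigma> \<Longrightarrow>
    swl j \<sigma> ! k = (if k = j then \<sigma> ! Suc j else if k = Suc j then \<sigma> ! j else \<sigma> ! k)"
  by (auto simp: swl_def nth_list_update)

lemma swl_swl [simp]: "Suc j < length \<sigma> \<Longrightarrow> swl j (swl j \<sigma>) = \<sigma>"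
  by (rule nth_equalityI) (auto simp: swl_nth)

lemma swl_far: "Suc j < length \<sigma> \<Longrightarrow> Suc k < length \<sigma> \<Longrightarrow> j \<noteq> k \<Longrightarrow> j \<noteq> Suc k \<Longrightarrow> k \<noteq> Suc j \<Longrightarrow>
    swl j (swl k \<sigma>) = swl k (swl j \<sigma>)"
  by (rule nth_equalityI) (auto simp: swl_nth)

lemma swl_braid: "Suc (Suc j) < length \<sigma> \<Longrightarrow>
    swl (Suc j) (swl j (swl (Suc j) \<sigma>)) = swl j (swl (Suc j) (swl j \<sigma>))"
  by (rule nth_equalityI) (auto simp: swl_nth)

lemma mset_swl: "Suc j < length \<sigma> \<Longrightarrow> mset (swl j \<sigma>) = mset \<sigma>"
  by (auto simp: swl_def mset_swap)

lemma map_swl: "Suc j < length \<sigma> \<Longrightarrow> map f (swl j \<sigma>) = swap_seq (Suc j) (map f \<sigma>)"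
  by (simp add: swl_def swap_seq_def map_update)

text \<open>A strand is a letter together with a label. Denominators arise only from strands with
  equal letters, so only these need different parameters.\<close>

locale generic =
  fixes n :: nat and \<alpha> :: "nat multiset" and S0 :: "(nat \<times> nat) list" and \<zeta> :: "nat \<times> nat \<Rightarrow> complex"
  assumes dS0: "distinct S0" and wS0: "map fst S0 \<in> seqs n \<alpha>"
    and \<zeta>_inj: "x \<in> set S0 \<Longrightarrow> y \<in> set S0 \<Longrightarrow> x \<noteq> y \<Longrightarrow> fst x = fst y \<Longrightarrow> \<zeta> x \<noteq> \<zeta> y"
begin

definition valid :: "(nat \<times> nat) list \<Rightarrow> bool" where "valid \<sigma> \<longleftrightarrow> mset \<sigma> = mset S0"

lemma valid_length: "valid \<sigma> \<Longrightarrow> length \<sigma> = size \<alpha>"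
  using seqs_length[OF wS0] by (metis length_map size_mset valid_def)

lemma valid_seqs: "valid \<sigma> \<Longrightarrow> map fst \<sigma> \<in> seqs n \<alpha>"
proof -
  assume v: "valid \<sigma>"
  have "mset (map fst \<sigma>) = mset (map fst S0)" using v by (simp add: valid_def)
  moreover from this have "set (map fst \<sigma>) = set (map fst S0)" by (rule mset_eq_setD)
  ultimately show ?thesis using wS0 unfolding seqs_def by (simp only: mem_Collect_eq)
qed

lemma valid_swl: "valid \<sigma> \<Longrightarrow> Suc j < size \<alpha> \<Longrightarrow> valid (swl j \<sigma>)"
  using valid_length by (simp add: valid_def mset_swl)

lemma valid_neq: "valid \<sigma> \<Longrightarrow> i < size \<alpha> \<Longrightarrow> j < size \<alpha> \<Longrightarrow> i \<noteq> j \<Longrightarrow> fst (\<sigma> ! i) = fst (\<sigma> ! j) \<Longrightarrow> \<zeta> (\<sigma> ! i) \<noteq> \<zeta> (\<sigma> ! j)"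
proof -
  assume v: "valid \<sigma>" and h: "i < size \<alpha>" "j < size \<alpha>" "i \<noteq> j" "fst (\<sigma> ! i) = fst (\<sigma> ! j)"
  have s: "set \<sigma> = set S0" "distinct \<sigma>"
    using v dS0 by (auto simp: valid_def dest: mset_eq_setD mset_eq_imp_distinct_iff)
  then have "\<sigma> ! i \<noteq> \<sigma> ! j" using h valid_length[OF v] by (simp add: nth_eq_iff_index_eq)
  then show ?thesis using \<zeta>_inj s(1) h valid_length[OF v] nth_mem by metis
qed

text \<open>For equal letters \<open>cA\<close> and \<open>cB\<close> coincide and change sign
  together, so that the operator squares to zero. For neighbouring letters the factor
  \<open>\<zeta> a + \<zeta> b\<close> of the quadratic relation is put entirely on one of the two
  orders; in all other cases strands are simply exchanged.\<close>

definition cA :: "nat \<times> nat \<Rightarrow> nat \<times> nat \<Rightarrow> complex" where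
  "cA a b = (if fst a = fst b then 1 / (\<zeta> a - \<zeta> b) else if fst a = Suc (fst b) then \<zeta> a + \<zeta> b else 1)"

definition cB :: "nat \<times> nat \<Rightarrow> nat \<times> nat \<Rightarrow> complex" where
  "cB a b = (if fst a = fst b then 1 / (\<zeta> a - \<zeta> b) else 0)"

definition opT :: "nat \<Rightarrow> ((nat \<times> nat) list \<Rightarrow> complex) \<Rightarrow> (nat \<times> nat) list \<Rightarrow> complex" where
  "opT j f \<sigma> = cA (\<sigma> ! j) (\<sigma> ! Suc j) * f (swl j \<sigma>) + cB (\<sigma> ! j) (\<sigma> ! Suc j) * f \<sigma>"

text \<open>Generators outside \<open>klr_gens\<close> act by 0, in agreement with the extension
  \<open>J\<close> of the ideal.\<close>

definition act :: "klr_gen \<Rightarrow> ((nat \<times> nat) list \<Rightarrow> complex) \<Rightarrow> (nat \<times> nat) list \<Rightarrow> complex" where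
  "act g f = (\<lambda>\<sigma>. if valid \<sigma> \<and> g \<in> klr_gens n \<alpha> then
     (case g of Gidem i \<Rightarrow> if map fst \<sigma> = i then f \<sigma> else 0
      | Gx k \<Rightarrow> \<zeta> (\<sigma> ! (k - 1)) * f \<sigma> | Gtau t \<Rightarrow> opT (t - 1) f \<sigma>) else 0)"

lemma act_linear: "act g (\<lambda>\<sigma>. c * f \<sigma> + h \<sigma>) = (\<lambda>\<sigma>. c * act g f \<sigma> + act g h \<sigma>)"
  by (rule ext) (auto simp: act_def opT_def algebra_simps split: klr_gen.split)

lemma acts_linear: "foldr act w (\<lambda>\<sigma>. c * f \<sigma> + h \<sigma>) = (\<lambda>\<sigma>. c * foldr act w f \<sigma> + foldr act w h \<sigma>)"
  by (induction w) (simp_all add: act_linear)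

definition rep :: "falg \<Rightarrow> ((nat \<times> nat) list \<Rightarrow> complex) \<Rightarrow> (nat \<times> nat) list \<Rightarrow> complex" where
  "rep p f = (\<lambda>\<sigma>. linext (*) (\<lambda>w. foldr act w f \<sigma>) p)"

lemma rep_add: "rep (p + q) f = (\<lambda>\<sigma>. rep p f \<sigma> + rep q f \<sigma>)"
  by (simp add: rep_def cm.linext_add)

lemma rep_diff: "rep (p - q) f = (\<lambda>\<sigma>. rep p f \<sigma> - rep q f \<sigma>)"
  by (simp add: rep_def cm.linext_minus)

lemma rep_cmon: "rep (cmon c w) f = (\<lambda>\<sigma>. c * foldr act w f \<sigma>)"
  by (simp add: rep_def)

lemma rep_zero: "rep 0 f = (\<lambda>\<sigma>. 0)"
  by (simp add: rep_def)

lemma rep_uminus: "rep (- q) f = (\<lambda>\<sigma>. - rep q f \<sigma>)"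
  using rep_diff[of 0 q f] by (simp add: rep_zero)

lemma rep_sum: "rep (sum p A) f = (\<lambda>\<sigma>. \<Sum>i\<in>A. rep (p i) f \<sigma>)"
  by (induction A rule: infinite_finite_induct) (simp_all add: rep_add rep_zero)

lemma rep_mult: "rep (p * q) f = rep p (rep q f)"
proof (induction p rule: poly_mapping_linear_induct)
  case (single u a)
  show ?case
  proof (induction q rule: poly_mapping_linear_induct)
    case (single v b)
    have "foldr act u (\<lambda>_. 0) = (\<lambda>_. 0)"
      using acts_linear[of u "-1" "\<lambda>_. 0" "\<lambda>_. 0"] by (simp add: fun_eq_iff)
    then show ?case using acts_linear[of u b "foldr act v f" "\<lambda>_. 0"]
      by (simp add: rep_cmon cmon_mult mult.assoc)
  next
    case (add p q)
    then show ?case using acts_linear[where w = u and c = 1 and f = "rep p f" and h = "rep q f"]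
      by (simp add: rep_add rep_cmon distrib_left)
  qed
qed (simp add: distrib_right rep_add)

lemma rep_one: "rep 1 f = f"
  using rep_cmon[where c = 1 and w = "[]" and f = f] by (simp add: cmon_one)

lemma rep_gg: "rep (gg g) f = act g f"
  by (simp add: rep_cmon)

lemma rep_cs: "rep (cs c p) f = (\<lambda>\<sigma>. c * rep p f \<sigma>)"
  by (simp add: cs_def rep_mult) (simp add: rep_cmon)

text \<open>On functions with other support the relation between the unit and the idempotents would
  fail, as the idempotents cut off everything outside the valid orderings.\<close>

definition supp :: "((nat \<times> nat) list \<Rightarrow> complex) \<Rightarrow> bool" where
  "supp f \<longleftrightarrow> (\<forall>\<sigma>. \<not> valid \<sigma> \<longrightarrow> f \<sigma> = 0)"

lemma supp_act: "supp (act g f)"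
  by (simp add: supp_def act_def)

lemma supp_rep: "supp f \<Longrightarrow> supp (rep p f)"
proof (induction p rule: poly_mapping_linear_induct)
  case (single u a)
  have "supp f \<Longrightarrow> supp (foldr act u f)" by (cases u) (simp_all add: supp_act)
  then show ?case using single by (simp add: supp_def rep_cmon)
next
  case (add p q)
  then show ?case by (simp add: supp_def rep_add)
qed

lemma act_E: "i \<in> seqs n \<alpha> \<Longrightarrow> valid \<sigma> \<Longrightarrow> act (Gidem i) f \<sigma> = (if map fst \<sigma> = i then f \<sigma> else 0)"
  by (simp add: act_def gens_memb)

lemma act_X: "k \<in> {1..size \<alpha>} \<Longrightarrow> valid \<sigma> \<Longrightarrow> act (Gx k) f \<sigma> = \<zeta> (\<sigma> ! (k - 1)) * f \<sigma>"
  by (simp add: act_def gens_memb)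

lemma act_T: "Suc j < size \<alpha> \<Longrightarrow> valid \<sigma> \<Longrightarrow> act (Gtau (Suc j)) f \<sigma> = opT j f \<sigma>"
  by (simp add: act_def gens_memb)

lemma op_quad:
  assumes "Suc j < size \<alpha>" "valid \<sigma>"
  shows "act (Gtau (Suc j)) (act (Gtau (Suc j)) f) \<sigma> =
    (let a = \<sigma> ! j; b = \<sigma> ! Suc j in if fst a = fst b then 0 else if \<not> adj (fst a) (fst b) then f \<sigma> else (\<zeta> a + \<zeta> b) * f \<sigma>)"
proof -
  have l: "length \<sigma> = size \<alpha>" using valid_length assms by blast
  note ne = valid_neq[OF assms(2), of j "Suc j"]
  let ?a = "\<sigma> ! j" and ?b = "\<sigma> ! Suc j"
  have e: "act (Gtau (Suc j)) (act (Gtau (Suc j)) f) \<sigma> =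
    cA ?a ?b * (cA ?b ?a * f \<sigma> + cB ?b ?a * f (swl j \<sigma>)) + cB ?a ?b * (cA ?a ?b * f (swl j \<sigma>) + cB ?a ?b * f \<sigma>)"
    using assms l valid_swl by (simp add: act_T opT_def swl_nth)
  show ?thesis
  proof (cases "fst ?a = fst ?b")
    case True
    define u where "u = 1 / (\<zeta> ?a - \<zeta> ?b)"
    have "1 / (\<zeta> ?b - \<zeta> ?a) = - u" unfolding u_def by (metis minus_diff_eq minus_divide_right)
    then have "cA ?a ?b = u" "cB ?a ?b = u" "cA ?b ?a = - u" "cB ?b ?a = - u"
      using True by (simp_all add: cA_def cB_def u_def)
    then show ?thesis unfolding e using True by (simp add: algebra_simps)
  next
    case False
    then show ?thesis unfolding e by (auto simp: cA_def cB_def Let_def adj_def algebra_simps)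
  qed
qed

lemma op_far:
  assumes "Suc j < size \<alpha>" "Suc k < size \<alpha>" "valid \<sigma>" "j \<noteq> k" "j \<noteq> Suc k" "k \<noteq> Suc j"
  shows "act (Gtau (Suc j)) (act (Gtau (Suc k)) f) \<sigma> = act (Gtau (Suc k)) (act (Gtau (Suc j)) f) \<sigma>"
proof -
  have l: "length \<sigma> = size \<alpha>" using valid_length assms by blast
  show ?thesis
    using assms l valid_swl swl_far[of j \<sigma> k]
    by (simp add: act_T opT_def swl_nth algebra_simps)
qed

text \<open>The six values of \<open>f\<close> on the reorderings of three strands are treated as
  unknowns, and their coefficients are compared for each pattern of equal letters.\<close>

lemma op_braid:
  assumes "Suc (Suc j) < size \<alpha>" "valid \<sigma>"
  shows "act (Gtau (Suc j)) (act (Gtau (Suc (Suc j))) (act (Gtau (Suc j)) f)) \<sigma> =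
    act (Gtau (Suc (Suc j))) (act (Gtau (Suc j)) (act (Gtau (Suc (Suc j))) f)) \<sigma> +
    (if fst (\<sigma> ! j) = fst (\<sigma> ! Suc (Suc j)) \<and> adj (fst (\<sigma> ! j)) (fst (\<sigma> ! Suc j)) then f \<sigma> else 0)"
proof -
  have l: "length \<sigma> = size \<alpha>" using valid_length assms by blast
  define a b c where abc: "a = \<sigma> ! j" "b = \<sigma> ! Suc j" "c = \<sigma> ! Suc (Suc j)"
  have ne: "fst a = fst b \<Longrightarrow> \<zeta> a \<noteq> \<zeta> b" "fst b = fst c \<Longrightarrow> \<zeta> b \<noteq> \<zeta> c" "fst a = fst c \<Longrightarrow> \<zeta> a \<noteq> \<zeta> c"
    using valid_neq[OF assms(2)] assms(1) unfolding abc by simp_all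
  define F1 F2 F3 F4 F5 F6 where F: "F1 = f \<sigma>" "F2 = f (swl j \<sigma>)" "F3 = f (swl (Suc j) \<sigma>)"
    "F4 = f (swl j (swl (Suc j) \<sigma>))" "F5 = f (swl (Suc j) (swl j \<sigma>))" "F6 = f (swl j (swl (Suc j) (swl j \<sigma>)))"
  have e1: "act (Gtau (Suc j)) (act (Gtau (Suc (Suc j))) (act (Gtau (Suc j)) f)) \<sigma> =
    cA a b * (cA a c * (cA b c * F6 + cB b c * F5) + cB a c * (cA b a * F1 + cB b a * F2)) +
    cB a b * (cA b c * (cA a c * F4 + cB a c * F3) + cB b c * (cA a b * F2 + cB a b * F1))"
    using assms l valid_swl by (simp add: act_T opT_def swl_nth abc F)
  have e2: "act (Gtau (Suc (Suc j))) (act (Gtau (Suc j)) (act (Gtau (Suc (Suc j))) f)) \<sigma> =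
    cA b c * (cA a c * (cA a b * F6 + cB a b * F4) + cB a c * (cA c b * F1 + cB c b * F3)) +
    cB b c * (cA a b * (cA a c * F5 + cB a c * F2) + cB a b * (cA b c * F3 + cB b c * F1))"
    using assms l valid_swl by (simp add: act_T opT_def swl_nth abc F swl_braid)
  have "cA a b * (cA a c * (cA b c * F6 + cB b c * F5) + cB a c * (cA b a * F1 + cB b a * F2)) +
    cB a b * (cA b c * (cA a c * F4 + cB a c * F3) + cB b c * (cA a b * F2 + cB a b * F1)) =
    cA b c * (cA a c * (cA a b * F6 + cB a b * F4) + cB a c * (cA c b * F1 + cB c b * F3)) +
    cB b c * (cA a b * (cA a c * F5 + cB a c * F2) + cB a b * (cA b c * F3 + cB b c * F1)) +
    (if fst a = fst c \<and> adj (fst a) (fst b) then F1 else 0)"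
  proof -
    consider "fst a = fst b" "fst b = fst c" | "fst a = fst b" "fst b \<noteq> fst c" | "fst a = fst c" "fst b \<noteq> fst c"
      | "fst b = fst c" "fst a \<noteq> fst b" | "fst a \<noteq> fst b" "fst a \<noteq> fst c" "fst b \<noteq> fst c" by metis
    then show ?thesis
    proof cases
      case 1
      define u v w where u: "u = 1 / (\<zeta> a - \<zeta> b)" "v = 1 / (\<zeta> b - \<zeta> c)" "w = 1 / (\<zeta> a - \<zeta> c)"
      have "\<zeta> a - \<zeta> b \<noteq> 0" "\<zeta> b - \<zeta> c \<noteq> 0" "\<zeta> a - \<zeta> c \<noteq> 0" using ne 1 by auto
      \<comment> \<open>The partial fraction identity for the three differences of parameters; the
        difference of both sides of the braid relation is a multiple of it.\<close>
      then have uvw: "u * v = w * (u + v)"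
        unfolding u by (simp add: divide_simps)
      have m: "1 / (\<zeta> b - \<zeta> a) = - u" "1 / (\<zeta> c - \<zeta> b) = - v" "1 / (\<zeta> c - \<zeta> a) = - w"
        unfolding u by (metis minus_diff_eq minus_divide_right)+
      have c: "cA a b = u" "cB a b = u" "cA b c = v" "cB b c = v" "cA a c = w" "cB a c = w"
        "cA b a = - u" "cB b a = - u" "cA c b = - v" "cB c b = - v"
        using 1 by (simp_all add: cA_def cB_def m flip: u)
      have "\<not> adj (fst a) (fst b)" using 1 by (simp add: adj_def)
      have "u * (w * (v * F6 + v * F5) + w * (- u * F1 + - u * F2)) + u * (v * (w * F4 + w * F3) + v * (u * F2 + u * F1)) -
          (v * (w * (u * F6 + u * F4) + w * (- v * F1 + - v * F3)) + v * (u * (w * F5 + w * F2) + u * (v * F3 + v * F1))) =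
          (u * v - w * (u + v)) * ((u - v) * F1 + u * F2 - v * F3)"
        by (simp add: algebra_simps)
      also have "\<dots> = 0" using uvw by simp
      finally show ?thesis using \<open>\<not> adj _ _\<close> unfolding c by simp
    next
      case 2
      then have "cB a c = 0" "cB b c = 0" "cA a b = cB a b" "\<not> adj (fst a) (fst b)"
        by (auto simp: cB_def cA_def adj_def)
      then show ?thesis by (simp add: algebra_simps)
    next
      case 3
      define w where "w = 1 / (\<zeta> a - \<zeta> c)"
      have "\<zeta> a - \<zeta> c \<noteq> 0" using ne 3 by simp
      then have "w * (\<zeta> a - \<zeta> c) = 1" by (simp add: w_def)
      then have w: "w * \<zeta> a = 1 + w * \<zeta> c" by (simp add: algebra_simps)
      have c: "cA a c = w" "cB a c = w" "cB a b = 0" "cB b c = 0" "cB b a = 0" "cB c b = 0"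
        using 3 by (auto simp: cA_def cB_def w_def)
      \<comment> \<open>The origin of the error term: for letters next to each other the bracket is
        \<open>\<zeta> a + \<zeta> b\<close> minus \<open>\<zeta> b + \<zeta> c\<close>, which
        cancels against the denominator of \<open>w\<close>.\<close>
      have d: "w * (cA a b * cA b a) - w * (cA b c * cA c b) = (if adj (fst a) (fst b) then 1 else 0)"
        using 3 by (auto simp: cA_def adj_def algebra_simps w)
      have "w * (cA a b * cA b a) * F1 = (w * (cA b c * cA c b) + (if adj (fst a) (fst b) then 1 else 0)) * F1"
        using d by (simp add: algebra_simps)
      then show ?thesis using 3 unfolding c by (cases "adj (fst a) (fst b)") (simp_all add: algebra_simps)
    next
      case 4
      then have "cB a c = 0" "cB a b = 0" "cA b c = cB b c" "fst a \<noteq> fst c"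
        by (auto simp: cB_def cA_def adj_def)
      then show ?thesis by (simp add: algebra_simps)
    next
      case 5
      then have "cB a c = 0" "cB a b = 0" "cB b c = 0"
        by (auto simp: cB_def)
      then show ?thesis using 5 by (simp add: algebra_simps)
    qed
  qed
  then show ?thesis unfolding e1 e2 by (simp only: abc F(1))
qed

lemma op_TX:
  assumes "Suc j < size \<alpha>" "valid \<sigma>" "k \<in> {1..size \<alpha>}"
  shows "act (Gtau (Suc j)) (act (Gx k) f) \<sigma> =
    act (Gx (if k = Suc j then Suc j + 1 else if k = Suc j + 1 then Suc j else k)) (act (Gtau (Suc j)) f) \<sigma> +
    (if k = Suc j \<and> fst (\<sigma> ! j) = fst (\<sigma> ! Suc j) then f \<sigma> else if k = Suc j + 1 \<and> fst (\<sigma> ! j) = fst (\<sigma> ! Suc j) then - f \<sigma> else 0)"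
proof -
  have l: "length \<sigma> = size \<alpha>" using valid_length assms by blast
  note ne = valid_neq[OF assms(2), of j "Suc j"]
  consider "k = Suc j" | "k = Suc (Suc j)" | "k \<noteq> Suc j" "k \<noteq> Suc (Suc j)" by blast
  then show ?thesis
  proof cases
    case 3
    then have "k - 1 \<noteq> j" "k - 1 \<noteq> Suc j" "k - 1 < length \<sigma>" using assms l by auto
    then have "swl j \<sigma> ! (k - 1) = \<sigma> ! (k - 1)" using assms(1) l by (simp add: swl_nth)
    then show ?thesis using 3 assms l valid_swl by (simp add: act_T act_X opT_def algebra_simps)
  qed (use assms l valid_swl ne in \<open>auto simp: act_T act_X opT_def swl_nth cA_def cB_def field_simps\<close>)
qed

lemma act_E_entry: "supp f \<Longrightarrow> i \<in> seqs n \<alpha> \<Longrightarrow> act (Gidem i) f \<sigma> \<noteq> 0 \<Longrightarrow> valid \<sigma> \<and> map fst \<sigma> = i"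
  by (auto simp: act_def split: if_splits)

lemma rep_rel:
  assumes "p \<in> klr_rels n \<alpha>" "supp f"
  shows "rep p f = (\<lambda>\<sigma>. 0)"
proof
  fix \<sigma>
  show "rep p f \<sigma> = 0"
  proof (cases "valid \<sigma>")
    case False
    then show ?thesis using supp_rep[OF assms(2)] by (simp add: supp_def)
  next
    case v: True
    have l: "length \<sigma> = size \<alpha>" using valid_length[OF v] .
    note R = rep_add rep_diff rep_mult rep_one rep_gg rep_zero rep_uminus
    show ?thesis
      using assms(1)
    proof (induct rule: klr_rels_cases)
      case unit
      have "(\<Sum>i\<in>seqs n \<alpha>. act (Gidem i) f \<sigma>) = (\<Sum>i\<in>seqs n \<alpha>. if i = map fst \<sigma> then f \<sigma> else 0)"
        by (rule sum.cong) (auto simp: act_E v)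
      also have "\<dots> = f \<sigma>" using valid_seqs[OF v] by simp
      finally show ?case by (simp add: R rep_sum)
    next
      case (idem i j)
      then show ?case using v by (auto simp: R act_E)
    next
      case (xidem k i)
      then show ?case using v by (auto simp: R act_E act_X)
    next
      case (tauidem t i)
      then obtain j where j: "t = Suc j" "Suc j < size \<alpha>" by (cases t) auto
      have si: "swap_seq t i \<in> seqs n \<alpha>" using tauidem seqs_length[OF tauidem(2)] by (auto intro: swap_seq_in_seqs)
      have li: "length i = size \<alpha>" using seqs_length[OF tauidem(2)] .
      have e: "map fst (swl j \<sigma>) = i \<longleftrightarrow> map fst \<sigma> = swap_seq t i"
        using j l li map_swl[of j \<sigma> fst] swap_swap[of t i] swap_swap[of t "map fst \<sigma>"] by auto
      have B: "map fst (swl j \<sigma>) = map fst \<sigma>" if "cB (\<sigma> ! j) (\<sigma> ! Suc j) \<noteq> 0"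
      proof -
        from that have "fst (\<sigma> ! j) = fst (\<sigma> ! Suc j)" by (metis cB_def)
        then show ?thesis using j l by (intro nth_equalityI) (auto simp: swl_nth)
      qed
      have B2: "cB (\<sigma> ! j) (\<sigma> ! Suc j) * (if map fst \<sigma> = i then f \<sigma> else 0) =
          (if map fst \<sigma> = swap_seq t i then cB (\<sigma> ! j) (\<sigma> ! Suc j) * f \<sigma> else 0)"
        using B e by (cases "cB (\<sigma> ! j) (\<sigma> ! Suc j) = 0") simp_all
      have "act (Gtau t) (act (Gidem i) f) \<sigma> = cA (\<sigma> ! j) (\<sigma> ! Suc j) * (if map fst \<sigma> = swap_seq t i then f (swl j \<sigma>) else 0)
        + cB (\<sigma> ! j) (\<sigma> ! Suc j) * (if map fst \<sigma> = i then f \<sigma> else 0)"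
        using j v valid_swl[OF v] tauidem by (simp add: act_E act_T opT_def e)
      also have "\<dots> = act (Gidem (swap_seq t i)) (act (Gtau t) f) \<sigma>"
        unfolding B2 using j v si by (simp add: act_E act_T opT_def)
      finally show ?case by (simp add: R)
    next
      case (xx k l)
      then show ?case using v by (simp add: R act_X)
    next
      case (tautau t s)
      then obtain j k where "t = Suc j" "s = Suc k" by (cases t; cases s) auto
      then show ?case using tautau op_far[of j k \<sigma> f] v by (auto simp: R)
    next
      case (quad t i)
      then obtain j where j: "t = Suc j" "Suc j < size \<alpha>" by (cases t) auto
      note q = op_quad[OF j(2) v, of "act (Gidem i) f"]
      \<comment> \<open>Either the idempotent annihilates the value at \<open>\<sigma>\<close>, or
        \<open>\<sigma>\<close> has the word \<open>i\<close>, and the conditions on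
        \<open>i\<close> become conditions on the letters of \<open>\<sigma>\<close>.\<close>
      show ?case
      proof (cases "act (Gidem i) f \<sigma> = 0")
        case True
        then show ?thesis using q v quad j by (auto simp: R Let_def act_X)
      next
        case False
        then have "map fst \<sigma> = i" using act_E_entry[OF assms(2) quad(2)] by blast
        then have "i ! j = fst (\<sigma> ! j)" "i ! Suc j = fst (\<sigma> ! Suc j)" using j l by auto
        then show ?thesis using q v quad j by (auto simp: R Let_def act_X algebra_simps)
      qed
    next
      case (braid t i)
      then obtain j where j: "t = Suc j" "Suc (Suc j) < size \<alpha>" by (cases t) auto
      note q = op_braid[OF j(2) v, of "act (Gidem i) f"]
      show ?case
      proof (cases "act (Gidem i) f \<sigma> = 0")
        case True
        then show ?thesis using q v braid j by (auto simp: R)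
      next
        case False
        then have "map fst \<sigma> = i" using act_E_entry[OF assms(2) braid(3)] by blast
        then have "i ! j = fst (\<sigma> ! j)" "i ! Suc j = fst (\<sigma> ! Suc j)" "i ! Suc (Suc j) = fst (\<sigma> ! Suc (Suc j))"
          using j l by auto
        then show ?thesis using q v braid j by (auto simp: R)
      qed
    next
      case (taux t k i)
      then obtain j where j: "t = Suc j" "Suc j < size \<alpha>" by (cases t) auto
      note q = op_TX[OF j(2) v taux(2), of "act (Gidem i) f"]
      show ?case
      proof (cases "act (Gidem i) f \<sigma> = 0")
        case True
        then show ?thesis using q v taux j by (auto simp: R)
      next
        case False
        then have "map fst \<sigma> = i" using act_E_entry[OF assms(2) taux(3)] by blast
        then have "i ! j = fst (\<sigma> ! j)" "i ! Suc j = fst (\<sigma> ! Suc j)" using j l by auto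
        then show ?thesis using q v taux j by (auto simp: R)
      qed
    qed
  qed
qed

lemma rep_J: "p \<in> J n \<alpha> \<Longrightarrow> supp f \<Longrightarrow> rep p f = (\<lambda>\<sigma>. 0)"
proof -
  have z: "rep q (\<lambda>\<sigma>. 0) = (\<lambda>\<sigma>. 0)" for q
    using rep_mult[of q 0 "\<lambda>_. 0"] by (simp add: rep_zero)
  have "J n \<alpha> \<subseteq> {p. \<forall>f. supp f \<longrightarrow> rep p f = (\<lambda>\<sigma>. 0)}"
  proof (rule J_minimal)
    show "add_sg {p. \<forall>f. supp f \<longrightarrow> rep p f = (\<lambda>\<sigma>. 0)}"
      by (auto simp: add_sg_def rep_zero rep_diff)
    show "klr_rels n \<alpha> \<subseteq> {p. \<forall>f. supp f \<longrightarrow> rep p f = (\<lambda>\<sigma>. 0)}" using rep_rel by blast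
  qed (auto simp: rep_mult z supp_rep rep_gg act_def)
  then show "p \<in> J n \<alpha> \<Longrightarrow> supp f \<Longrightarrow> ?thesis" by blast
qed

end

section \<open>The left ideal of a product of segment modules\<close>

text \<open>The expected annihilator of the cyclic vector. Labels number the segments, so equal
  labels at neighbouring places mark the crossings inside a segment.\<close>

inductive_set lideal :: "nat \<Rightarrow> nat multiset \<Rightarrow> nat list \<Rightarrow> nat list \<Rightarrow> falg set" for n \<alpha> i0 s0 where
  li_J: "p \<in> J n \<alpha> \<Longrightarrow> p \<in> lideal n \<alpha> i0 s0"
| li_add: "p \<in> lideal n \<alpha> i0 s0 \<Longrightarrow> q \<in> lideal n \<alpha> i0 s0 \<Longrightarrow> p + q \<in> lideal n \<alpha> i0 s0"
| li_mult: "p \<in> lideal n \<alpha> i0 s0 \<Longrightarrow> q * p \<in> lideal n \<alpha> i0 s0"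
| li_idem: "E i0 - 1 \<in> lideal n \<alpha> i0 s0"
| li_X: "X k * E i0 \<in> lideal n \<alpha> i0 s0"
| li_T: "Suc j < size \<alpha> \<Longrightarrow> s0 ! j = s0 ! Suc j \<Longrightarrow> T (Suc j) * E i0 \<in> lideal n \<alpha> i0 s0"

lemma pr_nth: "j < length \<sigma> \<Longrightarrow>
    pr lf f \<sigma> ! j = (\<sigma> ! j, lf (\<sigma> ! j) (f (\<sigma> ! j) + count_list (take j \<sigma>) (\<sigma> ! j)))"
proof (induction \<sigma> arbitrary: f j)
  case (Cons p \<sigma>)
  then show ?case by (cases j) auto
qed simp

lemma wd_nth: "j < length \<sigma> \<Longrightarrow> wd lf \<sigma> ! j = lf (\<sigma> ! j) (count_list (take j \<sigma>) (\<sigma> ! j))"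
  by (simp add: wd_def pr_nth)

locale segments =
  fixes n :: nat and \<alpha> :: "nat multiset" and i0 s0 :: "nat list" and lf :: "nat \<Rightarrow> nat \<Rightarrow> nat"
  assumes i0_seqs: "i0 \<in> seqs n \<alpha>" and sorted_s0: "sorted s0" and length_s0: "length s0 = size \<alpha>"
    and wd_s0: "wd lf s0 = i0" and lf_Suc: "lf p (Suc c) = Suc (lf p c)"
begin

abbreviation "L \<equiv> lideal n \<alpha> i0 s0"

lemma lf_less: "c < d \<Longrightarrow> lf p c < lf p d"
  by (induction d) (auto simp: lf_Suc less_Suc_eq)

lemma same_label_letters: "Suc j < size \<alpha> \<Longrightarrow> s0 ! j = s0 ! Suc j \<Longrightarrow> i0 ! Suc j = Suc (i0 ! j)"
  using wd_nth[of j s0 lf] wd_nth[of "Suc j" s0 lf] length_s0 lf_Suc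
  by (simp add: wd_s0 take_Suc_conv_app_nth)

text \<open>Letters strictly increase along a segment, so a letter occurs at most once with a given
  label.\<close>

lemma distinct_strands: "distinct (zip i0 s0)"
proof -
  have "(i0 ! i, s0 ! i) \<noteq> (i0 ! j, s0 ! j)" if "i < j" "j < size \<alpha>" for i j
  proof
    assume a: "(i0 ! i, s0 ! i) = (i0 ! j, s0 ! j)"
    let ?p = "s0 ! i"
    have "take j s0 = take (Suc i) s0 @ take (j - Suc i) (drop (Suc i) s0)"
      using that(1) by (metis Suc_leI le_add_diff_inverse take_add)
    then have "count_list (take i s0) ?p < count_list (take j s0) ?p"
      using that length_s0 by (simp add: take_Suc_conv_app_nth)
    from lf_less[OF this, of ?p] show False
      using a wd_nth[of i s0 lf] wd_nth[of j s0 lf] that length_s0 by (simp add: wd_s0)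
  qed
  then have "(i0 ! i, s0 ! i) \<noteq> (i0 ! j, s0 ! j)" if "i \<noteq> j" "i < size \<alpha>" "j < size \<alpha>" for i j
    using that by (metis linorder_neqE_nat)
  then show ?thesis using seqs_length[OF i0_seqs] length_s0
    by (simp add: distinct_conv_nth)
qed

lemma klr_left_L: "klr_left n \<alpha> L"
proof
  have "- p \<in> L" if "p \<in> L" for p using li_mult[OF that, of "-1"] by simp
  then have "p - q \<in> L" if "p \<in> L" "q \<in> L" for p q
    using li_add[of p n \<alpha> i0 s0 "- q"] that by simp
  then show "add_sg L" using li_J[OF add_sg_0[OF add_sg_J]] by (simp add: add_sg_def)
qed (auto intro: li_J li_mult)

text \<open>The generators of the left ideal are eigenvectors of the torus action, up to elements of
  the ideal.\<close>

lemma klr_graded_L: "klr_graded_left n \<alpha> L"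
proof (intro klr_graded_left.intro klr_left_L klr_graded_left_axioms.intro)
  interpret klr_left n \<alpha> L by (rule klr_left_L)
  interpret Jm: klr_left n \<alpha> "J n \<alpha>" by (rule klr_left_J)
  fix p assume "p \<in> L"
  then show "phi n \<alpha> p \<in> L"
  proof induction
    case (li_J p) then show ?case using phi_J J_sub_L by blast
  next
    case (li_add p q) then show ?case by (simp add: lideal.li_add)
  next
    case (li_mult p q) then show ?case by (simp add: lideal.li_mult)
  next
    case li_idem then show ?case by (simp add: lideal.li_idem)
  next
    case (li_X k)
    then show ?case using L_cs[OF lideal.li_X, of 4] by (simp add: cs_mult_left)
  next
    case (li_T j)
    have "phi n \<alpha> (T (Suc j)) * E i0 \<bumpeq>\<^bsub>J n \<alpha>\<^esub> cs (zf (entry i0 (Suc j)) (entry i0 (Suc j + 1))) (T (Suc j) * E i0)"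
      using Jm.phi_T[OF Jm.wt_E[OF i0_seqs, of 1], of "Suc j"] by (simp only: mult_1_right)
    then have e: "phi n \<alpha> (T (Suc j)) * E i0 \<bumpeq>\<^bsub>L\<^esub> cs (zf (entry i0 (Suc j)) (entry i0 (Suc j + 1))) (T (Suc j) * E i0)"
      unfolding eqv_def using J_sub_L by blast
    show ?case using L_cong[OF e] L_cs[OF lideal.li_T[OF li_T]] by simp
  qed
qed

sublocale klr_graded_left n \<alpha> L by (rule klr_graded_L)

lemma wt_one: "wt i0 1"
  using li_idem[of i0 n \<alpha> s0] i0_seqs by (simp add: wt_def eqv_def)

lemma X_one: "X k \<in> L"
proof -
  have "X k * (E i0 * 1) \<bumpeq>\<^bsub>L\<^esub> X k * 1" using wt_one by (intro eqv_mult) (simp add: wt_def)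
  then show ?thesis using L_cong[of "X k * E i0" "X k"] lideal.li_X[of k i0 n \<alpha> s0] by simp
qed

lemma T_one: "Suc j < size \<alpha> \<Longrightarrow> s0 ! j = s0 ! Suc j \<Longrightarrow> T (Suc j) \<in> L"
proof -
  assume a: "Suc j < size \<alpha>" "s0 ! j = s0 ! Suc j"
  have "T (Suc j) * (E i0 * 1) \<bumpeq>\<^bsub>L\<^esub> T (Suc j) * 1" using wt_one by (intro eqv_mult) (simp add: wt_def)
  then show ?thesis using L_cong[of "T (Suc j) * E i0" "T (Suc j)"] lideal.li_T[OF a, of i0 n] by simp
qed

text \<open>The initial vectors are the multiples of the cyclic vector; dots and crossings inside a
  segment send them to zero.\<close>

sublocale span: klr_span_letters n \<alpha> L s0 i0 "range (\<lambda>c. cs c 1)" lf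
proof
  show "\<exists>e'\<in>range (\<lambda>c. cs c 1). X k * e \<bumpeq>\<^bsub>L\<^esub> e'" if "e \<in> range (\<lambda>c. cs c 1)" for e k
    using that L_cs[OF X_one] by (intro bexI[of _ 0]) (auto simp: cs_mult_right intro: image_eqI[of _ _ 0] simp: cs.sc_zero)
  show "e + e' \<in> range (\<lambda>c. cs c 1)" if "e \<in> range (\<lambda>c. cs c 1)" "e' \<in> range (\<lambda>c. cs c 1)" for e e'
    using that by (auto simp flip: cs.sc_add)
  show "wt i0 e" if "e \<in> range (\<lambda>c. cs c 1)" for e using that wt_cs[OF wt_one] by blast
  show "0 \<in> range (\<lambda>c. cs c 1)" by (auto intro: image_eqI[of _ _ 0] simp: cs.sc_zero)
  show "T (Suc j) * e \<in> L" if "e \<in> range (\<lambda>c. cs c 1)" "Suc j < size \<alpha>" "s0 ! j = s0 ! Suc j" for e j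
    using that L_cs[OF T_one] by (auto simp: cs_mult_right)
qed (use sorted_s0 length_s0 wd_s0 i0_seqs in \<open>auto simp: cs.sc_mult\<close>)

text \<open>The sign alternates with the letter, so neighbouring letters of one segment have
  parameters with sum 0. The absolute value depends on the label, so equal letters in different
  segments have different parameters.\<close>

definition \<zeta> :: "nat \<times> nat \<Rightarrow> complex" where
  "\<zeta> x = (- 1) ^ fst x * of_nat (Suc (snd x))"

sublocale generic n \<alpha> "zip i0 s0" \<zeta>
proof
  show "map fst (zip i0 s0) \<in> seqs n \<alpha>" using i0_seqs length_s0 seqs_length[OF i0_seqs] by simp
  show "\<zeta> x \<noteq> \<zeta> y" if "x \<noteq> y" "fst x = fst y" for x y
    using that by (auto simp: \<zeta>_def prod_eq_iff)
qed (rule distinct_strands)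

text \<open>A deformation of the cyclic vector: the relations for idempotents and for crossings
  inside a segment hold exactly, while a dot acts by its parameter instead of 0.\<close>

definition vac :: "(nat \<times> nat) list \<Rightarrow> complex" where
  "vac \<sigma> = (if \<sigma> = zip i0 s0 then 1 else 0)"

lemma valid_S0: "valid (zip i0 s0)"
  by (simp add: valid_def)

lemma supp_vac: "supp vac"
  using valid_S0 by (auto simp: supp_def vac_def)

lemma fst_S0: "map fst (zip i0 s0) = i0"
  using length_s0 seqs_length[OF i0_seqs] by simp

lemma act_E_vac: "i \<in> seqs n \<alpha> \<Longrightarrow> act (Gidem i) vac = (if i = i0 then vac else (\<lambda>_. 0))"
  using supp_vac fst_S0 by (auto simp: fun_eq_iff act_def gens_memb vac_def valid_S0)

lemma act_X_vac: "k \<in> {1..size \<alpha>} \<Longrightarrow> act (Gx k) vac = (\<lambda>\<sigma>. \<zeta> (zip i0 s0 ! (k - 1)) * vac \<sigma>)"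
  using supp_vac by (auto simp: fun_eq_iff act_def gens_memb vac_def valid_S0)

lemma act_T_vac:
  assumes "Suc j < size \<alpha>" "s0 ! j = s0 ! Suc j"
  shows "act (Gtau (Suc j)) vac = (\<lambda>_. 0)"
proof
  fix \<sigma>
  note l = length_s0 seqs_length[OF i0_seqs] same_label_letters[OF assms]
  show "act (Gtau (Suc j)) vac \<sigma> = 0"
  proof (cases "valid \<sigma>")
    case True
    have ls: "length \<sigma> = size \<alpha>" using valid_length[OF True] .
    have "cA (\<sigma> ! j) (\<sigma> ! Suc j) * vac (swl j \<sigma>) = 0"
    proof (cases "swl j \<sigma> = zip i0 s0")
      case True
      then have "swl j (zip i0 s0) = \<sigma>" using ls assms(1) swl_swl[of j \<sigma>] by simp
      then have "\<sigma> ! j = (i0 ! Suc j, s0 ! Suc j)" "\<sigma> ! Suc j = (i0 ! j, s0 ! j)"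
        using assms(1) l by (auto simp: swl_nth)
      \<comment> \<open>After the swap the larger letter comes first, so the coefficient is the sum
        of the two parameters, which have opposite signs.\<close>
      then have "cA (\<sigma> ! j) (\<sigma> ! Suc j) = 0" using l assms by (simp add: cA_def \<zeta>_def)
      then show ?thesis by simp
    qed (simp add: vac_def)
    moreover have "cB (\<sigma> ! j) (\<sigma> ! Suc j) * vac \<sigma> = 0"
      using assms(1) l by (auto simp: vac_def cB_def)
    ultimately show ?thesis using True assms(1) by (simp only: act_T opT_def add_0_left)
  qed (simp add: act_def)
qed

text \<open>On \<open>vac\<close> the elements of the left ideal act like elements of smaller degree. Therefore, if the
  ideal contained 1, then elements of arbitrarily small degree would fix \<open>vac\<close>.\<close>

inductive lower :: "falg \<Rightarrow> bool" where
  lower_base: "homog n \<alpha> d p \<Longrightarrow> homog n \<alpha> (d - 2) r \<Longrightarrow> rep p vac = rep r vac \<Longrightarrow> lower p"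
| lower_add: "lower p \<Longrightarrow> lower q \<Longrightarrow> lower (p + q)"

lemma lower_J: "p \<in> J n \<alpha> \<Longrightarrow> lower p"
  using rep_J[OF _ supp_vac] by (intro lower_base[OF J_homog homog_zero]) (auto simp: rep_zero)

lemma lower_homog_mult: "lower p \<Longrightarrow> homog n \<alpha> d q \<Longrightarrow> lower (q * p)"
proof (induction rule: lower.induct)
  case (lower_base e p r)
  have "homog n \<alpha> (d + e - 2) (q * r)" using homog_mult[OF lower_base(4,2)] by (simp add: algebra_simps)
  from lower.lower_base[OF homog_mult[OF lower_base(4,1)] this]
  show ?case using lower_base(3) by (simp add: rep_mult)
qed (auto simp: distrib_left intro: lower_add)

lemma lower_sum: "(\<And>i. i \<in> A \<Longrightarrow> lower (f i)) \<Longrightarrow> lower (sum f A)"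
  by (induction A rule: infinite_finite_induct) (auto intro: lower_add lower_J add_sg_0[OF add_sg_J])

lemma lower_mult: "lower p \<Longrightarrow> lower (q * p)"
proof -
  assume p: "lower p"
  obtain D f where D: "\<forall>d\<in>D. homog n \<alpha> d (f d)" "q - (\<Sum>d\<in>D. f d) \<in> J n \<alpha>"
    using homog_decomp[of n \<alpha> q] by blast
  have "lower ((\<Sum>d\<in>D. f d * p) + (q - (\<Sum>d\<in>D. f d)) * p)"
    using D by (intro lower_add lower_sum lower_homog_mult[OF p] lower_J J_mult_right) auto
  then show ?thesis by (simp add: algebra_simps sum_distrib_right)
qed

text \<open>The dot \<open>X k * E i0\<close>, of degree 2, acts on \<open>vac\<close> as a multiple
  of \<open>E i0\<close>, of degree 0. All other generators are sums of homogeneous elements that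
  act by 0, and 0 has every degree.\<close>

lemma L_lower: "p \<in> L \<Longrightarrow> lower p"
proof (induction rule: lideal.induct)
  case li_idem
  \<comment> \<open>Modulo the relations this generator is minus the sum of the remaining
    idempotents, each of which kills \<open>vac\<close>.\<close>
  have "E i0 - 1 = (\<Sum>i\<in>seqs n \<alpha> - {i0}. - E i) + ((\<Sum>i\<in>seqs n \<alpha>. E i) - 1)"
    using i0_seqs by (simp add: sum_diff1 sum_negf)
  moreover have "lower (\<Sum>i\<in>seqs n \<alpha> - {i0}. - E i)"
    by (intro lower_sum lower_base[OF homog_uminus[OF homog_gens(1)] homog_zero])
      (auto simp: rep_uminus rep_gg act_E_vac rep_zero)
  ultimately show ?case using lower_add[OF _ lower_J[OF J_rel(1)]] by metis
next
  case (li_X k)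
  show ?case
  proof (cases "k \<in> {1..size \<alpha>}")
    case True
    let ?c = "\<zeta> (zip i0 s0 ! (k - 1))"
    have h: "homog n \<alpha> (2 - 2) (cs ?c (E i0))" using homog_cs[OF homog_gens(1)[OF i0_seqs]] by simp
    show ?thesis
      by (rule lower_base[OF homog_gens(2)[OF True i0_seqs] h])
        (use i0_seqs True in \<open>simp add: rep_mult rep_gg rep_cs act_E_vac act_X_vac\<close>)
  next
    case False
    then show ?thesis by (intro lower_J J_mult_right J_illegal) (simp add: gens_memb)
  qed
next
  case (li_T j)
  then show ?case
    by (intro lower_base[OF homog_gens(3)[OF _ i0_seqs] homog_zero])
      (auto simp: rep_mult rep_gg act_E_vac[OF i0_seqs] act_T_vac rep_zero)
qed (auto intro: lower_J lower_add lower_mult)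

lemma lower_decomp: "lower p \<Longrightarrow> \<exists>D f r. finite D \<and>
  (\<forall>d\<in>D. homog n \<alpha> d (f d) \<and> homog n \<alpha> (d - 2) (r d) \<and> rep (f d) vac = rep (r d) vac) \<and> p = (\<Sum>d\<in>D. f d)"
proof (induction rule: lower.induct)
  case (lower_base d p r)
  then show ?case by (intro exI[of _ "{d}"] exI[of _ "\<lambda>_. p"] exI[of _ "\<lambda>_. r"]) auto
next
  case (lower_add p q)
  then obtain D f r D' f' r' where
    D: "finite D" "\<forall>d\<in>D. homog n \<alpha> d (f d) \<and> homog n \<alpha> (d - 2) (r d) \<and> rep (f d) vac = rep (r d) vac" "p = (\<Sum>d\<in>D. f d)"
    and D': "finite D'" "\<forall>d\<in>D'. homog n \<alpha> d (f' d) \<and> homog n \<alpha> (d - 2) (r' d) \<and> rep (f' d) vac = rep (r' d) vac" "q = (\<Sum>d\<in>D'. f' d)"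
    by blast
  let ?g = "\<lambda>d. (if d \<in> D then f d else 0) + (if d \<in> D' then f' d else 0)"
  let ?h = "\<lambda>d. (if d \<in> D then r d else 0) + (if d \<in> D' then r' d else 0)"
  have "(\<Sum>d\<in>D \<union> D'. ?g d) = p + q"
    using D D' by (simp add: sum.distrib sum.If_cases Int_absorb1)
  then show ?case using D D'
    by (intro exI[of _ "D \<union> D'"] exI[of _ ?g] exI[of _ ?h])
      (auto intro!: homog_add homog_zero simp: rep_add rep_zero)
qed

text \<open>If 1 were in \<open>L\<close>, its component of degree 0 would fix \<open>vac\<close>
  and at the same time act like an element \<open>r\<close> of degree -2. The powers of
  \<open>r\<close> still fix \<open>vac\<close>, but those of sufficiently small degree are zero in
  the algebra.\<close>

theorem one_notin_L: "1 \<notin> L"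
proof
  assume "1 \<in> L"
  interpret Jm: klr_graded_left n \<alpha> "J n \<alpha>" by (rule klr_graded_J)
  let ?one = "\<Sum>i\<in>seqs n \<alpha>. E i"
  have one: "homog n \<alpha> 0 ?one" by (intro homog_sum homog_gens)
  obtain D f r where D: "finite D"
    "\<forall>d\<in>D. homog n \<alpha> d (f d) \<and> homog n \<alpha> (d - 2) (r d) \<and> rep (f d) vac = rep (r d) vac" "1 = (\<Sum>d\<in>D. f d)"
    using lower_decomp[OF L_lower[OF \<open>1 \<in> L\<close>]] by blast
  \<comment> \<open>Compares the given decomposition of 1 with the sum of idempotents, which has
    degree 0; by independence the components of degree 0 agree.\<close>
  let ?g = "\<lambda>d. (if d \<in> D then f d else 0) - (if d = 0 then ?one else 0)"
  have "(\<Sum>d\<in>insert 0 D. ?g d) = (\<Sum>d\<in>insert 0 D. if d \<in> D then f d else 0) - ?one"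
    using D(1) by (simp only: sum_subtractf sum.delta finite_insert insertI1 if_True)
  also have "(\<Sum>d\<in>insert 0 D. if d \<in> D then f d else 0) = (\<Sum>d\<in>D. f d)"
    using D(1) by (intro sum.mono_neutral_cong_right) auto
  finally have s: "(\<Sum>d\<in>insert 0 D. ?g d) = 1 - ?one" using D(3) by simp
  have "1 - ?one \<in> J n \<alpha>" using Jm.L_mult[OF J_rel(1), of "-1"] by simp
  then have "?g 0 \<in> J n \<alpha>"
    by (intro Jm.homog_direct[of "insert 0 D" ?g])
      (use D one s in \<open>auto intro!: homog_diff homog_zero homog_uminus\<close>)
  then have "rep (?g 0) vac = (\<lambda>_. 0)" by (rule rep_J[OF _ supp_vac])
  moreover have "rep ?one vac = vac"
  proof -
    have "rep (?one - 1) vac = (\<lambda>_. 0)" by (rule rep_J[OF J_rel(1) supp_vac])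
    then show ?thesis by (simp add: rep_diff rep_one fun_eq_iff)
  qed
  ultimately have v: "rep (if 0 \<in> D then f 0 else 0) vac = vac" by (simp add: rep_diff fun_eq_iff)
  have "\<exists>r. homog n \<alpha> (-2) r \<and> rep r vac = vac"
  proof (cases "0 \<in> D")
    case True
    then show ?thesis using v D(2) by (intro exI[of _ "r 0"]) fastforce
  next
    case False
    then show ?thesis using v homog_zero by (intro exI[of _ 0]) auto
  qed
  then obtain r where r: "homog n \<alpha> (-2) r" "rep r vac = vac" by blast
  \<comment> \<open>The sum of idempotents on the right provides a homogeneous unit for the start of
    the induction.\<close>
  have pw: "homog n \<alpha> (- 2 * int k) (r ^ k * ?one) \<and> rep (r ^ k * ?one) vac = vac" for k
  proof (induction k)
    case 0
    then show ?case using one \<open>rep ?one vac = vac\<close> by simp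
  next
    case (Suc k)
    then have "homog n \<alpha> (- 2 + - 2 * int k) (r * (r ^ k * ?one))" by (intro homog_mult r) auto
    then show ?case using Suc r(2) by (simp add: rep_mult mult.assoc algebra_simps)
  qed
  obtain b where b: "\<forall>d p. homog n \<alpha> d p \<longrightarrow> d < b \<longrightarrow> p \<in> J n \<alpha>" using klr_bounded_below by blast
  \<comment> \<open>Large enough that \<open>- 2 * k\<close> lies below \<open>b\<close>, also when
    \<open>b\<close> is positive and \<open>k\<close> is 0.\<close>
  define k where "k = nat (1 - b)"
  have "- 2 * int k < b" by (simp add: k_def)
  then have "r ^ k * ?one \<in> J n \<alpha>" using b pw[of k] by blast
  from rep_J[OF this supp_vac] pw[of k] have "vac = (\<lambda>_. 0)" by simp
  then have "vac (zip i0 s0) = 0" by simp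
  then show False by (simp add: vac_def)
qed

lemma Tw_one: "\<exists>\<epsilon>. p \<bumpeq>\<^bsub>L\<^esub> (\<Sum>\<sigma>\<in>span.shufs. cs (\<epsilon> \<sigma>) (span.Tw \<sigma>))"
proof -
  have "1 \<in> range (\<lambda>c. cs c (1 :: falg))" by (auto intro: image_eqI[of _ _ 1] simp: cs.sc_one)
  from span.spanning[OF this, of p] obtain \<epsilon> where
    e: "\<forall>\<sigma>. \<epsilon> \<sigma> \<in> range (\<lambda>c. cs c 1)" "p \<bumpeq>\<^bsub>L\<^esub> (\<Sum>\<sigma>\<in>span.shufs. span.Tw \<sigma> * \<epsilon> \<sigma>)" by auto
  then have "\<forall>\<sigma>. \<exists>c. \<epsilon> \<sigma> = cs c 1" by blast
  then obtain c where "\<And>\<sigma>. \<epsilon> \<sigma> = cs (c \<sigma>) 1" by metis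
  then show ?thesis using e(2) by (intro exI[of _ c]) (simp add: cs_mult_right)
qed

text \<open>In the expansion over shuffles, \<open>E i0\<close> selects those with word
  \<open>i0\<close>, and independence of degrees selects those of degree 0. By the hypothesis on
  shuffles only the trivial one is left, and its word is the empty product.\<close>

lemma deg0_weight_space:
  assumes u: "\<And>\<sigma>. mset \<sigma> = mset s0 \<Longrightarrow> wd lf \<sigma> = i0 \<Longrightarrow> dg lf \<sigma> = 0 \<Longrightarrow> \<sigma> = s0"
    and p: "homog n \<alpha> 0 p"
  shows "\<exists>c. E i0 * p \<bumpeq>\<^bsub>L\<^esub> cs c 1"
proof -
  obtain \<epsilon> where e: "p \<bumpeq>\<^bsub>L\<^esub> (\<Sum>\<sigma>\<in>span.shufs. cs (\<epsilon> \<sigma>) (span.Tw \<sigma>))" using Tw_one by blast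
  have one: "1 \<in> range (\<lambda>c. cs c (1 :: falg))" by (auto intro: image_eqI[of _ _ 1] simp: cs.sc_one)
  \<comment> \<open>The idempotent on the right does not change the class modulo \<open>L\<close>,
    but \<open>Tw_homog\<close> assigns a degree only to the product with it.\<close>
  let ?t = "\<lambda>\<sigma>. if wd lf \<sigma> = i0 then cs (\<epsilon> \<sigma>) (span.Tw \<sigma> * E i0) else 0"
  have "E i0 * p \<bumpeq>\<^bsub>L\<^esub> E i0 * (\<Sum>\<sigma>\<in>span.shufs. cs (\<epsilon> \<sigma>) (span.Tw \<sigma>))" by (rule eqv_mult[OF e])
  also have "\<dots> = (\<Sum>\<sigma>\<in>span.shufs. cs (\<epsilon> \<sigma>) (E i0 * span.Tw \<sigma>))" by (simp add: sum_distrib_left cs_mult_right)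
  also have "\<dots> \<bumpeq>\<^bsub>L\<^esub> (\<Sum>\<sigma>\<in>span.shufs. ?t \<sigma>)"
  proof (rule eqv_sum)
    fix \<sigma> assume s: "\<sigma> \<in> span.shufs"
    have w: "wt (wd lf \<sigma>) (span.Tw \<sigma>)" using span.Tw_wt[OF s one] by simp
    show "cs (\<epsilon> \<sigma>) (E i0 * span.Tw \<sigma>) \<bumpeq>\<^bsub>L\<^esub> ?t \<sigma>"
    proof (cases "wd lf \<sigma> = i0")
      case True
      have "E i0 * span.Tw \<sigma> \<bumpeq>\<^bsub>L\<^esub> span.Tw \<sigma> * 1" using w unfolding True by (simp only: wt_def mult_1_right)
      also have "span.Tw \<sigma> * 1 \<bumpeq>\<^bsub>L\<^esub> span.Tw \<sigma> * (E i0 * 1)"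
        by (rule eqv_mult[OF eqv_sym]) (use wt_one in \<open>simp only: wt_def\<close>)
      finally have "cs (\<epsilon> \<sigma>) (E i0 * span.Tw \<sigma>) \<bumpeq>\<^bsub>L\<^esub> cs (\<epsilon> \<sigma>) (span.Tw \<sigma> * E i0)"
        by (intro eqv_cs) (simp only: mult_1_right mult_1_left)
      then show ?thesis by (simp only: True if_True refl)
    next
      case False
      then have "cs (\<epsilon> \<sigma>) (E i0 * span.Tw \<sigma>) \<in> L" by (intro L_cs wt_orth[OF w i0_seqs])
      then show ?thesis using False by (simp only: if_False eqv_zero)
    qed
  qed
  finally have a: "E i0 * p \<bumpeq>\<^bsub>L\<^esub> (\<Sum>\<sigma>\<in>span.shufs. ?t \<sigma>)" .
  let ?D = "insert 0 (dg lf ` span.shufs)"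
  let ?y = "\<lambda>d. \<Sum>\<sigma>\<in>{\<sigma>\<in>span.shufs. dg lf \<sigma> = d}. ?t \<sigma>"
  have fin: "finite span.shufs" by (rule span.finite_shufs)
  have "(\<Sum>\<sigma>\<in>span.shufs. ?t \<sigma>) = (\<Sum>d\<in>?D. ?y d)"
    using fin by (intro sum.group[symmetric]) auto
  have hy: "homog n \<alpha> d (?y d)" for d
    using span.Tw_homog by (intro homog_sum) (auto intro!: homog_cs homog_zero)
  have hp: "homog n \<alpha> 0 (E i0 * p)" using homog_mult[OF homog_gens(1)[OF i0_seqs] p] by simp
  let ?g = "\<lambda>d. (if d = 0 then E i0 * p else 0) - ?y d"
  have "(\<Sum>d\<in>?D. ?g d) = E i0 * p - (\<Sum>d\<in>?D. ?y d)"
    using fin by (simp only: sum_subtractf sum.delta finite_insert finite_imageI insertI1 if_True)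
  then have s: "(\<Sum>d\<in>?D. ?g d) \<in> L"
    using a \<open>(\<Sum>\<sigma>\<in>span.shufs. ?t \<sigma>) = _\<close> by (simp add: eqv_def)
  have g0: "?g 0 \<in> L"
    by (rule homog_direct[OF _ _ s]) (use fin hp hy in \<open>auto intro!: homog_diff homog_zero homog_uminus\<close>)
  have i: "invs s0 = 0" by (rule sorted_inv[OF sorted_s0])
  have ms: "s0 \<in> span.shufs" by (simp add: span.shufs_def)
  have "?y 0 = (\<Sum>\<sigma>\<in>{s0}. ?t \<sigma>)"
  proof (rule sum.mono_neutral_right)
    show "finite {\<sigma> \<in> span.shufs. dg lf \<sigma> = 0}" using fin by simp
    show "{s0} \<subseteq> {\<sigma> \<in> span.shufs. dg lf \<sigma> = 0}" using ms dg_sorted[OF sorted_s0] by simp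
    show "\<forall>\<sigma>\<in>{\<sigma> \<in> span.shufs. dg lf \<sigma> = 0} - {s0}. ?t \<sigma> = 0"
      using u by (auto simp: span.shufs_def)
  qed
  then have y0: "?y 0 = cs (\<epsilon> s0) (span.Tw s0 * E i0)" using wd_s0 by simp
  have "span.filt 0 (span.Tw s0 * 1 - 1 * 1)"
    by (rule span.red_diamond[OF one]) (use span.red_Tw[of s0] span.red_0 i in auto)
  then have "span.Tw s0 \<bumpeq>\<^bsub>L\<^esub> 1" using span.filt_0 by (simp add: eqv_def)
  moreover have "span.Tw s0 * (E i0 * 1) \<bumpeq>\<^bsub>L\<^esub> span.Tw s0 * 1"
    using wt_one by (intro eqv_mult) (simp add: wt_def)
  ultimately have "span.Tw s0 * E i0 \<bumpeq>\<^bsub>L\<^esub> 1" using eqv_trans by simp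
  then have "?y 0 \<bumpeq>\<^bsub>L\<^esub> cs (\<epsilon> s0) 1" unfolding y0 by (rule eqv_cs)
  moreover have "E i0 * p \<bumpeq>\<^bsub>L\<^esub> ?y 0" using g0 by (simp add: eqv_def)
  ultimately show ?thesis using eqv_trans by blast
qed

end

section \<open>Shuffles of ordered segments with the standard word\<close>

text \<open>The trivial shuffle of the segments numbered by \<open>ps\<close>. The numbers form an
  arbitrary list, since the induction on shuffles deletes segments from the middle.\<close>

definition SS :: "(nat \<Rightarrow> nat) \<Rightarrow> nat list \<Rightarrow> nat list" where
  "SS len ps = concat (map (\<lambda>p. replicate (len p) p) ps)"

definition WW :: "(nat \<Rightarrow> nat) \<Rightarrow> (nat \<Rightarrow> nat) \<Rightarrow> nat list \<Rightarrow> nat list" where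
  "WW st len ps = concat (map (\<lambda>p. [st p..<st p + len p]) ps)"

lemma SS_simps: "SS len [] = []" "SS len (p # ps) = replicate (len p) p @ SS len ps"
  "SS len (ps @ qs) = SS len ps @ SS len qs"
  by (simp_all add: SS_def)

lemma WW_simps: "WW st len [] = []" "WW st len (p # ps) = [st p..<st p + len p] @ WW st len ps"
  "WW st len (ps @ qs) = WW st len ps @ WW st len qs"
  by (simp_all add: WW_def)

lemma count_SS: "distinct ps \<Longrightarrow> count (mset (SS len ps)) r = (if r \<in> set ps then len r else 0)"
  by (induction ps) (auto simp: SS_simps)

lemma set_SS: "set (SS len ps) \<subseteq> set ps"
  by (auto simp: SS_def)

lemma pr_cong: "(\<And>p. p \<in> set \<sigma> \<Longrightarrow> f p = g p) \<Longrightarrow> pr lf f \<sigma> = pr lf g \<sigma>"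
proof (induction \<sigma> arbitrary: f g)
  case (Cons p \<sigma>)
  have "pr lf (f(p := Suc (f p))) \<sigma> = pr lf (g(p := Suc (g p))) \<sigma>"
    by (rule Cons.IH) (use Cons.prems in auto)
  then show ?case using Cons.prems by simp
qed simp

lemma pr_replicate_append: "pr lf f (replicate l q @ \<sigma>) =
    map (\<lambda>c. (q, lf q (f q + c))) [0..<l] @ pr lf (f(q := f q + l)) \<sigma>"
proof (induction l arbitrary: f)
  case (Suc l)
  have "map (\<lambda>c. (q, lf q (f q + c))) [0..<Suc l] = (q, lf q (f q)) # map (\<lambda>c. (q, lf q (Suc (f q) + c))) [0..<l]"
    by (simp add: map_upt_Suc del: upt_Suc)
  moreover have "(f(q := Suc (f q)))(q := Suc (f q) + l) = f(q := f q + Suc l)" by auto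
  ultimately show ?case using Suc[of "f(q := Suc (f q))"] by (simp del: upt_Suc fun_upd_apply add: fun_upd_same)
qed simp

lemma dgl_append_same: "(\<And>x. x \<in> set XS \<Longrightarrow> fst x = q) \<Longrightarrow>
    dgl (XS @ Y) = (\<Sum>x\<leftarrow>XS. \<Sum>y\<leftarrow>Y. if fst y < q then - cartan (snd x) (snd y) else 0) + dgl Y"
proof (induction XS)
  case (Cons x XS)
  have "(\<Sum>y\<leftarrow>XS. if fst y < fst x then - cartan (snd x) (snd y) else 0) = (\<Sum>y\<leftarrow>XS. 0)"
    by (rule arg_cong[of _ _ sum_list], rule map_cong) (use Cons.prems in auto)
  then show ?case using Cons by simp
qed simp

lemma sum_list_swap: "(\<Sum>x\<leftarrow>xs. \<Sum>y\<leftarrow>ys. g x y) = (\<Sum>y\<leftarrow>ys. \<Sum>x\<leftarrow>xs. (g x y :: int))"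
  by (induction xs) (simp_all add: sum_list_addf)

lemma sum_list_nonpos_int: "(\<And>x. x \<in> set xs \<Longrightarrow> f x \<le> (0::int)) \<Longrightarrow> sum_list (map f xs) \<le> 0"
  by (induction xs) (auto simp: add_nonpos_nonpos)

lemma sum_list_neg_int: "(\<And>x. x \<in> set xs \<Longrightarrow> f x \<le> (0::int)) \<Longrightarrow> y \<in> set xs \<Longrightarrow> f y < 0 \<Longrightarrow> sum_list (map f xs) < 0"
proof (induction xs)
  case (Cons x xs)
  have "sum_list (map f xs) \<le> 0" by (rule sum_list_nonpos_int) (use Cons.prems in auto)
  moreover have "f x \<le> 0" using Cons.prems by auto
  moreover have "f x < 0 \<or> sum_list (map f xs) < 0" using Cons by auto
  ultimately show ?case by auto
qed simp

text \<open>A letter of a segment has at most two neighbours in it, the first letter at most one. So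
  moving a whole segment past a letter of an equal segment never raises the degree, and the first
  letter lowers it.\<close>

lemma cartan_block_sum:
  assumes "c' < l"
  shows "(\<Sum>c<l. cartan (s + c) (s + c')) \<ge> (if c' = 0 then 1 else 0)"
proof -
  have "(\<Sum>c<l. cartan (s + c) (s + c')) =
    (\<Sum>c<l. (if c = c' then 2 else 0) - (if c = Suc c' then 1 else 0) - (if Suc c = c' then 1 else 0))"
    by (rule sum.cong) (auto simp: cartan_def)
  also have "\<dots> = 2 - (if Suc c' < l then 1 else 0) - (\<Sum>c<l. if Suc c = c' then 1 else 0)"
    using assms by (simp add: sum_subtractf)
  also have "(\<Sum>c<l. if Suc c = c' then 1 else (0::int)) = (\<Sum>c<l. if c' \<noteq> 0 \<and> c = c' - 1 then 1 else 0)"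
    by (rule sum.cong) auto
  also have "\<dots> = (if c' = 0 then 0 else 1)" using assms by auto
  finally show ?thesis by auto
qed

lemma concat_replicate_comm: "concat (replicate k B) @ B = B @ concat (replicate k B)"
  by (induction k) auto

lemma count_list_take: "j < length \<sigma> \<Longrightarrow> count_list (take j \<sigma>) (\<sigma> ! j) < count (mset \<sigma>) (\<sigma> ! j)"
proof -
  assume "j < length \<sigma>"
  then have s: "\<sigma> = take j \<sigma> @ \<sigma> ! j # drop (Suc j) \<sigma>" by (rule id_take_nth_drop)
  have "count (mset \<sigma>) x = count_list \<sigma> x" for x
    by (induction \<sigma>) auto
  moreover have "count_list \<sigma> (\<sigma> ! j) = count_list (take j \<sigma>) (\<sigma> ! j) + Suc (count_list (drop (Suc j) \<sigma>) (\<sigma> ! j))"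
    by (subst (1) s) simp
  ultimately show ?thesis by simp
qed

text \<open>A letter following the start of a segment continues that segment, since no other segment starts
  later. So the first segment of the word is a segment of the shuffle, and moving it to the front past
  equal segments lowers the degree.\<close>

lemma standard_word_degree:
  fixes st len :: "nat \<Rightarrow> nat"
  defines "lf \<equiv> \<lambda>p c. st p + c"
  assumes "sorted_wrt (<) ps"
    and "\<And>p q. p \<in> set ps \<Longrightarrow> q \<in> set ps \<Longrightarrow> p < q \<Longrightarrow> st q < st p \<or> st q = st p \<and> len q \<le> len p"
    and "mset \<sigma> = mset (SS len ps)" and "\<And>p. p \<in> set ps \<Longrightarrow> f p = 0"
    and "map snd (pr lf f \<sigma>) = WW st len ps"
  shows "dgl (pr lf f \<sigma>) \<le> 0 \<and> (dgl (pr lf f \<sigma>) = 0 \<longrightarrow> \<sigma> = SS len ps)"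
  using assms(2-)
proof (induction "length ps" arbitrary: ps \<sigma> rule: less_induct)
  case less
  note inc = less.prems(1) and ord = less.prems(2) and ms = less.prems(3) and f0 = less.prems(4) and word = less.prems(5)
  show ?case
  proof (cases ps)
    case Nil
    then show ?thesis using ms by (simp add: SS_simps)
  next
    case (Cons p0 ps')
    show ?thesis
    proof (cases "len p0 = 0")
      case True
      then have e: "SS len ps = SS len ps'" "WW st len ps = WW st len ps'" using Cons by (simp_all add: SS_simps WW_simps)
      show ?thesis unfolding e(1)
        by (rule less.hyps) (use inc ord ms f0 word e Cons in auto)
    next
      case False
      define l where "l = len p0"
      have lpos: "0 < l" using False by (simp add: l_def)
      have dps: "distinct ps" using inc by (simp add: strict_sorted_iff)
      have sub: "set \<sigma> \<subseteq> set ps" using mset_eq_setD[OF ms] set_SS by metis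
      have lenle: "l \<le> length \<sigma>"
        using arg_cong[OF word, of length] Cons by (simp add: WW_simps l_def)
      define q where "q = \<sigma> ! 0"
      \<comment> \<open>The first segment has the largest starting point, so no letter above it can
        open a new segment.\<close>
      have p0max: "r \<in> set ps \<Longrightarrow> st r \<le> st p0" for r
        using ord[of p0 r] inc Cons by force
      have letter: "st (\<sigma> ! c) + count_list (take c \<sigma>) (\<sigma> ! c) = st p0 + c" if c: "c < l" for c
      proof -
        have cl: "c < length \<sigma>" using c lenle by simp
        then have "\<sigma> ! c \<in> set ps" using sub by auto
        then have "f (\<sigma> ! c) = 0" by (rule f0)
        then have "map snd (pr lf f \<sigma>) ! c = st (\<sigma> ! c) + count_list (take c \<sigma>) (\<sigma> ! c)"
          using cl by (simp add: pr_nth lf_def)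
        moreover have "WW st len ps ! c = st p0 + c"
          using c Cons by (simp add: WW_simps l_def nth_append)
        ultimately show ?thesis using word by simp
      qed
      have stq: "st q = st p0" using letter[of 0] lpos by (simp add: q_def)
      have allq: "c < l \<Longrightarrow> \<sigma> ! c = q" for c
      proof (induction c rule: less_induct)
        case (less c)
        show ?case
        proof (rule ccontr)
          assume ne: "\<sigma> ! c \<noteq> q"
          have "\<And>x. x \<in> set (take c \<sigma>) \<Longrightarrow> x = q"
            using less lenle by (auto simp: in_set_conv_nth)
          then have "count_list (take c \<sigma>) (\<sigma> ! c) = 0" using ne by (metis count_notin)
          then have "st (\<sigma> ! c) = st p0 + c" using letter[OF less.prems] by simp
          moreover have "\<sigma> ! c \<in> set ps" using sub less.prems lenle by auto
          ultimately have "c = 0" using p0max by fastforce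
          then show False using ne by (simp add: q_def)
        qed
      qed
      define \<sigma>' where "\<sigma>' = drop l \<sigma>"
      have "take l \<sigma> = replicate l q"
        by (rule nth_equalityI) (use allq lenle in auto)
      then have \<sigma>: "\<sigma> = replicate l q @ \<sigma>'" unfolding \<sigma>'_def by (metis append_take_drop_id)
      have qps: "q \<in> set ps" using sub lpos \<sigma> by (cases l) auto
      have cq: "count (mset \<sigma>) q = len q" using ms count_SS[OF dps] qps by simp
      \<comment> \<open>The initial block uses up \<open>l\<close> strands of segment
        \<open>q\<close>; conversely \<open>p0\<close> has the greatest length among the segments
        with its starting point. So the block is the whole of \<open>q\<close>.\<close>
      have "l \<le> len q" using cq \<sigma> by simp
      moreover have "len q \<le> l" using ord[of p0 q] stq qps inc Cons by (force simp: l_def)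
      ultimately have lq: "len q = l" by simp
      obtain as bs where ab: "ps = as @ q # bs" using qps by (meson split_list)
      let ?ps2 = "as @ bs"
      have as_lt: "r < q" if "r \<in> set as" for r using that inc ab by (simp add: sorted_wrt_append)
      \<comment> \<open>Segments between \<open>p0\<close> and \<open>q\<close> in the order are
        squeezed between two equal segments.\<close>
      have as_eq: "st r = st q \<and> len r = l" if r: "r \<in> set as" for r
      proof -
        have rps: "r \<in> set ps" using r ab by simp
        have 1: "st q < st r \<or> st q = st r \<and> len q \<le> len r" using ord[OF rps qps as_lt[OF r]] .
        have 2: "st r = st p0 \<and> len r \<le> len p0" if "st q = st r"
          using ord[of p0 r] rps inc Cons that stq by force
        show ?thesis using 1 2 p0max[OF rps] stq lq l_def by auto
      qed
      have bs_gt: "q < r" if "r \<in> set bs" for r using that inc ab by (simp add: sorted_wrt_append)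
      have ms': "mset \<sigma>' = mset (SS len ?ps2)"
        using ms unfolding \<sigma> ab by (simp add: SS_simps lq)
      have q': "q \<notin> set \<sigma>'"
        using mset_eq_setD[OF ms'] set_SS[of len ?ps2] as_lt bs_gt by fastforce
      let ?B = "[st q..<st q + l]"
      have pr\<sigma>: "pr lf f \<sigma> = map (\<lambda>c. (q, st q + c)) [0..<l] @ pr lf f \<sigma>'"
      proof -
        have "pr lf (f(q := f q + l)) \<sigma>' = pr lf f \<sigma>'" by (rule pr_cong) (use q' in auto)
        then show ?thesis unfolding \<sigma> pr_replicate_append using f0[OF qps] by (simp add: lf_def)
      qed
      have "WW st len as = concat (replicate (length as) ?B)"
        using as_eq by (induction as) (simp_all add: WW_simps)
      then have "WW st len ps = ?B @ WW st len ?ps2"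
        unfolding ab WW_simps lq using concat_replicate_comm[of "length as" ?B] by (metis append.assoc)
      then have word': "map snd (pr lf f \<sigma>') = WW st len ?ps2"
        using word unfolding pr\<sigma> by (simp add: append_eq_append_conv)
      have IH: "dgl (pr lf f \<sigma>') \<le> 0 \<and> (dgl (pr lf f \<sigma>') = 0 \<longrightarrow> \<sigma>' = SS len ?ps2)"
        by (rule less.hyps) (use inc ord f0 ms' word' ab in \<open>auto simp: sorted_wrt_append\<close>)
      let ?Y = "pr lf f \<sigma>'"
      let ?t = "\<lambda>y. \<Sum>c\<leftarrow>[0..<l]. if fst y < q then - cartan (st q + c) (snd y) else 0"
      have dg: "dgl (pr lf f \<sigma>) = (\<Sum>y\<leftarrow>?Y. ?t y) + dgl ?Y"
        unfolding pr\<sigma> by (subst dgl_append_same[of _ q]) (auto simp: sum_list_swap[of _ ?Y] comp_def cong: if_cong)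
      have t: "?t y = (if fst y < q then - (\<Sum>c<l. cartan (st q + c) (snd y)) else 0)" for y
        by (simp add: interv_sum_list_conv_sum_set_nat sum_negf atLeast0LessThan)
      \<comment> \<open>The initial block crosses exactly the strands with labels below
        \<open>q\<close>, and these belong to segments equal to it.\<close>
      have tle: "?t y \<le> 0 \<and> (fst y < q \<longrightarrow> snd y = st q \<longrightarrow> ?t y < 0)" if yY: "y \<in> set ?Y" for y
      proof -
        obtain j where j: "j < length \<sigma>'" "y = ?Y ! j" using yY by (auto simp: in_set_conv_nth)
        define r where "r = \<sigma>' ! j"
        define c' where "c' = count_list (take j \<sigma>') r"
        have rps: "r \<in> set ?ps2" using nth_mem[OF j(1)] mset_eq_setD[OF ms'] set_SS[of len ?ps2] unfolding r_def by auto
        then have y: "y = (r, st r + c')" using j f0[of r] ab by (auto simp: pr_nth lf_def r_def c'_def)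
        have "c' < count (mset \<sigma>') r" unfolding c'_def r_def by (rule count_list_take[OF j(1)])
        then have c': "c' < len r" using ms' count_SS[of ?ps2 len r] dps rps ab by simp
        show ?thesis
        proof (cases "r < q")
          case True
          then have "r \<in> set as" using rps bs_gt by fastforce
          then have e: "st r = st q" "len r = l" using as_eq by auto
          have "(if c' = 0 then 1 else 0) \<le> (\<Sum>c<l. cartan (st q + c) (st q + c'))"
            by (rule cartan_block_sum) (use c' e in simp)
          then show ?thesis using True e unfolding t y by (cases "c' = 0") auto
        next
          case False
          then show ?thesis unfolding t y by simp
        qed
      qed
      show ?thesis
      proof (cases as)
        case Nil
        have "(\<Sum>y\<leftarrow>?Y. ?t y) \<le> 0" by (rule sum_list_nonpos_int) (use tle in blast)
        moreover have "\<sigma> = SS len ps" if "\<sigma>' = SS len ?ps2"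
          using that \<sigma> Nil ab lq by (simp add: SS_simps)
        ultimately show ?thesis using IH dg by auto
      next
        case as: (Cons a as')
        then have a: "a = p0" using ab Cons by simp
        \<comment> \<open>If \<open>q\<close> is not the first segment, then the first letter of
          \<open>p0\<close> is among the strands crossed, and the degree is strictly
          negative.\<close>
        have "count (mset \<sigma>') p0 = l"
          using ms' count_SS[of ?ps2 len p0] dps ab as a l_def by simp
        then have "p0 \<in> set \<sigma>'" using lpos by (metis count_eq_zero_iff less_numeral_extra(3) set_mset_mset)
        then obtain u v where uv: "\<sigma>' = u @ p0 # v" "p0 \<notin> set u" by (meson split_list_first)
        have "?Y ! length u = (p0, st p0)"
          using uv f0[of p0] Cons by (simp add: pr_nth lf_def nth_append)
        then have y0: "(p0, st p0) \<in> set ?Y" using uv by (metis length_append length_pr length_Cons less_add_same_cancel1 nth_mem zero_less_Suc)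
        have "(\<Sum>y\<leftarrow>?Y. ?t y) < 0"
          by (rule sum_list_neg_int[OF _ y0]) (use tle tle[OF y0] as_lt[of p0] as a stq in auto)
        then show ?thesis using IH dg by auto
      qed
    qed
  qed
qed

lemma pr_SS:
  assumes "distinct ps" "\<And>p. p \<in> set ps \<Longrightarrow> f p = 0"
  shows "map snd (pr (\<lambda>p c. st p + c) f (SS len ps)) = WW st len ps"
  using assms
proof (induction ps arbitrary: f)
  case (Cons p ps)
  have "map snd (pr (\<lambda>p c. st p + c) (f(p := f p + len p)) (SS len ps)) = WW st len ps"
    by (rule Cons.IH) (use Cons.prems in auto)
  moreover have "map (\<lambda>c. st p + c) [0..<len p] = [st p..<st p + len p]"
    by (rule nth_equalityI) auto
  ultimately show ?case using Cons.prems
    by (simp add: SS_simps WW_simps pr_replicate_append comp_def)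
qed (simp add: SS_simps WW_simps)

lemma sorted_SS: "sorted ps \<Longrightarrow> sorted (SS len ps)"
proof (induction ps)
  case (Cons p ps)
  then show ?case using set_SS[of len ps] by (auto simp: SS_simps sorted_append)
qed (simp add: SS_simps)

lemma SS_shuffle_unique:
  assumes "sorted_wrt (<) ps"
    and "\<And>p q. p \<in> set ps \<Longrightarrow> q \<in> set ps \<Longrightarrow> p < q \<Longrightarrow> st q < st p \<or> st q = st p \<and> len q \<le> len p"
    and "mset \<sigma> = mset (SS len ps)" "wd (\<lambda>p c. st p + c) \<sigma> = WW st len ps" "dg (\<lambda>p c. st p + c) \<sigma> = 0"
  shows "\<sigma> = SS len ps"
  using standard_word_degree[of ps st len \<sigma> "\<lambda>_. 0"] assms by (simp add: wd_def dg_def)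

section \<open>Modules presented as quotients of the free algebra\<close>

lemma cs_sum_left: "cs (sum c A) p = (\<Sum>i\<in>A. cs (c i) p)"
  by (induction A rule: infinite_finite_induct) (simp_all add: cs.sc_zero cs.sc_add)

lemma (in klr_left) cls_act_J: "p - q \<in> J n \<alpha> \<Longrightarrow> p * u \<bumpeq>\<^bsub>L\<^esub> q * u"
  using J_act[of "p - q" u] by (simp add: eqv_def algebra_simps)

lemma (in klr_graded_left) homog_parts:
  assumes "p \<in> L"
  shows "\<exists>D f. finite D \<and> (\<forall>d\<in>D. homog n \<alpha> d (f d) \<and> f d \<in> L) \<and> p - (\<Sum>d\<in>D. f d) \<in> J n \<alpha>"
proof -
  obtain D f where D: "finite D" "\<forall>d\<in>D. homog n \<alpha> d (f d)" "p - (\<Sum>d\<in>D. f d) \<in> J n \<alpha>"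
    using homog_decomp[of n \<alpha> p] by blast
  have s: "(\<Sum>d\<in>D. f d) \<in> L" using L_cong[OF J_eqv[OF D(3)]] assms by simp
  have "f d \<in> L" if "d \<in> D" for d
    by (rule homog_direct[OF D(1) _ s that]) (use D(2) in auto)
  then show ?thesis using D by (intro exI[of _ D] exI[of _ f]) simp
qed

text \<open>Homogeneous components in \<open>K\<close> are eigenvectors, so \<open>phi\<close> maps
  them to multiples of themselves. The remainder may lie in a smaller graded ideal \<open>L\<close>,
  because submodules of \<open>R/L\<close> provide decompositions modulo \<open>L\<close>
  only.\<close>

lemma klr_graded_leftI:
  assumes "klr_left n \<alpha> K"
    and "\<And>p. p \<in> K \<Longrightarrow> \<exists>D f. (\<forall>d\<in>D. homog n \<alpha> d (f d) \<and> f d \<in> K) \<and> p - (\<Sum>d\<in>D. f d) \<in> L"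
    and "L \<subseteq> K" "\<And>p. p \<in> L \<Longrightarrow> phi n \<alpha> p \<in> L"
  shows "klr_graded_left n \<alpha> K"
proof (intro klr_graded_left.intro assms(1) klr_graded_left_axioms.intro)
  interpret klr_left n \<alpha> K by (rule assms(1))
  fix p assume "p \<in> K"
  then obtain D f where D: "\<forall>d\<in>D. homog n \<alpha> d (f d) \<and> f d \<in> K" "p - (\<Sum>d\<in>D. f d) \<in> L"
    using assms(2) by blast
  have "phi n \<alpha> (f d) \<in> K" if "d \<in> D" for d
  proof -
    have "phi n \<alpha> (f d) \<bumpeq>\<^bsub>K\<^esub> cs (2 powi d) (f d)" using homog_phi D that by (intro J_eqv) blast
    then show ?thesis using L_cong L_cs D that by blast
  qed
  then have "(\<Sum>d\<in>D. phi n \<alpha> (f d)) \<in> K" by (rule add_sg_sum[OF sgL])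
  moreover have "phi n \<alpha> (p - (\<Sum>d\<in>D. f d)) \<in> K" using assms(3,4) D(2) by blast
  ultimately show "phi n \<alpha> p \<in> K" using L_add by fastforce
qed

text \<open>\<open>\<pi>\<close> identifies the record \<open>M\<close> with \<open>R/L\<close> as a
  graded module. Submodules, quotients and dimensions are thereby translated into statements on left
  ideals of the free algebra.\<close>

locale presented = klr_graded_left n \<alpha> L for n \<alpha> L +
  fixes M :: "(klr_elt, 'm) graded" and \<pi> :: "falg \<Rightarrow> 'm"
  assumes carrier_M: "carrier M = range \<pi>"
    and add_M: "\<pi> p \<oplus>\<^bsub>M\<^esub> \<pi> q = \<pi> (p + q)"
    and smult_M: "cls n \<alpha> q \<odot>\<^bsub>M\<^esub> \<pi> p = \<pi> (q * p)"
    and zero_M: "\<zero>\<^bsub>M\<^esub> = \<pi> 0"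
    and eq_M: "\<pi> p = \<pi> q \<longleftrightarrow> p - q \<in> L"
    and grade_M: "grade M d = \<pi> ` {p. homog n \<alpha> d p}"
begin

abbreviation "R \<equiv> klr n \<alpha>"

lemma abelian_group_M: "abelian_group M"
proof (rule abelian_groupI)
  fix x assume "x \<in> carrier M"
  then obtain p where "x = \<pi> p" by (auto simp: carrier_M)
  then show "\<exists>y\<in>carrier M. y \<oplus>\<^bsub>M\<^esub> x = \<zero>\<^bsub>M\<^esub>"
    by (intro bexI[of _ "\<pi> (- p)"]) (auto simp: add_M zero_M carrier_M)
qed (auto simp: carrier_M add_M zero_M algebra_simps)

lemma left_module_M: "left_module R M"
  unfolding left_module_def
  using ring_klr abelian_group_M
  by (auto simp: carrier_M carrier_klr klr_simps klr_one add_M smult_M algebra_simps)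

lemma finsum_M: "finite A \<Longrightarrow> (\<Oplus>\<^bsub>M\<^esub>i\<in>A. \<pi> (f i)) = \<pi> (sum f A)"
proof (induction A rule: finite_induct)
  interpret abelian_group M by (rule abelian_group_M)
  case empty
  show ?case by (simp add: zero_M)
next
  interpret abelian_group M by (rule abelian_group_M)
  case (insert x F)
  then show ?case by (subst finsum_insert) (auto simp: carrier_M add_M)
qed

lemma finsum_M': "finite A \<Longrightarrow> (\<And>i. i \<in> A \<Longrightarrow> g i = \<pi> (f i)) \<Longrightarrow> (\<Oplus>\<^bsub>M\<^esub>i\<in>A. g i) = \<pi> (sum f A)"
proof -
  interpret abelian_group M by (rule abelian_group_M)
  assume a: "finite A" "\<And>i. i \<in> A \<Longrightarrow> g i = \<pi> (f i)"
  have "(\<Oplus>\<^bsub>M\<^esub>i\<in>A. g i) = (\<Oplus>\<^bsub>M\<^esub>i\<in>A. \<pi> (f i))"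
    by (rule finsum_cong') (use a in \<open>auto simp: carrier_M\<close>)
  then show ?thesis using finsum_M[OF a(1)] by simp
qed

lemma minus_M: "\<ominus>\<^bsub>M\<^esub> \<pi> p = \<pi> (- p)"
proof -
  interpret abelian_group M by (rule abelian_group_M)
  have "\<pi> (- p) \<oplus>\<^bsub>M\<^esub> \<pi> p = \<zero>\<^bsub>M\<^esub>" by (simp add: add_M zero_M)
  then show ?thesis using minus_equality carrier_M by blast
qed

lemma additive_subgroup_image:
  assumes "add_sg K"
  shows "additive_subgroup (\<pi> ` K) M"
proof -
  interpret abelian_group M by (rule abelian_group_M)
  have "subgroup (\<pi> ` K) (add_monoid M)"
  proof (rule group.subgroupI)
    show "group (add_monoid M)" by (rule a_group)
    show "\<pi> ` K \<subseteq> carrier (add_monoid M)" by (auto simp: carrier_M)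
    show "\<pi> ` K \<noteq> {}" using add_sg_0[OF assms] by auto
    fix a assume "a \<in> \<pi> ` K"
    then obtain p where p: "p \<in> K" "a = \<pi> p" by auto
    have "inv\<^bsub>add_monoid M\<^esub> a = \<pi> (- p)" using minus_M[of p] p by (simp add: a_inv_def)
    then show "inv\<^bsub>add_monoid M\<^esub> a \<in> \<pi> ` K" using p add_sg_uminus[OF assms] by auto
  next
    fix a b assume "a \<in> \<pi> ` K" "b \<in> \<pi> ` K"
    then show "a \<otimes>\<^bsub>add_monoid M\<^esub> b \<in> \<pi> ` K" using add_sg_add[OF assms] by (auto simp: add_M)
  qed
  then show ?thesis by (rule additive_subgroup.intro)
qed

text \<open>The grading of a record sums over the exact support; here the support is replaced by any
  finite set containing it, at the cost of terms in \<open>L\<close>.\<close>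

lemma grade_finsum:
  assumes "finite D" "{d. g d \<noteq> \<zero>\<^bsub>M\<^esub>} \<subseteq> D" "\<And>d. g d = \<pi> (h d)"
  shows "(\<Oplus>\<^bsub>M\<^esub>d\<in>{d. g d \<noteq> \<zero>\<^bsub>M\<^esub>}. g d) = \<pi> (sum h D)"
proof -
  let ?S = "{d. g d \<noteq> \<zero>\<^bsub>M\<^esub>}"
  have "(\<Oplus>\<^bsub>M\<^esub>d\<in>?S. g d) = \<pi> (sum h ?S)"
    by (rule finsum_M') (use assms finite_subset in auto)
  moreover have "sum h D = sum h ?S + sum h (D - ?S)"
    by (metis add.commute assms(1,2) sum.subset_diff)
  moreover have "sum h (D - ?S) \<in> L"
  proof (rule add_sg_sum[OF sgL])
    fix d assume "d \<in> D - ?S"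
    then have "\<pi> (h d) = \<pi> 0" using assms(3)[of d] zero_M by auto
    then show "h d \<in> L" by (simp add: eq_M)
  qed
  ultimately show ?thesis using add_sg_uminus[OF sgL] by (simp add: eq_M)
qed

lemma graded_module_M: "graded_module R M"
  unfolding graded_module_def
proof (intro conjI allI ballI)
  show "left_module R M" by (rule left_module_M)
  fix d
  show "additive_subgroup (grade M d) M"
    unfolding grade_M by (rule additive_subgroup_image) (auto simp: add_sg_def homog_zero homog_diff)
next
  fix x assume "x \<in> carrier M"
  then obtain p where p: "x = \<pi> p" by (auto simp: carrier_M)
  obtain D f where D: "finite D" "\<forall>d\<in>D. homog n \<alpha> d (f d)" "p - (\<Sum>d\<in>D. f d) \<in> J n \<alpha>"
    using homog_decomp[of n \<alpha> p] by blast
  let ?h = "\<lambda>d. if d \<in> D then f d else 0"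
  let ?g = "\<lambda>d. \<pi> (?h d)"
  have s: "{d. ?g d \<noteq> \<zero>\<^bsub>M\<^esub>} \<subseteq> D" by (auto simp: zero_M)
  have "(\<Oplus>\<^bsub>M\<^esub>d\<in>{d. ?g d \<noteq> \<zero>\<^bsub>M\<^esub>}. ?g d) = \<pi> (sum ?h D)" by (rule grade_finsum[OF D(1) s refl])
  also have "\<dots> = x" using D(3) J_sub_L p add_sg_uminus[OF sgL, of "p - sum f D"] by (auto simp: eq_M)
  finally have x: "x = (\<Oplus>\<^bsub>M\<^esub>d\<in>{d. ?g d \<noteq> \<zero>\<^bsub>M\<^esub>}. ?g d)" by simp
  show "\<exists>!f. (\<forall>d. f d \<in> grade M d) \<and> finite {d. f d \<noteq> \<zero>\<^bsub>M\<^esub>} \<and> x = (\<Oplus>\<^bsub>M\<^esub>d\<in>{d. f d \<noteq> \<zero>\<^bsub>M\<^esub>}. f d)"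
  proof (rule ex1I[of _ ?g])
    show "(\<forall>d. ?g d \<in> grade M d) \<and> finite {d. ?g d \<noteq> \<zero>\<^bsub>M\<^esub>} \<and> x = (\<Oplus>\<^bsub>M\<^esub>d\<in>{d. ?g d \<noteq> \<zero>\<^bsub>M\<^esub>}. ?g d)"
    proof (intro conjI allI x)
      show "?g d \<in> grade M d" for d
        unfolding grade_M using D(2) by (intro imageI) (simp add: homog_zero)
      show "finite {d. ?g d \<noteq> \<zero>\<^bsub>M\<^esub>}" by (rule finite_subset[OF s D(1)])
    qed
  next
    fix g assume g: "(\<forall>d. g d \<in> grade M d) \<and> finite {d. g d \<noteq> \<zero>\<^bsub>M\<^esub>} \<and> x = (\<Oplus>\<^bsub>M\<^esub>d\<in>{d. g d \<noteq> \<zero>\<^bsub>M\<^esub>}. g d)"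
    then have "\<forall>d. \<exists>h. homog n \<alpha> d h \<and> g d = \<pi> h" by (auto simp: grade_M)
    then obtain h where h: "\<And>d. homog n \<alpha> d (h d)" "\<And>d. g d = \<pi> (h d)" by metis
    \<comment> \<open>Both decompositions are written over one index set, so that independence
      applies to their difference.\<close>
    let ?D = "D \<union> {d. g d \<noteq> \<zero>\<^bsub>M\<^esub>}"
    have fin: "finite ?D" using D g by auto
    have "x = \<pi> (sum h ?D)" using g grade_finsum[OF fin _ h(2)] by auto
    moreover have "x = \<pi> (sum ?h ?D)"
    proof -
      have s2: "{d. ?g d \<noteq> \<zero>\<^bsub>M\<^esub>} \<subseteq> ?D" using s by (rule le_supI1)
      show ?thesis by (rule trans[OF x grade_finsum[OF fin s2 refl]])
    qed
    ultimately have "(\<Sum>d\<in>?D. h d - ?h d) \<in> L" by (simp add: sum_subtractf flip: eq_M)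
    then have c: "h d - ?h d \<in> L" if "d \<in> ?D" for d
      by (rule homog_direct[OF fin, rotated]) (use that h(1) D(2) in \<open>auto intro!: homog_diff homog_zero\<close>)
    show "g = ?g"
    proof
      fix d
      show "g d = ?g d"
      proof (cases "d \<in> ?D")
        case True then show ?thesis using c[OF True] by (simp only: h(2) eq_M)
      next
        case False then show ?thesis by (simp add: zero_M)
      qed
    qed
  qed
next
  fix i j r v assume "r \<in> grade R i" "v \<in> grade M j"
  then show "r \<odot>\<^bsub>M\<^esub> v \<in> grade M (i + j)"
    by (auto simp: grade_klr grade_M smult_M intro: homog_mult)
qed

lemma cscale_M: "cscale R M c (\<pi> p) = \<pi> (cs c p)"
  by (simp add: cscale_def klr_one klr_simps smult_M cs_mult_left)

lemma fin_dim_M: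
  assumes "finite B" "\<And>p. \<exists>c. p \<bumpeq>\<^bsub>L\<^esub> (\<Sum>b\<in>B. cs (c b) b)"
  shows "fin_dim R M"
  unfolding fin_dim_def
proof (intro exI[of _ "\<pi> ` B"] conjI ballI)
  fix x assume "x \<in> carrier M"
  then obtain p where p: "x = \<pi> p" by (auto simp: carrier_M)
  obtain c where c: "p \<bumpeq>\<^bsub>L\<^esub> (\<Sum>b\<in>B. cs (c b) b)" using assms(2) by blast
  \<comment> \<open>\<open>\<pi>\<close> may identify elements of \<open>B\<close>. One preimage is
    chosen for each image, and the coefficients over each fibre are added.\<close>
  define s where "s y = (SOME b. b \<in> B \<and> \<pi> b = y)" for y
  have s: "s (\<pi> b) \<in> B \<and> \<pi> (s (\<pi> b)) = \<pi> b" if "b \<in> B" for b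
    unfolding s_def by (rule someI[of _ b]) (use that in auto)
  let ?c = "\<lambda>y. \<Sum>b\<in>{b\<in>B. \<pi> b = y}. c b"
  have "(\<Sum>b\<in>B. cs (c b) b) \<bumpeq>\<^bsub>L\<^esub> (\<Sum>b\<in>B. cs (c b) (s (\<pi> b)))"
    using s by (intro eqv_sum eqv_cs) (metis eq_M eqv_def)
  also have "(\<Sum>b\<in>B. cs (c b) (s (\<pi> b))) = (\<Sum>y\<in>\<pi> ` B. \<Sum>b\<in>{b\<in>B. \<pi> b = y}. cs (c b) (s (\<pi> b)))"
    by (rule sum.image_gen[OF assms(1)])
  also have "\<dots> = (\<Sum>y\<in>\<pi> ` B. cs (?c y) (s y))"
  proof (rule sum.cong[OF refl])
    fix y
    have "(\<Sum>b\<in>{b\<in>B. \<pi> b = y}. cs (c b) (s (\<pi> b))) = (\<Sum>b\<in>{b\<in>B. \<pi> b = y}. cs (c b) (s y))"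
      by (rule sum.cong) auto
    also have "\<dots> = cs (?c y) (s y)"
      by (rule cs_sum_left[symmetric])
    finally show "(\<Sum>b\<in>{b\<in>B. \<pi> b = y}. cs (c b) (s (\<pi> b))) = cs (?c y) (s y)" .
  qed
  finally have "(\<Sum>b\<in>B. cs (c b) b) \<bumpeq>\<^bsub>L\<^esub> (\<Sum>y\<in>\<pi> ` B. cs (?c y) (s y))" .
  from eqv_trans[OF c this] have "x = \<pi> (\<Sum>y\<in>\<pi> ` B. cs (?c y) (s y))"
    by (simp only: p eq_M eqv_def)
  also have "\<dots> = (\<Oplus>\<^bsub>M\<^esub>y\<in>\<pi> ` B. cscale R M (?c y) y)"
  proof (rule finsum_M'[symmetric])
    show "finite (\<pi> ` B)" using assms(1) by simp
    fix y assume "y \<in> \<pi> ` B"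
    then have "\<pi> (s y) = y" using s by auto
    then show "cscale R M (?c y) y = \<pi> (cs (?c y) (s y))" using cscale_M[of "?c y" "s y"] by (simp only:)
  qed
  finally have "x = (\<Oplus>\<^bsub>M\<^esub>y\<in>\<pi> ` B. cscale R M (?c y) y)" .
  then show "\<exists>c. x = (\<Oplus>\<^bsub>M\<^esub>b\<in>\<pi> ` B. cscale R M (c b) b)" by (intro exI[of _ ?c])
qed (use assms(1) in \<open>auto simp: carrier_M\<close>)

text \<open>One half of the correspondence theorem for graded submodules of \<open>R/L\<close>; the
  preimage is stable under \<open>phi\<close> because its elements have homogeneous parts modulo
  \<open>L\<close>.\<close>

lemma graded_submodule_ideal:
  assumes "graded_submodule R M N"
  obtains K where "klr_graded_left n \<alpha> K" "L \<subseteq> K" "N = \<pi> ` K"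
proof -
  interpret abelian_group M by (rule abelian_group_M)
  define K where "K = {p. \<pi> p \<in> N}"
  have sub: "additive_subgroup N M" and act: "\<And>r v. r \<in> carrier R \<Longrightarrow> v \<in> N \<Longrightarrow> r \<odot>\<^bsub>M\<^esub> v \<in> N"
    and hom: "\<And>x. x \<in> N \<Longrightarrow> \<exists>D f. finite D \<and> (\<forall>d\<in>D. f d \<in> N \<inter> grade M d) \<and> x = (\<Oplus>\<^bsub>M\<^esub>d\<in>D. f d)"
    using assms unfolding graded_submodule_def by auto
  interpret N: additive_subgroup N M by (rule sub)
  have NK: "N = \<pi> ` K" using N.a_subset by (auto simp: K_def carrier_M)
  have LK: "L \<subseteq> K"
  proof
    fix p assume "p \<in> L"
    then have "\<pi> p = \<zero>\<^bsub>M\<^esub>" by (simp add: zero_M eq_M)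
    then show "p \<in> K" by (simp add: K_def N.zero_closed)
  qed
  have mul: "q * p \<in> K" if "p \<in> K" for p q
    using act[of "cls n \<alpha> q" "\<pi> p"] that by (simp add: K_def carrier_klr smult_M)
  have "klr_left n \<alpha> K"
  proof
    have "p + q \<in> K" if "p \<in> K" "q \<in> K" for p q
      using N.a_closed[of "\<pi> p" "\<pi> q"] that by (simp add: K_def add_M)
    then have "p - q \<in> K" if "p \<in> K" "q \<in> K" for p q
      using mul[of q "-1"] that by fastforce
    then show "add_sg K" using LK by (auto simp: add_sg_def)
  qed (use mul LK J_sub_L in auto)
  then have "klr_graded_left n \<alpha> K"
  proof (rule klr_graded_leftI[OF _ _ LK phi_L])
    fix p assume "p \<in> K"
    then obtain D g where D: "finite D" "\<forall>d\<in>D. g d \<in> N \<inter> grade M d" "\<pi> p = (\<Oplus>\<^bsub>M\<^esub>d\<in>D. g d)"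
      using hom[of "\<pi> p"] by (auto simp: K_def)
    have "\<forall>d\<in>D. \<exists>f. homog n \<alpha> d f \<and> g d = \<pi> f" using D(2) by (auto simp: grade_M)
    then obtain f where f: "\<forall>d\<in>D. homog n \<alpha> d (f d) \<and> g d = \<pi> (f d)" by metis
    have "\<pi> p = \<pi> (sum f D)" using D f finsum_M'[OF D(1), of g f] by auto
    then show "\<exists>D f. (\<forall>d\<in>D. homog n \<alpha> d (f d) \<and> f d \<in> K) \<and> p - (\<Sum>d\<in>D. f d) \<in> L"
      using f D(2) by (intro exI[of _ D] exI[of _ f]) (auto simp: eq_M K_def)
  qed
  then show ?thesis using that LK NK by blast
qed

lemma ideal_graded_submodule:
  assumes "klr_graded_left n \<alpha> K" "L \<subseteq> K"
  shows "graded_submodule R M (\<pi> ` K)"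
proof -
  interpret K: klr_graded_left n \<alpha> K by (rule assms(1))
  show ?thesis
    unfolding graded_submodule_def
  proof (intro conjI ballI)
    show "additive_subgroup (\<pi> ` K) M" by (rule additive_subgroup_image[OF K.sgL])
    fix r v assume "r \<in> carrier R" "v \<in> \<pi> ` K"
    then show "r \<odot>\<^bsub>M\<^esub> v \<in> \<pi> ` K" by (auto simp: carrier_klr smult_M K.L_mult)
  next
    fix x assume "x \<in> \<pi> ` K"
    then obtain p where p: "p \<in> K" "x = \<pi> p" by auto
    obtain D f where D: "finite D" "\<forall>d\<in>D. homog n \<alpha> d (f d) \<and> f d \<in> K" "p - (\<Sum>d\<in>D. f d) \<in> J n \<alpha>"
      using K.homog_parts[OF p(1)] by blast
    have "x = \<pi> (sum f D)" using D(3) J_sub_L p(2) by (auto simp: eq_M)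
    then show "\<exists>D f. finite D \<and> (\<forall>d\<in>D. f d \<in> \<pi> ` K \<inter> grade M d) \<and> x = (\<Oplus>\<^bsub>M\<^esub>d\<in>D. f d)"
      using D finsum_M[OF D(1), of f] by (intro exI[of _ D] exI[of _ "\<lambda>d. \<pi> (f d)"]) (auto simp: grade_M)
  qed
qed

lemma image_eq_carrier: "klr_left n \<alpha> K \<Longrightarrow> L \<subseteq> K \<Longrightarrow> \<pi> ` K = carrier M \<longleftrightarrow> 1 \<in> K"
proof
  assume K: "klr_left n \<alpha> K" "L \<subseteq> K"
  interpret K: klr_left n \<alpha> K by (rule K(1))
  show "1 \<in> K \<Longrightarrow> \<pi> ` K = carrier M"
    using K.L_mult[of 1] by (force simp: carrier_M)
  assume "\<pi> ` K = carrier M"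
  then obtain p where "p \<in> K" "\<pi> 1 = \<pi> p" by (metis carrier_M image_iff rangeI)
  then show "1 \<in> K" using K(2) K.L_add[of "1 - p" p] by (auto simp: eq_M)
qed

lemma image_eq_zero: "klr_left n \<alpha> K \<Longrightarrow> \<pi> ` K = {\<zero>\<^bsub>M\<^esub>} \<longleftrightarrow> K \<subseteq> L"
proof -
  assume "klr_left n \<alpha> K"
  then have "0 \<in> K" by (intro add_sg_0 klr_left.sgL)
  then have "\<pi> ` K = {\<zero>\<^bsub>M\<^esub>} \<longleftrightarrow> (\<forall>p\<in>K. \<pi> p = \<pi> 0)" unfolding zero_M by blast
  then show ?thesis by (auto simp: eq_M)
qed

lemma coset_M: "N = \<pi> ` K \<Longrightarrow> L \<subseteq> K \<Longrightarrow> klr_left n \<alpha> K \<Longrightarrow> N +>\<^bsub>M\<^esub> \<pi> p = \<pi> ` {x. x - p \<in> K}"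
proof -
  assume a: "N = \<pi> ` K" "L \<subseteq> K" "klr_left n \<alpha> K"
  have "N +>\<^bsub>M\<^esub> \<pi> p = (\<lambda>x. \<pi> (x + p)) ` K"
    by (auto simp: a_r_coset_def' a(1) add_M)
  also have "\<dots> = \<pi> ` {x. x - p \<in> K}"
    by (force simp: image_iff)
  finally show ?thesis .
qed

text \<open>\<open>R/L\<close> modulo the image of \<open>K\<close> is \<open>R/K\<close>. So
  quotients, and submodules of quotients, are again governed by left ideals.\<close>

lemma presented_quot:
  assumes K: "klr_graded_left n \<alpha> K" "L \<subseteq> K"
  shows "presented n \<alpha> K (quot_mod M (\<pi> ` K)) (\<lambda>p. \<pi> ` K +>\<^bsub>M\<^esub> \<pi> p)"
proof -
  interpret K: klr_graded_left n \<alpha> K by (rule K(1))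
  note cs = coset_M[OF refl K(2) K.klr_left_axioms]
  let ?N = "\<pi> ` K"
  have up: "x - p \<in> K" if "\<pi> x = \<pi> y" "y - p \<in> K" for x y p
    using K.L_add[of "x - y" "y - p"] that K(2) by (auto simp: eq_M)
  have eq: "\<pi> ` {x. x - p \<in> K} = \<pi> ` {x. x - q \<in> K} \<longleftrightarrow> p - q \<in> K" for p q
  proof
    assume "\<pi> ` {x. x - p \<in> K} = \<pi> ` {x. x - q \<in> K}"
    moreover have "\<pi> p \<in> \<pi> ` {x. x - p \<in> K}" by auto
    ultimately obtain y where "\<pi> p = \<pi> y" "y - q \<in> K" by auto
    then show "p - q \<in> K" by (rule up)
  next
    assume h: "p - q \<in> K"
    have "x - p \<in> K \<longleftrightarrow> x - q \<in> K" for x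
      using K.L_add[OF _ h, of "x - p"] K.L_diff[OF _ h, of "x - q"] by auto
    then show "\<pi> ` {x. x - p \<in> K} = \<pi> ` {x. x - q \<in> K}" by simp
  qed
  show ?thesis
  proof
    show "carrier (quot_mod M ?N) = range (\<lambda>p. ?N +>\<^bsub>M\<^esub> \<pi> p)"
      by (auto simp: quot_mod_def A_RCOSETS_def' carrier_M)
    show "(?N +>\<^bsub>M\<^esub> \<pi> p) \<oplus>\<^bsub>quot_mod M ?N\<^esub> (?N +>\<^bsub>M\<^esub> \<pi> q) = ?N +>\<^bsub>M\<^esub> \<pi> (p + q)" for p q
    proof -
      have "set_add M (\<pi> ` {x. x - p \<in> K}) (\<pi> ` {x. x - q \<in> K}) = \<pi> ` {x. x - (p + q) \<in> K}" (is "?A = ?B")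
      proof
        show "?A \<subseteq> ?B"
        proof
          fix z assume "z \<in> ?A"
          then obtain x y where "x - p \<in> K" "y - q \<in> K" "z = \<pi> (x + y)"
            by (auto simp: set_add_def' add_M)
          then show "z \<in> ?B" using K.L_add[of "x - p" "y - q"] by (auto simp: algebra_simps)
        qed
        show "?B \<subseteq> ?A"
        proof
          fix z assume "z \<in> ?B"
          then obtain x where x: "x - (p + q) \<in> K" "z = \<pi> x" by auto
          then have "z = \<pi> (x - q) \<oplus>\<^bsub>M\<^esub> \<pi> q" "x - q - p \<in> K" "q - q \<in> K" by (auto simp: add_M algebra_simps)
          then show "z \<in> ?A" unfolding set_add_def' by blast
        qed
      qed
      then show ?thesis by (simp add: quot_mod_def cs)
    qed
    show "cls n \<alpha> q \<odot>\<^bsub>quot_mod M ?N\<^esub> (?N +>\<^bsub>M\<^esub> \<pi> p) = ?N +>\<^bsub>M\<^esub> \<pi> (q * p)" for q p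
    proof -
      have "\<pi> ` {z. z - q * x \<in> K} = \<pi> ` {z. z - q * p \<in> K}" if "x - p \<in> K" for x
        using K.L_mult[OF that, of q] by (simp add: eq algebra_simps)
      moreover have "p - p \<in> K" by simp
      ultimately have "(\<Union>x\<in>{x. x - p \<in> K}. \<pi> ` {z. z - q * x \<in> K}) = \<pi> ` {z. z - q * p \<in> K}" by blast
      then show ?thesis by (simp add: quot_mod_def cs smult_M)
    qed
    show "\<zero>\<^bsub>quot_mod M ?N\<^esub> = ?N +>\<^bsub>M\<^esub> \<pi> 0" by (simp add: quot_mod_def cs)
    show "(?N +>\<^bsub>M\<^esub> \<pi> p = ?N +>\<^bsub>M\<^esub> \<pi> q) = (p - q \<in> K)" for p q by (simp add: cs eq)
    show "grade (quot_mod M ?N) d = (\<lambda>p. ?N +>\<^bsub>M\<^esub> \<pi> p) ` {p. homog n \<alpha> d p}" for d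
      by (auto simp: quot_mod_def grade_M)
  qed
qed

lemma sub_mod_carrier: "sub_mod M (carrier M) = M"
proof -
  have "(\<lambda>d. grade M d \<inter> carrier M) = grade M"
    by (rule ext) (auto simp: grade_M carrier_M)
  then show ?thesis by (simp add: sub_mod_def)
qed

lemma irreducible_semisimple:
  assumes "irreducible_graded R M"
  shows "semisimple_graded R M"
proof -
  interpret abelian_group M by (rule abelian_group_M)
  have "klr_graded_left n \<alpha> UNIV"
    by (intro klr_graded_left.intro klr_left.intro klr_graded_left_axioms.intro) (auto simp: add_sg_def)
  then have g: "graded_submodule R M (carrier M)"
    using ideal_graded_submodule[of UNIV] by (simp add: carrier_M)
  have ex: "\<exists>!f. f \<in> (\<Pi>\<^sub>E i\<in>{..<1::nat}. carrier M) \<and> x = (\<Oplus>\<^bsub>M\<^esub>i\<in>{..<1}. f i)" if x: "x \<in> carrier M" for x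
  proof (rule ex1I[of _ "\<lambda>i\<in>{..<1}. x"])
    have s: "(\<Oplus>\<^bsub>M\<^esub>i\<in>{..<1::nat}. f i) = f 0" if "f \<in> (\<Pi>\<^sub>E i\<in>{..<1::nat}. carrier M)" for f
    proof -
      have "{..<1::nat} = {0}" by auto
      then show ?thesis using that by (simp add: PiE_iff)
    qed
    show f: "(\<lambda>i\<in>{..<1}. x) \<in> (\<Pi>\<^sub>E i\<in>{..<1::nat}. carrier M) \<and> x = (\<Oplus>\<^bsub>M\<^esub>i\<in>{..<1::nat}. (\<lambda>i\<in>{..<1}. x) i)"
    proof
      show m: "(\<lambda>i\<in>{..<1}. x) \<in> (\<Pi>\<^sub>E i\<in>{..<1::nat}. carrier M)" using x by auto
      show "x = (\<Oplus>\<^bsub>M\<^esub>i\<in>{..<1::nat}. (\<lambda>i\<in>{..<1}. x) i)" by (subst s[OF m]) simp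
    qed
    fix f assume f: "f \<in> (\<Pi>\<^sub>E i\<in>{..<1::nat}. carrier M) \<and> x = (\<Oplus>\<^bsub>M\<^esub>i\<in>{..<1}. f i)"
    then have "x = f 0" using s by simp
    then show "f = (\<lambda>i\<in>{..<1}. x)" using f by (auto simp: fun_eq_iff PiE_iff extensional_def)
  qed
  show ?thesis
    unfolding semisimple_graded_def
    using assms g ex unfolding irreducible_graded_def
    by (intro conjI exI[of _ "1::nat"] exI[of _ "\<lambda>_. carrier M"])
      (use assms in \<open>auto simp: sub_mod_carrier irreducible_graded_def\<close>)
qed

end

section \<open>The head of a cyclic module with one-dimensional top weight space\<close>

inductive nz :: "nat \<Rightarrow> nat multiset \<Rightarrow> falg \<Rightarrow> bool" for n \<alpha> where
  nz_homog: "homog n \<alpha> d p \<Longrightarrow> d \<noteq> 0 \<Longrightarrow> nz n \<alpha> p"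
| nz_add: "nz n \<alpha> p \<Longrightarrow> nz n \<alpha> q \<Longrightarrow> nz n \<alpha> (p + q)"

lemma nz_zero: "nz n \<alpha> 0"
  by (rule nz_homog[OF homog_zero, of 1]) simp

lemma nz_sum: "(\<And>i. i \<in> A \<Longrightarrow> nz n \<alpha> (f i)) \<Longrightarrow> nz n \<alpha> (sum f A)"
  by (induction A rule: infinite_finite_induct) (auto intro: nz_add nz_zero)

lemma nz_uminus: "nz n \<alpha> p \<Longrightarrow> nz n \<alpha> (- p)"
proof (induction rule: nz.induct)
  case (nz_add p q)
  have "nz n \<alpha> (- p + - q)" by (rule nz.nz_add) (use nz_add in auto)
  then show ?case by (simp add: algebra_simps)
qed (auto intro: nz_homog homog_uminus)

lemma nz_decomp: "nz n \<alpha> p \<Longrightarrow>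
  \<exists>D f. finite D \<and> 0 \<notin> D \<and> (\<forall>d\<in>D. homog n \<alpha> d (f d)) \<and> p = (\<Sum>d\<in>D. f d)"
proof (induction rule: nz.induct)
  case (nz_homog d p)
  then show ?case by (intro exI[of _ "{d}"] exI[of _ "\<lambda>_. p"]) auto
next
  case (nz_add p q)
  then obtain D f D' f' where D: "finite D" "0 \<notin> D" "\<forall>d\<in>D. homog n \<alpha> d (f d)" "p = (\<Sum>d\<in>D. f d)"
    and D': "finite D'" "0 \<notin> D'" "\<forall>d\<in>D'. homog n \<alpha> d (f' d)" "q = (\<Sum>d\<in>D'. f' d)" by blast
  let ?g = "\<lambda>d. (if d \<in> D then f d else 0) + (if d \<in> D' then f' d else 0)"
  have "(\<Sum>d\<in>D \<union> D'. ?g d) = p + q"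
    using D D' by (simp add: sum.distrib sum.If_cases Int_absorb1)
  then show ?case using D D' by (intro exI[of _ "D \<union> D'"] exI[of _ ?g]) (auto intro!: homog_add homog_zero)
qed

lemma degree0_split: "\<exists>u r. homog n \<alpha> 0 u \<and> nz n \<alpha> r \<and> p - (u + r) \<in> J n \<alpha>"
proof -
  obtain D f where D: "finite D" "\<forall>d\<in>D. homog n \<alpha> d (f d)" "p - (\<Sum>d\<in>D. f d) \<in> J n \<alpha>"
    using homog_decomp[of n \<alpha> p] by blast
  let ?u = "if 0 \<in> D then f 0 else 0"
  have "(\<Sum>d\<in>D. f d) = ?u + (\<Sum>d\<in>D - {0}. f d)"
    using D(1) by (simp add: sum.remove)
  moreover have "homog n \<alpha> 0 ?u" using D(2) homog_zero by auto
  moreover have "nz n \<alpha> (\<Sum>d\<in>D - {0}. f d)" by (rule nz_sum) (use D(2) in \<open>auto intro: nz_homog\<close>)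
  ultimately show ?thesis using D(3) by (intro exI[of _ ?u] exI[of _ "\<Sum>d\<in>D - {0}. f d"]) simp
qed

lemma (in klr_graded_left) degree0_unique:
  assumes "homog n \<alpha> 0 u" "nz n \<alpha> r" "u + r \<in> L"
  shows "u \<in> L"
proof -
  obtain D f where D: "finite D" "0 \<notin> D" "\<forall>d\<in>D. homog n \<alpha> d (f d)" "r = (\<Sum>d\<in>D. f d)"
    using nz_decomp[OF assms(2)] by blast
  let ?g = "\<lambda>d. if d = 0 then u else f d"
  have "(\<Sum>d\<in>D. ?g d) = (\<Sum>d\<in>D. f d)" by (rule sum.cong) (use D(2) in auto)
  then have s: "(\<Sum>d\<in>insert 0 D. ?g d) \<in> L" using D assms(3) by simp
  have "?g 0 \<in> L" by (rule homog_direct[OF _ _ s]) (use D assms(1) in auto)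
  then show ?thesis by simp
qed

text \<open>The abstract situation of the overview: a cyclic module whose part of degree 0 and
  weight \<open>i0\<close> is spanned by the generator. \<open>B\<close> provides finite
  dimension.\<close>

locale local_module = presented n \<alpha> L M \<pi> for n \<alpha> L and M :: "(klr_elt, 'm) graded" and \<pi> +
  fixes i0 :: "nat list" and B :: "falg set"
  assumes i0: "i0 \<in> seqs n \<alpha>" and E_one: "E i0 - 1 \<in> L" and one_notin: "1 \<notin> L"
    and deg0: "homog n \<alpha> 0 p \<Longrightarrow> \<exists>c. E i0 * p \<bumpeq>\<^bsub>L\<^esub> cs c 1"
    and finB: "finite B" and spanB: "\<exists>c. p \<bumpeq>\<^bsub>L\<^esub> (\<Sum>b\<in>B. cs (c b) b)"
begin

text \<open>The component in degree 0 and weight \<open>i0\<close> vanishes. That this does not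
  depend on the chosen decomposition is \<open>van_iff\<close>.\<close>

definition van :: "falg \<Rightarrow> bool" where
  "van p \<longleftrightarrow> (\<exists>u r. homog n \<alpha> 0 u \<and> nz n \<alpha> r \<and> p \<bumpeq>\<^bsub>L\<^esub> u + r \<and> E i0 * u \<in> L)"

lemma van_iff: "homog n \<alpha> 0 u \<Longrightarrow> nz n \<alpha> r \<Longrightarrow> p \<bumpeq>\<^bsub>L\<^esub> u + r \<Longrightarrow> van p \<longleftrightarrow> E i0 * u \<in> L"
proof
  assume a: "homog n \<alpha> 0 u" "nz n \<alpha> r" "p \<bumpeq>\<^bsub>L\<^esub> u + r"
  then show "E i0 * u \<in> L \<Longrightarrow> van p" unfolding van_def by blast
  assume "van p"
  then obtain u' r' where b: "homog n \<alpha> 0 u'" "nz n \<alpha> r'" "p \<bumpeq>\<^bsub>L\<^esub> u' + r'" "E i0 * u' \<in> L"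
    unfolding van_def by blast
  have "u + r \<bumpeq>\<^bsub>L\<^esub> u' + r'" using eqv_trans[OF eqv_sym[OF a(3)] b(3)] .
  then have "(u - u') + (r + - r') \<in> L" by (simp add: eqv_def algebra_simps)
  then have "u - u' \<in> L" by (rule degree0_unique[OF homog_diff[OF a(1) b(1)] nz_add[OF a(2) nz_uminus[OF b(2)]]])
  then have "E i0 * u \<bumpeq>\<^bsub>L\<^esub> E i0 * u'" by (intro eqv_mult) (simp add: eqv_def)
  then show "E i0 * u \<in> L" using L_cong b(4) by blast
qed

lemma split_ex: "\<exists>u r. homog n \<alpha> 0 u \<and> nz n \<alpha> r \<and> p \<bumpeq>\<^bsub>L\<^esub> u + r"
  using degree0_split[of n \<alpha> p] J_eqv by blast

lemma van_add: "van p \<Longrightarrow> van q \<Longrightarrow> van (p + q)"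
proof -
  assume a: "van p" "van q"
  obtain u r where u: "homog n \<alpha> 0 u" "nz n \<alpha> r" "p \<bumpeq>\<^bsub>L\<^esub> u + r" "E i0 * u \<in> L" using a(1) unfolding van_def by blast
  obtain u' r' where u': "homog n \<alpha> 0 u'" "nz n \<alpha> r'" "q \<bumpeq>\<^bsub>L\<^esub> u' + r'" "E i0 * u' \<in> L" using a(2) unfolding van_def by blast
  have "p + q \<bumpeq>\<^bsub>L\<^esub> (u + u') + (r + r')" using eqv_add[OF u(3) u'(3)] by (simp add: algebra_simps)
  from van_iff[OF homog_add[OF u(1) u'(1)] nz_add[OF u(2) u'(2)] this]
  show ?thesis using L_add[OF u(4) u'(4)] by (simp add: distrib_left)
qed

lemma van_L: "p \<in> L \<Longrightarrow> van p"
  using van_iff[OF homog_zero nz_zero, of p] by simp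

lemma van_cong: "p \<bumpeq>\<^bsub>L\<^esub> q \<Longrightarrow> van q \<Longrightarrow> van p"
  using van_add[OF van_L[of "p - q"], of q] by (simp add: eqv_def)

lemma van_sum: "(\<And>i. i \<in> A \<Longrightarrow> van (f i)) \<Longrightarrow> van (sum f A)"
  by (induction A rule: infinite_finite_induct) (auto intro: van_add van_L)

lemma van_nz: "homog n \<alpha> d p \<Longrightarrow> d \<noteq> 0 \<Longrightarrow> van p"
  using van_iff[OF homog_zero nz_homog, of d p p] by simp

text \<open>The vectors that generate a submodule without component on the line through the
  generator: the largest left ideal inside \<open>van\<close>.\<close>

definition Lmax :: "falg set" where "Lmax = {p. \<forall>q. van (q * p)}"

lemma L_sub_Lmax: "L \<subseteq> Lmax"
  by (auto simp: Lmax_def intro: van_L L_mult)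

lemma klr_left_Lmax: "klr_left n \<alpha> Lmax"
proof
  have m: "q * p \<in> Lmax" if "p \<in> Lmax" for p q
    using that by (auto simp: Lmax_def simp flip: mult.assoc)
  have "p + q \<in> Lmax" if "p \<in> Lmax" "q \<in> Lmax" for p q
    using that by (auto simp: Lmax_def distrib_left intro: van_add)
  then have "p - q \<in> Lmax" if "p \<in> Lmax" "q \<in> Lmax" for p q
    using m[of q "-1"] that by fastforce
  then show "add_sg Lmax" using L_sub_Lmax by (auto simp: add_sg_def)
  show "q * p \<in> Lmax" if "p \<in> Lmax" for p q by (rule m[OF that])
qed (use L_sub_Lmax J_sub_L in auto)

text \<open>For a homogeneous \<open>q\<close> of degree \<open>- d\<close> the part of degree 0 of
  \<open>q * p\<close> is \<open>q\<close> times the component of \<open>p\<close> in degree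
  \<open>d\<close>. For other degrees of \<open>q\<close> there is nothing in degree 0 to
  test.\<close>

lemma Lmax_part:
  assumes p: "p \<in> Lmax" and D: "finite D" "\<forall>d\<in>D. homog n \<alpha> d (f d)" "p - (\<Sum>d\<in>D. f d) \<in> J n \<alpha>" and d: "d \<in> D"
  shows "f d \<in> Lmax"
proof -
  have h: "van (q * f d)" if q: "homog n \<alpha> e q" for q e
  proof (cases "e + d = 0")
    case False
    then show ?thesis using homog_mult[OF q] D(2) d van_nz by blast
  next
    case True
    let ?r = "\<Sum>c\<in>D - {d}. q * f c"
    have u: "homog n \<alpha> 0 (q * f d)" using homog_mult[OF q] D(2) d True by metis
    have r: "nz n \<alpha> ?r"
    proof (rule nz_sum)
      fix c assume c: "c \<in> D - {d}"
      then have "e + c \<noteq> 0" using True by auto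
      then show "nz n \<alpha> (q * f c)" using homog_mult[OF q] D(2) c nz_homog by blast
    qed
    have "q * p \<bumpeq>\<^bsub>L\<^esub> q * (\<Sum>d\<in>D. f d)" by (rule eqv_mult[OF J_eqv[OF D(3)]])
    also have "q * (\<Sum>d\<in>D. f d) = q * f d + ?r"
      using D(1) d by (simp add: sum_distrib_left sum.remove distrib_left)
    finally have e: "q * p \<bumpeq>\<^bsub>L\<^esub> q * f d + ?r" .
    have "van (q * p)" using p by (simp add: Lmax_def)
    then have "E i0 * (q * f d) \<in> L" using van_iff[OF u r e] by simp
    then show ?thesis using van_iff[OF u nz_zero] by simp
  qed
  have "van (q * f d)" for q
  proof -
    obtain A g where A: "\<forall>e\<in>A. homog n \<alpha> e (g e)" "q - (\<Sum>e\<in>A. g e) \<in> J n \<alpha>"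
      using homog_decomp[of n \<alpha> q] by blast
    have "q * f d \<bumpeq>\<^bsub>L\<^esub> (\<Sum>e\<in>A. g e * f d)"
      using cls_act_J[OF A(2), of "f d"] by (simp add: sum_distrib_right)
    moreover have "van (\<Sum>e\<in>A. g e * f d)" by (rule van_sum) (use A(1) h in blast)
    ultimately show ?thesis by (rule van_cong)
  qed
  then show ?thesis by (simp add: Lmax_def)
qed

lemma klr_graded_Lmax: "klr_graded_left n \<alpha> Lmax"
proof (rule klr_graded_leftI[OF klr_left_Lmax _ L_sub_Lmax phi_L])
  fix p assume p: "p \<in> Lmax"
  obtain D f where D: "finite D" "\<forall>d\<in>D. homog n \<alpha> d (f d)" "p - (\<Sum>d\<in>D. f d) \<in> J n \<alpha>"
    using homog_decomp[of n \<alpha> p] by blast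
  have "p - (\<Sum>d\<in>D. f d) \<in> L" using D(3) J_sub_L by blast
  then show "\<exists>D f. (\<forall>d\<in>D. homog n \<alpha> d (f d) \<and> f d \<in> Lmax) \<and> p - (\<Sum>d\<in>D. f d) \<in> L"
    using Lmax_part[OF p D] D(2) by (intro exI[of _ D] exI[of _ f]) simp
qed

lemma E_one_act: "E i0 \<bumpeq>\<^bsub>L\<^esub> 1"
  using E_one by (simp add: eqv_def)

lemma one_notin_Lmax: "1 \<notin> Lmax"
proof
  assume "1 \<in> Lmax"
  then have "van (E i0 * 1)" by (simp only: Lmax_def mem_Collect_eq)
  then have v: "van (E i0)" by simp
  have "E i0 * E i0 \<in> L"
    using van_iff[OF homog_gens(1)[OF i0] nz_zero, of "E i0"] v by simp
  moreover have "E i0 * E i0 \<bumpeq>\<^bsub>L\<^esub> E i0 * 1" by (rule eqv_mult[OF E_one_act])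
  ultimately have "E i0 \<in> L" using L_cong by simp
  then show False using L_cong[OF E_one_act] one_notin by simp
qed

text \<open>A graded \<open>K\<close> contains with every element its component of degree 0 and
  weight \<open>i0\<close>, which is a scalar modulo \<open>L\<close>. A non-zero scalar would bring
  1 into \<open>K\<close>.\<close>

lemma Lmax_maximal:
  assumes "klr_graded_left n \<alpha> K" "L \<subseteq> K" "1 \<notin> K"
  shows "K \<subseteq> Lmax"
proof
  interpret K: klr_graded_left n \<alpha> K by (rule assms(1))
  fix p assume p: "p \<in> K"
  have "van (q * p)" for q
  proof -
    obtain u r where u: "homog n \<alpha> 0 u" "nz n \<alpha> r" "q * p \<bumpeq>\<^bsub>L\<^esub> u + r" using split_ex by blast
    have "q * p \<bumpeq>\<^bsub>K\<^esub> u + r" using u(3) assms(2) by (auto simp: eqv_def)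
    then have "u + r \<in> K" using K.L_cong K.L_mult[OF p] by blast
    then have "u \<in> K" by (rule K.degree0_unique[OF u(1,2)])
    then have Eu: "E i0 * u \<in> K" by (rule K.L_mult)
    obtain c where c: "E i0 * u \<bumpeq>\<^bsub>L\<^esub> cs c 1" using deg0[OF u(1)] by blast
    then have "E i0 * u \<bumpeq>\<^bsub>K\<^esub> cs c 1" using assms(2) by (auto simp: eqv_def)
    then have ck: "cs c 1 \<in> K" using K.L_cong Eu by blast
    have "c = 0"
    proof (rule ccontr)
      assume "c \<noteq> 0"
      then have "1 = cs (inverse c) (cs c (1 :: falg))" by (simp add: cs.sc_mult cs.sc_one)
      then have "1 \<in> K" using K.L_cs[OF ck, of "inverse c"] by simp
      then show False using assms(3) by simp
    qed
    then have "E i0 * u \<in> L" using c by (simp add: cs.sc_zero)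
    then show ?thesis using van_iff[OF u] by simp
  qed
  then show "p \<in> Lmax" by (simp add: Lmax_def)
qed

abbreviation "Nmax \<equiv> \<pi> ` Lmax"

lemma presented_max: "presented n \<alpha> Lmax (quot_mod M Nmax) (\<lambda>p. Nmax +>\<^bsub>M\<^esub> \<pi> p)"
  by (rule presented_quot[OF klr_graded_Lmax L_sub_Lmax])

lemma fin_dim_quot:
  assumes "klr_graded_left n \<alpha> K" "L \<subseteq> K"
  shows "fin_dim R (quot_mod M (\<pi> ` K))"
proof -
  interpret Q: presented n \<alpha> K "quot_mod M (\<pi> ` K)" "\<lambda>p. \<pi> ` K +>\<^bsub>M\<^esub> \<pi> p"
    by (rule presented_quot[OF assms])
  have "\<exists>c. p \<bumpeq>\<^bsub>K\<^esub> (\<Sum>b\<in>B. cs (c b) b)" for p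
    using spanB[of p] assms(2) by (auto simp: eqv_def)
  then show ?thesis by (rule Q.fin_dim_M[OF finB])
qed

lemma irreducible_max: "irreducible_graded R (quot_mod M Nmax)"
proof -
  interpret Q: presented n \<alpha> Lmax "quot_mod M Nmax" "\<lambda>p. Nmax +>\<^bsub>M\<^esub> \<pi> p" by (rule presented_max)
  show ?thesis
    unfolding irreducible_graded_def
  proof (intro conjI allI impI)
    show "graded_module R (quot_mod M Nmax)" by (rule Q.graded_module_M)
    show "fin_dim R (quot_mod M Nmax)" by (rule fin_dim_quot[OF klr_graded_Lmax L_sub_Lmax])
    have "Nmax +>\<^bsub>M\<^esub> \<pi> 1 \<noteq> Nmax +>\<^bsub>M\<^esub> \<pi> 0" using one_notin_Lmax unfolding Q.eq_M by simp
    then show "carrier (quot_mod M Nmax) \<noteq> {\<zero>\<^bsub>quot_mod M Nmax\<^esub>}"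
      unfolding Q.carrier_M Q.zero_M by blast
    fix N assume "graded_submodule R (quot_mod M Nmax) N"
    then obtain K where K: "klr_graded_left n \<alpha> K" "Lmax \<subseteq> K" "N = (\<lambda>p. Nmax +>\<^bsub>M\<^esub> \<pi> p) ` K"
      by (rule Q.graded_submodule_ideal)
    have Kl: "klr_left n \<alpha> K" using K(1) by (rule klr_graded_left.axioms)
    show "N = {\<zero>\<^bsub>quot_mod M Nmax\<^esub>} \<or> N = carrier (quot_mod M Nmax)"
    proof (cases "1 \<in> K")
      case True
      then show ?thesis using Q.image_eq_carrier[OF Kl K(2)] K(3) by simp
    next
      case False
      then have "K \<subseteq> Lmax" using Lmax_maximal[OF K(1)] K(2) L_sub_Lmax by blast
      then show ?thesis using Q.image_eq_zero[OF Kl] K(3) by simp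
    qed
  qed
qed

text \<open>\<open>Nmax\<close> takes part in the intersection because its quotient is irreducible.
  Conversely let a proper \<open>K\<close> have a semisimple quotient. Were all simple summands
  proper, they would come from \<open>Lmax\<close>, and so would their sum, which contains the class
  of 1. So one summand is everything, the quotient is irreducible, and \<open>Lmax\<close> is
  contained in \<open>K\<close>.\<close>

lemma radical_eq: "radical R M = Nmax"
proof
  interpret Q: presented n \<alpha> Lmax "quot_mod M Nmax" "\<lambda>p. Nmax +>\<^bsub>M\<^esub> \<pi> p" by (rule presented_max)
  have "graded_submodule R M Nmax" by (rule ideal_graded_submodule[OF klr_graded_Lmax L_sub_Lmax])
  moreover have "semisimple_graded R (quot_mod M Nmax)" by (rule Q.irreducible_semisimple[OF irreducible_max])
  ultimately show "radical R M \<subseteq> Nmax" unfolding radical_def by blast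
  show "Nmax \<subseteq> radical R M"
    unfolding radical_def
  proof (rule Inter_greatest)
    fix N assume "N \<in> {N. graded_submodule R M N \<and> semisimple_graded R (quot_mod M N)}"
    then have N: "graded_submodule R M N" "semisimple_graded R (quot_mod M N)" by auto
    from N(1) obtain K where K: "klr_graded_left n \<alpha> K" "L \<subseteq> K" "N = \<pi> ` K" by (rule graded_submodule_ideal)
    have Kl: "klr_left n \<alpha> K" using K(1) by (rule klr_graded_left.axioms)
    show "Nmax \<subseteq> N"
    proof (cases "1 \<in> K")
      case True
      then have "N = carrier M" using image_eq_carrier[OF Kl K(2)] K(3) by simp
      then show ?thesis by (auto simp: carrier_M)
    next
      case False
      then have KL: "K \<subseteq> Lmax" by (rule Lmax_maximal[OF K(1,2)])
      let ?Q = "quot_mod M N" and ?q = "\<lambda>p. N +>\<^bsub>M\<^esub> \<pi> p"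
      interpret P: presented n \<alpha> K ?Q ?q unfolding K(3) by (rule presented_quot[OF K(1,2)])
      have "\<exists>(k::nat) S. (\<forall>i<k. graded_submodule R ?Q (S i) \<and> irreducible_graded R (sub_mod ?Q (S i))) \<and>
        (\<forall>x\<in>carrier ?Q. \<exists>!f. f \<in> (\<Pi>\<^sub>E i\<in>{..<k}. S i) \<and> x = (\<Oplus>\<^bsub>?Q\<^esub>i\<in>{..<k}. f i))"
        using N(2)[unfolded semisimple_graded_def] by (rule conjunct2[OF conjunct2])
      then obtain k S where kS: "\<forall>i<(k::nat). graded_submodule R ?Q (S i) \<and> irreducible_graded R (sub_mod ?Q (S i))"
        and dec: "\<forall>x\<in>carrier ?Q. \<exists>!f. f \<in> (\<Pi>\<^sub>E i\<in>{..<k}. S i) \<and> x = (\<Oplus>\<^bsub>?Q\<^esub>i\<in>{..<k}. f i)"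
        by (elim exE conjE)
      have S: "graded_submodule R ?Q (S i)" "irreducible_graded R (sub_mod ?Q (S i))" if "i < k" for i
        using kS that by auto
      have "\<exists>i<k. S i = carrier ?Q"
      proof (rule ccontr)
        assume no: "\<not> (\<exists>i<k. S i = carrier ?Q)"
        have sub: "\<exists>A. A \<subseteq> Lmax \<and> S i = ?q ` A" if i: "i < k" for i
        proof -
          obtain A where A: "klr_graded_left n \<alpha> A" "K \<subseteq> A" "S i = ?q ` A"
            using S(1)[OF i] by (rule P.graded_submodule_ideal)
          have Al: "klr_left n \<alpha> A" using A(1) by (rule klr_graded_left.axioms)
          have "1 \<notin> A" using P.image_eq_carrier[OF Al A(2)] A(3) no i by auto
          then show ?thesis using Lmax_maximal[OF A(1)] A K(2) by blast
        qed
        have "?q 1 \<in> carrier ?Q" by (simp add: P.carrier_M)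
        from bspec[OF dec this] obtain f where f: "f \<in> (\<Pi>\<^sub>E i\<in>{..<k}. S i)" "?q 1 = (\<Oplus>\<^bsub>?Q\<^esub>i\<in>{..<k}. f i)"
          by (elim ex1E conjE)
        have "\<forall>i\<in>{..<k}. \<exists>p. p \<in> Lmax \<and> f i = ?q p"
        proof
          fix i assume i: "i \<in> {..<k}"
          then have "f i \<in> S i" using f(1) by (rule PiE_mem[rotated])
          moreover obtain A where "A \<subseteq> Lmax" "S i = ?q ` A" using sub[of i] i by auto
          ultimately obtain p where "p \<in> Lmax" "f i = ?q p" by blast
          then show "\<exists>p. p \<in> Lmax \<and> f i = ?q p" by (intro exI[of _ p] conjI)
        qed
        then obtain h where h: "\<And>i. i \<in> {..<k} \<Longrightarrow> h i \<in> Lmax" "\<And>i. i \<in> {..<k} \<Longrightarrow> f i = ?q (h i)"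
          by metis
        \<comment> \<open>The generator is decomposed along the summands, each of which has
          representatives in \<open>Lmax\<close>.\<close>
        have "?q 1 = ?q (sum h {..<k})" unfolding f(2) by (rule P.finsum_M') (use h in auto)
        then have "1 - sum h {..<k} \<in> Lmax" unfolding P.eq_M using KL by blast
        moreover have "sum h {..<k} \<in> Lmax" by (rule add_sg_sum[OF klr_left.sgL[OF klr_left_Lmax] h(1)])
        ultimately have "1 \<in> Lmax" using add_sg_add[OF klr_left.sgL[OF klr_left_Lmax]] by fastforce
        then show False using one_notin_Lmax by simp
      qed
      then obtain i where i: "i < k" "S i = carrier ?Q" by blast
      have irr: "irreducible_graded R ?Q" using S(2)[OF i(1)] unfolding i(2) P.sub_mod_carrier .
      have "graded_submodule R ?Q (?q ` Lmax)" by (rule P.ideal_graded_submodule[OF klr_graded_Lmax KL])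
      then have "?q ` Lmax = {\<zero>\<^bsub>?Q\<^esub>} \<or> ?q ` Lmax = carrier ?Q"
        using irr unfolding irreducible_graded_def by blast
      then have "Lmax \<subseteq> K"
        using P.image_eq_carrier[OF klr_left_Lmax KL] P.image_eq_zero[OF klr_left_Lmax] one_notin_Lmax by blast
      then show ?thesis using K(3) by blast
    qed
  qed
qed

theorem head_irreducible: "irreducible_graded R (hd_mod R M)"
  unfolding hd_mod_def radical_eq by (rule irreducible_max)

end

section \<open>Monoid algebras and tensor products of algebras\<close>

lemma poly_mapping_induct_on [consumes 1, case_names zero single add]:
  fixes p :: "'a \<Rightarrow>\<^sub>0 'b::comm_monoid_add"
  assumes "Poly_Mapping.keys p \<subseteq> A" "P 0" "\<And>u a. u \<in> A \<Longrightarrow> P (Poly_Mapping.single u a)" "\<And>p q. P p \<Longrightarrow> P q \<Longrightarrow> P (p + q)"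
  shows "P p"
proof -
  have "finite B \<Longrightarrow> B \<subseteq> A \<Longrightarrow> P (\<Sum>u\<in>B. Poly_Mapping.single u (Poly_Mapping.lookup p u))" for B
    by (induction B rule: finite_induct) (auto intro: assms)
  then show ?thesis using poly_mapping_sum_singles[of p] assms(1) by (metis finite_keys)
qed

lemma add_sg_keys: "add_sg {p :: 'a \<Rightarrow>\<^sub>0 'b::ab_group_add. Poly_Mapping.keys p \<subseteq> A}"
proof -
  have "Poly_Mapping.keys (p - q) \<subseteq> A" if "Poly_Mapping.keys p \<subseteq> A" "Poly_Mapping.keys q \<subseteq> A" for p q :: "'a \<Rightarrow>\<^sub>0 'b"
    using that by (auto simp: in_keys_iff lookup_minus subset_iff) (metis diff_0_right)
  then show ?thesis by (auto simp: add_sg_def)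
qed

text \<open>Generated subgroups of a record whose operations are those of the type are the least
  subgroups in the type. It is used for the outer tensor product and for the induced module.\<close>

lemma add_group_generate:
  fixes C S :: "'a::ab_group_add set"
  assumes G: "carrier G = C" "\<And>x y. x \<otimes>\<^bsub>G\<^esub> y = x + y" "\<one>\<^bsub>G\<^esub> = 0" and C: "add_sg C" and S: "S \<subseteq> C"
  shows "group G" "add_sg (generate G S)" "S \<subseteq> generate G S" "\<And>H. add_sg H \<Longrightarrow> S \<subseteq> H \<Longrightarrow> generate G S \<subseteq> H"
    "generate G S \<subseteq> C"
proof -
  show g: "group G"
  proof (rule groupI)
    fix x assume "x \<in> carrier G"
    then show "\<exists>y\<in>carrier G. y \<otimes>\<^bsub>G\<^esub> x = \<one>\<^bsub>G\<^esub>"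
      by (intro bexI[of _ "- x"]) (auto simp: G add_sg_uminus[OF C])
  qed (auto simp: G add_sg_add[OF C] add_sg_0[OF C] algebra_simps)
  interpret group G by (rule g)
  have inv: "inv\<^bsub>G\<^esub> x = - x" if "x \<in> C" for x
    by (rule inv_equality) (use that in \<open>auto simp: G add_sg_uminus[OF C]\<close>)
  show le: "generate G S \<subseteq> H" if H: "add_sg H" "S \<subseteq> H" for H
  proof
    fix x assume "x \<in> generate G S"
    then show "x \<in> H"
    proof induction
      case (inv h)
      then have "h \<in> C" "h \<in> H" using S H(2) by auto
      then show ?case using add_sg_uminus[OF H(1)] \<open>\<And>x. x \<in> C \<Longrightarrow> inv\<^bsub>G\<^esub> x = - x\<close>[OF \<open>h \<in> C\<close>] by simp
    qed (use H in \<open>auto simp: G add_sg_0 add_sg_add\<close>)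
  qed
  show sub: "generate G S \<subseteq> C" by (rule le[OF C S])
  show "S \<subseteq> generate G S" by (auto intro: generate.incl)
  have "x + y \<in> generate G S" if "x \<in> generate G S" "y \<in> generate G S" for x y
    using generate.eng[OF that] by (simp add: G)
  moreover have "- x \<in> generate G S" if "x \<in> generate G S" for x
    using generate_m_inv_closed[OF _ that] S sub that inv[of x] by (auto simp: G)
  ultimately have "x - y \<in> generate G S" if "x \<in> generate G S" "y \<in> generate G S" for x y
    using that by (metis diff_conv_add_uminus)
  moreover have "0 \<in> generate G S" using generate.one[of G S] by (simp add: G)
  ultimately show "add_sg (generate G S)" by (simp add: add_sg_def)
qed

text \<open>Over an arbitrary basis there is no empty word to multiply with, so coefficients are
  scaled directly, in contrast to \<open>cs\<close>.\<close>

definition psc :: "complex \<Rightarrow> ('a \<Rightarrow>\<^sub>0 complex) \<Rightarrow> ('a \<Rightarrow>\<^sub>0 complex)" where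
  "psc c p = Poly_Mapping.map ((*) c) p"

lemma lookup_psc [simp]: "Poly_Mapping.lookup (psc c p) x = c * Poly_Mapping.lookup p x"
  by (simp add: psc_def Poly_Mapping.map.rep_eq when_def)

lemma psc_single [simp]: "psc c (Poly_Mapping.single u a) = Poly_Mapping.single u (c * a)"
  by (rule poly_mapping_eqI) (simp add: lookup_single when_def)

interpretation psc: scaling psc
  by standard (auto intro!: poly_mapping_eqI simp: lookup_add algebra_simps)

lemma psc_sum: "psc c (sum f A) = (\<Sum>i\<in>A. psc c (f i))"
  by (induction A rule: infinite_finite_induct) (simp_all add: psc.sc_zero2 psc.sc_add2)

lemma (in scaling) linext_add_fun: "linext sc (\<lambda>u. f u + g u) p = linext sc f p + linext sc g p"
  by (simp add: linext_def sc_add2 sum.distrib)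

lemma linext_cong: "(\<And>u. u \<in> Poly_Mapping.keys p \<Longrightarrow> f u = g u) \<Longrightarrow> linext sc f p = linext sc g p"
  unfolding linext_def by (rule sum.cong) auto

lemma bilin_linext: "bilin f p q = linext psc (\<lambda>u. linext psc (\<lambda>v. cmon 1 (f u v)) q) p"
  by (simp add: bilin_def linext_def psc_sum mult.assoc)

lemma bilin_simps [simp]:
  "bilin f (p + p') q = bilin f p q + bilin f p' q" "bilin f p (q + q') = bilin f p q + bilin f p q'"
  "bilin f (cmon a u) (cmon b v) = cmon (a * b) (f u v)" "bilin f 0 q = 0" "bilin f p 0 = 0"
  by (simp_all add: bilin_linext psc.linext_add psc.linext_add_fun)
    (simp add: linext_def psc.sc_zero2)

lemma bilin_keys:
  assumes "Poly_Mapping.keys p \<subseteq> A" "Poly_Mapping.keys q \<subseteq> B" "\<And>u v. u \<in> A \<Longrightarrow> v \<in> B \<Longrightarrow> f u v \<in> C"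
  shows "Poly_Mapping.keys (bilin f p q) \<subseteq> C"
  using assms(1)
proof (induction p rule: poly_mapping_induct_on)
  case (single u a)
  show ?case using assms(2)
  proof (induction q rule: poly_mapping_induct_on)
    case (add p q)
    then show ?case using Poly_Mapping.keys_add by fastforce
  qed (use single assms(3) in auto)
next
  case (add p q)
  then show ?case using Poly_Mapping.keys_add by fastforce
qed simp

lemma ring_monoid_alg:
  assumes "Group.monoid G"
  shows "ring (monoid_alg G)"
proof (rule ringI)
  interpret monoid G by (rule assms)
  let ?R = "monoid_alg G"
  have sg: "add_sg (carrier ?R)" using add_sg_keys by (simp add: monoid_alg_def)
  show "abelian_group ?R"
  proof (rule abelian_groupI)
    fix x assume "x \<in> carrier ?R"
    then show "\<exists>y\<in>carrier ?R. y \<oplus>\<^bsub>?R\<^esub> x = \<zero>\<^bsub>?R\<^esub>"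
      using add_sg_uminus[OF sg, of x] by (intro bexI[of _ "- x"]) (auto simp: monoid_alg_def)
  qed (use add_sg_add[OF sg] add_sg_0[OF sg] in \<open>auto simp: monoid_alg_def algebra_simps\<close>)
  show "Group.monoid ?R"
  proof (rule monoidI)
    fix x y z assume "x \<in> carrier ?R" "y \<in> carrier ?R" "z \<in> carrier ?R"
    then have k: "Poly_Mapping.keys x \<subseteq> carrier G" "Poly_Mapping.keys y \<subseteq> carrier G" "Poly_Mapping.keys z \<subseteq> carrier G"
      by (auto simp: monoid_alg_def)
    show "x \<otimes>\<^bsub>?R\<^esub> y \<in> carrier ?R"
      using bilin_keys[OF k(1,2), of "monoid.mult G" "carrier G"] by (simp add: monoid_alg_def)
    have "bilin (monoid.mult G) (bilin (monoid.mult G) x y) z = bilin (monoid.mult G) x (bilin (monoid.mult G) y z)"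
      using k(1)
    proof (induction x rule: poly_mapping_induct_on)
      case (single u a)
      show ?case using k(2)
      proof (induction y rule: poly_mapping_induct_on)
        case (single v b)
        show ?case using k(3)
          by (induction z rule: poly_mapping_induct_on) (use single \<open>u \<in> carrier G\<close> in \<open>auto simp: m_assoc mult.assoc\<close>)
      qed auto
    qed auto
    then show "(x \<otimes>\<^bsub>?R\<^esub> y) \<otimes>\<^bsub>?R\<^esub> z = x \<otimes>\<^bsub>?R\<^esub> (y \<otimes>\<^bsub>?R\<^esub> z)" by (simp add: monoid_alg_def)
    have "bilin (monoid.mult G) (cmon 1 \<one>\<^bsub>G\<^esub>) x = x"
      using k(1) by (induction x rule: poly_mapping_induct_on) auto
    then show "\<one>\<^bsub>?R\<^esub> \<otimes>\<^bsub>?R\<^esub> x = x" by (simp add: monoid_alg_def)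
    have "bilin (monoid.mult G) x (cmon 1 \<one>\<^bsub>G\<^esub>) = x"
      using k(1) by (induction x rule: poly_mapping_induct_on) auto
    then show "x \<otimes>\<^bsub>?R\<^esub> \<one>\<^bsub>?R\<^esub> = x" by (simp add: monoid_alg_def)
  qed (simp add: monoid_alg_def)
qed (simp_all add: monoid_alg_def)

locale tensor_factors =
  fixes Rs :: "(complex, 'r) graded list"
  assumes rings: "j < length Rs \<Longrightarrow> ring (Rs ! j)"
    and smult_closed: "j < length Rs \<Longrightarrow> x \<in> carrier (Rs ! j) \<Longrightarrow> c \<odot>\<^bsub>Rs ! j\<^esub> x \<in> carrier (Rs ! j)"
    and smult_left: "j < length Rs \<Longrightarrow> x \<in> carrier (Rs ! j) \<Longrightarrow> y \<in> carrier (Rs ! j) \<Longrightarrow>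
      (c \<odot>\<^bsub>Rs ! j\<^esub> x) \<otimes>\<^bsub>Rs ! j\<^esub> y = c \<odot>\<^bsub>Rs ! j\<^esub> (x \<otimes>\<^bsub>Rs ! j\<^esub> y)"
    and smult_right: "j < length Rs \<Longrightarrow> x \<in> carrier (Rs ! j) \<Longrightarrow> y \<in> carrier (Rs ! j) \<Longrightarrow>
      x \<otimes>\<^bsub>Rs ! j\<^esub> (c \<odot>\<^bsub>Rs ! j\<^esub> y) = c \<odot>\<^bsub>Rs ! j\<^esub> (x \<otimes>\<^bsub>Rs ! j\<^esub> y)"
begin

abbreviation "G \<equiv> prod_monoid Rs"

definition tup :: "'r list set" where "tup = tuples (map carrier Rs)"

lemma tup_iff: "us \<in> tup \<longleftrightarrow> length us = length Rs \<and> (\<forall>j<length Rs. us ! j \<in> carrier (Rs ! j))"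
  by (simp add: tup_def tuples_def)

lemma carrier_G: "carrier G = tup"
  by (simp add: prod_monoid_def tup_def)

lemma mult_G: "us \<otimes>\<^bsub>G\<^esub> vs = map (\<lambda>j. us ! j \<otimes>\<^bsub>Rs ! j\<^esub> vs ! j) [0..<length Rs]"
  by (simp add: prod_monoid_def)

lemma one_G: "\<one>\<^bsub>G\<^esub> = map (\<lambda>R. \<one>\<^bsub>R\<^esub>) Rs"
  by (simp add: prod_monoid_def)

lemma monoid_G: "Group.monoid G"
proof (rule monoidI)
  fix x y z assume xyz: "x \<in> carrier G" "y \<in> carrier G" "z \<in> carrier G"
  show "x \<otimes>\<^bsub>G\<^esub> y \<in> carrier G"
    using xyz by (auto simp: carrier_G mult_G tup_iff intro: monoid.m_closed[OF ring.is_monoid[OF rings]])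
  show "(x \<otimes>\<^bsub>G\<^esub> y) \<otimes>\<^bsub>G\<^esub> z = x \<otimes>\<^bsub>G\<^esub> (y \<otimes>\<^bsub>G\<^esub> z)"
    using xyz by (auto simp: carrier_G mult_G tup_iff intro!: nth_equalityI monoid.m_assoc[OF ring.is_monoid[OF rings]])
  show "\<one>\<^bsub>G\<^esub> \<otimes>\<^bsub>G\<^esub> x = x"
    using xyz by (auto simp: carrier_G mult_G tup_iff one_G intro!: nth_equalityI monoid.l_one[OF ring.is_monoid[OF rings]])
  show "x \<otimes>\<^bsub>G\<^esub> \<one>\<^bsub>G\<^esub> = x"
    using xyz by (auto simp: carrier_G mult_G tup_iff one_G intro!: nth_equalityI monoid.r_one[OF ring.is_monoid[OF rings]])
next
  show "\<one>\<^bsub>G\<^esub> \<in> carrier G"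
    by (auto simp: carrier_G tup_iff one_G intro: monoid.one_closed[OF ring.is_monoid[OF rings]])
qed

definition trels :: "('r list \<Rightarrow>\<^sub>0 complex) set" where
  "trels = multilin_rels (map (\<lambda>R. (carrier R, ring.add R, smult R)) Rs)"

definition TI :: "('r list \<Rightarrow>\<^sub>0 complex) set" where
  "TI = Idl\<^bsub>monoid_alg G\<^esub> trels"

definition TA :: "('r list \<Rightarrow>\<^sub>0 complex) set" where
  "TA = {p. Poly_Mapping.keys p \<subseteq> tup}"

lemma tensor_rels_cases:
  assumes "r \<in> trels"
  obtains (add) a us j u v where "us \<in> tup" "j < length Rs" "u \<in> carrier (Rs ! j)" "v \<in> carrier (Rs ! j)"
      "r = cmon a (us[j := u \<oplus>\<^bsub>Rs ! j\<^esub> v]) - cmon a (us[j := u]) - cmon a (us[j := v])"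
    | (scale) a us j c u where "us \<in> tup" "j < length Rs" "u \<in> carrier (Rs ! j)"
      "r = cmon a (us[j := c \<odot>\<^bsub>Rs ! j\<^esub> u]) - cmon (a * c) (us[j := u])"
  using assms unfolding trels_def multilin_rels_def
  by (auto simp: tup_def comp_def)

lemma TA_single: "us \<in> tup \<Longrightarrow> cmon a us \<in> TA"
  by (simp add: TA_def)

lemma add_sg_TA: "add_sg TA"
  unfolding TA_def by (rule add_sg_keys)

lemma tup_update: "us \<in> tup \<Longrightarrow> j < length Rs \<Longrightarrow> u \<in> carrier (Rs ! j) \<Longrightarrow> us[j := u] \<in> tup"
  by (auto simp: tup_iff nth_list_update)

lemma add_closed: "j < length Rs \<Longrightarrow> u \<in> carrier (Rs ! j) \<Longrightarrow> v \<in> carrier (Rs ! j) \<Longrightarrow> u \<oplus>\<^bsub>Rs ! j\<^esub> v \<in> carrier (Rs ! j)"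
  using rings[of j] by (simp add: ring.ring_simprules(1))

lemma trels_TA: "trels \<subseteq> TA"
proof
  fix r assume "r \<in> trels"
  then show "r \<in> TA"
    by (cases rule: tensor_rels_cases)
      (auto intro!: add_sg_diff[OF add_sg_TA] TA_single tup_update add_closed smult_closed)
qed

lemma carrier_alg: "carrier (monoid_alg G) = TA"
  by (simp add: monoid_alg_def TA_def carrier_G)

lemma ring_alg: "ring (monoid_alg G)"
  by (rule ring_monoid_alg[OF monoid_G])

lemma ideal_TI: "ideal TI (monoid_alg G)"
  unfolding TI_def by (rule ring.genideal_ideal[OF ring_alg]) (simp add: carrier_alg trels_TA)

lemma tensor_alg_carrier: "carrier (tensor_alg Rs) = cst TI ` TA"
  by (simp add: tensor_alg_def FactRing_def TI_def trels_def a_rcosets_eq_cst monoid_alg_def TA_def carrier_G)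

lemma TI_sub_TA: "TI \<subseteq> TA"
  using ideal.Icarr[OF ideal_TI] carrier_alg by auto

lemma add_sg_ideal_alg:
  assumes "add_sg H" "H \<subseteq> TA"
    "\<And>x a b. x \<in> H \<Longrightarrow> a \<in> TA \<Longrightarrow> bilin (monoid.mult G) a x \<in> H" "\<And>x a b. x \<in> H \<Longrightarrow> a \<in> TA \<Longrightarrow> bilin (monoid.mult G) x a \<in> H"
  shows "ideal H (monoid_alg G)"
proof (rule idealI[OF ring_alg])
  have g: "group (add_monoid (monoid_alg G))"
    by (rule abelian_group.a_group[OF ring.is_abelian_group[OF ring_alg]])
  show "subgroup H (add_monoid (monoid_alg G))"
  proof (rule group.subgroupI[OF g])
    fix a assume a: "a \<in> H"
    have "inv\<^bsub>add_monoid (monoid_alg G)\<^esub> a = - a"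
      by (rule group.inv_equality[OF g])
        (use a assms add_sg_uminus[OF add_sg_TA] in \<open>auto simp: monoid_alg_def TA_def carrier_G\<close>)
    then show "inv\<^bsub>add_monoid (monoid_alg G)\<^esub> a \<in> H" using a add_sg_uminus[OF assms(1)] by simp
  qed (use assms(2) add_sg_0[OF assms(1)] add_sg_add[OF assms(1)] in \<open>auto simp: monoid_alg_def TA_def carrier_G\<close>)
  show "\<And>a x. a \<in> H \<Longrightarrow> x \<in> carrier (monoid_alg G) \<Longrightarrow> x \<otimes>\<^bsub>monoid_alg G\<^esub> a \<in> H"
    "\<And>a x. a \<in> H \<Longrightarrow> x \<in> carrier (monoid_alg G) \<Longrightarrow> a \<otimes>\<^bsub>monoid_alg G\<^esub> x \<in> H"
    using assms(3,4) by (simp_all add: monoid_alg_def TA_def carrier_G)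
qed

lemma add_sg_TI: "add_sg TI"
proof -
  interpret ideal TI "monoid_alg G" by (rule ideal_TI)
  have z: "0 \<in> TI" using additive_subgroup.zero_closed[OF additive_subgroup_axioms] by (simp add: monoid_alg_def)
  have add: "x + y \<in> TI" if "x \<in> TI" "y \<in> TI" for x y
    using additive_subgroup.a_closed[OF additive_subgroup_axioms that] by (simp add: monoid_alg_def)
  have "- x \<in> TI" if "x \<in> TI" for x
  proof -
    have k: "Poly_Mapping.keys x \<subseteq> tup" using TI_sub_TA that by (auto simp: TA_def)
    have "bilin (monoid.mult G) (cmon (-1) \<one>\<^bsub>G\<^esub>) x = - x"
      using k monoid.l_one[OF monoid_G]
      by (induction x rule: poly_mapping_induct_on) (auto simp: carrier_G simp flip: single_uminus)
    moreover have "cmon (-1) \<one>\<^bsub>G\<^esub> \<in> carrier (monoid_alg G)"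
      using monoid.one_closed[OF monoid_G] by (simp add: monoid_alg_def)
    ultimately show ?thesis using I_l_closed[OF that, of "cmon (-1) \<one>\<^bsub>G\<^esub>"] by (simp add: monoid_alg_def)
  qed
  then have "x - y \<in> TI" if "x \<in> TI" "y \<in> TI" for x y
    using add[of x "- y"] that by simp
  then show ?thesis using z by (simp add: add_sg_def)
qed

text \<open>Multilinearity is stable under multiplication of tuples on both sides; so a multilinear function
  kills the ideal although it need not be multiplicative.\<close>

lemma kills_TI:
  fixes sc :: "complex \<Rightarrow> 'b \<Rightarrow> 'b::ab_group_add"
  assumes "scaling sc" and K: "add_sg K" "\<And>c x. x \<in> K \<Longrightarrow> sc c x \<in> K"
    and add: "\<And>us j u v. us \<in> tup \<Longrightarrow> j < length Rs \<Longrightarrow> u \<in> carrier (Rs ! j) \<Longrightarrow> v \<in> carrier (Rs ! j) \<Longrightarrow>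
      \<Phi> (us[j := u \<oplus>\<^bsub>Rs ! j\<^esub> v]) - \<Phi> (us[j := u]) - \<Phi> (us[j := v]) \<in> K"
    and scale: "\<And>us j c u. us \<in> tup \<Longrightarrow> j < length Rs \<Longrightarrow> u \<in> carrier (Rs ! j) \<Longrightarrow>
      \<Phi> (us[j := c \<odot>\<^bsub>Rs ! j\<^esub> u]) - sc c (\<Phi> (us[j := u])) \<in> K"
    and q: "q \<in> TI"
  shows "linext sc \<Phi> q \<in> K"
proof -
  interpret scaling sc by (rule assms(1))
  interpret M: monoid G by (rule monoid_G)
  \<comment> \<open>Surrounding a tuple by arbitrary factors makes the set \<open>H\<close> of
    killed elements a two-sided ideal; at the end both factors are set to the unit.\<close>
  let ?F = "\<lambda>a b us. \<Phi> (a \<otimes>\<^bsub>G\<^esub> us \<otimes>\<^bsub>G\<^esub> b)"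
  define H where "H = {q \<in> TA. \<forall>a\<in>tup. \<forall>b\<in>tup. linext sc (?F a b) q \<in> K}"
  have "ideal H (monoid_alg G)"
  proof (rule add_sg_ideal_alg)
    show "add_sg H"
      using add_sg_0[OF add_sg_TA] add_sg_diff[OF add_sg_TA] add_sg_0[OF K(1)] add_sg_diff[OF K(1)]
      by (auto simp: add_sg_def H_def linext_minus)
    show HT: "H \<subseteq> TA" by (auto simp: H_def)
    fix x a assume x: "x \<in> H" and a: "a \<in> TA"
    have kx: "Poly_Mapping.keys x \<subseteq> tup" and ka: "Poly_Mapping.keys a \<subseteq> tup" using x a by (auto simp: H_def TA_def)
    have bt: "bilin (monoid.mult G) a x \<in> TA" "bilin (monoid.mult G) x a \<in> TA"
      using bilin_keys[OF ka kx, of "monoid.mult G" tup] bilin_keys[OF kx ka, of "monoid.mult G" tup] M.m_closed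
      by (auto simp: TA_def carrier_G)
    have "linext sc (?F c d) (bilin (monoid.mult G) a x) \<in> K" if cd: "c \<in> tup" "d \<in> tup" for c d
      using ka
    proof (induction a rule: poly_mapping_induct_on)
      case (single u z)
      have "linext sc (?F c d) (bilin (monoid.mult G) (cmon z u) x) = sc z (linext sc (?F (c \<otimes>\<^bsub>G\<^esub> u) d) x)"
        using kx
        by (induction x rule: poly_mapping_induct_on)
          (use single cd M.m_closed in \<open>auto simp: linext_add sc_add2 sc_mult sc_zero2 M.m_assoc carrier_G\<close>)
      moreover have "c \<otimes>\<^bsub>G\<^esub> u \<in> tup" using M.m_closed single cd by (simp add: carrier_G)
      ultimately show ?case using x cd K(2) by (auto simp: H_def)
    qed (auto simp: linext_add add_sg_add[OF K(1)] add_sg_0[OF K(1)])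
    then show "bilin (monoid.mult G) a x \<in> H" using bt by (simp add: H_def)
    have "linext sc (?F c d) (bilin (monoid.mult G) x a) \<in> K" if cd: "c \<in> tup" "d \<in> tup" for c d
      using ka
    proof (induction a rule: poly_mapping_induct_on)
      case (single u z)
      have "linext sc (?F c d) (bilin (monoid.mult G) x (cmon z u)) = sc z (linext sc (?F c (u \<otimes>\<^bsub>G\<^esub> d)) x)"
        using kx
        by (induction x rule: poly_mapping_induct_on)
          (use single cd M.m_closed in \<open>auto simp: linext_add sc_add2 sc_mult sc_zero2 M.m_assoc carrier_G mult.commute\<close>)
      moreover have "u \<otimes>\<^bsub>G\<^esub> d \<in> tup" using M.m_closed single cd by (simp add: carrier_G)
      ultimately show ?case using x cd K(2) by (auto simp: H_def)
    qed (auto simp: linext_add add_sg_add[OF K(1)] add_sg_0[OF K(1)])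
    then show "bilin (monoid.mult G) x a \<in> H" using bt by (simp add: H_def)
  qed
  moreover have "trels \<subseteq> H"
  proof
    fix r assume r: "r \<in> trels"
    have upd: "a \<otimes>\<^bsub>G\<^esub> us[j := w] \<otimes>\<^bsub>G\<^esub> b = (a \<otimes>\<^bsub>G\<^esub> us \<otimes>\<^bsub>G\<^esub> b)[j := a ! j \<otimes>\<^bsub>Rs ! j\<^esub> w \<otimes>\<^bsub>Rs ! j\<^esub> b ! j]"
      if "us \<in> tup" "j < length Rs" for a b us j w
      using that by (intro nth_equalityI) (auto simp: mult_G tup_iff nth_list_update)
    have "linext sc (?F a b) r \<in> K" if ab: "a \<in> tup" "b \<in> tup" for a b
      using r
    proof (cases rule: tensor_rels_cases)
      case (add z us j u v)
      let ?t = "a \<otimes>\<^bsub>G\<^esub> us \<otimes>\<^bsub>G\<^esub> b"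
      let ?f = "\<lambda>w. a ! j \<otimes>\<^bsub>Rs ! j\<^esub> w \<otimes>\<^bsub>Rs ! j\<^esub> b ! j"
      interpret Rj: ring "Rs ! j" by (rule rings[OF add(2)])
      have abj: "a ! j \<in> carrier (Rs ! j)" "b ! j \<in> carrier (Rs ! j)" using ab add(2) by (auto simp: tup_iff)
      have t: "?t \<in> tup" using M.m_closed ab add(1) by (simp add: carrier_G)
      have "?f (u \<oplus>\<^bsub>Rs ! j\<^esub> v) = ?f u \<oplus>\<^bsub>Rs ! j\<^esub> ?f v" using abj add by (simp add: Rj.r_distr Rj.l_distr)
      then have "\<Phi> (?t[j := ?f (u \<oplus>\<^bsub>Rs ! j\<^esub> v)]) - \<Phi> (?t[j := ?f u]) - \<Phi> (?t[j := ?f v]) \<in> K"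
        using assms(4)[OF t add(2), of "?f u" "?f v"] abj add by simp
      then have "sc z (\<Phi> (?t[j := ?f (u \<oplus>\<^bsub>Rs ! j\<^esub> v)]) - \<Phi> (?t[j := ?f u]) - \<Phi> (?t[j := ?f v])) \<in> K" by (rule K(2))
      moreover have "sc z (x - y) = sc z x - sc z y" for x y by (metis add_diff_cancel_right' diff_add_cancel sc_add2)
      ultimately show ?thesis unfolding add(5) by (simp add: linext_minus upd[OF add(1,2)])
    next
      case (scale z us j c u)
      let ?t = "a \<otimes>\<^bsub>G\<^esub> us \<otimes>\<^bsub>G\<^esub> b"
      let ?f = "\<lambda>w. a ! j \<otimes>\<^bsub>Rs ! j\<^esub> w \<otimes>\<^bsub>Rs ! j\<^esub> b ! j"
      interpret Rj: ring "Rs ! j" by (rule rings[OF scale(2)])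
      have abj: "a ! j \<in> carrier (Rs ! j)" "b ! j \<in> carrier (Rs ! j)" using ab scale(2) by (auto simp: tup_iff)
      have t: "?t \<in> tup" using M.m_closed ab scale(1) by (simp add: carrier_G)
      have "?f (c \<odot>\<^bsub>Rs ! j\<^esub> u) = c \<odot>\<^bsub>Rs ! j\<^esub> ?f u" using abj scale by (simp add: smult_left smult_right)
      then have "\<Phi> (?t[j := ?f (c \<odot>\<^bsub>Rs ! j\<^esub> u)]) - sc c (\<Phi> (?t[j := ?f u])) \<in> K"
        using assms(5)[OF t scale(2), of "?f u" c] abj scale by simp
      then have "sc z (\<Phi> (?t[j := ?f (c \<odot>\<^bsub>Rs ! j\<^esub> u)]) - sc c (\<Phi> (?t[j := ?f u]))) \<in> K" by (rule K(2))
      moreover have "sc z (x - y) = sc z x - sc z y" for x y by (metis add_diff_cancel_right' diff_add_cancel sc_add2)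
      ultimately show ?thesis unfolding scale(4) by (simp add: linext_minus upd[OF scale(1,2)] sc_mult)
    qed
    then show "r \<in> H" using r trels_TA by (auto simp: H_def)
  qed
  ultimately have "TI \<subseteq> H" unfolding TI_def by (rule ring.genideal_minimal[OF ring_alg])
  then have qH: "q \<in> TA" "linext sc (?F \<one>\<^bsub>G\<^esub> \<one>\<^bsub>G\<^esub>) q \<in> K" using q M.one_closed by (auto simp: H_def carrier_G)
  have "linext sc (?F \<one>\<^bsub>G\<^esub> \<one>\<^bsub>G\<^esub>) q = linext sc \<Phi> q"
    by (rule linext_cong) (use qH(1) in \<open>auto simp: TA_def carrier_G[symmetric]\<close>)
  then show ?thesis using qH(2) by simp
qed

end

section \<open>The concatenation embedding\<close>

lemma blocks_iff: "b \<in> blocks n ws \<longleftrightarrow> length b = length ws \<and> (\<forall>j<length ws. b ! j \<in> seqs n (ws ! j))"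
  by (simp add: blocks_def tuples_def)

lemma blocks_update: "b \<in> blocks n ws \<Longrightarrow> j < length ws \<Longrightarrow> x \<in> seqs n (ws ! j) \<Longrightarrow> b[j := x] \<in> blocks n ws"
  by (auto simp: blocks_iff nth_list_update)

lemma concat_in_seqs: "b \<in> blocks n ws \<Longrightarrow> concat b \<in> seqs n (sum_list ws)"
proof -
  assume b: "b \<in> blocks n ws"
  then have "map mset b = ws" by (auto simp: blocks_iff seqs_def intro: nth_equalityI)
  moreover have "set (concat b) \<subseteq> {1..n}" using b by (force simp: blocks_iff seqs_def in_set_conv_nth)
  ultimately show ?thesis by (auto simp: seqs_def mset_concat)
qed

lemma blocks_length: "b \<in> blocks n ws \<Longrightarrow> j < length ws \<Longrightarrow> length (b ! j) = size (ws ! j)"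
  by (auto simp: blocks_iff seqs_length)

text \<open>The lengths of the blocks are prescribed by \<open>ws\<close>, so the cutting points of
  a concatenation are known.\<close>

lemma inj_concat_blocks: "inj_on concat (blocks n ws)"
proof (rule inj_onI)
  fix b b' assume a: "b \<in> blocks n ws" "b' \<in> blocks n ws" "concat b = concat b'"
  then have "\<forall>(x, y)\<in>set (zip b b'). length x = length y"
    using blocks_length by (fastforce simp: set_zip blocks_iff)
  then show "b = b'" using a concat_eq_concat_iff[of b b'] by (auto simp: blocks_iff)
qed

lemma finite_blocks [simp]: "finite (blocks n ws)"
  by (rule finite_imageD[OF _ inj_concat_blocks]) (auto intro: finite_subset[of _ "seqs n (sum_list ws)"] concat_in_seqs)

lemma offset_Suc: "offset ws (Suc j) = offset ws j + size (ws ! j)"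
  by (simp add: offset_def)

lemma size_sum_list: "size (sum_list ws) = offset ws (length ws)"
proof -
  have "size (sum_list ws) = sum_list (map size ws)" by (induction ws) auto
  then show ?thesis by (simp add: offset_def sum_list_sum_nth atLeast0LessThan)
qed

lemma offset_mono: "j \<le> k \<Longrightarrow> offset ws j \<le> offset ws k"
  unfolding offset_def by (rule sum_mono2) auto

lemma offset_bound: "j < length ws \<Longrightarrow> offset ws j + size (ws ! j) \<le> size (sum_list ws)"
  using offset_mono[of "Suc j" "length ws" ws] by (simp add: offset_Suc size_sum_list)

lemma concat_split:
  assumes "b \<in> blocks n ws" "j < length ws"
  shows "length (concat (take j b)) = offset ws j"
    "concat (b[j := x]) = concat (take j b) @ x @ concat (drop (Suc j) b)"
    "concat b = concat (take j b) @ b ! j @ concat (drop (Suc j) b)"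
proof -
  have l: "length b = length ws" using assms by (simp add: blocks_iff)
  have "length (concat (take j b)) = (\<Sum>i<j. length (b ! i))"
    using assms(2) l by (simp add: length_concat sum_list_sum_nth atLeast0LessThan)
  also have "\<dots> = offset ws j" unfolding offset_def
    by (rule sum.cong) (use assms blocks_length in auto)
  finally show "length (concat (take j b)) = offset ws j" .
  show u: "concat (b[j := x]) = concat (take j b) @ x @ concat (drop (Suc j) b)" for x
    using assms(2) l by (simp add: upd_conv_take_nth_drop)
  show "concat b = concat (take j b) @ b ! j @ concat (drop (Suc j) b)"
    using u[of "b ! j"] by simp
qed

lemma concat_entry:
  assumes "b \<in> blocks n ws" "j < length ws" "1 \<le> t" "t \<le> size (ws ! j)"
  shows "entry (concat b) (offset ws j + t) = entry (b ! j) t"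
proof -
  have "(A @ m @ C) ! (length A + t - 1) = m ! (t - 1)" if "t \<le> length m" for A m C :: "nat list"
    using that assms(3) by (cases t) (auto simp: nth_append)
  from this[of "b ! j" "concat (take j b)" "concat (drop (Suc j) b)"]
  show ?thesis using assms(4) unfolding concat_split(3)[OF assms(1,2), symmetric] concat_split(1)[OF assms(1,2)]
      blocks_length[OF assms(1,2)] by blast
qed

lemma swap_concat:
  assumes "b \<in> blocks n ws" "j < length ws" "t \<in> {1..<size (ws ! j)}"
  shows "swap_seq (offset ws j + t) (concat b) = concat (b[j := swap_seq t (b ! j)])"
proof -
  have "swap_seq (length A + t) (A @ m @ C) = A @ swap_seq t m @ C" if "1 \<le> t" "t < length m" for A m C :: "nat list"
    using that by (cases t) (simp_all add: swap_seq_def list_update_append nth_append)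
  from this[of "b ! j" "concat (take j b)" "concat (drop (Suc j) b)"] show ?thesis
    using assms(3) unfolding concat_split(2)[OF assms(1,2), symmetric] concat_split(3)[OF assms(1,2), symmetric]
      concat_split(1)[OF assms(1,2)] blocks_length[OF assms(1,2)] by simp
qed

section \<open>The concatenation embedding lifted to the free algebra\<close>

definition ci :: "nat \<Rightarrow> nat multiset list \<Rightarrow> falg" where
  "ci n ws = (\<Sum>b\<in>blocks n ws. E (concat b))"

definition eg :: "nat \<Rightarrow> nat multiset list \<Rightarrow> nat \<Rightarrow> klr_gen \<Rightarrow> falg" where
  "eg n ws j g = (case g of Gidem i \<Rightarrow> \<Sum>b\<in>{b \<in> blocks n ws. b ! j = i}. E (concat b)
     | Gx k \<Rightarrow> X (offset ws j + k) * ci n ws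
     | Gtau t \<Rightarrow> T (offset ws j + t) * ci n ws)"

text \<open>The final factor \<open>ci\<close> corresponds to the last factor in
  \<open>embed_prod\<close>. It restricts to weights that are concatenations of blocks, where the
  relations can be verified.\<close>

definition Ev :: "nat \<Rightarrow> nat multiset list \<Rightarrow> nat \<Rightarrow> falg \<Rightarrow> falg" where
  "Ev n ws j p = ext (eg n ws j) p * ci n ws"

locale concat_left = klr_left n "sum_list ws" L for n ws L
begin

text \<open>Weight vectors whose weight is a concatenation of blocks. On them \<open>ci\<close> acts
  as the identity, and images of generators act as generators with shifted strand numbers.\<close>

abbreviation bwt :: "nat list list \<Rightarrow> falg \<Rightarrow> bool" where
  "bwt b u \<equiv> b \<in> blocks n ws \<and> wt (concat b) u"

lemma E_sum_act:
  assumes "bwt b u" "A \<subseteq> blocks n ws"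
  shows "(\<Sum>b\<in>A. E (concat b)) * u \<bumpeq>\<^bsub>L\<^esub> (if b \<in> A then u else 0)"
proof -
  have fin: "finite A" using assms(2) finite_blocks finite_subset by blast
  have "(\<Sum>b'\<in>A. E (concat b') * u) \<bumpeq>\<^bsub>L\<^esub> (\<Sum>b'\<in>A. if b' = b then u else 0)"
  proof (rule eqv_sum)
    fix b' assume b': "b' \<in> A"
    show "E (concat b') * u \<bumpeq>\<^bsub>L\<^esub> (if b' = b then u else 0)"
    proof (cases "b' = b")
      case True
      then show ?thesis using assms(1) by (simp add: wt_def)
    next
      case False
      then have "concat b \<noteq> concat b'" using inj_concat_blocks b' assms by (auto simp: inj_on_def)
      then have "E (concat b') * u \<in> L"
        using wt_orth[of "concat b" u "concat b'"] assms b' concat_in_seqs by blast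
      then show ?thesis using False by simp
    qed
  qed
  then show ?thesis using fin by (simp add: sum_distrib_right sum.delta)
qed

lemma ci_act: "bwt b u \<Longrightarrow> ci n ws * u \<bumpeq>\<^bsub>L\<^esub> u"
  using E_sum_act[of b u "blocks n ws"] by (simp add: ci_def)

lemma eg_E: "bwt b u \<Longrightarrow> v \<bumpeq>\<^bsub>L\<^esub> u \<Longrightarrow> eg n ws j (Gidem i) * v \<bumpeq>\<^bsub>L\<^esub> (if b ! j = i then u else 0)"
  using eqv_trans[OF eqv_mult E_sum_act[of b u "{b \<in> blocks n ws. b ! j = i}"]] by (auto simp: eg_def)

lemma eg_X: "bwt b u \<Longrightarrow> v \<bumpeq>\<^bsub>L\<^esub> u \<Longrightarrow> eg n ws j (Gx k) * v \<bumpeq>\<^bsub>L\<^esub> X (offset ws j + k) * u"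
  using eqv_mult[OF eqv_trans[OF eqv_mult ci_act]] by (simp add: eg_def mult.assoc)

lemma eg_T: "bwt b u \<Longrightarrow> v \<bumpeq>\<^bsub>L\<^esub> u \<Longrightarrow> eg n ws j (Gtau t) * v \<bumpeq>\<^bsub>L\<^esub> T (offset ws j + t) * u"
  using eqv_mult[OF eqv_trans[OF eqv_mult ci_act]] by (simp add: eg_def mult.assoc)

lemma bwt_X: "bwt b u \<Longrightarrow> bwt b (X k * u)"
  using wt_X by blast

lemma bwt_T:
  assumes "bwt b u" "j < length ws" "t \<in> {1..<size (ws ! j)}"
  shows "bwt (b[j := swap_seq t (b ! j)]) (T (offset ws j + t) * u)"
proof -
  have "offset ws j + t \<in> {1..<size (sum_list ws)}" using offset_bound[OF assms(2)] assms(3) by auto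
  from wt_T[OF _ this] have "wt (swap_seq (offset ws j + t) (concat b)) (T (offset ws j + t) * u)" using assms(1) by blast
  moreover have "b[j := swap_seq t (b ! j)] \<in> blocks n ws"
    using assms blocks_length[of b n ws j] by (intro blocks_update swap_seq_in_seqs) (auto simp: blocks_iff)
  ultimately show ?thesis using swap_concat[OF conjunct1[OF assms(1)] assms(2,3)] by (simp only:)
qed

lemma bwt_zero: "b \<in> blocks n ws \<Longrightarrow> bwt b 0"
  using wt_zero concat_in_seqs by blast

lemma wprod_eg:
  assumes "bwt b u" "j < length ws" "set w \<subseteq> klr_gens n (ws ! j)"
  shows "\<exists>b'. bwt b' (wprod (eg n ws j) w * u)"
  using assms(3)
proof (induction w)
  case Nil
  then show ?case using assms(1) by (auto simp: wprod_def)
next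
  case (Cons g w)
  then obtain b' where b': "bwt b' (wprod (eg n ws j) w * u)" by auto
  let ?v = "wprod (eg n ws j) w * u"
  have "\<exists>b''. bwt b'' (eg n ws j g * ?v)"
  proof (cases g)
    case (Gidem i)
    show ?thesis using wt_cong[OF eg_E[OF b' eqv_refl, of j i]] b' bwt_zero[of b'] Gidem by (auto split: if_splits)
  next
    case (Gx k)
    show ?thesis using wt_cong[OF eg_X[OF b' eqv_refl, of j k]] b' bwt_X[OF b'] Gx by blast
  next
    case (Gtau t)
    then have "t \<in> {1..<size (ws ! j)}" using Cons.prems by (simp add: gens_memb)
    from bwt_T[OF b' assms(2) this] show ?thesis using wt_cong[OF eg_T[OF b' eqv_refl, of j t]] Gtau by blast
  qed
  then show ?case by (simp add: wprod_def mult.assoc)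
qed

text \<open>On a vector of block weight the images of generators act as generators on strands
  shifted by the offset, whose letters are those of block \<open>j\<close>. So each relation of the
  factor becomes the same relation of the big algebra at shifted places.\<close>

lemma rel_act:
  assumes u: "bwt b u" and j: "j < length ws" and r: "r \<in> klr_rels n (ws ! j)"
  shows "ext (eg n ws j) r * u \<in> L"
proof -
  let ?e = "eg n ws j" and ?o = "offset ws j"
  let ?\<beta> = "b ! j"
  have E_right: "ext ?e p * (?e (Gidem i) * u) \<bumpeq>\<^bsub>L\<^esub> (if ?\<beta> = i then ext ?e p * u else 0)" for p i
    using eqv_mult[OF eg_E[OF u eqv_refl, of j i], of "ext ?e p"] by (auto split: if_splits)
  \<comment> \<open>The longer relations end with an idempotent, so they matter only if block
    \<open>j\<close> is its word.\<close>
  have E_kill: "ext ?e (p * E i) * u \<bumpeq>\<^bsub>L\<^esub> 0" if "?\<beta> = i \<Longrightarrow> ext ?e p * u \<bumpeq>\<^bsub>L\<^esub> 0" for p i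
  proof -
    have "(if ?\<beta> = i then ext ?e p * u else 0) \<bumpeq>\<^bsub>L\<^esub> 0" using that by simp
    from eqv_trans[OF E_right[of p i] this] show ?thesis by (simp only: ext_mult ext_simps(6) mult.assoc)
  qed
  have tr: "?o + t \<in> {1..<size (sum_list ws)}" if "t \<in> {1..<size (ws ! j)}" for t
    using offset_bound[OF j] that by auto
  have xr: "?o + k \<in> {1..size (sum_list ws)}" if "k \<in> {1..size (ws ! j)}" for k
    using offset_bound[OF j] that by auto
  have en: "entry (concat b) (?o + t) = entry ?\<beta> t" if "1 \<le> t" "t \<le> size (ws ! j)" for t
    using concat_entry[OF _ j that] u by blast
  have wu: "wt (concat b) u" using u by blast
  have \<beta>: "?\<beta> \<in> seqs n (ws ! j)" using u j by (simp add: blocks_iff)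
  have "ext ?e r * u \<bumpeq>\<^bsub>L\<^esub> 0"
    using r
  proof (induct rule: klr_rels_cases)
    case unit
    have "(\<Sum>i\<in>seqs n (ws ! j). ?e (Gidem i) * u) \<bumpeq>\<^bsub>L\<^esub> (\<Sum>i\<in>seqs n (ws ! j). if ?\<beta> = i then u else 0)"
      by (intro eqv_sum eg_E[OF u eqv_refl])
    also have "(\<Sum>i\<in>seqs n (ws ! j). if ?\<beta> = i then u else 0) = u" using \<beta> by simp
    finally show ?case by (simp add: algebra_simps sum_distrib_right eqv_def)
  next
    case (idem i i')
    have "?e (Gidem i) * (?e (Gidem i') * u) \<bumpeq>\<^bsub>L\<^esub> (if ?\<beta> = i' then ?e (Gidem i) * u else 0)"
      using E_right[of "E i" i'] by (simp cong: if_cong)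
    also have "\<dots> \<bumpeq>\<^bsub>L\<^esub> (if i = i' then ?e (Gidem i) * u else 0)"
      using eg_E[OF u eqv_refl, of j i] eqv_sym by (auto split: if_splits)
    finally show ?case by (cases "i = i'") (simp_all add: ext_mult algebra_simps eqv_def)
  next
    case (xidem k i)
    have "?e (Gx k) * (?e (Gidem i) * u) \<bumpeq>\<^bsub>L\<^esub> (if ?\<beta> = i then ?e (Gx k) * u else 0)"
      using E_right[of "X k" i] by (simp cong: if_cong)
    also have "\<dots> \<bumpeq>\<^bsub>L\<^esub> (if ?\<beta> = i then X (?o + k) * u else 0)"
      using eg_X[OF u eqv_refl, of j k] by simp
    also have "\<dots> \<bumpeq>\<^bsub>L\<^esub> ?e (Gidem i) * (?e (Gx k) * u)"
      by (rule eqv_sym[OF eg_E[OF bwt_X[OF u] eg_X[OF u eqv_refl]]])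
    finally show ?case by (simp add: ext_mult algebra_simps eqv_def)
  next
    case (tauidem t i)
    have "?\<beta> = i \<longleftrightarrow> swap_seq t ?\<beta> = swap_seq t i"
    proof
      assume e: "swap_seq t ?\<beta> = swap_seq t i"
      have "swap_seq t (swap_seq t ?\<beta>) = ?\<beta>" "swap_seq t (swap_seq t i) = i"
        using tauidem(1) seqs_length[OF \<beta>] seqs_length[OF tauidem(2)] by (simp_all add: swap_swap)
      then show "?\<beta> = i" unfolding e by (rule trans[OF sym])
    qed simp
    moreover have "j < length b" using u j by (simp add: blocks_iff)
    ultimately have c: "?\<beta> = i \<longleftrightarrow> b[j := swap_seq t (b ! j)] ! j = swap_seq t i" by simp
    have "?e (Gtau t) * (?e (Gidem i) * u) \<bumpeq>\<^bsub>L\<^esub> (if ?\<beta> = i then ?e (Gtau t) * u else 0)"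
      using E_right[of "T t" i] by (simp cong: if_cong)
    also have "\<dots> \<bumpeq>\<^bsub>L\<^esub> (if ?\<beta> = i then T (?o + t) * u else 0)"
      using eg_T[OF u eqv_refl, of j t] by simp
    also have "\<dots> \<bumpeq>\<^bsub>L\<^esub> ?e (Gidem (swap_seq t i)) * (?e (Gtau t) * u)"
      unfolding c by (rule eqv_sym[OF eg_E[OF bwt_T[OF u j tauidem(1)] eg_T[OF u eqv_refl]]])
    finally show ?case by (simp add: ext_mult algebra_simps eqv_def)
  next
    case (xx k l)
    have "?e (Gx k) * (?e (Gx l) * u) \<bumpeq>\<^bsub>L\<^esub> X (?o + k) * (X (?o + l) * u)"
      by (rule eg_X[OF bwt_X[OF u] eg_X[OF u eqv_refl]])
    also have "\<dots> \<bumpeq>\<^bsub>L\<^esub> X (?o + l) * (X (?o + k) * u)" by (rule XX_act)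
    also have "\<dots> \<bumpeq>\<^bsub>L\<^esub> ?e (Gx l) * (?e (Gx k) * u)"
      by (rule eqv_sym[OF eg_X[OF bwt_X[OF u] eg_X[OF u eqv_refl]]])
    finally show ?case by (simp add: ext_mult algebra_simps eqv_def)
  next
    case (tautau t s)
    have "?e (Gtau t) * (?e (Gtau s) * u) \<bumpeq>\<^bsub>L\<^esub> T (?o + t) * (T (?o + s) * u)"
      by (rule eg_T[OF bwt_T[OF u j tautau(2)] eg_T[OF u eqv_refl]])
    also have "\<dots> \<bumpeq>\<^bsub>L\<^esub> T (?o + s) * (T (?o + t) * u)" by (rule TT_far) (use tautau in auto)
    also have "\<dots> \<bumpeq>\<^bsub>L\<^esub> ?e (Gtau s) * (?e (Gtau t) * u)"
      by (rule eqv_sym[OF eg_T[OF bwt_T[OF u j tautau(1)] eg_T[OF u eqv_refl]]])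
    finally show ?case by (simp add: ext_mult algebra_simps eqv_def)
  next
    case (quad t i)
    let ?A = "if entry i t = entry i (t + 1) then 0 else if \<not> adj (entry i t) (entry i (t + 1)) then 1
        else X t + X (t + 1) :: falg"
    have "T t * T t * E i - (if entry i t = entry i (t + 1) then 0
        else if \<not> adj (entry i t) (entry i (t + 1)) then E i
        else (X t + X (t + 1)) * E i) = (T t * T t - ?A) * E i" by (simp add: algebra_simps)
    moreover have "ext ?e (T t * T t - ?A) * u \<bumpeq>\<^bsub>L\<^esub> 0" if "?\<beta> = i"
    proof -
      have "?e (Gtau t) * (?e (Gtau t) * u) \<bumpeq>\<^bsub>L\<^esub> T (?o + t) * (T (?o + t) * u)"
        by (rule eg_T[OF bwt_T[OF u j quad(1)] eg_T[OF u eqv_refl]])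
      also note TT_act[OF wu tr[OF quad(1)]]
      also have "(if entry (concat b) (?o + t) = entry (concat b) (?o + t + 1) then 0
        else if \<not> adj (entry (concat b) (?o + t)) (entry (concat b) (?o + t + 1)) then u
        else X (?o + t) * u + X (?o + t + 1) * u) \<bumpeq>\<^bsub>L\<^esub> ext ?e ?A * u"
        using en[of t] en[of "t + 1"] quad(1) that
          eqv_add[OF eqv_sym[OF eg_X[OF u eqv_refl, of j t]] eqv_sym[OF eg_X[OF u eqv_refl, of j "t + 1"]]]
        by (simp add: algebra_simps)
      finally show ?thesis by (simp add: ext_mult algebra_simps eqv_def)
    qed
    ultimately show ?case using E_kill[of i "T t * T t - ?A"] by (simp only:)
  next
    case (braid t i)
    let ?A = "if entry i t = entry i (t + 2) \<and> adj (entry i t) (entry i (t + 1)) then 1 else 0 :: falg"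
    let ?P = "T t * T (t + 1) * T t - T (t + 1) * T t * T (t + 1) - ?A"
    have "T t * T (t + 1) * T t * E i - T (t + 1) * T t * T (t + 1) * E i
       - (if entry i t = entry i (t + 2) \<and> adj (entry i t) (entry i (t + 1)) then E i else 0) = ?P * E i"
      by (simp only: left_diff_distrib if_distrib[of "\<lambda>x. x * E i"] mult_1_left mult_zero_left mult_minus_left)
    moreover have "ext ?e ?P * u \<bumpeq>\<^bsub>L\<^esub> 0" if "?\<beta> = i"
    proof -
      have A: "(if entry (concat b) (?o + t) = entry (concat b) (?o + t + 2) \<and>
          adj (entry (concat b) (?o + t)) (entry (concat b) (?o + t + 1)) then u else 0) = ext ?e ?A * u"
        using en[of t] en[of "t + 1"] en[of "t + 2"] braid(1,2) that by (auto simp: add.assoc)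
      have "?e (Gtau t) * (?e (Gtau (t + 1)) * (?e (Gtau t) * u)) \<bumpeq>\<^bsub>L\<^esub> T (?o + t) * (T (?o + (t + 1)) * (T (?o + t) * u))"
        by (rule eg_T[OF bwt_T[OF bwt_T[OF u j braid(1)] j braid(2)] eg_T[OF bwt_T[OF u j braid(1)] eg_T[OF u eqv_refl]]])
      also have "\<dots> \<bumpeq>\<^bsub>L\<^esub> T (?o + t + 1) * (T (?o + t) * (T (?o + t + 1) * u)) + ext ?e ?A * u"
        using TTT_act[OF wu tr[OF braid(1)]] tr[OF braid(2)] unfolding A by (simp only: add.assoc)
      also have "\<dots> \<bumpeq>\<^bsub>L\<^esub> ?e (Gtau (t + 1)) * (?e (Gtau t) * (?e (Gtau (t + 1)) * u)) + ext ?e ?A * u"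
        using eg_T[OF bwt_T[OF bwt_T[OF u j braid(2)] j braid(1)] eg_T[OF bwt_T[OF u j braid(2)] eg_T[OF u eqv_refl]], of j "t + 1"]
        by (intro eqv_add[OF eqv_sym eqv_refl]) (simp only: add.assoc)
      finally show ?thesis by (simp add: ext_mult algebra_simps eqv_def)
    qed
    ultimately show ?case using E_kill[of i ?P] by (simp only:)
  next
    case (taux t k i)
    let ?k = "if k = t then t + 1 else if k = t + 1 then t else k"
    let ?A = "if k = t \<and> entry i t = entry i (t + 1) then 1
          else if k = t + 1 \<and> entry i t = entry i (t + 1) then - 1 else 0 :: falg"
    let ?P = "T t * X k - X ?k * T t - ?A"
    have "T t * X k * E i - X ?k * T t * E i - (if k = t \<and> entry i t = entry i (t + 1) then E i
          else if k = t + 1 \<and> entry i t = entry i (t + 1) then - E i else 0) = ?P * E i"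
      by (simp only: left_diff_distrib if_distrib[of "\<lambda>x. x * E i"] mult_1_left mult_zero_left mult_minus_left)
    moreover have "ext ?e ?P * u \<bumpeq>\<^bsub>L\<^esub> 0" if "?\<beta> = i"
    proof -
      have "?e (Gtau t) * (?e (Gx k) * u) \<bumpeq>\<^bsub>L\<^esub> T (?o + t) * (X (?o + k) * u)"
        by (rule eg_T[OF bwt_X[OF u] eg_X[OF u eqv_refl]])
      also have "\<dots> \<bumpeq>\<^bsub>L\<^esub> X (?o + ?k) * (T (?o + t) * u) + ext ?e ?A * u"
      proof -
        have A: "(if ?o + k = ?o + t \<and> entry (concat b) (?o + t) = entry (concat b) (?o + t + 1) then u
          else if ?o + k = ?o + t + 1 \<and> entry (concat b) (?o + t) = entry (concat b) (?o + t + 1) then - u else 0)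
          = ext ?e ?A * u"
          using en[of t] en[of "t + 1"] taux(1,2) that by (auto simp: add.assoc)
        have "(if ?o + k = ?o + t then ?o + t + 1 else if ?o + k = ?o + t + 1 then ?o + t else ?o + k) = ?o + ?k" by auto
        then show ?thesis using TX_act[OF wu tr[OF taux(1)] xr[OF taux(2)]] unfolding A by (simp only:)
      qed
      also have "\<dots> \<bumpeq>\<^bsub>L\<^esub> ?e (Gx ?k) * (?e (Gtau t) * u) + ext ?e ?A * u"
        by (rule eqv_add[OF eqv_sym[OF eg_X[OF bwt_T[OF u j taux(1)] eg_T[OF u eqv_refl]]] eqv_refl])
      finally show ?thesis by (simp add: ext_mult algebra_simps eqv_def)
    qed
    ultimately show ?case using E_kill[of i ?P] by (simp only:)
  qed
  then show ?thesis by simp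
qed

lemma klr_ideal_act:
  assumes "p \<in> klr_ideal n (ws ! j)" "j < length ws" "bwt b u"
  shows "ext (eg n ws j) p * u \<in> L"
proof -
  let ?e = "eg n ws j"
  let ?H = "{p. \<forall>b u. bwt b u \<longrightarrow> ext ?e p * u \<in> L}"
  have "klr_ideal n (ws ! j) \<subseteq> ?H"
  proof (rule klr_ideal_minimal)
    show "add_sg ?H" by (auto simp: add_sg_def left_diff_distrib intro: L_diff)
    show "q * p \<in> ?H" if "p \<in> ?H" for p q
      using that by (auto simp: ext_mult mult.assoc intro: L_mult)
    show "p * q \<in> ?H" if p: "p \<in> ?H" and q: "q \<in> legal n (ws ! j)" for p q
    proof -
      have "ext ?e p * (ext ?e q * u) \<in> L" if bu: "bwt b u" for b u
        using q[unfolded legal_def mem_Collect_eq]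
      proof (induction q rule: poly_mapping_induct_on)
        case (single w a)
        obtain b' where "bwt b' (wprod ?e w * u)" using wprod_eg[OF bu assms(2), of w] single by auto
        then have "ext ?e p * (wprod ?e w * u) \<in> L" using p by blast
        then have "cs a (ext ?e p * (wprod ?e w * u)) \<in> L" by (rule L_cs)
        then show ?case by (simp add: ext_def cs_mult_left cs_mult_right)
      qed (simp_all add: algebra_simps L_add)
      then show ?thesis by (auto simp: ext_mult mult.assoc)
    qed
    show "klr_rels n (ws ! j) \<subseteq> ?H" using rel_act[OF _ assms(2)] by blast
  qed
  then show ?thesis using assms by blast
qed

lemma Ev_kills: "p \<in> klr_ideal n (ws ! j) \<Longrightarrow> j < length ws \<Longrightarrow> Ev n ws j p \<in> L"
proof -
  assume a: "p \<in> klr_ideal n (ws ! j)" "j < length ws"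
  have "(\<Sum>b\<in>blocks n ws. ext (eg n ws j) p * E (concat b)) \<in> L"
  proof (rule add_sg_sum[OF sgL])
    fix b assume b: "b \<in> blocks n ws"
    show "ext (eg n ws j) p * E (concat b) \<in> L"
      using klr_ideal_act[OF a, of b "E (concat b)"] wt_E[OF concat_in_seqs[OF b], of 1] b by simp
  qed
  then show ?thesis by (simp add: Ev_def ci_def sum_distrib_left)
qed

end

section \<open>Representatives of classes and well-definedness of the embedding\<close>

lemma prod_list_update:
  "j < length xs \<Longrightarrow> prod_list (xs[j := y]) = prod_list (take j xs) * y * prod_list (drop (Suc j) xs)"
  for y :: "'a::monoid_mult"
  by (simp add: upd_conv_take_nth_drop mult.assoc)

lemma map_upt_update: "length us = k \<Longrightarrow> j < k \<Longrightarrow>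
    map (\<lambda>i. f i (us[j := v] ! i)) [0..<k] = (map (\<lambda>i. f i (us ! i)) [0..<k])[j := f j v]"
  by (rule nth_equalityI) (auto simp: nth_list_update)

text \<open>Functions on classes are defined through \<open>the_elem\<close> over all
  representatives. Once the value is known to be constant, a fixed representative turns them into
  expressions in the free algebra.\<close>

definition rp :: "klr_elt \<Rightarrow> falg" where "rp P = (SOME p. p \<in> P)"

lemma rp_mem: "P \<in> carrier (klr n \<alpha>) \<Longrightarrow> rp P \<in> P"
  unfolding rp_def carrier_klr using cls_nonempty by (metis imageE someI)

lemma rp_cls: "rp (cls n \<alpha> q) - q \<in> J n \<alpha>" "rp (cls n \<alpha> q) \<in> legal n \<alpha>"
  using mem_cls[OF rp_mem[of "cls n \<alpha> q" n \<alpha>]] by (auto simp: carrier_klr)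

lemma cls_rp: "P \<in> carrier (klr n \<alpha>) \<Longrightarrow> cls n \<alpha> (rp P) = P"
proof -
  assume "P \<in> carrier (klr n \<alpha>)"
  then obtain q where "P = cls n \<alpha> q" by (auto simp: carrier_klr)
  then show ?thesis using rp_cls(1)[of n \<alpha> q] by (simp only: cls_eq_iff)
qed

lemma rp_klr_ideal:
  "q \<in> legal n \<alpha> \<Longrightarrow> rp (cls n \<alpha> q) - q \<in> klr_ideal n \<alpha>"
  using J_legal[OF rp_cls(1) legal_diff[OF rp_cls(2)]] .

lemma legal_cs: "p \<in> legal n \<alpha> \<Longrightarrow> cs c p \<in> legal n \<alpha>"
  unfolding cs_def by (intro legal_mult legal_cmon) auto

lemma rp_add_scale:
  assumes "P \<in> carrier (klr n \<alpha>)" "Q \<in> carrier (klr n \<alpha>)"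
  shows "rp (P \<oplus>\<^bsub>klr n \<alpha>\<^esub> Q) - (rp P + rp Q) \<in> klr_ideal n \<alpha>"
    "rp (c \<odot>\<^bsub>klr n \<alpha>\<^esub> P) - cs c (rp P) \<in> klr_ideal n \<alpha>"
proof -
  obtain p q where pq: "P = cls n \<alpha> p" "Q = cls n \<alpha> q" using assms by (auto simp: carrier_klr)
  have l: "rp P \<in> legal n \<alpha>" "rp Q \<in> legal n \<alpha>" by (simp_all add: pq rp_cls(2))
  have "P \<oplus>\<^bsub>klr n \<alpha>\<^esub> Q = cls n \<alpha> (rp P + rp Q)"
    using klr_simps(2)[of n \<alpha> "rp P" "rp Q"] cls_rp assms by simp
  then show "rp (P \<oplus>\<^bsub>klr n \<alpha>\<^esub> Q) - (rp P + rp Q) \<in> klr_ideal n \<alpha>" using rp_klr_ideal l legal_add by metis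
  have "c \<odot>\<^bsub>klr n \<alpha>\<^esub> P = cls n \<alpha> (cs c (rp P))"
    using klr_simps(4)[of n \<alpha> c "rp P"] cls_rp assms by simp
  then show "rp (c \<odot>\<^bsub>klr n \<alpha>\<^esub> P) - cs c (rp P) \<in> klr_ideal n \<alpha>" using rp_klr_ideal l legal_cs by metis
qed

lemma tensor_factors_klr: "tensor_factors (map (klr n) ws)"
  by (rule tensor_factors.intro) (auto simp: carrier_klr klr_simps cs_mult_left cs_mult_right ring_klr)

lemma the_elem_const: "x \<in> A \<Longrightarrow> (\<And>y. y \<in> A \<Longrightarrow> f y = c) \<Longrightarrow> the_elem (f ` A) = c"
  by (metis (mono_tags, lifting) empty_iff image_cong image_constant the_elem_eq)

lemma wprod_mult: "wprod f w * c = foldr (*) (map f w) c"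
  by (induction w) (simp_all add: wprod_def mult.assoc)

lemma foldr_mult: "foldr (*) xs c = prod_list xs * c" for c :: "'a::monoid_mult"
  by (induction xs) (simp_all add: mult.assoc)

locale klr_tensor =
  fixes n :: nat and ws :: "nat multiset list"
begin

abbreviation "\<alpha> \<equiv> sum_list ws"
abbreviation "R \<equiv> klr n \<alpha>"

sublocale Jc: concat_left n ws "J n \<alpha>"
  by (intro concat_left.intro klr_left_J)

sublocale tf: tensor_factors "map (klr n) ws"
  by (rule tensor_factors_klr)

lemma tup_klr: "us \<in> tf.tup \<longleftrightarrow> length us = length ws \<and> (\<forall>j<length ws. us ! j \<in> carrier (klr n (ws ! j)))"
  by (auto simp: tf.tup_iff)

lemma legal_ci: "ci n ws \<in> legal n \<alpha>"
  unfolding ci_def by (intro legal_sum legal_cmon) (auto simp: gens_memb concat_in_seqs)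

lemma concat_idem_cls: "concat_idem n ws = cls n \<alpha> (ci n ws)"
  using klr_class_eq[OF legal_ci] by (simp add: concat_idem_def ci_def)

lemma embed_gen_cls:
  assumes "j < length ws" "g \<in> klr_gens n (ws ! j)"
  shows "embed_gen n ws j g = cls n \<alpha> (eg n ws j g)"
proof (cases g)
  case (Gidem i)
  have "(\<Sum>b\<in>{b \<in> blocks n ws. b ! j = i}. E (concat b)) \<in> legal n \<alpha>"
    by (intro legal_sum legal_cmon) (auto simp: gens_memb concat_in_seqs)
  then show ?thesis by (simp add: Gidem eg_def klr_class_eq)
next
  case (Gx k)
  have "(\<Sum>b\<in>blocks n ws. cmon 1 [Gx (offset ws j + k), Gidem (concat b)]) = X (offset ws j + k) * ci n ws"
    by (simp add: ci_def sum_distrib_left cmon_mult)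
  moreover have "X (offset ws j + k) * ci n ws \<in> legal n \<alpha>"
    using assms offset_bound[OF assms(1)] legal_ci by (intro legal_mult legal_cmon) (auto simp: gens_memb Gx)
  ultimately show ?thesis by (simp add: Gx eg_def klr_class_eq)
next
  case (Gtau t)
  have "(\<Sum>b\<in>blocks n ws. cmon 1 [Gtau (offset ws j + t), Gidem (concat b)]) = T (offset ws j + t) * ci n ws"
    by (simp add: ci_def sum_distrib_left cmon_mult)
  moreover have "T (offset ws j + t) * ci n ws \<in> legal n \<alpha>"
    using assms offset_bound[OF assms(1)] legal_ci by (intro legal_mult legal_cmon) (auto simp: gens_memb Gtau)
  ultimately show ?thesis by (simp add: Gtau eg_def klr_class_eq)
qed

lemma embed_prod_cls: "embed_prod n ws (map (cls n \<alpha>) ps) = cls n \<alpha> (prod_list ps * ci n ws)"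
  unfolding embed_prod_def by (induction ps) (simp_all add: concat_idem_cls klr_simps mult.assoc)

lemma lincomb_cls:
  assumes "\<And>u. u \<in> Poly_Mapping.keys p \<Longrightarrow> F u = cls n \<alpha> (f u)"
  shows "(\<Oplus>\<^bsub>R\<^esub>u\<in>Poly_Mapping.keys p. Poly_Mapping.lookup p u \<odot>\<^bsub>R\<^esub> F u) = cls n \<alpha> (linext cs f p)"
proof -
  interpret ring R by (rule ring_klr)
  have "(\<Oplus>\<^bsub>R\<^esub>u\<in>Poly_Mapping.keys p. Poly_Mapping.lookup p u \<odot>\<^bsub>R\<^esub> F u)
      = (\<Oplus>\<^bsub>R\<^esub>u\<in>Poly_Mapping.keys p. cls n \<alpha> (cs (Poly_Mapping.lookup p u) (f u)))"
    by (rule finsum_cong') (auto simp: assms klr_simps carrier_klr)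
  then show ?thesis by (simp add: klr_sum linext_def)
qed

lemma Ev_diff: "Ev n ws j (p - q) = Ev n ws j p - Ev n ws j q"
  by (simp add: Ev_def left_diff_distrib)

lemma embed_factor_cls:
  assumes "j < length ws" "P \<in> carrier (klr n (ws ! j))"
  shows "embed_factor n ws j P = cls n \<alpha> (Ev n ws j (rp P))"
proof -
  have "(\<Oplus>\<^bsub>R\<^esub>w\<in>Poly_Mapping.keys p. Poly_Mapping.lookup p w \<odot>\<^bsub>R\<^esub> embed_prod n ws (map (embed_gen n ws j) w))
      = cls n \<alpha> (Ev n ws j (rp P))" if p: "p \<in> P" for p
  proof -
    have pl: "p \<in> legal n (ws ! j)" "p - rp P \<in> J n (ws ! j)"
      using p mem_cls[of p n "ws ! j" "rp P"] cls_rp[OF assms(2)] by auto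
    have "embed_prod n ws (map (embed_gen n ws j) w) = cls n \<alpha> (wprod (eg n ws j) w * ci n ws)"
      if "w \<in> Poly_Mapping.keys p" for w
    proof -
      have "map (embed_gen n ws j) w = map (cls n \<alpha>) (map (eg n ws j) w)"
        using that pl(1) embed_gen_cls[OF assms(1)] by (auto simp: legal_def)
      then show ?thesis using embed_prod_cls[of "map (eg n ws j) w"] unfolding wprod_mult foldr_mult by (simp only:)
    qed
    from lincomb_cls[OF this] have "(\<Oplus>\<^bsub>R\<^esub>w\<in>Poly_Mapping.keys p. Poly_Mapping.lookup p w \<odot>\<^bsub>R\<^esub> embed_prod n ws (map (embed_gen n ws j) w))
      = cls n \<alpha> (linext cs (\<lambda>w. wprod (eg n ws j) w * ci n ws) p)" .
    moreover have "linext cs (\<lambda>w. wprod (eg n ws j) w * ci n ws) p = Ev n ws j p"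
      by (simp add: Ev_def ext_def linext_def sum_distrib_right cs_mult_left)
    moreover have "rp P \<in> legal n (ws ! j)" using rp_cls(2)[of n "ws ! j" "rp P"] cls_rp[OF assms(2)] by simp
    then have "Ev n ws j (p - rp P) \<in> J n \<alpha>"
      using Jc.Ev_kills[OF J_legal[OF pl(2) legal_diff[OF pl(1)]] assms(1)] by blast
    ultimately show ?thesis by (simp add: Ev_diff cls_eq_iff)
  qed
  then show ?thesis
    unfolding embed_factor_def Let_def by (rule the_elem_const[OF rp_mem[OF assms(2)]])
qed

text \<open>The lift of the embedding on pure tensors. It is multilinear only modulo
  \<open>J\<close>, because representatives are chosen.\<close>

definition \<Phi> :: "klr_elt list \<Rightarrow> falg" where
  "\<Phi> Ps = prod_list (map (\<lambda>j. Ev n ws j (rp (Ps ! j))) [0..<length ws]) * ci n ws"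

definition EF :: "(klr_elt list \<Rightarrow>\<^sub>0 complex) \<Rightarrow> falg" where
  "EF = linext cs \<Phi>"

lemma \<Phi>_update:
  assumes "us \<in> tf.tup" "j < length ws"
  obtains a b where "\<And>v. \<Phi> (us[j := v]) = a * Ev n ws j (rp v) * b"
proof -
  let ?xs = "map (\<lambda>j. Ev n ws j (rp (us ! j))) [0..<length ws]"
  have "\<Phi> (us[j := v]) = prod_list (take j ?xs) * Ev n ws j (rp v) * (prod_list (drop (Suc j) ?xs) * ci n ws)" for v
    unfolding \<Phi>_def using assms
    by (subst map_upt_update[where f = "\<lambda>j v. Ev n ws j (rp v)"])
      (simp_all add: tup_klr prod_list_update mult.assoc del: drop_map take_map)
  then show thesis by (rule that)
qed

lemma Ev_simps: "Ev n ws j (p + q) = Ev n ws j p + Ev n ws j q" "Ev n ws j (cs c p) = cs c (Ev n ws j p)"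
  by (simp_all add: Ev_def distrib_right cs_mult_left)

text \<open>Changing one entry of a tuple changes one factor of the product, and there additivity
  and homogeneity fail only by images of elements of the relation ideal.\<close>

lemma EF_TI: "q \<in> tf.TI \<Longrightarrow> EF q \<in> J n \<alpha>"
  unfolding EF_def
proof (rule tf.kills_TI[OF cs.scaling_axioms add_sg_J])
  show "cs c x \<in> J n \<alpha>" if "x \<in> J n \<alpha>" for c x using Jc.L_cs that by simp
  fix us j u v assume a: "us \<in> tf.tup" "j < length (map (klr n) ws)" "u \<in> carrier (map (klr n) ws ! j)" "v \<in> carrier (map (klr n) ws ! j)"
  then have j: "j < length ws" and uv: "u \<in> carrier (klr n (ws ! j))" "v \<in> carrier (klr n (ws ! j))" by auto
  obtain a' b' where ab: "\<And>v. \<Phi> (us[j := v]) = a' * Ev n ws j (rp v) * b'" using \<Phi>_update[OF a(1) j] by blast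
  have "a' * Ev n ws j (rp (u \<oplus>\<^bsub>klr n (ws ! j)\<^esub> v) - (rp u + rp v)) * b' \<in> J n \<alpha>"
    by (intro J_mult_left J_mult_right Jc.Ev_kills[OF rp_add_scale(1)[OF uv] j])
  then show "\<Phi> (us[j := u \<oplus>\<^bsub>map (klr n) ws ! j\<^esub> v]) - \<Phi> (us[j := u]) - \<Phi> (us[j := v]) \<in> J n \<alpha>"
    unfolding ab nth_map[OF j] by (simp add: Ev_diff Ev_simps algebra_simps)
next
  fix us j c u assume a: "us \<in> tf.tup" "j < length (map (klr n) ws)" "u \<in> carrier (map (klr n) ws ! j)"
  then have j: "j < length ws" and u: "u \<in> carrier (klr n (ws ! j))" by auto
  obtain a' b' where ab: "\<And>v. \<Phi> (us[j := v]) = a' * Ev n ws j (rp v) * b'" using \<Phi>_update[OF a(1) j] by blast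
  have "a' * Ev n ws j (rp (c \<odot>\<^bsub>klr n (ws ! j)\<^esub> u) - cs c (rp u)) * b' \<in> J n \<alpha>"
    by (intro J_mult_left J_mult_right Jc.Ev_kills[OF rp_add_scale(2)[OF u u] j])
  then show "\<Phi> (us[j := c \<odot>\<^bsub>map (klr n) ws ! j\<^esub> u]) - cs c (\<Phi> (us[j := u])) \<in> J n \<alpha>"
    unfolding ab nth_map[OF j] by (simp add: Ev_diff Ev_simps algebra_simps cs_mult_left cs_mult_right)
qed

lemma EF_diff: "EF (p - q) = EF p - EF q"
  by (simp add: EF_def cs.linext_minus)

lemma mem_cst_TI: "q \<in> tf.TA \<Longrightarrow> q' \<in> cst tf.TI q \<Longrightarrow> q' \<in> tf.TA \<and> q' - q \<in> tf.TI"
  using add_sg_add[OF tf.add_sg_TA, of "q' - q" q] tf.TI_sub_TA by (auto simp: cst_def)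

lemma concat_embed_cls:
  assumes "q \<in> tf.TA"
  shows "concat_embed n ws (cst tf.TI q) = cls n \<alpha> (EF q)"
proof -
  have "(\<Oplus>\<^bsub>R\<^esub>Ps\<in>Poly_Mapping.keys q'. Poly_Mapping.lookup q' Ps \<odot>\<^bsub>R\<^esub>
       embed_prod n ws (map (\<lambda>j. embed_factor n ws j (Ps ! j)) [0..<length ws])) = cls n \<alpha> (EF q)"
    if q': "q' \<in> cst tf.TI q" for q'
  proof -
    have "embed_prod n ws (map (\<lambda>j. embed_factor n ws j (Ps ! j)) [0..<length ws]) = cls n \<alpha> (\<Phi> Ps)"
      if "Ps \<in> Poly_Mapping.keys q'" for Ps
    proof -
      have "Ps \<in> tf.tup" using mem_cst_TI[OF assms q'] that by (auto simp: tf.TA_def)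
      then have "map (\<lambda>j. embed_factor n ws j (Ps ! j)) [0..<length ws] =
          map (cls n \<alpha>) (map (\<lambda>j. Ev n ws j (rp (Ps ! j))) [0..<length ws])"
        by (auto simp: tup_klr intro!: embed_factor_cls)
      then show ?thesis by (simp only: embed_prod_cls \<Phi>_def)
    qed
    from lincomb_cls[OF this] have "(\<Oplus>\<^bsub>R\<^esub>Ps\<in>Poly_Mapping.keys q'. Poly_Mapping.lookup q' Ps \<odot>\<^bsub>R\<^esub>
       embed_prod n ws (map (\<lambda>j. embed_factor n ws j (Ps ! j)) [0..<length ws])) = cls n \<alpha> (EF q')" by (simp add: EF_def)
    then show ?thesis using EF_TI[of "q' - q"] mem_cst_TI[OF assms q'] by (simp add: EF_diff cls_eq_iff)
  qed
  then show ?thesis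
    unfolding concat_embed_def Let_def by (rule the_elem_const[OF cst_self[OF tf.add_sg_TI]])
qed

end

section \<open>Products of segment modules\<close>

lemma seg_char_linext: "seg_char sg = linext (*) (\<lambda>w. prod_list (map (seg_gen sg) w))"
  by (rule HOL.ext) (simp add: seg_char_def linext_def)

lemma seg_char_simps:
  "seg_char sg (p + q) = seg_char sg p + seg_char sg q" "seg_char sg (p - q) = seg_char sg p - seg_char sg q"
  "seg_char sg 0 = 0" "seg_char sg (p * q) = seg_char sg p * seg_char sg q" "seg_char sg (gg g) = seg_gen sg g"
  "seg_char sg 1 = 1" "seg_char sg (sum f A) = (\<Sum>i\<in>A. seg_char sg (f i))" "seg_char sg (cs c p) = c * seg_char sg p"
  "seg_char sg (- p) = - seg_char sg p"
proof -
  show 1: "seg_char sg (p * q) = seg_char sg p * seg_char sg q" for p q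
    unfolding seg_char_linext by (rule linext_cm_mult) simp
  have c: "seg_char sg (cmon c []) = c" for c by (simp add: seg_char_linext)
  show "seg_char sg 1 = 1" using c[of 1] by (simp add: cmon_one)
  show "seg_char sg (cs c p) = c * seg_char sg p" by (simp add: cs_def 1 c)
  show "seg_char sg (p - q) = seg_char sg p - seg_char sg q" for p q by (simp add: seg_char_linext cm.linext_minus)
  from this[of 0 p] show "seg_char sg (- p) = - seg_char sg p" by (simp add: seg_char_linext)
qed (simp_all add: seg_char_linext cm.linext_add cm.linext_sum)

text \<open>Only idempotents survive, and only the one of the segment. Consecutive letters of a
  segment are neighbours, so the quadratic relation yields dots, which act by 0; the corrections of
  the other relations require equal letters at distance one or two, which do not occur.\<close>

lemma seg_char_kills:
  assumes "set [a..<a + l] \<subseteq> {1..n}" "p \<in> klr_ideal n (seg_weight (a, l))"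
  shows "seg_char (a, l) p = 0"
proof -
  let ?s = "seg_char (a, l)"
  let ?i = "[a..<a + l]"
  have i: "?i \<in> seqs n (seg_weight (a, l))" using assms(1) by (simp add: seqs_def seg_weight_def)
  have sz: "size (seg_weight (a, l)) = l" by (simp add: seg_weight_def)
  have "klr_ideal n (seg_weight (a, l)) \<subseteq> {p. ?s p = 0}"
  proof (rule klr_ideal_minimal)
    show "klr_rels n (seg_weight (a, l)) \<subseteq> {p. ?s p = 0}"
    proof
      fix r assume "r \<in> klr_rels n (seg_weight (a, l))"
      then have "?s r = 0"
      proof (induct rule: klr_rels_cases)
        case unit
        then show ?case using i by (simp add: seg_char_simps)
      next
        case (quad t i)
        then show ?case by (cases "i = ?i") (auto simp: seg_char_simps adj_def sz)
      next
        case (taux t k i)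
        then show ?case by (cases "i = ?i") (auto simp: seg_char_simps sz)
      next
        case (braid t i)
        then show ?case by (cases "i = ?i") (auto simp: seg_char_simps sz)
      qed (auto simp: seg_char_simps)
      then show "r \<in> {p. ?s p = 0}" by simp
    qed
  qed (auto simp: add_sg_def seg_char_simps)
  then show ?thesis using assms(2) by blast
qed

locale segment_list =
  fixes n :: nat and segs :: "(nat \<times> nat) list"
  assumes letters: "(a, l) \<in> set segs \<Longrightarrow> set [a..<a + l] \<subseteq> {1..n}"
begin

abbreviation "ws \<equiv> map seg_weight segs"
abbreviation "k \<equiv> length segs"

sublocale klr_tensor n ws .

definition \<sigma> :: "nat \<Rightarrow> klr_elt \<Rightarrow> complex" where
  "\<sigma> j P = seg_char (segs ! j) (rp P)"

lemma \<sigma>_eq: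
  assumes "j < k" "P \<in> carrier (klr n (ws ! j))"
  shows "the_elem (seg_char (segs ! j) ` P) = \<sigma> j P"
proof (rule the_elem_const[OF rp_mem[OF assms(2)]])
  fix p assume "p \<in> P"
  then have p: "p - rp P \<in> J n (ws ! j)" "p \<in> legal n (ws ! j)"
    using mem_cls[of p n "ws ! j" "rp P"] cls_rp[OF assms(2)] by auto
  have "rp P \<in> legal n (ws ! j)" using rp_cls(2)[of n "ws ! j" "rp P"] cls_rp[OF assms(2)] by simp
  then have "p - rp P \<in> klr_ideal n (seg_weight (segs ! j))"
    using J_legal[OF p(1) legal_diff[OF p(2)]] assms(1) by simp
  then have "seg_char (segs ! j) (p - rp P) = 0"
    using seg_char_kills[of "fst (segs ! j)" "snd (segs ! j)"] letters[of "fst (segs ! j)" "snd (segs ! j)"] assms(1) by simp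
  then show "seg_char (segs ! j) p = \<sigma> j P" by (simp add: seg_char_simps \<sigma>_def)
qed

lemma \<sigma>_cls: "j < k \<Longrightarrow> q \<in> legal n (ws ! j) \<Longrightarrow> \<sigma> j (cls n (ws ! j) q) = seg_char (segs ! j) q"
proof -
  assume a: "j < k" "q \<in> legal n (ws ! j)"
  then have "rp (cls n (ws ! j) q) - q \<in> klr_ideal n (seg_weight (segs ! j))" using rp_klr_ideal[of q n "ws ! j"] by simp
  then have "seg_char (segs ! j) (rp (cls n (ws ! j) q) - q) = 0"
    using seg_char_kills[of "fst (segs ! j)" "snd (segs ! j)"] letters[of "fst (segs ! j)" "snd (segs ! j)"] a(1) by simp
  then show ?thesis by (simp add: \<sigma>_def seg_char_simps)
qed

lemma \<sigma>_add_scale: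
  assumes "j < k" "P \<in> carrier (klr n (ws ! j))" "Q \<in> carrier (klr n (ws ! j))"
  shows "\<sigma> j (P \<oplus>\<^bsub>klr n (ws ! j)\<^esub> Q) = \<sigma> j P + \<sigma> j Q" "\<sigma> j (c \<odot>\<^bsub>klr n (ws ! j)\<^esub> P) = c * \<sigma> j P"
proof -
  have z: "seg_char (segs ! j) p = 0" if "p \<in> klr_ideal n (ws ! j)" for p
    using seg_char_kills[of "fst (segs ! j)" "snd (segs ! j)"] letters[of "fst (segs ! j)" "snd (segs ! j)"] assms(1) that by simp
  show "\<sigma> j (P \<oplus>\<^bsub>klr n (ws ! j)\<^esub> Q) = \<sigma> j P + \<sigma> j Q"
    using z[OF rp_add_scale(1)[OF assms(2,3)]] by (simp add: \<sigma>_def seg_char_simps)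
  show "\<sigma> j (c \<odot>\<^bsub>klr n (ws ! j)\<^esub> P) = c * \<sigma> j P"
    using z[OF rp_add_scale(2)[OF assms(2,3)]] by (simp add: \<sigma>_def seg_char_simps)
qed

text \<open>The character by which the tensor product of algebras acts on the one-dimensional
  product of segment modules.\<close>

definition \<chi>0 :: "klr_elt list \<Rightarrow> complex" where
  "\<chi>0 us = prod_list (map (\<lambda>j. \<sigma> j (us ! j)) [0..<k])"

definition \<chi> :: "(klr_elt list \<Rightarrow>\<^sub>0 complex) \<Rightarrow> complex" where
  "\<chi> = linext (*) \<chi>0"

lemma \<chi>0_update:
  assumes "us \<in> tf.tup" "j < k"
  obtains a where "\<And>v. \<chi>0 (us[j := v]) = a * \<sigma> j v"
proof -
  let ?xs = "map (\<lambda>j. \<sigma> j (us ! j)) [0..<k]"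
  have "\<chi>0 (us[j := v]) = prod_list (take j ?xs) * prod_list (drop (Suc j) ?xs) * \<sigma> j v" for v
    unfolding \<chi>0_def using assms
    by (subst map_upt_update) (simp_all add: tup_klr prod_list_update mult_ac del: drop_map take_map map_map)
  then show thesis by (rule that)
qed

lemma \<chi>_TI: "q \<in> tf.TI \<Longrightarrow> \<chi> q = 0"
proof -
  have "\<chi> q \<in> {0}" if "q \<in> tf.TI"
    unfolding \<chi>_def
  proof (rule tf.kills_TI[OF cm.scaling_axioms _ _ _ _ that])
    fix us j u v assume a: "us \<in> tf.tup" "j < length (map (klr n) ws)" "u \<in> carrier (map (klr n) ws ! j)" "v \<in> carrier (map (klr n) ws ! j)"
    then have j: "j < k" and uv: "u \<in> carrier (klr n (ws ! j))" "v \<in> carrier (klr n (ws ! j))" by auto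
    obtain b where "\<And>v. \<chi>0 (us[j := v]) = b * \<sigma> j v" using \<chi>0_update[OF a(1) j] by blast
    then show "\<chi>0 (us[j := u \<oplus>\<^bsub>map (klr n) ws ! j\<^esub> v]) - \<chi>0 (us[j := u]) - \<chi>0 (us[j := v]) \<in> {0}"
      using \<sigma>_add_scale(1)[OF j uv] j by (simp add: algebra_simps)
  next
    fix us j c u assume a: "us \<in> tf.tup" "j < length (map (klr n) ws)" "u \<in> carrier (map (klr n) ws ! j)"
    then have j: "j < k" and u: "u \<in> carrier (klr n (ws ! j))" by auto
    obtain b where "\<And>v. \<chi>0 (us[j := v]) = b * \<sigma> j v" using \<chi>0_update[OF a(1) j] by blast
    then show "\<chi>0 (us[j := c \<odot>\<^bsub>map (klr n) ws ! j\<^esub> u]) - c * \<chi>0 (us[j := u]) \<in> {0}"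
      using \<sigma>_add_scale(2)[OF j u u] j by (simp add: algebra_simps)
  qed (auto simp: add_sg_def)
  then show "q \<in> tf.TI \<Longrightarrow> \<chi> q = 0" by simp
qed

lemma \<chi>_cong: "q \<in> tf.TA \<Longrightarrow> q' \<in> cst tf.TI q \<Longrightarrow> \<chi> q' = \<chi> q"
  using \<chi>_TI[of "q' - q"] mem_cst_TI by (simp add: \<chi>_def cm.linext_minus)

section \<open>The outer tensor product of segment modules is one-dimensional\<close>

abbreviation "V \<equiv> {us :: complex list. length us = k}"
abbreviation "F \<equiv> free_space V"
abbreviation "lam \<equiv> linext (*) (prod_list :: complex list \<Rightarrow> complex)"
abbreviation "mrels \<equiv> multilin_rels (map (\<lambda>_. (UNIV :: complex set, (+), (*))) segs)"

lemma mrels_eq: "multilin_rels (map (\<lambda>(R, M). (carrier M, ring.add M, cscale R M)) (zip (map (klr n) ws) (map seg_module segs))) = mrels"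
proof -
  have "cscale (klr n (ws ! j)) (seg_module (segs ! j)) c v = c * v" if "j < k" for j c v
  proof -
    have l: "cs c 1 \<in> legal n (ws ! j)" by (rule legal_cs[OF legal_one])
    have "the_elem (seg_char (segs ! j) ` cls n (ws ! j) (cs c 1)) = c"
      using \<sigma>_eq[OF that, of "cls n (ws ! j) (cs c 1)"] \<sigma>_cls[OF that l] by (simp add: carrier_klr seg_char_simps)
    then show ?thesis by (simp add: cscale_def klr_one klr_simps seg_module_def)
  qed
  then have "map (\<lambda>(R, M). (carrier M, ring.add M, cscale R M)) (zip (map (klr n) ws) (map seg_module segs)) =
      map (\<lambda>_. (UNIV, (+), (*))) segs"
    by (intro nth_equalityI) (auto simp: seg_module_def fun_eq_iff)
  then show ?thesis by simp
qed

lemma tuples_V: "tuples (map carrier (map seg_module segs)) = V"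
  by (auto simp: tuples_def seg_module_def)

lemma mrels_cases:
  assumes "r \<in> mrels"
  obtains (add) a us j u v where "us \<in> V" "j < k"
      "r = cmon a (us[j := u + v]) - cmon a (us[j := u]) - cmon a (us[j := v])"
    | (scale) a us j c u where "us \<in> V" "j < k" "r = cmon a (us[j := c * u]) - cmon (a * c) (us[j := u])"
  using assms unfolding multilin_rels_def by (auto simp: tuples_def)

lemma mrels_scale: "us \<in> V \<Longrightarrow> j < k \<Longrightarrow> cmon a (us[j := c * u]) - cmon (a * c) (us[j := u]) \<in> mrels"
  unfolding multilin_rels_def
  by (rule UnI2, intro CollectI exI[of _ a] exI[of _ us] exI[of _ j] exI[of _ UNIV] exI[of _ "(+)"] exI[of _ "(*)"]
      exI[of _ c] exI[of _ u]) (auto simp: tuples_def)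

definition N :: "(complex list \<Rightarrow>\<^sub>0 complex) set" where
  "N = {p. Poly_Mapping.keys p \<subseteq> V \<and> lam p = 0}"

lemma add_sg_N: "add_sg N"
  using add_sg_keys[of V] by (auto simp: add_sg_def N_def cm.linext_minus)

lemma mrels_N: "mrels \<subseteq> N"
proof
  fix r assume "r \<in> mrels"
  then show "r \<in> N"
  proof (cases rule: mrels_cases)
    case (add a us j u v)
    have "r \<in> {p. Poly_Mapping.keys p \<subseteq> V}" unfolding add(3)
      by (intro add_sg_diff[OF add_sg_keys]) (use add(1) in auto)
    moreover have "lam r = 0" unfolding add(3) using add(1,2)
      by (simp add: cm.linext_minus cm.linext_add prod_list_update algebra_simps)
    ultimately show ?thesis by (simp add: N_def)
  next
    case (scale a us j c u)
    have "r \<in> {p. Poly_Mapping.keys p \<subseteq> V}" unfolding scale(3)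
      by (intro add_sg_diff[OF add_sg_keys]) (use scale(1) in auto)
    moreover have "lam r = 0" unfolding scale(3) using scale(1,2)
      by (simp add: cm.linext_minus prod_list_update algebra_simps)
    ultimately show ?thesis by (simp add: N_def)
  qed
qed

abbreviation "ones \<equiv> replicate k (1 :: complex)"

lemma generate_F:
  shows "S \<subseteq> {p. Poly_Mapping.keys p \<subseteq> V} \<Longrightarrow> add_sg (generate (add_monoid F) S)"
    "S \<subseteq> {p. Poly_Mapping.keys p \<subseteq> V} \<Longrightarrow> S \<subseteq> generate (add_monoid F) S"
    "S \<subseteq> {p. Poly_Mapping.keys p \<subseteq> V} \<Longrightarrow> add_sg H \<Longrightarrow> S \<subseteq> H \<Longrightarrow> generate (add_monoid F) S \<subseteq> H"
  by (rule add_group_generate[of "add_monoid F" "{p. Poly_Mapping.keys p \<subseteq> V}"];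
      simp add: free_space_def add_sg_keys)+

text \<open>The multilinearity relations generate the whole kernel of the product of entries: modulo
  them every tuple is a multiple of the tuple of ones.\<close>

lemma generate_mrels: "generate (add_monoid F) mrels = N"
proof
  have S: "mrels \<subseteq> {p. Poly_Mapping.keys p \<subseteq> V}" using mrels_N by (auto simp: N_def)
  show "generate (add_monoid F) mrels \<subseteq> N" by (rule generate_F(3)[OF S add_sg_N mrels_N])
  let ?G = "generate (add_monoid F) mrels"
  note sg = generate_F(1)[OF S]
  \<comment> \<open>The first \<open>j\<close> entries have been moved into the coefficient, one
    after the other.\<close>
  have pull: "cmon c us - cmon (c * prod_list (take j us)) (replicate j 1 @ drop j us) \<in> ?G"
    if "us \<in> V" "j \<le> k" for c us j
    using that(2)
  proof (induction j)
    case 0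
    then show ?case using add_sg_0[OF sg] by simp
  next
    case (Suc j)
    let ?u = "replicate j 1 @ drop j us" and ?a = "c * prod_list (take j us)"
    have l: "length us = k" using that by simp
    have d: "drop j us = us ! j # drop (Suc j) us" using Suc.prems l by (simp add: Cons_nth_drop_Suc)
    have "cmon ?a (?u[j := us ! j * 1]) - cmon (?a * us ! j) (?u[j := 1]) \<in> ?G"
      by (rule subsetD[OF generate_F(2)[OF S]], rule mrels_scale) (use Suc.prems l in auto)
    moreover have "?u[j := us ! j * 1] = ?u" "?u[j := 1] = replicate (Suc j) 1 @ drop (Suc j) us"
      unfolding d by (simp_all add: list_update_append replicate_app_Cons_same)
    moreover have "?a * us ! j = c * prod_list (take (Suc j) us)" using Suc.prems l by (simp add: take_Suc_conv_app_nth)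
    ultimately have "cmon ?a ?u - cmon (c * prod_list (take (Suc j) us)) (replicate (Suc j) 1 @ drop (Suc j) us) \<in> ?G" by simp
    from add_sg_add[OF sg Suc.IH this] Suc.prems show ?case by simp
  qed
  show "N \<subseteq> ?G"
  proof
    fix p assume p: "p \<in> N"
    then have "Poly_Mapping.keys p \<subseteq> V" by (simp add: N_def)
    then have "p - cmon (lam p) ones \<in> ?G"
    proof (induction p rule: poly_mapping_induct_on)
      case zero
      then show ?case using add_sg_0[OF sg] by simp
    next
      case (single u a)
      then show ?case using pull[of u k a] by simp
    next
      case (add p q)
      then show ?case using add_sg_add[OF sg, of "p - cmon (lam p) ones" "q - cmon (lam q) ones"]
        by (simp add: cm.linext_add single_add algebra_simps)
    qed
    then show "p \<in> ?G" using p by (simp add: N_def)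
  qed
qed

text \<open>The coordinate on the one-dimensional tensor product.\<close>

definition nv :: "complex \<Rightarrow> (complex list \<Rightarrow>\<^sub>0 complex) set" where
  "nv z = cst N (cmon z ones)"

abbreviation "NM \<equiv> outer_tensor (map (klr n) ws) (map seg_module segs)"

lemma add_F: "ring.add F = (+)"
  by (simp add: free_space_def)

lemma NM_eq: "NM = \<lparr>carrier = cst N ` {p. Poly_Mapping.keys p \<subseteq> V}, monoid.mult = undefined, one = undefined,
    ring.zero = N, ring.add = set_add F,
    smult = \<lambda>P A. \<Union>p\<in>P. \<Union>a\<in>A. cst N
      (bilin (\<lambda>us vs. map (\<lambda>j. us ! j \<odot>\<^bsub>map seg_module segs ! j\<^esub> vs ! j) [0..<k]) p a),
    grade = \<lambda>d. cst N ` generate (add_monoid F)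
      {cmon c vs | c vs ds. length ds = k \<and> sum_list ds = d \<and>
        vs \<in> tuples (map (\<lambda>j. grade (map seg_module segs ! j) (ds ! j)) [0..<k])}\<rparr>"
proof -
  have "carrier F = {p. Poly_Mapping.keys p \<subseteq> V}" by (simp add: free_space_def)
  then show ?thesis
    unfolding outer_tensor_def Let_def mrels_eq tuples_V generate_mrels a_rcosets_eq_cst[OF add_F] a_r_coset_eq_cst[OF add_F]
      length_map by simp
qed

lemma nv_eq_iff: "nv z = nv w \<longleftrightarrow> z = w"
proof -
  have "cmon z ones - cmon w ones \<in> {p. Poly_Mapping.keys p \<subseteq> V}"
    by (intro add_sg_diff[OF add_sg_keys]) auto
  then show ?thesis unfolding nv_def cst_eq_iff[OF add_sg_N] by (simp add: N_def cm.linext_minus)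
qed

lemma cst_nv: "Poly_Mapping.keys p \<subseteq> V \<Longrightarrow> cst N p = nv (lam p)"
proof -
  assume "Poly_Mapping.keys p \<subseteq> V"
  then have "p - cmon (lam p) ones \<in> {p. Poly_Mapping.keys p \<subseteq> V}"
    by (intro add_sg_diff[OF add_sg_keys]) auto
  then show ?thesis unfolding nv_def cst_eq_iff[OF add_sg_N] by (simp add: N_def cm.linext_minus)
qed

lemma carrier_NM: "carrier NM = range nv"
proof -
  have "carrier NM = cst N ` {p. Poly_Mapping.keys p \<subseteq> V}"
    unfolding NM_eq by simp
  also have "\<dots> = range nv"
  proof
    show "cst N ` {p. Poly_Mapping.keys p \<subseteq> V} \<subseteq> range nv" using cst_nv by auto
    show "range nv \<subseteq> cst N ` {p. Poly_Mapping.keys p \<subseteq> V}" unfolding nv_def by auto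
  qed
  finally show ?thesis .
qed

lemma add_NM: "nv z \<oplus>\<^bsub>NM\<^esub> nv w = nv (z + w)"
  unfolding NM_eq by (simp add: nv_def set_add_cst add_F add_sg_N single_add)

text \<open>Every factor lives in degree 0. A non-zero total degree forces some factor to have
  non-zero degree, hence a zero entry.\<close>

lemma grade_NM: "grade NM d = (if d = 0 then range nv else {nv 0})"
proof -
  let ?S = "{cmon c vs | c vs ds. length ds = k \<and> sum_list ds = d \<and>
      vs \<in> tuples (map (\<lambda>j. grade (map seg_module segs ! j) (ds ! j)) [0..<k])}"
  have g: "grade NM d = (\<lambda>p. cst N p) ` generate (add_monoid F) ?S"
    unfolding NM_eq by simp
  have S: "?S \<subseteq> {p. Poly_Mapping.keys p \<subseteq> V}" by (auto simp: tuples_def split: if_splits)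
  have sub: "generate (add_monoid F) ?S \<subseteq> {p. Poly_Mapping.keys p \<subseteq> V}" by (rule generate_F(3)[OF S add_sg_keys S])
  show ?thesis
  proof (cases "d = 0")
    case True
    have "cmon z ones \<in> ?S" for z
    proof -
      have "ones \<in> tuples (map (\<lambda>j. grade (map seg_module segs ! j) (replicate k 0 ! j)) [0..<k])"
        by (auto simp: tuples_def seg_module_def)
      then show ?thesis using True by (intro CollectI exI[of _ z] exI[of _ ones] exI[of _ "replicate k 0"]) (simp add: sum_list_replicate)
    qed
    then have "nv z \<in> grade NM d" for z
      unfolding g nv_def using generate_F(2)[OF S] by blast
    moreover have "grade NM d \<subseteq> range nv" unfolding g using sub cst_nv by auto
    ultimately show ?thesis using True by auto
  next
    case False
    have "?S \<subseteq> N"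
    proof
      fix p assume "p \<in> ?S"
      then obtain c vs ds where p: "p = cmon c vs" "length ds = k" "sum_list ds = d"
        "vs \<in> tuples (map (\<lambda>j. grade (map seg_module segs ! j) (ds ! j)) [0..<k])" by blast
      have "\<exists>j<k. ds ! j \<noteq> 0"
      proof (rule ccontr)
        assume "\<not> ?thesis"
        then have "ds = replicate k 0" using p(2) by (intro nth_equalityI) auto
        then show False using False p(3) by (simp add: sum_list_replicate)
      qed
      then obtain j where j: "j < k" "ds ! j \<noteq> 0" by blast
      then have "vs ! j = 0" "length vs = k" using p(4) by (auto simp: tuples_def seg_module_def split: if_splits)
      then have "prod_list vs = 0" using j(1) by (metis nth_mem prod_list_zero_iff)
      then show "p \<in> N" using \<open>length vs = k\<close> by (simp add: p(1) N_def)
    qed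
    then have le: "generate (add_monoid F) ?S \<subseteq> N" by (rule generate_F(3)[OF S add_sg_N])
    have "cst N p = nv 0" if "p \<in> N" for p using that cst_nv[of p] by (simp add: N_def)
    moreover have "0 \<in> generate (add_monoid F) ?S" using add_sg_0[OF generate_F(1)[OF S]] .
    ultimately show ?thesis using False le unfolding g by (auto simp: subset_iff)
  qed
qed

lemma smult_NM:
  assumes "q \<in> tf.TA"
  shows "cst tf.TI q \<odot>\<^bsub>NM\<^esub> nv z = nv (\<chi> q * z)"
proof -
  let ?f = "\<lambda>us vs. map (\<lambda>j. us ! j \<odot>\<^bsub>map seg_module segs ! j\<^esub> vs ! j) [0..<k]"
  have s: "cst tf.TI q \<odot>\<^bsub>NM\<^esub> nv z = (\<Union>p\<in>cst tf.TI q. \<Union>a\<in>nv z. cst N (bilin ?f p a))"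
    unfolding NM_eq by simp
  have "cst N (bilin ?f p a) = nv (\<chi> q * z)" if p: "p \<in> cst tf.TI q" and a: "a \<in> nv z" for p a
  proof -
    have kp: "Poly_Mapping.keys p \<subseteq> tf.tup" using mem_cst_TI[OF assms p] unfolding tf.TA_def by blast
    have "a - cmon z ones \<in> N" using a by (simp add: nv_def cst_def)
    then have m: "a - cmon z ones \<in> {p. Poly_Mapping.keys p \<subseteq> V}" "lam a = z"
      by (simp_all add: N_def cm.linext_minus)
    have "cmon z ones \<in> {p. Poly_Mapping.keys p \<subseteq> V}" by simp
    from add_sg_add[OF add_sg_keys m(1) this] have ka: "Poly_Mapping.keys a \<subseteq> V" by simp
    have f: "prod_list (?f us vs) = \<chi>0 us * prod_list vs" if us: "us \<in> tf.tup" and vs: "vs \<in> V" for us vs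
    proof -
      have "?f us vs = map (\<lambda>j. \<sigma> j (us ! j) * vs ! j) [0..<k]"
        using us[unfolded tup_klr] by (auto simp: seg_module_def \<sigma>_eq)
      moreover have "map (\<lambda>j. vs ! j) [0..<k] = vs" using vs by (metis mem_Collect_eq map_nth)
      moreover have "prod_list (map (\<lambda>j. g j * h j) xs) = prod_list (map g xs) * prod_list (map h xs)"
        for g h :: "nat \<Rightarrow> complex" and xs by (induction xs) (simp_all add: mult_ac)
      ultimately show ?thesis by (simp only: \<chi>0_def)
    qed
    have "lam (bilin ?f p a) = \<chi> p * lam a"
      using kp
    proof (induction p rule: poly_mapping_induct_on)
      case (single u c)
      show ?case using ka
        by (induction a rule: poly_mapping_induct_on) (use single f in \<open>auto simp: \<chi>_def cm.linext_add algebra_simps\<close>)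
    qed (auto simp: \<chi>_def cm.linext_add algebra_simps)
    moreover have "Poly_Mapping.keys (bilin ?f p a) \<subseteq> V"
      by (rule bilin_keys[OF kp ka]) auto
    ultimately show ?thesis using cst_nv[of "bilin ?f p a"] \<chi>_cong[OF assms p] m(2) by simp
  qed
  moreover have "q \<in> cst tf.TI q" "cmon z ones \<in> nv z"
    unfolding nv_def by (intro cst_self tf.add_sg_TI add_sg_N)+
  ultimately show ?thesis unfolding s by blast
qed

definition b0 :: "nat list list" where "b0 = map (\<lambda>(a, l). [a..<a + l]) segs"

lemma b0_blocks: "b0 \<in> blocks n ws"
proof -
  have "(case segs ! j of (a, l) \<Rightarrow> [a..<a + l]) \<in> seqs n (seg_weight (segs ! j))" if "j < k" for j
    using letters[of "fst (segs ! j)" "snd (segs ! j)"] that by (simp add: seqs_def seg_weight_def split_beta)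
  then show ?thesis by (simp add: blocks_iff b0_def)
qed

end

text \<open>Left ideals that contain the expected relations of the cyclic vector. The annihilator
  \<open>Kr\<close> in the induced module is one of them and lies in all of them.\<close>

locale segment_ideal = segment_list + klr_left n "sum_list (map seg_weight segs)" L for L +
  assumes one_wt: "E (concat b0) - 1 \<in> L" and X_in: "X m \<in> L"
    and T_in: "j < length segs \<Longrightarrow> 0 < t \<Longrightarrow> t < snd (segs ! j) \<Longrightarrow> T (offset (map seg_weight segs) j + t) \<in> L"
begin

sublocale L: concat_left n "map seg_weight segs" L ..

lemma bwt_one: "L.bwt b0 1"
  using b0_blocks concat_in_seqs[OF b0_blocks] one_wt by (simp add: wt_def eqv_def)

lemma eg_one: "j < k \<Longrightarrow> g \<in> klr_gens n (ws ! j) \<Longrightarrow> eg n ws j g \<bumpeq>\<^bsub>L\<^esub> cs (seg_gen (segs ! j) g) 1"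
proof -
  assume j: "j < k" and g: "g \<in> klr_gens n (ws ! j)"
  obtain a l where al: "segs ! j = (a, l)" by (cases "segs ! j")
  show ?thesis
  proof (cases g)
    case (Gidem i)
    have "b0 ! j = [a..<a + l]" using j al by (simp add: b0_def)
    then show ?thesis using L.eg_E[OF bwt_one eqv_refl, of j i] Gidem al
      by (auto simp: cs.sc_one cs.sc_zero split: if_splits)
  next
    case (Gx m)
    then show ?thesis using L.eg_X[OF bwt_one eqv_refl, of j m] L_cong[OF L.eg_X[OF bwt_one eqv_refl, of j m]] X_in al
      by (simp add: cs.sc_zero)
  next
    case (Gtau t)
    then have "0 < t" "t < snd (segs ! j)" using g j al by (auto simp: gens_memb seg_weight_def)
    then show ?thesis using L_cong[OF L.eg_T[OF bwt_one eqv_refl, of j t]] T_in[OF j] Gtau al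
      by (simp add: cs.sc_zero)
  qed
qed

lemma Ev_one:
  assumes "j < k" "p \<in> legal n (ws ! j)"
  shows "Ev n ws j p \<bumpeq>\<^bsub>L\<^esub> cs (seg_char (segs ! j) p) 1"
proof -
  have w: "wprod (eg n ws j) w \<bumpeq>\<^bsub>L\<^esub> cs (prod_list (map (seg_gen (segs ! j)) w)) 1"
    if "set w \<subseteq> klr_gens n (ws ! j)" for w
    using that
  proof (induction w)
    case Nil
    then show ?case by (simp add: wprod_def cs.sc_one)
  next
    case (Cons g w)
    let ?c = "prod_list (map (seg_gen (segs ! j)) w)"
    have "eg n ws j g * wprod (eg n ws j) w \<bumpeq>\<^bsub>L\<^esub> eg n ws j g * cs ?c 1" using Cons by (intro eqv_mult) auto
    also have "eg n ws j g * cs ?c 1 = cs ?c (eg n ws j g)" by (simp add: cs_mult_right)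
    also have "\<dots> \<bumpeq>\<^bsub>L\<^esub> cs ?c (cs (seg_gen (segs ! j) g) 1)" using Cons.prems by (intro eqv_cs eg_one[OF assms(1)]) auto
    finally show ?case by (simp add: wprod_def cs.sc_mult mult.commute)
  qed
  have "ext (eg n ws j) p \<bumpeq>\<^bsub>L\<^esub> cs (seg_char (segs ! j) p) 1"
    using assms(2)[unfolded legal_def mem_Collect_eq]
  proof (induction p rule: poly_mapping_induct_on)
    case (single u a)
    then have "cs a (wprod (eg n ws j) u) \<bumpeq>\<^bsub>L\<^esub> cs a (cs (prod_list (map (seg_gen (segs ! j)) u)) 1)"
      by (intro eqv_cs w) auto
    then show ?case by (simp add: ext_def seg_char_linext cs.sc_mult)
  qed (simp_all add: seg_char_simps cs.sc_zero cs.sc_add eqv_add)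
  moreover have "ext (eg n ws j) p * ci n ws \<bumpeq>\<^bsub>L\<^esub> ext (eg n ws j) p * 1"
    using eqv_mult[OF L.ci_act[OF bwt_one]] by simp
  ultimately show ?thesis unfolding Ev_def using eqv_trans by simp
qed

lemma EF_one: "q \<in> tf.TA \<Longrightarrow> EF q \<bumpeq>\<^bsub>L\<^esub> cs (\<chi> q) 1"
  unfolding tf.TA_def mem_Collect_eq
proof (induction q rule: poly_mapping_induct_on)
  case (single us a)
  have "prod_list (map (\<lambda>j. Ev n ws j (rp (us ! j))) js) \<bumpeq>\<^bsub>L\<^esub> cs (prod_list (map (\<lambda>j. \<sigma> j (us ! j)) js)) 1"
    if "set js \<subseteq> {..<k}" for js
    using that
  proof (induction js)
    case Nil
    then show ?case by (simp add: cs.sc_one)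
  next
    case (Cons j js)
    let ?c = "prod_list (map (\<lambda>j. \<sigma> j (us ! j)) js)"
    have j: "j < k" using Cons.prems by simp
    have P: "us ! j \<in> carrier (klr n (ws ! j))" using single j by (simp add: tup_klr del: map_map)
    have l: "rp (us ! j) \<in> legal n (ws ! j)" using rp_cls(2)[of n "ws ! j" "rp (us ! j)"] cls_rp[OF P] by simp
    let ?e = "Ev n ws j (rp (us ! j))"
    have "?e * prod_list (map (\<lambda>j. Ev n ws j (rp (us ! j))) js) \<bumpeq>\<^bsub>L\<^esub> ?e * cs ?c 1" using Cons by (intro eqv_mult) auto
    also have "?e * cs ?c 1 = cs ?c ?e" by (simp add: cs_mult_right)
    also have "\<dots> \<bumpeq>\<^bsub>L\<^esub> cs ?c (cs (\<sigma> j (us ! j)) 1)" unfolding \<sigma>_def by (intro eqv_cs Ev_one j l)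
    finally show ?case by (simp add: cs.sc_mult mult.commute)
  qed
  from this[of "[0..<k]"] have "prod_list (map (\<lambda>j. Ev n ws j (rp (us ! j))) [0..<k]) \<bumpeq>\<^bsub>L\<^esub> cs (\<chi>0 us) 1"
    by (simp add: \<chi>0_def atLeast0LessThan)
  from eqv_trans[OF eqv_mult[OF L.ci_act[OF bwt_one]]] this
  have "\<Phi> us \<bumpeq>\<^bsub>L\<^esub> cs (\<chi>0 us) 1" unfolding \<Phi>_def by simp
  then show ?case using eqv_cs[of "\<Phi> us" "cs (\<chi>0 us) 1" a] by (simp add: EF_def \<chi>_def cs.sc_mult)
qed (simp_all add: EF_def \<chi>_def cs.linext_add cm.linext_add cs.sc_zero cs.sc_add eqv_add)

end

section \<open>The induced module\<close>

lemma mult_ci: "x * ci n ws = (\<Sum>b\<in>blocks n ws. x * E (concat b))"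
  by (simp add: ci_def sum_distrib_left)

lemma offset_cover:
  assumes "m \<in> {1..size (sum_list ws)}"
  shows "\<exists>j<length ws. \<exists>m'\<in>{1..size (ws ! j)}. m = offset ws j + m'"
proof -
  have "m \<le> offset ws i \<Longrightarrow> \<exists>j<i. \<exists>m'\<in>{1..size (ws ! j)}. m = offset ws j + m'" for i
  proof (induction i)
    case 0
    then show ?case using assms by (simp add: offset_def)
  next
    case (Suc i)
    show ?case
    proof (cases "m \<le> offset ws i")
      case True
      then show ?thesis using Suc less_SucI by fastforce
    next
      case False
      then have "m - offset ws i \<in> {1..size (ws ! i)}" "m = offset ws i + (m - offset ws i)"
        using Suc.prems by (auto simp: offset_Suc)
      then show ?thesis by blast
    qed
  qed
  then show ?thesis using assms by (simp add: size_sum_list)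
qed

context concat_left
begin

lemma ci_E: "b \<in> blocks n ws \<Longrightarrow> ci n ws * E (concat b) \<bumpeq>\<^bsub>L\<^esub> E (concat b)"
  using ci_act[of b "E (concat b)"] wt_E[OF concat_in_seqs, of b 1] by simp

lemma ci_wprod:
  assumes "j < length ws" "set w \<subseteq> klr_gens n (ws ! j)"
  shows "ci n ws * (wprod (eg n ws j) w * ci n ws) \<bumpeq>\<^bsub>L\<^esub> wprod (eg n ws j) w * ci n ws"
proof -
  have "(\<Sum>b\<in>blocks n ws. ci n ws * (wprod (eg n ws j) w * E (concat b))) \<bumpeq>\<^bsub>L\<^esub>
      (\<Sum>b\<in>blocks n ws. wprod (eg n ws j) w * E (concat b))"
  proof (rule eqv_sum)
    fix b assume b: "b \<in> blocks n ws"
    then have "bwt b (E (concat b))" using wt_E[OF concat_in_seqs[OF b], of 1] by simp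
    then obtain b' where "bwt b' (wprod (eg n ws j) w * E (concat b))" using wprod_eg[OF _ assms] by blast
    then show "ci n ws * (wprod (eg n ws j) w * E (concat b)) \<bumpeq>\<^bsub>L\<^esub> wprod (eg n ws j) w * E (concat b)"
      by (rule ci_act)
  qed
  then show ?thesis by (simp add: mult_ci sum_distrib_left)
qed

end

context segment_list
begin

abbreviation "S \<equiv> tensor_alg (map (klr n) ws)"
abbreviation "CC \<equiv> {c :: (klr_elt \<times> (complex list \<Rightarrow>\<^sub>0 complex) set) \<Rightarrow>\<^sub>0 int. Poly_Mapping.keys c \<subseteq> carrier R \<times> carrier NM}"
abbreviation "FA \<equiv> free_Abelian_group (carrier R \<times> carrier NM)"

definition fo :: "falg \<Rightarrow> complex \<Rightarrow> (klr_elt \<times> (complex list \<Rightarrow>\<^sub>0 complex) set) \<Rightarrow>\<^sub>0 int" where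
  "fo p z = frag_of (cls n \<alpha> p, nv z)"

text \<open>The relations of the induced module in coordinates: elements of the algebra through the
  free algebra, vectors through \<open>nv\<close>, the embedding through \<open>EF\<close> and the
  action through \<open>\<chi>\<close>.\<close>

definition irels :: "((klr_elt \<times> (complex list \<Rightarrow>\<^sub>0 complex) set) \<Rightarrow>\<^sub>0 int) set" where
  "irels = {fo (p + p') z - fo p z - fo p' z | p p' z. True} \<union> {fo p (z + z') - fo p z - fo p z' | p z z'. True} \<union>
     {fo (p * EF q) z - fo p (\<chi> q * z) | p q z. q \<in> tf.TA}"

definition NN where "NN = generate FA irels"

lemma irelsI:
  "fo (p + p') z - fo p z - fo p' z \<in> irels" "fo p (z + z') - fo p z - fo p z' \<in> irels"
  "q \<in> tf.TA \<Longrightarrow> fo (p * EF q) z - fo p (\<chi> q * z) \<in> irels"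
  unfolding irels_def
    apply (rule UnI1, rule UnI1, rule CollectI, rule exI[of _ p], rule exI[of _ p'], rule exI[of _ z], simp)
   apply (rule UnI1, rule UnI2, rule CollectI, rule exI[of _ p], rule exI[of _ z], rule exI[of _ z'], simp)
  apply (rule UnI2, rule CollectI, rule exI[of _ p], rule exI[of _ q], rule exI[of _ z], simp)
  done

lemma irels_eq: "irels = {frag_of (r \<oplus>\<^bsub>R\<^esub> r', v) - frag_of (r, v) - frag_of (r', v) | r r' v.
           r \<in> carrier R \<and> r' \<in> carrier R \<and> v \<in> carrier NM} \<union>
        {frag_of (r, v \<oplus>\<^bsub>NM\<^esub> v') - frag_of (r, v) - frag_of (r, v') | r v v'.
           r \<in> carrier R \<and> v \<in> carrier NM \<and> v' \<in> carrier NM} \<union>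
        {frag_of (r \<otimes>\<^bsub>R\<^esub> concat_embed n ws s, v) - frag_of (r, s \<odot>\<^bsub>NM\<^esub> v) | r s v.
           r \<in> carrier R \<and> s \<in> carrier S \<and> v \<in> carrier NM}"
    (is "_ = ?A \<union> ?B \<union> ?C")
proof -
  have "{fo (p + p') z - fo p z - fo p' z | p p' z. True} = ?A"
    unfolding carrier_klr carrier_NM fo_def by (auto simp: klr_simps) (metis klr_simps(2) rangeI)+
  moreover have "{fo p (z + z') - fo p z - fo p z' | p z z'. True} = ?B"
    unfolding carrier_klr carrier_NM fo_def by (auto simp: add_NM simp del: map_map) (metis add_NM rangeI)+
  moreover have "{fo (p * EF q) z - fo p (\<chi> q * z) | p q z. q \<in> tf.TA} = ?C"
  proof
    show "{fo (p * EF q) z - fo p (\<chi> q * z) | p q z. q \<in> tf.TA} \<subseteq> ?C"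
    proof
      fix x assume "x \<in> {fo (p * EF q) z - fo p (\<chi> q * z) | p q z. q \<in> tf.TA}"
      then obtain p q z where q: "q \<in> tf.TA" and x: "x = fo (p * EF q) z - fo p (\<chi> q * z)" by blast
      have "x = frag_of (cls n \<alpha> p \<otimes>\<^bsub>R\<^esub> concat_embed n ws (cst tf.TI q), nv z) - frag_of (cls n \<alpha> p, cst tf.TI q \<odot>\<^bsub>NM\<^esub> nv z)"
        unfolding x fo_def smult_NM[OF q] concat_embed_cls[OF q] klr_simps ..
      then show "x \<in> ?C" using q unfolding carrier_klr carrier_NM tf.tensor_alg_carrier by blast
    qed
    show "?C \<subseteq> {fo (p * EF q) z - fo p (\<chi> q * z) | p q z. q \<in> tf.TA}"
    proof
      fix x assume "x \<in> ?C"
      then obtain p q z where q: "q \<in> tf.TA"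
        and x: "x = frag_of (cls n \<alpha> p \<otimes>\<^bsub>R\<^esub> concat_embed n ws (cst tf.TI q), nv z) - frag_of (cls n \<alpha> p, cst tf.TI q \<odot>\<^bsub>NM\<^esub> nv z)"
        unfolding carrier_klr carrier_NM tf.tensor_alg_carrier by blast
      have "x = fo (p * EF q) z - fo p (\<chi> q * z)"
        unfolding x fo_def smult_NM[OF q] concat_embed_cls[OF q] klr_simps ..
      then show "x \<in> {fo (p * EF q) z - fo p (\<chi> q * z) | p q z. q \<in> tf.TA}" using q by blast
    qed
  qed
  ultimately show ?thesis unfolding irels_def by (simp only:)
qed

lemma add_sg_CC: "add_sg CC" by (rule add_sg_keys)

lemma fo_CC: "fo p z \<in> CC"
  unfolding fo_def carrier_klr carrier_NM by simp

lemma irels_CC: "irels \<subseteq> CC"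
proof -
  have "fo p z - fo q w \<in> CC" "fo p z - fo q w - fo r y \<in> CC" for p q r z w y
    by (intro add_sg_diff[OF add_sg_CC] fo_CC)+
  then show ?thesis unfolding irels_def by blast
qed

lemma generate_FA:
  shows "Y \<subseteq> CC \<Longrightarrow> add_sg (generate FA Y)" "Y \<subseteq> CC \<Longrightarrow> Y \<subseteq> generate FA Y"
    "Y \<subseteq> CC \<Longrightarrow> add_sg H \<Longrightarrow> Y \<subseteq> H \<Longrightarrow> generate FA Y \<subseteq> H"
  by (rule add_group_generate[of FA CC]; simp add: free_Abelian_group_def add_sg_keys del: map_map)+

lemma add_sg_NN: "add_sg NN" and irels_NN: "irels \<subseteq> NN"
  unfolding NN_def using generate_FA(1,2)[OF irels_CC] by blast+

lemma fo_add: "fo (p + p') z - fo p z - fo p' z \<in> NN"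
  by (rule subsetD[OF irels_NN irelsI(1)])

lemma fo_balanced: "q \<in> tf.TA \<Longrightarrow> fo (p * EF q) z - fo p (\<chi> q * z) \<in> NN"
  by (rule subsetD[OF irels_NN irelsI(3)])

abbreviation sm :: "klr_elt \<Rightarrow> ((klr_elt \<times> (complex list \<Rightarrow>\<^sub>0 complex) set) \<Rightarrow>\<^sub>0 int) \<Rightarrow> _" where
  "sm r \<equiv> frag_extend (\<lambda>(r', v). frag_of (r \<otimes>\<^bsub>R\<^esub> r', v))"

lemma sm_fo: "sm (cls n \<alpha> q) (fo p z) = fo (q * p) z"
  by (simp add: fo_def klr_simps)

lemma sm_NN: "f \<in> NN \<Longrightarrow> sm (cls n \<alpha> r) f \<in> NN"
proof -
  have "generate FA irels \<subseteq> {f. sm (cls n \<alpha> r) f \<in> NN}"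
  proof (rule generate_FA(3)[OF irels_CC])
    show "add_sg {f. sm (cls n \<alpha> r) f \<in> NN}"
      using add_sg_NN by (simp add: add_sg_def frag_extend_diff)
    show "irels \<subseteq> {f. sm (cls n \<alpha> r) f \<in> NN}"
    proof
      fix x assume "x \<in> irels"
      then consider p p' z where "x = fo (p + p') z - fo p z - fo p' z" | p z z' where "x = fo p (z + z') - fo p z - fo p z'"
        | p q z where "q \<in> tf.TA" "x = fo (p * EF q) z - fo p (\<chi> q * z)" unfolding irels_def by blast
      then have "sm (cls n \<alpha> r) x \<in> irels"
      proof cases
        case (1 p p' z)
        have "sm (cls n \<alpha> r) x = fo (r * p + r * p') z - fo (r * p) z - fo (r * p') z"
          unfolding 1 frag_extend_diff sm_fo by (simp add: distrib_left)
        then show ?thesis by (simp only: irelsI)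
      next
        case (2 p z z')
        have "sm (cls n \<alpha> r) x = fo (r * p) (z + z') - fo (r * p) z - fo (r * p) z'"
          unfolding 2 frag_extend_diff sm_fo ..
        then show ?thesis by (simp only: irelsI)
      next
        case (3 p q z)
        have "sm (cls n \<alpha> r) x = fo (r * p * EF q) z - fo (r * p) (\<chi> q * z)"
          unfolding 3(2) frag_extend_diff sm_fo by (simp add: mult.assoc)
        then show ?thesis using 3(1) by (simp only: irelsI)
      qed
      then show "x \<in> {f. sm (cls n \<alpha> r) f \<in> NN}" using irels_NN by blast
    qed
  qed
  then show "f \<in> NN \<Longrightarrow> sm (cls n \<alpha> r) f \<in> NN" unfolding NN_def[symmetric] by blast
qed

definition ONE :: "klr_elt list" where "ONE = map (\<lambda>w. cls n w 1) ws"

lemma ONE_tup: "ONE \<in> tf.tup"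
  unfolding tup_klr by (simp add: ONE_def carrier_klr)

lemma \<sigma>_ONE: "j < k \<Longrightarrow> \<sigma> j (ONE ! j) = 1"
  using \<sigma>_cls[of j 1] by (simp add: ONE_def legal_one seg_char_simps)

lemma \<chi>0_ONE_update: "j < k \<Longrightarrow> \<chi>0 (ONE[j := v]) = \<sigma> j v"
proof -
  assume j: "j < k"
  have "map (\<lambda>i. \<sigma> i (ONE ! i)) [0..<k] = replicate k 1"
    using \<sigma>_ONE by (intro nth_equalityI) auto
  then have "map (\<lambda>i. \<sigma> i (ONE[j := v] ! i)) [0..<k] = (replicate k 1)[j := \<sigma> j v]"
    using map_upt_update[of ONE k j \<sigma> v] j by (simp add: ONE_def)
  then show ?thesis using j by (simp add: \<chi>0_def prod_list_update)
qed

lemma \<chi>0_ONE: "\<chi>0 ONE = 1"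
proof -
  have "map (\<lambda>i. \<sigma> i (ONE ! i)) [0..<k] = replicate k 1"
    using \<sigma>_ONE by (intro nth_equalityI) auto
  then show ?thesis by (simp add: \<chi>0_def)
qed

text \<open>The definition of the induced module imposes only additivity and balancing, so complex
  scalars have to pass the tensor sign as multiples of the unit of the tensor algebra.\<close>

lemma fo_scale: "fo p z - fo (cs z p) 1 \<in> NN"
proof -
  have TA: "cmon c ONE \<in> tf.TA" for c using ONE_tup by (rule tf.TA_single)
  have \<chi>: "\<chi> (cmon c ONE) = c" for c by (simp add: \<chi>_def \<chi>0_ONE)
  \<comment> \<open>The same element of the algebra is balanced in two ways, once as
    \<open>cs z p\<close> times the unit and once as \<open>p\<close> times a multiple of the
    unit.\<close>
  have "cs z p * EF (cmon 1 ONE) = p * EF (cmon z ONE)"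
    by (simp add: EF_def cs_mult_left cs_mult_right cs.sc_one)
  then have "fo (p * EF (cmon z ONE)) 1 - fo (cs z p) 1 \<in> NN"
    using fo_balanced[OF TA, of "cs z p" 1 1] by (simp add: \<chi>)
  moreover have "fo (p * EF (cmon z ONE)) 1 - fo p z \<in> NN"
    using fo_balanced[OF TA, of p z 1] by (simp add: \<chi>)
  ultimately have "fo (p * EF (cmon z ONE)) 1 - fo (cs z p) 1 - (fo (p * EF (cmon z ONE)) 1 - fo p z) \<in> NN"
    by (rule add_sg_diff[OF add_sg_NN])
  then show ?thesis by simp
qed

text \<open>The annihilator of the vector 1 tensor \<open>nv 1\<close>, which generates the induced
  module by \<open>CC_fo\<close>.\<close>

definition Kr :: "falg set" where "Kr = {p. fo p 1 \<in> NN}"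

lemma fo_zero: "fo 0 z \<in> NN"
  using add_sg_uminus[OF add_sg_NN fo_add[of 0 0 z]] by simp

lemma fo_diff: "fo p z - fo q z - fo (p - q) z \<in> NN"
  using fo_add[of "p - q" q z] by (simp add: algebra_simps)

lemma klr_left_Kr: "klr_left n \<alpha> Kr"
proof
  have "fo (p - q) 1 \<in> NN" if "fo p 1 \<in> NN" "fo q 1 \<in> NN" for p q
    using add_sg_diff[OF add_sg_NN add_sg_diff[OF add_sg_NN that] fo_diff[of p 1 q]] by simp
  then show "add_sg Kr" using fo_zero by (simp add: Kr_def add_sg_def)
  show "q * p \<in> Kr" if "p \<in> Kr" for p q
    using sm_NN[of "fo p 1" q] that by (simp add: Kr_def sm_fo)
  show "J n \<alpha> \<subseteq> Kr"
  proof
    fix p assume "p \<in> J n \<alpha>"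
    then have "cls n \<alpha> p = cls n \<alpha> 0" unfolding cls_eq_iff by simp
    then have "fo p 1 = fo 0 1" unfolding fo_def by (simp only:)
    then show "p \<in> Kr" using fo_zero by (simp add: Kr_def)
  qed
qed

sublocale Kr: concat_left n "map seg_weight segs" Kr
  by (intro concat_left.intro klr_left_Kr)

lemma EF_Kr: "q \<in> tf.TA \<Longrightarrow> EF q \<bumpeq>\<^bsub>Kr\<^esub> cs (\<chi> q) 1"
proof -
  assume q: "q \<in> tf.TA"
  have "fo (EF q) 1 - fo (cs (\<chi> q) 1) 1 \<in> NN"
    using add_sg_add[OF add_sg_NN fo_balanced[OF q, of 1 1] fo_scale[of 1 "\<chi> q"]] by simp
  from add_sg_diff[OF add_sg_NN this fo_diff[of "EF q" 1 "cs (\<chi> q) 1"]] show ?thesis by (simp add: eqv_def Kr_def)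
qed

lemma \<Phi>_Kr: "us \<in> tf.tup \<Longrightarrow> \<Phi> us \<bumpeq>\<^bsub>Kr\<^esub> cs (\<chi>0 us) 1"
  using EF_Kr[OF tf.TA_single, of us 1] by (simp add: EF_def \<chi>_def cs.sc_one)

lemma Ev_rp: "j < k \<Longrightarrow> q \<in> legal n (ws ! j) \<Longrightarrow> Ev n ws j (rp (cls n (ws ! j) q)) \<bumpeq>\<^bsub>J n \<alpha>\<^esub> Ev n ws j q"
  using Jc.Ev_kills[OF rp_klr_ideal, of q j] by (simp add: eqv_def Ev_diff)

lemma J_two: "a \<bumpeq>\<^bsub>J n \<alpha>\<^esub> a' \<Longrightarrow> b \<bumpeq>\<^bsub>J n \<alpha>\<^esub> b' \<Longrightarrow> a * b \<bumpeq>\<^bsub>J n \<alpha>\<^esub> a' * b'"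
proof -
  assume "a \<bumpeq>\<^bsub>J n \<alpha>\<^esub> a'" "b \<bumpeq>\<^bsub>J n \<alpha>\<^esub> b'"
  then have "(a - a') * b + a' * (b - b') \<in> J n \<alpha>"
    unfolding eqv_def by (intro add_sg_add[OF add_sg_J] J_mult_left J_mult_right)
  then show ?thesis by (simp add: eqv_def algebra_simps)
qed

lemma J_Kr: "a \<bumpeq>\<^bsub>J n \<alpha>\<^esub> b \<Longrightarrow> a \<bumpeq>\<^bsub>Kr\<^esub> b"
  unfolding eqv_def using Kr.J_sub_L by blast

abbreviation "c \<equiv> ci n ws"

lemma cc: "c * c \<bumpeq>\<^bsub>J n \<alpha>\<^esub> c"
proof -
  have "(\<Sum>b\<in>blocks n ws. c * E (concat b)) \<bumpeq>\<^bsub>J n \<alpha>\<^esub> (\<Sum>b\<in>blocks n ws. E (concat b))"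
    by (intro Jc.eqv_sum Jc.ci_E)
  then show ?thesis unfolding mult_ci by (simp only: ci_def)
qed

lemma ONE_list: "js \<noteq> [] \<Longrightarrow> set js \<subseteq> {..<k} \<Longrightarrow> prod_list (map (\<lambda>j. Ev n ws j (rp (ONE ! j))) js) \<bumpeq>\<^bsub>J n \<alpha>\<^esub> c"
proof (induction js)
  case (Cons j js)
  have "Ev n ws j 1 = c" by (simp add: Ev_def)
  then have j: "Ev n ws j (rp (ONE ! j)) \<bumpeq>\<^bsub>J n \<alpha>\<^esub> c"
    using Ev_rp[of j 1] Cons.prems by (simp add: ONE_def legal_one)
  show ?case
  proof (cases "js = []")
    case True
    then show ?thesis using j by simp
  next
    case False
    then have "prod_list (map (\<lambda>j. Ev n ws j (rp (ONE ! j))) js) \<bumpeq>\<^bsub>J n \<alpha>\<^esub> c" using Cons by simp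
    from Jc.eqv_trans[OF J_two[OF j this] cc] show ?thesis by simp
  qed
qed simp

text \<open>The unit of the tensor algebra is mapped to the idempotent \<open>ci\<close>, while it
  acts by 1 on the segment modules; balancing identifies the two.\<close>

lemma ci_Kr: "c \<bumpeq>\<^bsub>Kr\<^esub> 1"
proof -
  have "\<Phi> ONE \<bumpeq>\<^bsub>J n \<alpha>\<^esub> c"
  proof (cases "k = 0")
    case False
    then have "prod_list (map (\<lambda>j. Ev n ws j (rp (ONE ! j))) [0..<k]) \<bumpeq>\<^bsub>J n \<alpha>\<^esub> c"
      by (intro ONE_list) (auto simp: atLeast0LessThan)
    from Jc.eqv_trans[OF J_two[OF this Jc.eqv_refl] cc] show ?thesis by (simp add: \<Phi>_def)
  next
    case True
    have "\<Phi> ONE = c" unfolding \<Phi>_def length_map True by simp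
    then show ?thesis using Jc.eqv_refl by (simp only:)
  qed
  from Kr.eqv_trans[OF Kr.eqv_sym[OF J_Kr[OF this]] \<Phi>_Kr[OF ONE_tup]] show ?thesis
    by (simp add: \<chi>0_ONE cs.sc_one)
qed

text \<open>Balancing with the tuple that has the generator in place \<open>j\<close> and units
  elsewhere. The units are mapped to \<open>ci\<close>, which is absorbed on both sides of the image
  of the generator.\<close>

lemma eg_Kr:
  assumes j: "j < k" and g: "g \<in> klr_gens n (ws ! j)"
  shows "eg n ws j g \<bumpeq>\<^bsub>Kr\<^esub> cs (seg_gen (segs ! j) g) 1"
proof -
  let ?v = "cls n (ws ! j) (gg g)" and ?y = "eg n ws j g * c"
  let ?us = "ONE[j := ?v]"
  let ?xs = "map (\<lambda>j. Ev n ws j (rp (ONE ! j))) [0..<k]"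
  have gl: "gg g \<in> legal n (ws ! j)" using g by (intro legal_cmon) auto
  have us: "?us \<in> tf.tup" using j by (intro tf.tup_update ONE_tup) (auto simp: carrier_klr)
  have Ev: "Ev n ws j (rp ?v) \<bumpeq>\<^bsub>J n \<alpha>\<^esub> ?y" using Ev_rp[OF j gl] by (simp add: Ev_def)
  have "map (\<lambda>i. Ev n ws i (rp (?us ! i))) [0..<k] = ?xs[j := Ev n ws j (rp ?v)]"
    by (rule map_upt_update[where f = "\<lambda>j v. Ev n ws j (rp v)"]) (use j in \<open>simp_all add: ONE_def\<close>)
  then have \<Phi>: "\<Phi> ?us = prod_list (take j ?xs) * Ev n ws j (rp ?v) * prod_list (drop (Suc j) ?xs) * c"
    using j by (simp add: \<Phi>_def prod_list_update del: take_map drop_map)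
  have cy: "c * ?y \<bumpeq>\<^bsub>J n \<alpha>\<^esub> ?y" using Jc.ci_wprod[of j "[g]"] j g by (simp add: wprod_def)
  have "prod_list (take j ?xs) * Ev n ws j (rp ?v) \<bumpeq>\<^bsub>J n \<alpha>\<^esub> ?y"
  proof (cases "j = 0")
    case False
    then have "prod_list (map (\<lambda>j. Ev n ws j (rp (ONE ! j))) [0..<j]) \<bumpeq>\<^bsub>J n \<alpha>\<^esub> c" using j by (intro ONE_list) auto
    then have "prod_list (take j ?xs) \<bumpeq>\<^bsub>J n \<alpha>\<^esub> c" using j by (simp add: take_map)
    from Jc.eqv_trans[OF J_two[OF this Ev] cy] show ?thesis .
  qed (use Ev in simp)
  moreover have "prod_list (drop (Suc j) ?xs) * c \<bumpeq>\<^bsub>J n \<alpha>\<^esub> c"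
  proof (cases "Suc j = k")
    case False
    then have "prod_list (map (\<lambda>j. Ev n ws j (rp (ONE ! j))) [Suc j..<k]) \<bumpeq>\<^bsub>J n \<alpha>\<^esub> c" using j by (intro ONE_list) auto
    then have "prod_list (drop (Suc j) ?xs) \<bumpeq>\<^bsub>J n \<alpha>\<^esub> c" by (simp add: drop_map)
    from Jc.eqv_trans[OF J_two[OF this Jc.eqv_refl] cc] show ?thesis .
  qed simp
  ultimately have "\<Phi> ?us \<bumpeq>\<^bsub>J n \<alpha>\<^esub> ?y * c" unfolding \<Phi> mult.assoc[of _ "prod_list (drop (Suc j) ?xs)" c] by (rule J_two)
  then have 1: "\<Phi> ?us \<bumpeq>\<^bsub>Kr\<^esub> ?y * c" by (rule J_Kr)
  have "?y * c \<bumpeq>\<^bsub>Kr\<^esub> ?y * 1" by (rule Kr.eqv_mult[OF ci_Kr])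
  also have "?y * 1 \<bumpeq>\<^bsub>Kr\<^esub> eg n ws j g * 1" using Kr.eqv_mult[OF ci_Kr, of "eg n ws j g"] by simp
  finally have 2: "?y * c \<bumpeq>\<^bsub>Kr\<^esub> eg n ws j g" by simp
  from Kr.eqv_trans[OF Kr.eqv_sym[OF Kr.eqv_trans[OF 1 2]] \<Phi>_Kr[OF us]]
  show ?thesis using \<chi>0_ONE_update[OF j, of ?v] \<sigma>_cls[OF j gl] by (simp add: seg_char_simps)
qed

lemma X_Kr: "X m \<in> Kr"
proof (cases "m \<in> {1..size \<alpha>}")
  case True
  then have "\<exists>j<k. \<exists>m'\<in>{1..size (ws ! j)}. m = offset ws j + m'" using offset_cover[of m ws] by simp
  then obtain j m' where j: "j < k" "m' \<in> {1..size (ws ! j)}" "m = offset ws j + m'" by blast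
  then have "Gx m' \<in> klr_gens n (ws ! j)" by (simp only: gens_memb)
  from eg_Kr[OF j(1) this] have "X m * c \<in> Kr"
    using j(3) by (cases "segs ! j") (simp add: eg_def cs.sc_zero)
  then show ?thesis using Kr.L_cong[OF Kr.eqv_mult[OF ci_Kr, of "X m"]] by simp
next
  case False
  then show ?thesis using Kr.X_illegal[of m 1] by simp
qed

lemma T_Kr: "j < k \<Longrightarrow> 0 < t \<Longrightarrow> t < snd (segs ! j) \<Longrightarrow> T (offset ws j + t) \<in> Kr"
proof -
  assume j: "j < k" "0 < t" "t < snd (segs ! j)"
  then have "Gtau t \<in> klr_gens n (ws ! j)" by (simp add: gens_memb seg_weight_def split_beta)
  from eg_Kr[OF j(1) this] have "T (offset ws j + t) * c \<in> Kr"
    by (cases "segs ! j") (simp add: eg_def cs.sc_zero)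
  then show ?thesis using Kr.L_cong[OF Kr.eqv_mult[OF ci_Kr, of "T (offset ws j + t)"]] by simp
qed

text \<open>A block sequence other than \<open>b0\<close> differs from it in some block
  \<open>j\<close>. The idempotent of the \<open>j\<close>th factor at \<open>b0 ! j\<close> acts by
  1 but annihilates that sequence. So \<open>ci\<close>, which acts by 1, reduces to the single
  summand of \<open>b0\<close>.\<close>

lemma E_Kr: "E (concat b0) - 1 \<in> Kr"
proof -
  have o: "E (concat b) \<in> Kr" if b: "b \<in> blocks n ws" "b \<noteq> b0" for b
  proof -
    obtain j where j: "j < k" "b ! j \<noteq> b0 ! j"
      using b b0_blocks nth_equalityI[of b b0] by (auto simp: blocks_iff)
    have g: "Gidem (b0 ! j) \<in> klr_gens n (ws ! j)" using b0_blocks j(1) by (simp add: gens_memb blocks_iff)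
    have "seg_gen (segs ! j) (Gidem (b0 ! j)) = 1" using j(1) by (cases "segs ! j") (simp add: b0_def)
    then have e: "eg n ws j (Gidem (b0 ! j)) \<bumpeq>\<^bsub>Kr\<^esub> 1" using eg_Kr[OF j(1) g] by (simp add: cs.sc_one)
    have "E (concat b) * eg n ws j (Gidem (b0 ! j)) \<in> Kr"
    proof -
      have "(\<Sum>b'\<in>{b \<in> blocks n ws. b ! j = b0 ! j}. E (concat b) * E (concat b')) \<in> Kr"
      proof (rule add_sg_sum[OF Kr.sgL])
        fix b' assume "b' \<in> {b \<in> blocks n ws. b ! j = b0 ! j}"
        then have b': "b' \<in> blocks n ws" "b \<noteq> b'" using j by auto
        then have "concat b' \<noteq> concat b" using inj_concat_blocks b(1) by (auto simp: inj_on_def)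
        then show "E (concat b) * E (concat b') \<in> Kr"
          using Kr.wt_orth[OF Kr.wt_E[OF concat_in_seqs[OF b'(1)], of 1] concat_in_seqs[OF b(1)]] by simp
      qed
      then show ?thesis by (simp add: eg_def sum_distrib_left)
    qed
    then show ?thesis using Kr.L_cong[OF Kr.eqv_mult[OF e, of "E (concat b)"]] by simp
  qed
  have "c = E (concat b0) + (\<Sum>b\<in>blocks n ws - {b0}. E (concat b))"
    unfolding ci_def using b0_blocks by (simp add: sum.remove[of _ b0] del: map_map)
  moreover have "(\<Sum>b\<in>blocks n ws - {b0}. E (concat b)) \<in> Kr"
    by (rule add_sg_sum[OF Kr.sgL]) (use o in auto)
  ultimately have "c \<bumpeq>\<^bsub>Kr\<^esub> E (concat b0)" by (simp add: eqv_def)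
  from Kr.eqv_trans[OF Kr.eqv_sym[OF this] ci_Kr] show ?thesis by (simp add: eqv_def)
qed

lemma segment_ideal_Kr: "segment_ideal n segs Kr"
  by (intro segment_ideal.intro segment_ideal_axioms.intro segment_list_axioms klr_left_Kr E_Kr X_Kr T_Kr)

section \<open>The induced module as a quotient of the free algebra\<close>

abbreviation "IM \<equiv> Ind n ws NM"

definition \<pi> :: "falg \<Rightarrow> ((klr_elt \<times> (complex list \<Rightarrow>\<^sub>0 complex) set) \<Rightarrow>\<^sub>0 int) set" where
  "\<pi> p = cst NN (fo p 1)"

lemma IM_eq: "IM = \<lparr>carrier = cst NN ` CC, monoid.mult = undefined, one = undefined,
     ring.zero = NN, ring.add = set_add (pair_mod R NM),
     smult = \<lambda>r A. \<Union>a\<in>A. cst NN (sm r a),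
     grade = \<lambda>d. cst NN ` generate FA {frag_of (r, v) | r v i j. r \<in> grade R i \<and> v \<in> grade NM j \<and> i + j = d}\<rparr>"
proof -
  have a: "ring.add (pair_mod R NM) = (+)" by (simp add: pair_mod_def)
  have "carrier (pair_mod R NM) = CC" by (simp add: pair_mod_def free_Abelian_group_def)
  then show ?thesis
    unfolding Ind_def induced_def irels_eq[symmetric] NN_def[symmetric] quot_mod_def a_rcosets_eq_cst[OF a] a_r_coset_eq_cst[OF a]
    by (simp add: pair_mod_def)
qed

text \<open>Scalars are moved to the left factor by \<open>fo_scale\<close>, after which sums of
  tensors with the same right factor can be combined.\<close>

lemma CC_fo: "f \<in> CC \<Longrightarrow> \<exists>p. f - fo p 1 \<in> NN"
proof -
  assume "f \<in> CC"
  then have "Poly_Mapping.keys f \<subseteq> carrier R \<times> carrier NM" by blast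
  then show ?thesis
  proof (induction f rule: frag_induction)
    case zero
    then show ?case using add_sg_uminus[OF add_sg_NN fo_zero[of 1]] by (intro exI[of _ 0]) simp
  next
    case (one x)
    then obtain p z where "x = (cls n \<alpha> p, nv z)" unfolding carrier_klr carrier_NM by auto
    then show ?case using fo_scale[of p z] by (auto simp: fo_def)
  next
    case (diff a b)
    then obtain p q where pq: "a - fo p 1 \<in> NN" "b - fo q 1 \<in> NN" by blast
    have "(a - fo p 1) - (b - fo q 1) + (fo p 1 - fo q 1 - fo (p - q) 1) \<in> NN"
      by (intro add_sg_add[OF add_sg_NN] add_sg_diff[OF add_sg_NN pq] fo_diff)
    then show ?case by (intro exI[of _ "p - q"]) (simp add: algebra_simps)
  qed
qed

lemma cst_\<pi>: "f - fo p 1 \<in> NN \<Longrightarrow> cst NN f = \<pi> p"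
  by (simp add: \<pi>_def cst_eq_iff[OF add_sg_NN])

lemma carrier_IM: "carrier IM = range \<pi>"
proof -
  have "cst NN ` CC = range \<pi>"
  proof
    show "cst NN ` CC \<subseteq> range \<pi>"
    proof (rule image_subsetI)
      fix f assume "f \<in> CC"
      from CC_fo[OF this] obtain p where "f - fo p 1 \<in> NN" by (elim exE)
      from cst_\<pi>[OF this] show "cst NN f \<in> range \<pi>" by (rule range_eqI)
    qed
    show "range \<pi> \<subseteq> cst NN ` CC" unfolding \<pi>_def by (rule image_subsetI) (rule imageI[OF fo_CC])
  qed
  then show ?thesis unfolding IM_eq by simp
qed

text \<open>The vector \<open>nv z\<close> has degree 0, and for other degrees of the right factor
  only \<open>z = 0\<close> is possible; so the degree of a tensor is that of its left
  factor.\<close>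

lemma grade_IM: "grade IM d = \<pi> ` {p. homog n \<alpha> d p}"
proof -
  let ?Y = "{frag_of (r, v) | r v i j. r \<in> grade R i \<and> v \<in> grade NM j \<and> i + j = d}"
  have Y: "\<exists>p z. x = fo p z \<and> homog n \<alpha> d (cs z p)" if xY: "x \<in> ?Y" for x
  proof -
    obtain r v i j where rv: "x = frag_of (r, v)" "r \<in> grade R i" "v \<in> grade NM j" "i + j = d" using xY by blast
    obtain p where p: "r = cls n \<alpha> p" "homog n \<alpha> i p" using rv(2) unfolding grade_klr by blast
    obtain z where z: "v = nv z" "j \<noteq> 0 \<Longrightarrow> z = 0" using rv(3) unfolding grade_NM by (auto split: if_splits)
    have "homog n \<alpha> d (cs z p)"
      using rv(4) z(2) homog_cs[OF p(2), of z] homog_zero by (cases "j = 0") (auto simp: cs.sc_zero)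
    then show ?thesis using rv(1) p z by (auto simp: fo_def)
  qed
  have YC: "?Y \<subseteq> CC"
  proof
    fix x assume "x \<in> ?Y"
    from Y[OF this] obtain p z where "x = fo p z" by blast
    then show "x \<in> CC" by (simp only: fo_CC)
  qed
  have "generate FA ?Y \<subseteq> {f. \<exists>p. homog n \<alpha> d p \<and> f - fo p 1 \<in> NN}"
  proof (rule generate_FA(3)[OF YC])
    show "add_sg {f. \<exists>p. homog n \<alpha> d p \<and> f - fo p 1 \<in> NN}"
    proof -
      have "\<exists>r. homog n \<alpha> d r \<and> a - b - fo r 1 \<in> NN"
        if pq: "homog n \<alpha> d p" "a - fo p 1 \<in> NN" "homog n \<alpha> d q" "b - fo q 1 \<in> NN" for a b p q
      proof -
        have "(a - fo p 1) - (b - fo q 1) + (fo p 1 - fo q 1 - fo (p - q) 1) \<in> NN"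
          by (intro add_sg_add[OF add_sg_NN] add_sg_diff[OF add_sg_NN pq(2,4)] fo_diff)
        then show ?thesis using homog_diff[OF pq(1,3)] by (intro exI[of _ "p - q"]) (simp add: algebra_simps)
      qed
      moreover have "\<exists>p. homog n \<alpha> d p \<and> 0 - fo p 1 \<in> NN"
        using add_sg_uminus[OF add_sg_NN fo_zero[of 1]] homog_zero by (intro exI[of _ 0]) simp
      ultimately show ?thesis unfolding add_sg_def by blast
    qed
    show "?Y \<subseteq> {f. \<exists>p. homog n \<alpha> d p \<and> f - fo p 1 \<in> NN}"
    proof
      fix x assume "x \<in> ?Y"
      from Y[OF this] obtain p z where x: "x = fo p z" "homog n \<alpha> d (cs z p)" by blast
      then show "x \<in> {f. \<exists>p. homog n \<alpha> d p \<and> f - fo p 1 \<in> NN}" using fo_scale[of p z] by blast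
    qed
  qed
  then have sub: "\<exists>p. homog n \<alpha> d p \<and> f - fo p 1 \<in> NN" if "f \<in> generate FA ?Y" for f using that by (rule CollectD[OF subsetD])
  have "cst NN ` generate FA ?Y \<subseteq> \<pi> ` {p. homog n \<alpha> d p}"
  proof (rule image_subsetI)
    fix f assume "f \<in> generate FA ?Y"
    from sub[OF this] obtain p where p: "homog n \<alpha> d p" "f - fo p 1 \<in> NN" by (elim exE conjE)
    show "cst NN f \<in> \<pi> ` {p. homog n \<alpha> d p}" unfolding cst_\<pi>[OF p(2)] by (rule imageI) (rule CollectI, rule p(1))
  qed
  moreover have "\<pi> ` {p. homog n \<alpha> d p} \<subseteq> cst NN ` generate FA ?Y"
  proof
    fix x assume "x \<in> \<pi> ` {p. homog n \<alpha> d p}"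
    then obtain p where p: "homog n \<alpha> d p" "x = \<pi> p" by blast
    have "cls n \<alpha> p \<in> grade R d" "nv 1 \<in> grade NM 0" using p(1) unfolding grade_klr grade_NM by auto
    then have "fo p 1 \<in> ?Y" unfolding fo_def by (intro CollectI exI[of _ "cls n \<alpha> p"] exI[of _ "nv 1"] exI[of _ d] exI[of _ 0]) simp
    from subsetD[OF generate_FA(2)[OF YC] this] show "x \<in> cst NN ` generate FA ?Y" unfolding p(2) \<pi>_def by (rule imageI)
  qed
  ultimately show ?thesis unfolding IM_eq by (simp only: graded.simps)
qed

lemma add_IM: "\<pi> p \<oplus>\<^bsub>IM\<^esub> \<pi> q = \<pi> (p + q)"
proof -
  have "\<pi> p \<oplus>\<^bsub>IM\<^esub> \<pi> q = cst NN (fo p 1 + fo q 1)"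
    unfolding IM_eq \<pi>_def by (simp add: set_add_cst add_sg_NN pair_mod_def)
  also have "\<dots> = \<pi> (p + q)"
    using add_sg_uminus[OF add_sg_NN fo_add[of p q 1]] by (intro cst_\<pi>) (simp add: algebra_simps)
  finally show ?thesis .
qed

lemma smult_IM: "cls n \<alpha> q \<odot>\<^bsub>IM\<^esub> \<pi> p = \<pi> (q * p)"
proof -
  have "cst NN (sm (cls n \<alpha> q) a) = \<pi> (q * p)" if "a \<in> \<pi> p" for a
  proof (rule cst_\<pi>)
    have "a - fo p 1 \<in> NN" using that by (simp add: \<pi>_def cst_def)
    from sm_NN[OF this, of q] show "sm (cls n \<alpha> q) a - fo (q * p) 1 \<in> NN" by (simp add: frag_extend_diff sm_fo)
  qed
  moreover have "fo p 1 \<in> \<pi> p" unfolding \<pi>_def by (rule cst_self[OF add_sg_NN])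
  ultimately show ?thesis unfolding IM_eq by (simp only: module.simps) blast
qed

lemma zero_IM: "\<zero>\<^bsub>IM\<^esub> = \<pi> 0"
proof -
  have "\<pi> 0 = cst NN 0"
    using fo_zero[of 1] by (simp add: \<pi>_def cst_eq_iff[OF add_sg_NN])
  then show ?thesis unfolding IM_eq by (simp add: cst_zero)
qed

lemma eq_IM: "\<pi> p = \<pi> q \<longleftrightarrow> p - q \<in> Kr"
proof -
  have "fo p 1 - fo q 1 \<in> NN \<longleftrightarrow> fo (p - q) 1 \<in> NN"
    using add_sg_diff[OF add_sg_NN _ fo_diff[of p 1 q], of "fo p 1 - fo q 1"]
      add_sg_add[OF add_sg_NN fo_diff[of p 1 q], of "fo (p - q) 1"] by auto
  then show ?thesis by (simp add: \<pi>_def cst_eq_iff[OF add_sg_NN] Kr_def)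
qed

end

context segment_ideal
begin

definition g :: "klr_elt \<times> (complex list \<Rightarrow>\<^sub>0 complex) set \<Rightarrow> falg" where
  "g = (\<lambda>(P, v). cs (inv_into UNIV nv v) (rp P))"

text \<open>The inverse map, sending p tensor z to z p modulo \<open>L\<close>. It starts from
  formal combinations, where no relation has to be respected; \<open>NN_H\<close> shows that it maps
  relations into \<open>L\<close>.\<close>

definition H :: "((klr_elt \<times> (complex list \<Rightarrow>\<^sub>0 complex) set) \<Rightarrow>\<^sub>0 int) \<Rightarrow> falg" where
  "H f = linext cs g (Poly_Mapping.map of_int f)"

lemma H_diff: "H (a - b) = H a - H b"
proof -
  have "Poly_Mapping.map of_int (a - b) = Poly_Mapping.map of_int a - (Poly_Mapping.map of_int b :: _ \<Rightarrow>\<^sub>0 complex)"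
    by (rule poly_mapping_eqI) (simp add: Poly_Mapping.map.rep_eq lookup_minus when_def)
  then show ?thesis by (simp add: H_def cs.linext_minus)
qed

lemma H_fo: "H (fo p z) \<bumpeq>\<^bsub>L\<^esub> cs z p"
proof -
  have "Poly_Mapping.map of_int (frag_of x) = cmon 1 x" for x :: "klr_elt \<times> (complex list \<Rightarrow>\<^sub>0 complex) set"
    by (rule poly_mapping_eqI) (simp add: Poly_Mapping.map.rep_eq lookup_single when_def)
  moreover have "inj nv" by (simp add: inj_def nv_eq_iff)
  ultimately have "H (fo p z) = cs z (rp (cls n \<alpha> p))"
    by (simp add: H_def fo_def g_def cs.sc_one inv_f_f)
  also have "\<dots> \<bumpeq>\<^bsub>L\<^esub> cs z p" by (intro eqv_cs J_eqv rp_cls)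
  finally show ?thesis .
qed

lemma NN_H: "f \<in> NN \<Longrightarrow> H f \<in> L"
proof -
  have "NN \<subseteq> {f. H f \<in> L}"
    unfolding NN_def
  proof (rule generate_FA(3)[OF irels_CC])
    have "H 0 = 0" using H_diff[of 0 0] by simp
    then show "add_sg {f. H f \<in> L}" by (simp add: add_sg_def H_diff L_diff)
    show "irels \<subseteq> {f. H f \<in> L}"
    proof
      fix x assume "x \<in> irels"
      then consider p p' z where "x = fo (p + p') z - fo p z - fo p' z" | p z z' where "x = fo p (z + z') - fo p z - fo p z'"
        | p q z where "q \<in> tf.TA" "x = fo (p * EF q) z - fo p (\<chi> q * z)" unfolding irels_def by blast
      then have "H x \<in> L"
      proof cases
        case (1 p p' z)
        have "H x \<bumpeq>\<^bsub>L\<^esub> cs z (p + p') - cs z p - cs z p'"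
          unfolding 1 H_diff by (intro eqv_diff H_fo)
        then show ?thesis by (simp add: cs.sc_add2)
      next
        case (2 p z z')
        have "H x \<bumpeq>\<^bsub>L\<^esub> cs (z + z') p - cs z p - cs z' p"
          unfolding 2 H_diff by (intro eqv_diff H_fo)
        then show ?thesis by (simp add: cs.sc_add)
      next
        case (3 p q z)
        have "H x \<bumpeq>\<^bsub>L\<^esub> cs z (p * EF q) - cs (\<chi> q * z) p"
          unfolding 3(2) H_diff by (intro eqv_diff H_fo)
        moreover have "cs z (p * EF q) \<bumpeq>\<^bsub>L\<^esub> cs z (p * cs (\<chi> q) 1)"
          by (intro eqv_cs eqv_mult EF_one 3(1))
        then have "cs z (p * EF q) - cs (\<chi> q * z) p \<in> L"
          by (simp add: eqv_def cs_mult_right cs.sc_mult mult.commute)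
        ultimately show ?thesis using L_cong by blast
      qed
      then show "x \<in> {f. H f \<in> L}" by blast
    qed
  qed
  then show "f \<in> NN \<Longrightarrow> H f \<in> L" by blast
qed

lemma Kr_sub_L: "Kr \<subseteq> L"
proof
  fix p assume "p \<in> Kr"
  then have "H (fo p 1) \<in> L" using NN_H by (simp add: Kr_def)
  then show "p \<in> L" using L_cong[OF H_fo[of p 1]] by (simp add: cs.sc_one)
qed

text \<open>\<open>Kr\<close> lies in every segment ideal and is one itself; so it equals any
  smallest one.\<close>

lemma presented_IM:
  assumes "klr_graded_left n \<alpha> L" "\<And>K. segment_ideal n segs K \<Longrightarrow> L \<subseteq> K"
  shows "presented n \<alpha> L IM \<pi>"
proof -
  have "Kr = L" using Kr_sub_L assms(2)[OF segment_ideal_Kr] by blast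
  then show ?thesis
    by (intro presented.intro presented_axioms.intro assms(1) carrier_IM add_IM smult_IM zero_IM grade_IM) (simp add: eq_IM)
qed

end

section \<open>Ordered segments\<close>

locale ordered_segments = segment_list +
  assumes order: "p < q \<Longrightarrow> q < length segs \<Longrightarrow> fst (segs ! q) < fst (segs ! p) \<or>
      fst (segs ! q) = fst (segs ! p) \<and> snd (segs ! q) \<le> snd (segs ! p)"
begin

abbreviation "st \<equiv> \<lambda>p. fst (segs ! p)"
abbreviation "len \<equiv> \<lambda>p. snd (segs ! p)"
abbreviation "i0 \<equiv> concat b0"
abbreviation "s0 \<equiv> SS len [0..<k]"
abbreviation "lf \<equiv> \<lambda>p c. st p + c"

lemma i0_WW: "i0 = WW st len [0..<k]"
proof -
  have "b0 = map (\<lambda>p. [st p..<st p + len p]) [0..<k]"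
    by (rule nth_equalityI) (auto simp: b0_def split_beta)
  then show ?thesis by (simp only: WW_def)
qed

lemma size_ws: "p < k \<Longrightarrow> size (ws ! p) = len p"
  by (simp add: seg_weight_def split_beta)

lemma length_SS: "length (SS len ps) = (\<Sum>p\<leftarrow>ps. len p)"
  by (simp add: SS_def length_concat comp_def)

lemma length_SS_offset: "p \<le> k \<Longrightarrow> length (SS len [0..<p]) = offset ws p"
  by (induction p) (simp_all add: length_SS offset_def size_ws seg_weight_def split_beta)

lemma s0_nth:
  assumes "p < k" "m < len p"
  shows "s0 ! (offset ws p + m) = p"
proof -
  have "[0..<k] = [0..<p] @ p # [Suc p..<k]"
    using upt_add_eq_append[of 0 p "k - p"] assms(1) by (simp add: upt_conv_Cons)
  then have "s0 = SS len [0..<p] @ replicate (len p) p @ SS len [Suc p..<k]"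
    by (simp only: SS_simps)
  then show ?thesis using length_SS_offset[of p] assms by (simp add: nth_append)
qed

text \<open>Each place lies in a block, and its label is the number of the block; equal labels
  therefore put both places in one block, with \<open>Suc j\<close> not its last place.\<close>

lemma s0_same:
  assumes "Suc j < size \<alpha>" "s0 ! j = s0 ! Suc j"
  shows "\<exists>p<k. \<exists>t. 0 < t \<and> t < len p \<and> Suc j = offset ws p + t"
proof -
  obtain p m where p: "p < k" "m \<in> {1..size (ws ! p)}" "Suc j = offset ws p + m"
    using offset_cover[of "Suc j" ws] assms(1) by auto
  obtain q m' where q: "q < k" "m' \<in> {1..size (ws ! q)}" "Suc (Suc j) = offset ws q + m'"
    using offset_cover[of "Suc (Suc j)" ws] assms(1) by auto
  have "s0 ! (offset ws p + (m - 1)) = p" "s0 ! (offset ws q + (m' - 1)) = q"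
    by (rule s0_nth; use p q size_ws in auto)+
  moreover have "offset ws p + (m - 1) = j" "offset ws q + (m' - 1) = Suc j" using p q by auto
  ultimately have "p = q" using assms(2) by simp
  then have "m < len p" using p q size_ws[OF p(1)] by auto
  then show ?thesis using p by auto
qed

sublocale sg: segments n \<alpha> i0 s0 lf
proof
  show "i0 \<in> seqs n \<alpha>" by (rule concat_in_seqs[OF b0_blocks])
  show "sorted s0" by (rule sorted_SS) simp
  show "length s0 = size \<alpha>" using length_SS_offset[of k] by (simp add: size_sum_list)
  show "wd lf s0 = i0" unfolding wd_def i0_WW by (rule pr_SS) auto
qed simp

lemma segment_ideal_L: "segment_ideal n segs sg.L"
proof (intro segment_ideal.intro segment_ideal_axioms.intro segment_list_axioms sg.klr_left_L)
  show "E i0 - 1 \<in> sg.L" by (rule li_idem)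
  show "X m \<in> sg.L" for m by (rule sg.X_one)
  fix j t assume j: "j < k" "0 < t" "t < len j"
  have o: "offset ws j + len j \<le> size \<alpha>" using offset_bound[of j ws] size_ws[OF j(1)] j(1) by simp
  have "s0 ! (offset ws j + (t - 1)) = j" "s0 ! (offset ws j + t) = j" by (rule s0_nth; use j in auto)+
  then have "T (Suc (offset ws j + (t - 1))) \<in> sg.L"
    using j o by (intro sg.T_one) auto
  then show "T (offset ws j + t) \<in> sg.L" using j(2) by simp
qed

text \<open>\<open>lideal\<close> is generated by its relations, and these hold in every segment
  ideal; factors \<open>E i0\<close> on the right may be dropped because they act as 1.\<close>

lemma L_minimal:
  assumes "segment_ideal n segs K"
  shows "sg.L \<subseteq> K"
proof
  interpret K: segment_ideal n segs K by (rule assms)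
  have E: "q * E i0 \<in> K" if "q \<in> K" for q
  proof -
    have "E i0 \<bumpeq>\<^bsub>K\<^esub> 1" using K.one_wt by (simp add: eqv_def)
    from K.L_cong[OF K.eqv_mult[OF this, of q]] show ?thesis using that by simp
  qed
  fix p assume "p \<in> sg.L"
  then show "p \<in> K"
  proof induction
    case (li_T j)
    obtain q t where q: "q < k" "0 < t" "t < len q" "Suc j = offset ws q + t" using s0_same[OF li_T] by blast
    show ?case unfolding q(4) by (rule E[OF K.T_in[OF q(1-3)]])
  next
    case (li_J p)
    then show ?case by (rule subsetD[OF K.J_sub_L])
  next
    case li_idem
    show ?case by (rule K.one_wt)
  next
    case (li_X m)
    show ?case by (rule E[OF K.X_in])
  qed (auto intro: K.L_add K.L_mult)
qed

theorem head_Ind_irreducible: "irreducible_graded (klr n \<alpha>) (hd_mod (klr n \<alpha>) IM)"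
proof -
  interpret sL: segment_ideal n segs sg.L by (rule segment_ideal_L)
  let ?B = "sg.span.Tw ` sg.span.shufs"
  have "presented n \<alpha> sg.L IM \<pi>" by (rule sL.presented_IM[OF sg.klr_graded_L L_minimal])
  moreover have "local_module_axioms n \<alpha> sg.L i0 ?B"
  proof
    show "i0 \<in> seqs n \<alpha>" by (rule sg.i0_seqs)
    show "E i0 - 1 \<in> sg.L" by (rule li_idem)
    show "1 \<notin> sg.L" by (rule sg.one_notin_L)
    show "finite ?B" using sg.span.finite_shufs by simp
    have u: "\<tau> = s0" if "mset \<tau> = mset s0" "wd lf \<tau> = i0" "dg lf \<tau> = 0" for \<tau>
      by (rule SS_shuffle_unique[of "[0..<k]" st len]) (use that order i0_WW in auto)
    show "\<exists>c. E i0 * p \<bumpeq>\<^bsub>sg.L\<^esub> cs c 1" if "homog n \<alpha> 0 p" for p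
      by (rule sg.deg0_weight_space[OF u that])
    show "\<exists>c. p \<bumpeq>\<^bsub>sg.L\<^esub> (\<Sum>b\<in>?B. cs (c b) b)" for p
    proof -
      obtain \<epsilon> where e: "p \<bumpeq>\<^bsub>sg.L\<^esub> (\<Sum>\<tau>\<in>sg.span.shufs. cs (\<epsilon> \<tau>) (sg.span.Tw \<tau>))" using sg.Tw_one by blast
      \<comment> \<open>Different shuffles could have the same chosen product, so coefficients are
        added over the fibres of \<open>Tw\<close>.\<close>
      have "(\<Sum>\<tau>\<in>sg.span.shufs. cs (\<epsilon> \<tau>) (sg.span.Tw \<tau>))
          = (\<Sum>b\<in>?B. \<Sum>\<tau>\<in>{\<tau> \<in> sg.span.shufs. sg.span.Tw \<tau> = b}. cs (\<epsilon> \<tau>) (sg.span.Tw \<tau>))"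
        by (rule sum.image_gen[OF sg.span.finite_shufs])
      also have "\<dots> = (\<Sum>b\<in>?B. cs (\<Sum>\<tau>\<in>{\<tau> \<in> sg.span.shufs. sg.span.Tw \<tau> = b}. \<epsilon> \<tau>) b)"
        by (rule sum.cong) (auto simp: cs_sum_left)
      finally show ?thesis using e by (intro exI[of _ "\<lambda>b. \<Sum>\<tau>\<in>{\<tau> \<in> sg.span.shufs. sg.span.Tw \<tau> = b}. \<epsilon> \<tau>"]) (simp only:)
    qed
  qed
  ultimately have "local_module n \<alpha> sg.L IM \<pi> i0 ?B" by (rule local_module.intro)
  then show ?thesis by (rule local_module.head_irreducible)
qed

end

section \<open>Tableaux\<close>

lemma Psi_nth: "1 \<le> k \<Longrightarrow> k \<le> length Tab \<Longrightarrow> Psi Tab ! (k - 1) = map (\<lambda>a. a - k) (rev (Tab ! (k - 1)))"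
  using nth_upt[of 1 "k - 1" "length Tab + 1"] by (simp add: Psi_def del: upt_Suc)

text \<open>An entry \<open>e\<close> in row \<open>a\<close> gives a segment that ends at
  \<open>e - 1\<close>, and entries are at most \<open>n + 1\<close>.\<close>

lemma tableau_segs_elem:
  assumes "semistandard n lam Tab" "(a, l) \<in> set (tableau_segs Tab)"
  shows "set [a..<a + l] \<subseteq> {1..n}"
proof -
  have a: "1 \<le> a" "a \<le> length Tab" "l \<in> set (Psi Tab ! (a - 1))" using assms(2) by (auto simp: tableau_segs_def)
  then obtain e where e: "e \<in> set (Tab ! (a - 1))" "l = e - a" using Psi_nth[of a Tab] by auto
  have "Tab ! (a - 1) \<in> set Tab" using a by auto
  then have "e \<le> n + 1" using assms(1) e(1) by (fastforce simp: semistandard_def)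
  then show ?thesis using a(1) e(2) by auto
qed

lemma sorted_wrt_concat_map:
  assumes "sorted_wrt (>) ks" "\<And>k. k \<in> set ks \<Longrightarrow> sorted_wrt (\<ge>) (g k)"
  shows "sorted_wrt (\<lambda>x y. fst y < fst x \<or> fst y = fst x \<and> snd y \<le> snd x)
    (concat (map (\<lambda>k::nat. map (\<lambda>l::nat. (k, l)) (g k)) ks))"
  using assms
proof (induction ks)
  case (Cons k ks)
  then show ?case by (auto simp: sorted_wrt_append sorted_wrt_map)
qed simp

text \<open>Rows are taken from the last to the first, so starting points decrease; within a row the
  entries are read backwards, so lengths decrease. This is the order that
  \<open>ordered_segments\<close> demands.\<close>

lemma tableau_segs_sorted:
  assumes "semistandard n lam Tab"
  shows "sorted_wrt (\<lambda>x y. fst y < fst x \<or> fst y = fst x \<and> snd y \<le> snd x) (tableau_segs Tab)"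
  unfolding tableau_segs_def
proof (rule sorted_wrt_concat_map)
  show "sorted_wrt (>) (rev [1..<length Tab + 1])" by (simp add: sorted_wrt_rev del: upt_Suc)
  fix k assume "k \<in> set (rev [1..<length Tab + 1])"
  then have k: "1 \<le> k" "k \<le> length Tab" by auto
  then have "sorted (Tab ! (k - 1))" using assms by (auto simp: semistandard_def)
  then have "sorted_wrt (\<lambda>x y. y \<le> x) (rev (Tab ! (k - 1)))" by (simp add: sorted_wrt_rev)
  then have "sorted_wrt (\<ge>) (map (\<lambda>a. a - k) (rev (Tab ! (k - 1))))"
    unfolding sorted_wrt_map by (rule sorted_wrt_mono_rel[rotated]) (simp add: diff_le_mono)
  then show "sorted_wrt (\<ge>) (Psi Tab ! (k - 1))" unfolding Psi_nth[OF k] .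
qed

theorem theorem4p5:
  fixes n :: nat and lam :: "nat list" and T :: "nat list list"
  assumes "n \<ge> 1"
    and "is_partition lam"
    and "length lam \<le> n"
    and "semistandard n lam T"
  shows "irreducible_graded (klr n (sum_list (tableau_weights T)))
           (hd_mod (klr n (sum_list (tableau_weights T))) (Ind n (tableau_weights T) (nabla n T)))"
proof -
  interpret ordered_segments n "tableau_segs T"
  proof
    show "set [a..<a + l] \<subseteq> {1..n}" if "(a, l) \<in> set (tableau_segs T)" for a l
      by (rule tableau_segs_elem[OF assms(4) that])
    show "fst (tableau_segs T ! q) < fst (tableau_segs T ! p) \<or>
        fst (tableau_segs T ! q) = fst (tableau_segs T ! p) \<and> snd (tableau_segs T ! q) \<le> snd (tableau_segs T ! p)"
      if "p < q" "q < length (tableau_segs T)" for p q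
      using sorted_wrt_nth_less[OF tableau_segs_sorted[OF assms(4)] that] .
  qed
  show ?thesis using head_Ind_irreducible unfolding tableau_weights_def nabla_def .
qed

end
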